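(* Let $(H,G,\mathfrak m)$ be a null non-branching synthetic null hypersurface (in a topological causal space $(X,\ll,\leq,\mathfrak T)$). Then the following are equivalent. (i) $(H,G,\mathfrak m)$ satisfies the Null Energy Condition $\mathsf{NC}^e(N)$. (ii) Considering the disintegration $\mathfrak m\llcorner_{H^\circ}=\int_Q\mathfrak m_\alpha\,\mathfrak q(d\alpha)$ of $\mathfrak m\llcorner_{H^\circ}$ along the rays of $H$ (described in the context), for $\mathfrak q$-a.e. $\alpha\in Q$ the metric measure space $(H_\alpha,|G(\cdot)-G(\cdot)|,\mathfrak m_\alpha)$ satisfies the $\mathsf{CD}(0,N-1)$ condition. That is, using the identification $\Psi_G(\alpha,\cdot)$ between $H_\alpha$ and a real interval $I_\alpha\subset\mathbb R$, the measure $\mathfrak m_\alpha$ is absolutely continuous and, denoting by $h_\alpha:I_\alpha\to[0,\infty)$ its density, the function $t\mapsto h_\alpha^{1/(N-2)}(t)$ is concave.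
   Context: A causal space $(X,\ll,\le)$ is a set $X$ with a preorder $\le$ and a transitive relation $\ll$ contained in $\le$. A topological causal space $(X,\ll,\leq,\mathfrak T)$ is a causal space with a Polish topology $\mathfrak T$ induced by a separable proper metric (closed balls are compact), such that $J:=\{(x,y):x\le y\}$ is closed and $\{(x,y):x\ll y\}$ is open in $X\times X$. A set $H$ is achronal if no $x,y\in H$ satisfy $x\ll y$. A causal curve is a non-constant continuous curve $\gamma:I\to X$ ($I\subset\mathbb R$ an interval) with $\gamma_{t_1}\le\gamma_{t_2}$ for all $t_1<t_2$ in $I$. A set $A\subset X$ is weakly convex if for all $x,y\in A$ with $x\le y$ there is a causal curve contained in $A$ connecting $x$ to $y$. For a closed achronal set $H$: $\mathfrak a=\{m\in H:\nexists x\in H,\ x\le m,\ x\ne m\}$ (initial points); $\mathfrak b=\{m\in H:\nexists x\in H,\ m\le x,\ x\neq m\}$ (final points); $H^\circ=H\setminus(\mathfrak a\cup\mathfrak b)$. A gauge for $H$ is a Borel map $G:H^\circ\to\mathbb R$ such that (1) for any injective causal curve $\gamma$ in $H^\circ$, $G\circ\gamma$ is strictly increasing and continuous; (2) for any causal $\gamma:[0,1]\to H$ with $\gamma((0,1))\subset H^\circ$, $\sup_{(0,1)}G\circ\gamma$ and $\inf_{(0,1)}G\circ\gamma$ are finite. A curve $\gamma:[0,1]\to H$ is $G$-causal if it is causal, $\gamma((0,1))\subset H^\circ$ and $G\circ\gamma|_{(0,1)}$ is affine; $\mathrm{Caus}_G\subset C([0,1];H)$ is the set of $G$-causal curves. A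 synthetic null hypersurface is a triple $(H,G,\mathfrak m)$ with $H$ closed achronal, $G$ a gauge for $H$, and $\mathfrak m$ a non-negative Radon measure on $H$ with $\mathfrak m(\mathfrak a\cap\mathfrak b)=0$. $H$ is forward null non-branching if for every pair of injective causal curves $\gamma^1,\gamma^2:[0,1]\to H$ with $\gamma^1_0=\gamma^2_0$ and $\gamma^1_{1/2}=\gamma^2_{1/2}$, either $\gamma^1([0,1])\subset\gamma^2([0,1])$ or $\gamma^2([0,1])\subset\gamma^1([0,1])$; backward null non-branching if it is forward null non-branching in the causally reversed space; null non-branching if both. $\Pi_\le(\mu_0,\mu_1)$: couplings $\pi$ of $\mu_0,\mu_1$ with $\pi(J)=1$. $\mathrm{OptGeo}^G(\mu_0,\mu_1)$: probability measures $\nu$ on $C([0,1];H)$ with $(e_i)_\sharp\nu=\mu_i$, $i=0,1$ ($e_t$ evaluation at $t$), and $\nu(\mathrm{Caus}_G)=1$. $\mathrm{Ent}(\mu|\mathfrak m)=\int\rho\log\rho\,d\mathfrak m$ if $\mu=\rho\mathfrak m$ and $(\rho\log\rho)_+$ is $\mathfrak m$-integrable, $+\infty$ otherwise; $\mathrm U_{N-1}(\mu|\mathfrak m)=\exp(-\mathrm{Ent}(\mu|\mathfrak m)/(N-1))$ ($=0$ if $\mathrm{Ent}=+\infty$). $\mathsf{NC}^e(N)$: for all probability measures $\mu_0,\mu_1$ on $H$ with $\Pi_\le(\mu_0,\mu_1)\neq\emptyset$ there is $\nu\in\mathrm{OptGeo}^G(\mu_0,\mu_1)$ such that, with $\mu_t=(e_t)_\sharp\nu$,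 for all $t\in[0,1]$: $\mathrm U_{N-1}(\mu_t|\mathfrak m)\ge(1-t)\mathrm U_{N-1}(\mu_0|\mathfrak m)+t\,\mathrm U_{N-1}(\mu_1|\mathfrak m)$. Rays and disintegration. The following structure is available when the null non-branching closed achronal set $H$ (admitting a gauge $G$) is weakly convex; $\mathsf{NC}^e(N)$ implies that $H$ is weakly convex. Let $\mathcal R=(J\cup J^{-1})\cap(H\times H)$, which is an equivalence relation on $H^\circ$. For $\alpha\in H^\circ$ put $H^\circ_\alpha=\{x\in H^\circ:(x,\alpha)\in\mathcal R\}$ and $H_\alpha=\{x\in H:(x,\alpha)\in\mathcal R\}$ (the ray through $\alpha$, without and with end-points). For $t\in\mathbb R$, $\Psi_G(\alpha,t)$ is the unique $y\in H^\circ_\alpha$ with $G(y)-G(\alpha)=t$, when it exists; $\Psi_G(\alpha,\cdot)$ is extended to cover also the possible end-points of $H_\alpha$, $I_\alpha$ is the resulting interval, and $G$ is extended accordingly to $H_\alpha$. There is a quotient map $\mathfrak Q:H^\circ\to H^\circ$, measurable with respect to the $\sigma$-algebra generated by analytic sets, with $(x,\mathfrak Q(x))\in\mathcal R$ and $\mathfrak Q(x)=\mathfrak Q(y)\iff(x,y)\in\mathcal R$; $Q$ is its image. The disintegration is $\mathfrak m\llcorner_{H^\circ}=\int_Q\mathfrak m_\alpha\,\mathfrak q(d\alpha)$, where $\mathfrak q$ is a Borel probability measure on $Q$ with $\mathfrak Q_\sharp\mathfrak m\llcorner_{H^\circ}\ll\mathfrak q$; $\alpha\mapsto\mathfrak m_\alpha(B)$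 is $\mathfrak q$-measurable for every $\mathfrak m$-measurable $B$; $\mathfrak m_\alpha$ is a non-negative measure concentrated on the ray $\mathfrak Q^{-1}(\alpha)$ for $\mathfrak q$-a.e. $\alpha$; $\mathfrak m(B\cap\mathfrak Q^{-1}(C))=\int_C\mathfrak m_\alpha(B)\,\mathfrak q(d\alpha)$ for $\mathfrak m$-measurable $B\subset H^\circ$ and $\mathfrak q$-measurable $C$; and for each compact $K$ there is $C_K\in(0,\infty)$ with $\mathfrak m_\alpha(K)\le C_K$ for $\mathfrak q$-a.e. $\alpha$. For fixed $\mathfrak q$ it is $\mathfrak q$-essentially unique.
   Formalization: Constant curves count as G-causal, weak convexity concerns only x ≠ y, N > 2, and (ii) also requires that H is weakly convex and that 𝔪(𝔞∪𝔟)=0; without the last, 𝔪 = δ_0 + Lebesgue on H = [0,1] satisfies (ii) but not (i). *)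

theory Defs
  imports "HOL-Probability.Probability"
begin

section \<open>Topological causal spaces and causal curves\<close>

text \<open>The class \<open>heine_borel\<close> says that the metric is proper.  Throughout, \<open>ll\<close> is the
  chronological relation and \<open>le\<close> the causal relation.\<close>

definition topological_causal_space ::
  "('a::{heine_borel,polish_space} \<Rightarrow> 'a \<Rightarrow> bool) \<Rightarrow> ('a \<Rightarrow> 'a \<Rightarrow> bool) \<Rightarrow> bool" where
  "topological_causal_space ll le \<longleftrightarrow>
     reflp le \<and> transp le \<and> transp ll \<and> (\<forall>x y. ll x y \<longrightarrow> le x y) \<and>
     closed {(x, y). le x y} \<and> open {(x, y). ll x y}"

definition achronal :: "('a \<Rightarrow> 'a \<Rightarrow> bool) \<Rightarrow> 'a set \<Rightarrow> bool" where
  "achronal ll H \<longleftrightarrow> (\<forall>x\<in>H. \<forall>y\<in>H. \<not> ll x y)"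

definition causal_curve ::
  "('a::topological_space \<Rightarrow> 'a \<Rightarrow> bool) \<Rightarrow> real set \<Rightarrow> (real \<Rightarrow> 'a) \<Rightarrow> bool" where
  "causal_curve le I \<gamma> \<longleftrightarrow>
     is_interval I \<and> continuous_on I \<gamma> \<and> \<not> \<gamma> constant_on I \<and>
     (\<forall>s\<in>I. \<forall>t\<in>I. s < t \<longrightarrow> le (\<gamma> s) (\<gamma> t))"

text \<open>Causal curves are non-constant, so the condition is only imposed on distinct points.\<close>

definition weakly_convex :: "('a::topological_space \<Rightarrow> 'a \<Rightarrow> bool) \<Rightarrow> 'a set \<Rightarrow> bool" where
  "weakly_convex le A \<longleftrightarrow>
     (\<forall>x\<in>A. \<forall>y\<in>A. le x y \<and> x \<noteq> y \<longrightarrow>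
        (\<exists>\<gamma>. causal_curve le {0..1} \<gamma> \<and> \<gamma> ` {0..1} \<subseteq> A \<and> \<gamma> 0 = x \<and> \<gamma> 1 = y))"

definition initial_points :: "('a \<Rightarrow> 'a \<Rightarrow> bool) \<Rightarrow> 'a set \<Rightarrow> 'a set" where
  "initial_points le H = {m\<in>H. \<not> (\<exists>x\<in>H. le x m \<and> x \<noteq> m)}"

definition final_points :: "('a \<Rightarrow> 'a \<Rightarrow> bool) \<Rightarrow> 'a set \<Rightarrow> 'a set" where
  "final_points le H = {m\<in>H. \<not> (\<exists>x\<in>H. le m x \<and> x \<noteq> m)}"

definition inner_part :: "('a \<Rightarrow> 'a \<Rightarrow> bool) \<Rightarrow> 'a set \<Rightarrow> 'a set" where
  "inner_part le H = H - (initial_points le H \<union> final_points le H)"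

definition forward_null_non_branching ::
  "('a::topological_space \<Rightarrow> 'a \<Rightarrow> bool) \<Rightarrow> 'a set \<Rightarrow> bool" where
  "forward_null_non_branching le H \<longleftrightarrow>
     (\<forall>\<gamma>1 \<gamma>2.
        causal_curve le {0..1} \<gamma>1 \<and> inj_on \<gamma>1 {0..1} \<and> \<gamma>1 ` {0..1} \<subseteq> H \<and>
        causal_curve le {0..1} \<gamma>2 \<and> inj_on \<gamma>2 {0..1} \<and> \<gamma>2 ` {0..1} \<subseteq> H \<and>
        \<gamma>1 0 = \<gamma>2 0 \<and> \<gamma>1 (1/2) = \<gamma>2 (1/2) \<longrightarrow>
        \<gamma>1 ` {0..1} \<subseteq> \<gamma>2 ` {0..1} \<or> \<gamma>2 ` {0..1} \<subseteq> \<gamma>1 ` {0..1})"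

definition null_non_branching ::
  "('a::topological_space \<Rightarrow> 'a \<Rightarrow> bool) \<Rightarrow> 'a set \<Rightarrow> bool" where
  "null_non_branching le H \<longleftrightarrow>
     forward_null_non_branching le H \<and> forward_null_non_branching (\<lambda>x y. le y x) H"


section \<open>Synthetic null hypersurfaces\<close>

abbreviation borel_on :: "'a::topological_space set \<Rightarrow> 'a measure" where
  "borel_on A \<equiv> restrict_space borel A"

definition gauge_for ::
  "('a::topological_space \<Rightarrow> 'a \<Rightarrow> bool) \<Rightarrow> 'a set \<Rightarrow> ('a \<Rightarrow> real) \<Rightarrow> bool" where
  "gauge_for le H G \<longleftrightarrow>
     G \<in> borel_measurable (borel_on (inner_part le H)) \<and>
     (\<forall>I \<gamma>. causal_curve le I \<gamma> \<and> inj_on \<gamma> I \<and> \<gamma> ` I \<subseteq> inner_part le H \<longrightarrow>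
        strict_mono_on I (G \<circ> \<gamma>) \<and> continuous_on I (G \<circ> \<gamma>)) \<and>
     (\<forall>\<gamma>. causal_curve le {0..1} \<gamma> \<and> \<gamma> ` {0..1} \<subseteq> H \<and> \<gamma> ` {0<..<1} \<subseteq> inner_part le H \<longrightarrow>
        bdd_above ((G \<circ> \<gamma>) ` {0<..<1}) \<and> bdd_below ((G \<circ> \<gamma>) ` {0<..<1}))"

definition radon_measure_on :: "'a::topological_space set \<Rightarrow> 'a measure \<Rightarrow> bool" where
  "radon_measure_on H m \<longleftrightarrow>
     sets m = sets (borel_on H) \<and>
     (\<forall>K. compact K \<and> K \<subseteq> H \<longrightarrow> emeasure m K < \<infinity>) \<and>
     (\<forall>A\<in>sets m. emeasure m A = (SUP K\<in>{K. compact K \<and> K \<subseteq> A}. emeasure m K))"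

definition synthetic_null_hypersurface ::
  "('a::topological_space \<Rightarrow> 'a \<Rightarrow> bool) \<Rightarrow> ('a \<Rightarrow> 'a \<Rightarrow> bool) \<Rightarrow> 'a set \<Rightarrow> ('a \<Rightarrow> real) \<Rightarrow>
     'a measure \<Rightarrow> bool" where
  "synthetic_null_hypersurface ll le H G m \<longleftrightarrow>
     closed H \<and> achronal ll H \<and> gauge_for le H G \<and> radon_measure_on H m \<and>
     initial_points le H \<inter> final_points le H \<in> null_sets m"


section \<open>The null energy condition\<close>

text \<open>\<open>C([0,1];H)\<close> with the uniform metric; its elements are set to \<open>undefined\<close> off \<open>[0,1]\<close>.\<close>

definition curve_space :: "'a::metric_space set \<Rightarrow> (real \<Rightarrow> 'a) metric" where
  "curve_space H = cfunspace (top_of_set {0..1}) (submetric euclidean_metric H)"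

definition borel_curves :: "'a::metric_space set \<Rightarrow> (real \<Rightarrow> 'a) measure" where
  "borel_curves H = sigma (mspace (curve_space H)) {U. openin (mtopology_of (curve_space H)) U}"

text \<open>Constant curves are admitted as degenerate \<open>G\<close>-causal curves, although causal curves
  are non-constant.  Otherwise no plan could connect a Dirac mass to itself, and the null energy
  condition below would fail on every nonempty \<open>H\<close>.\<close>

definition G_causal_curves ::
  "('a::metric_space \<Rightarrow> 'a \<Rightarrow> bool) \<Rightarrow> 'a set \<Rightarrow> ('a \<Rightarrow> real) \<Rightarrow> (real \<Rightarrow> 'a) set" where
  "G_causal_curves le H G =
     {\<gamma> \<in> mspace (curve_space H).
        \<gamma> constant_on {0..1} \<or>
        (causal_curve le {0..1} \<gamma> \<and> \<gamma> ` {0<..<1} \<subseteq> inner_part le H \<and>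
         (\<exists>a b. \<forall>t\<in>{0<..<1}. G (\<gamma> t) = a + b * t))}"

definition causal_couplings ::
  "('a::topological_space \<Rightarrow> 'a \<Rightarrow> bool) \<Rightarrow> 'a set \<Rightarrow> 'a measure \<Rightarrow> 'a measure \<Rightarrow>
     ('a \<times> 'a) measure set" where
  "causal_couplings le H \<mu>0 \<mu>1 =
     {\<pi>. sets \<pi> = sets (borel_on H \<Otimes>\<^sub>M borel_on H) \<and> prob_space \<pi> \<and>
         distr \<pi> (borel_on H) fst = \<mu>0 \<and> distr \<pi> (borel_on H) snd = \<mu>1 \<and>
         emeasure \<pi> {p \<in> H \<times> H. le (fst p) (snd p)} = 1}"

abbreviation curve_marginal :: "'a::metric_space set \<Rightarrow> (real \<Rightarrow> 'a) measure \<Rightarrow> real \<Rightarrow> 'a measure" where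
  "curve_marginal H \<nu> t \<equiv> distr \<nu> (borel_on H) (\<lambda>\<gamma>. \<gamma> t)"

definition OptGeo ::
  "('a::metric_space \<Rightarrow> 'a \<Rightarrow> bool) \<Rightarrow> 'a set \<Rightarrow> ('a \<Rightarrow> real) \<Rightarrow> 'a measure \<Rightarrow> 'a measure \<Rightarrow>
     (real \<Rightarrow> 'a) measure set" where
  "OptGeo le H G \<mu>0 \<mu>1 =
     {\<nu>. sets \<nu> = sets (borel_curves H) \<and> prob_space \<nu> \<and>
         curve_marginal H \<nu> 0 = \<mu>0 \<and> curve_marginal H \<nu> 1 = \<mu>1 \<and>
         (AE \<gamma> in \<nu>. \<gamma> \<in> G_causal_curves le H G)}"

text \<open>\<open>ennreal\<close> truncates negative reals to 0, so the two integrals are those of the positive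
  and the negative part of \<open>\<rho> log \<rho>\<close>; the entropy may be \<open>-\<infinity>\<close> if \<open>m\<close> is infinite.\<close>

definition Ent :: "'a measure \<Rightarrow> 'a measure \<Rightarrow> ereal" where
  "Ent \<mu> m =
     (let \<rho> = (\<lambda>x. enn2real (RN_deriv m \<mu> x));
          pos = (\<integral>\<^sup>+x. ennreal (\<rho> x * ln (\<rho> x)) \<partial>m);
          neg = (\<integral>\<^sup>+x. ennreal (- (\<rho> x * ln (\<rho> x))) \<partial>m)
      in if density m (RN_deriv m \<mu>) = \<mu> \<and> pos < \<infinity>
         then enn2ereal pos - enn2ereal neg else \<infinity>)"

definition Uent :: "real \<Rightarrow> 'a measure \<Rightarrow> 'a measure \<Rightarrow> ennreal" where
  "Uent K \<mu> m =
     (if Ent \<mu> m = \<infinity> then 0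
      else if Ent \<mu> m = -\<infinity> then \<infinity>
      else ennreal (exp (- real_of_ereal (Ent \<mu> m) / K)))"

definition NCe ::
  "('a::metric_space \<Rightarrow> 'a \<Rightarrow> bool) \<Rightarrow> 'a set \<Rightarrow> ('a \<Rightarrow> real) \<Rightarrow> 'a measure \<Rightarrow> real \<Rightarrow> bool" where
  "NCe le H G m N \<longleftrightarrow>
     (\<forall>\<mu>0 \<mu>1.
        sets \<mu>0 = sets (borel_on H) \<and> prob_space \<mu>0 \<and>
        sets \<mu>1 = sets (borel_on H) \<and> prob_space \<mu>1 \<and>
        causal_couplings le H \<mu>0 \<mu>1 \<noteq> {} \<longrightarrow>
        (\<exists>\<nu>\<in>OptGeo le H G \<mu>0 \<mu>1. \<forall>t\<in>{0..1}.
           ennreal (1 - t) * Uent (N - 1) \<mu>0 m + ennreal t * Uent (N - 1) \<mu>1 m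
             \<le> Uent (N - 1) (curve_marginal H \<nu> t) m))"


section \<open>Rays and disintegration\<close>

definition causally_related :: "('a \<Rightarrow> 'a \<Rightarrow> bool) \<Rightarrow> 'a set \<Rightarrow> 'a \<Rightarrow> 'a \<Rightarrow> bool" where
  "causally_related le H x y \<longleftrightarrow> x \<in> H \<and> y \<in> H \<and> (le x y \<or> le y x)"

definition open_ray :: "('a \<Rightarrow> 'a \<Rightarrow> bool) \<Rightarrow> 'a set \<Rightarrow> 'a \<Rightarrow> 'a set" where
  "open_ray le H \<alpha> = {x \<in> inner_part le H. causally_related le H x \<alpha>}"

definition ray :: "('a \<Rightarrow> 'a \<Rightarrow> bool) \<Rightarrow> 'a set \<Rightarrow> 'a \<Rightarrow> 'a set" where
  "ray le H \<alpha> = {x \<in> H. causally_related le H x \<alpha>}"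

text \<open>An end-point may belong to several rays, and the extension of \<open>G\<close> to it (the limit of
  \<open>G\<close> along the ray) depends on the ray.\<close>

definition gauge_ext ::
  "('a \<Rightarrow> 'a \<Rightarrow> bool) \<Rightarrow> 'a set \<Rightarrow> ('a \<Rightarrow> real) \<Rightarrow> 'a \<Rightarrow> 'a \<Rightarrow> real" where
  "gauge_ext le H G \<alpha> x =
     (if x \<in> initial_points le H then Inf (G ` open_ray le H \<alpha>)
      else if x \<in> final_points le H then Sup (G ` open_ray le H \<alpha>)
      else G x)"

definition ray_interval ::
  "('a \<Rightarrow> 'a \<Rightarrow> bool) \<Rightarrow> 'a set \<Rightarrow> ('a \<Rightarrow> real) \<Rightarrow> 'a \<Rightarrow> real set" where
  "ray_interval le H G \<alpha> = (\<lambda>y. gauge_ext le H G \<alpha> y - G \<alpha>) ` ray le H \<alpha>"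

definition Psi ::
  "('a \<Rightarrow> 'a \<Rightarrow> bool) \<Rightarrow> 'a set \<Rightarrow> ('a \<Rightarrow> real) \<Rightarrow> 'a \<Rightarrow> real \<Rightarrow> 'a" where
  "Psi le H G \<alpha> = the_inv_into (ray le H \<alpha>) (\<lambda>y. gauge_ext le H G \<alpha> y - G \<alpha>)"

definition analytic_set :: "'a::topological_space set \<Rightarrow> bool" where
  "analytic_set A \<longleftrightarrow> A = {} \<or> (\<exists>f :: (nat \<Rightarrow> nat) \<Rightarrow> 'a. continuous_on UNIV f \<and> A = range f)"

definition ray_quotient_map ::
  "('a::topological_space \<Rightarrow> 'a \<Rightarrow> bool) \<Rightarrow> 'a set \<Rightarrow> ('a \<Rightarrow> 'a) \<Rightarrow> bool" where
  "ray_quotient_map le H QQ \<longleftrightarrow>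
     QQ \<in> inner_part le H \<rightarrow> inner_part le H \<and>
     QQ \<in> restrict_space (sigma UNIV {A. analytic_set A}) (inner_part le H) \<rightarrow>\<^sub>M borel \<and>
     (\<forall>x\<in>inner_part le H. causally_related le H x (QQ x)) \<and>
     (\<forall>x\<in>inner_part le H. \<forall>y\<in>inner_part le H. QQ x = QQ y \<longleftrightarrow> causally_related le H x y)"

text \<open>\<open>QQ\<close> and \<open>qq\<close> are the quotient map and the quotient measure, \<open>ma \<alpha>\<close> is the conditional
  measure on the ray of \<open>\<alpha>\<close>.  Sets measurable for a measure are those of its completion.
  If the inner part is empty, then so is the quotient set, which carries no
  probability measure; \<open>qq\<close> is then the zero measure.\<close>

definition ray_disintegration ::
  "('a::topological_space \<Rightarrow> 'a \<Rightarrow> bool) \<Rightarrow> 'a set \<Rightarrow> 'a measure \<Rightarrow>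
     ('a \<Rightarrow> 'a) \<Rightarrow> 'a measure \<Rightarrow> ('a \<Rightarrow> 'a measure) \<Rightarrow> bool" where
  "ray_disintegration le H m QQ qq ma \<longleftrightarrow>
     ray_quotient_map le H QQ \<and>
     sets qq = sets (borel_on (QQ ` inner_part le H)) \<and>
     (inner_part le H \<noteq> {} \<longrightarrow> prob_space qq) \<and>
     (\<forall>C\<in>null_sets qq. {x \<in> inner_part le H. QQ x \<in> C} \<in> null_sets (completion m)) \<and>
     (\<forall>\<alpha>\<in>QQ ` inner_part le H. sets (ma \<alpha>) = sets (borel_on H)) \<and>
     (\<forall>B\<in>sets (completion m).
        (\<lambda>\<alpha>. emeasure (completion (ma \<alpha>)) B) \<in> borel_measurable (completion qq)) \<and>
     (AE \<alpha> in qq. AE x in ma \<alpha>. x \<in> inner_part le H \<and> QQ x = \<alpha>) \<and>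
     (\<forall>B\<in>sets (completion m). \<forall>C\<in>sets (completion qq). B \<subseteq> inner_part le H \<longrightarrow>
        emeasure (completion m) {x \<in> B. QQ x \<in> C} =
          (\<integral>\<^sup>+\<alpha>\<in>C. emeasure (completion (ma \<alpha>)) B \<partial>completion qq)) \<and>
     (\<forall>K. compact K \<and> K \<subseteq> H \<longrightarrow>
        (\<exists>c>0. AE \<alpha> in qq. emeasure (ma \<alpha>) K \<le> ennreal c))"

text \<open>The \<open>CD(0,N-1)\<close> condition for the ray of \<open>\<alpha>\<close> with the distance \<open>|G(\<cdot>) - G(\<cdot>)|\<close> and the
  measure \<open>ma\<close>, read in the coordinate given by \<open>Psi\<close>.\<close>

definition ray_CD0 ::
  "('a::topological_space \<Rightarrow> 'a \<Rightarrow> bool) \<Rightarrow> 'a set \<Rightarrow> ('a \<Rightarrow> real) \<Rightarrow> real \<Rightarrow> 'a \<Rightarrow> 'a measure \<Rightarrow>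
     bool" where
  "ray_CD0 le H G N \<alpha> ma \<longleftrightarrow>
     (\<exists>h :: real \<Rightarrow> real.
        h \<in> borel_measurable (borel_on (ray_interval le H G \<alpha>)) \<and>
        (\<forall>t\<in>ray_interval le H G \<alpha>. 0 \<le> h t) \<and>
        ma = distr (density (restrict_space lborel (ray_interval le H G \<alpha>)) (\<lambda>t. ennreal (h t)))
               (borel_on H) (Psi le H G \<alpha>) \<and>
        concave_on (ray_interval le H G \<alpha>) (\<lambda>t. h t powr (1 / (N - 2))))"

end

theory Submission
imports Defs
begin

notation pair_measure (infixr "OM" 80) and measurable (infixr "->M" 60) and LIMSEQ (infix "---->" 60)
and emeasure ("em") and indicator ("ind")

abbreviation (input) iffa (infixr "<->" 25) where "A <-> B == A = (B::bool)"

abbreviation (input) "bmeas == borel_measurable"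

text \<open>The gauge turns every ray into an interval and \<open>G\<close>-causal curves into affine motions in it, so
optimal transport in \<open>H\<close> decomposes into one-dimensional transports along the rays.

If the energy condition holds, apply it to measures that spread over a set of rays and are, on each of
these rays, uniform on an interval: comparing entropies yields the Brunn--Minkowski inequality with
exponent \<open>1/(N-1)\<close> for almost every conditional measure, and on the line this inequality (for
rational intervals and weights) forces a density whose power \<open>1/(N - 2)\<close> is concave.

Conversely, a causal coupling is replaced by the one that is monotone on each ray, obtained from
conditional quantile functions.  Concavity of the density bounds the interpolated density along each
transported point by a power mean of the end densities, and Jensen's inequality, applied to the
entropy written as the Legendre transform of an exponential integral, gives concavity of \<open>U\<close>.\<close>

section \<open>Arcs in metric spaces\<close>

text \<open>Several obstacles shape the proof. Rays exist only in a weakly convex \<open>H\<close>,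
  and end-points may belong to several rays; weak convexity is extracted from the energy condition
  by transporting Dirac masses, and end-points have to be shown to be null. The quotient map is
  measurable only for completions, and measurability of the set of \<open>G\<close>-causal curves is
  bypassed by an explicit Borel subset. Since closed balls are compact, the strict order is
  sigma-compact, and points, end-points and coordinates on rays can be selected in a Borel way.
  Almost everywhere statements on rays can be intersected only countably often, which is why the
  one-dimensional results start from rational data. The exponents come from dimension one: for a
  density \<open>k^(n-1)\<close> with \<open>k\<close> concave, the \<open>n\<close>-th roots of
  masses of intervals are concave under interpolation; here \<open>n = N - 1\<close>. In the
  converse direction the coupling is known to respect rays if one marginal is absolutely continuous;
  if neither is, both values of \<open>U\<close> vanish and any plan along \<open>G\<close>-causal
  curves will do.\<close>

lemma path_contains_arc_metric:
fixes p :: "real => 'a::metric_space"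
assumes p: "path p" and ne: "pathstart p ~= pathfinish p"
obtains q where "arc q" "path_image q <= path_image p"
 "pathstart q = pathstart p" "pathfinish q = pathfinish p"
proof -
text \<open>The Kuratowski embedding reduces the claim to Banach spaces.\<close>
define o' :: 'a where "o' = undefined"
define f :: "'a => 'a \<Rightarrow>\<^sub>C real" where "f x = Bcontfun (%y. dist x y - dist o' y)" for x
have bc: "(%y. dist x y - dist o' y):bcontfun" for x
proof (rule bcontfun_normI[where b = "dist x o'"])
 show "continuous_on UNIV (%y. dist x y - dist o' y)" by(intro continuous_intros)
 show "norm (dist x y - dist o' y) <= dist x o'" for y
  using dist_triangle[of x y o'] dist_triangle[of o' y x] by(auto simp:dist_commute abs_le_iff)
qed
have ap: "apply_bcontfun (f x) y = dist x y - dist o' y" for x y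
 unfolding f_def using bc by(simp add:Bcontfun_inverse)
have iso: "dist (f x) (f y) = dist x y" for x y
proof (rule antisym)
 show "dist (f x) (f y) <= dist x y"
  by(rule dist_bound) (auto simp:ap dist_real_def abs_le_iff,
   (metis add.commute diff_le_eq dist_commute dist_triangle)+)
 have "dist x y = dist (f x y) (f y y)" by(simp add:ap dist_real_def)
 also have "... <= dist (f x) (f y)" by(rule dist_bounded)
 finally show "dist x y <= dist (f x) (f y)" .
qed
have inj: "inj f" by(rule injI) (metis iso dist_eq_0_iff)
have cf: "continuous_on S f" for S
 unfolding continuous_on_iff iso by blast
have cinv: "continuous_on (range f) (inv f)"
 unfolding continuous_on_iff using inj by(force simp:iso)
have "path (f o p)" using p cf by(metis path_continuous_image)
moreover have "pathstart (f o p) ~= pathfinish (f o p)"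
 using ne inj by(auto simp:pathstart_def pathfinish_def inj_eq)
ultimately obtain q where q: "arc q" "path_image q <= path_image (f o p)"
 "pathstart q = pathstart (f o p)" "pathfinish q = pathfinish (f o p)"
 using path_contains_arc by metis
have im: "path_image q <= range f" using q(2) by(auto simp:path_image_def)
have "arc (inv f o q)"
 unfolding arc_def
proof
 show "path (inv f o q)"
  using q(1) cinv im by(meson arc_imp_path continuous_on_subset path_continuous_image)
 show "inj_on (inv f o q) {0..1}"
  using q(1) im by(intro comp_inj_on) (auto simp:arc_def path_image_def intro:inj_on_inv_into)
qed
moreover have "path_image (inv f o q) <= path_image p"
 using q(2) inj by(force simp:path_image_def)
ultimately show thesis
 using that[of "inv f o q"] q(3,4) inj by(auto simp:pathstart_def pathfinish_def)
qed

lemma connected_closedin_cover: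
assumes "connected S" "closedin (top_of_set S) A" "closedin (top_of_set S) B"
 and "S <= A Un B" "A ~= {}" "B ~= {}"
shows "A Int B ~= {}"
using assms unfolding connected_closedin by metis

section \<open>The order structure of a null hypersurface\<close>

text \<open>Injectivity takes the place of non-constancy. The order is asked also for
  \<open>s = t\<close>, which is harmless for a reflexive \<open>le\<close> and saves case
  distinctions.\<close>

definition causal_arc ::
"('a::topological_space => 'a => bool) => 'a set => (real => 'a) => 'a => 'a => bool" where
"causal_arc le H ga x y <-> continuous_on {0..1} ga & ga ` {0..1} <= H & inj_on ga {0..1} &
  (ALL s:{0..1}. ALL t:{0..1}. s <= t --> le (ga s) (ga t)) & ga 0 = x & ga 1 = y"

lemma causal_arc_curve:
assumes "causal_arc le H ga x y"
shows "causal_curve le {0..1} ga"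
proof -
have "ga 0 ~= ga 1"
 using assms inj_onD[of ga "{0..1}" 0 1] by(auto simp:causal_arc_def)
hence "~ ga constant_on {0..1}"
 by(fastforce simp:constant_on_def)
thus ?thesis
 using assms by(auto simp:causal_arc_def causal_curve_def is_interval_cc)
qed

section \<open>Reversal of the causal order\<close>

lemma causal_curve_reverse:
assumes "causal_curve (%x y. le y x) I ga"
shows "causal_curve le (uminus ` I) (%t. ga (- t))"
unfolding causal_curve_def
proof (intro conjI)
show "is_interval (uminus ` I)"
 using assms is_interval_neg_translationI[of I 0] by(simp add:causal_curve_def)
show "continuous_on (uminus ` I) (%t. ga (- t))"
 by(rule continuous_on_compose2[of I ga])
  (use assms[unfolded causal_curve_def] in "auto intro:continuous_intros")
have "~ ga constant_on I" using assms unfolding causal_curve_def by blast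
thus "~ (%t. ga (- t)) constant_on uminus ` I"
 unfolding constant_on_def by simp
show "ALL s:uminus ` I. ALL t:uminus ` I. s < t --> le (ga (- s)) (ga (- t))"
 using assms unfolding causal_curve_def by(metis (no_types, lifting) add.inverse_inverse imageE neg_less_iff_less)
qed

lemma causal_curve_reverse01:
assumes "causal_curve (%x y. le y x) {0..1} ga"
shows "causal_curve le {0..1} (%t. ga (1-t))"
unfolding causal_curve_def
proof (intro conjI)
show "is_interval {0..1::real}" by(rule is_interval_cc)
show "continuous_on {0..1} (%t. ga (1-t))"
 by(rule continuous_on_compose2[of "{0..1}" ga])
  (use assms[unfolded causal_curve_def] in "auto intro:continuous_intros")
show "~ (%t. ga (1-t)) constant_on {0..1}"
proof
 assume "(%t. ga (1-t)) constant_on {0..1}"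
 then obtain c where c: "!!t. t:{0..1} ==> ga (1-t) = c" by(auto simp:constant_on_def)
 have "ga t = c" if "t:{0..1}" for t using c[of "1 - t"] that by simp
 hence "ga constant_on {0..1}" unfolding constant_on_def by blast
 thus False using assms unfolding causal_curve_def by blast
qed
show "ALL s:{0..1}. ALL t:{0..1}. s < t --> le (ga (1 - s)) (ga (1-t))"
proof (intro ballI impI)
 fix s t :: real assume "s:{0..1}" "t:{0..1}" "s < t"
 hence "1 - t:{0..1}" "1 - s:{0..1}" "1 - t < 1 - s" by auto
 thus "le (ga (1 - s)) (ga (1-t))" using assms unfolding causal_curve_def by blast
qed
qed

lemma initial_points_reverse: "initial_points (%x y. le y x) H = final_points le H"
by(simp add:initial_points_def final_points_def)

lemma final_points_reverse: "final_points (%x y. le y x) H = initial_points le H"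
by(simp add:initial_points_def final_points_def)

lemma inner_part_reverse: "inner_part (%x y. le y x) H = inner_part le H"
by(auto simp:inner_part_def initial_points_reverse[of le] final_points_reverse[of le])

lemma causally_related_reverse: "causally_related (%x y. le y x) H = causally_related le H"
by(force simp:causally_related_def fun_eq_iff)

lemma ray_reverse: "ray (%x y. le y x) H = ray le H"
by(simp add:ray_def causally_related_reverse[of le] fun_eq_iff)

lemma open_ray_reverse: "open_ray (%x y. le y x) H = open_ray le H"
by(simp add:open_ray_def causally_related_reverse[of le] inner_part_reverse[of le] fun_eq_iff)

lemma strict_mono_on_minus:
fixes f :: "real => real"
shows "strict_mono_on I (%t. - f t) <-> strict_mono_on (uminus ` I) (%t. f (- t))"
by(force simp:strict_mono_on_def)

lemma gauge_for_bdd: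
assumes "gauge_for le H G" "causal_curve le {0..1} ga" "ga ` {0..1} <= H"
 "ga ` {0<..<1} <= inner_part le H"
shows "bdd_above ((G o ga) ` {0<..<1})" "bdd_below ((G o ga) ` {0<..<1})"
using assms(1)[unfolded gauge_for_def, THEN conjunct2, THEN conjunct2, rule_format, of ga] assms(2-)
by simp_all

lemma gauge_for_reverse:
assumes "gauge_for le H G"
shows "gauge_for (%x y. le y x) H (%x. - G x)"
unfolding gauge_for_def
proof (intro conjI allI impI; (elim conjE)?)
have meas: "G:bmeas (borel_on (inner_part le H))"
 and inc: "!!I ga. causal_curve le I ga ==> inj_on ga I ==> ga ` I <= inner_part le H ==>
   strict_mono_on I (G o ga) & continuous_on I (G o ga)"
 using assms unfolding gauge_for_def by blast+
show "(%x. - G x):bmeas (borel_on (inner_part (%x y. le y x) H))"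
 unfolding inner_part_reverse[of le] using meas by simp
fix I ga assume a: "causal_curve (%x y. le y x) I ga" "inj_on ga I" "ga ` I <= inner_part (%x y. le y x) H"
have "inj_on (%t. ga (- t)) (uminus ` I)" using a(2) by(auto simp:inj_on_def)
moreover have "(%t. ga (- t)) ` uminus ` I <= inner_part le H"
 using a(3) by(auto simp:inner_part_reverse[of le])
ultimately have r: "strict_mono_on (uminus ` I) (G o (%t. ga (- t)))"
  "continuous_on (uminus ` I) (G o (%t. ga (- t)))"
 using inc causal_curve_reverse[OF a(1)] by blast+
show "strict_mono_on I ((%x. - G x) o ga)"
 using r(1) strict_mono_on_minus[of I "G o ga"] by(simp add:comp_def)
have "continuous_on I (%t. (G o (%t. ga (- t))) (- t))"
 by(rule continuous_on_compose2[OF r(2)]) (auto intro:continuous_intros)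
thus "continuous_on I ((%x. - G x) o ga)"
 by(auto simp:comp_def intro:continuous_intros)
next
fix ga assume a: "causal_curve (%x y. le y x) {0..1} ga" "ga ` {0..1} <= H"
 "ga ` {0<..<1} <= inner_part (%x y. le y x) H"
let ?g = "%t. ga (1-t)"
have "?g ` {0..1} <= H" using a(2) by auto
moreover have "?g ` {0<..<1} <= inner_part le H" using a(3) by(auto simp:inner_part_reverse[of le])
ultimately have *: "bdd_above ((G o ?g) ` {0<..<1})" "bdd_below ((G o ?g) ` {0<..<1})"
 using gauge_for_bdd[OF assms causal_curve_reverse01[OF a(1)]] by auto
have eq: "(G o ga) ` {0<..<1} <= (G o ?g) ` {0<..<1}"
 by(force intro!:image_eqI[where x = "1 - t" for t])
have neg: "((%x. - G x) o ga) ` {0<..<1} = uminus ` (G o ga) ` {0<..<1}"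
 by(auto simp:image_comp comp_def)
show "bdd_above (((%x. - G x) o ga) ` {0<..<1})"
 using bdd_below_mono[OF *(2) eq] unfolding neg bdd_above_uminus .
show "bdd_below (((%x. - G x) o ga) ` {0<..<1})"
 using bdd_above_mono[OF *(1) eq] unfolding neg bdd_below_uminus .
qed

lemma weakly_convex_reverse:
assumes "weakly_convex le H"
shows "weakly_convex (%x y. le y x) H"
unfolding weakly_convex_def
proof (intro ballI impI; elim conjE)
fix x y assume "x:H" "y:H" "le y x" "x ~= y"
then obtain ga where g: "causal_curve le {0..1} ga" "ga ` {0..1} <= H" "ga 0 = y" "ga 1 = x"
 using assms unfolding weakly_convex_def by metis
have "causal_curve (%x y. le y x) {0..1} (%t. ga (1-t))"
 by(rule causal_curve_reverse01) (use g in simp)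
thus "EX ga. causal_curve (%x y. le y x) {0..1} ga & ga ` {0..1} <= H & ga 0 = x & ga 1 = y"
 using g by(intro exI[of _ "%t. ga (1-t)"]) auto
qed

section \<open>The linear order on a ray\<close>

locale null_rays =
fixes le :: "'a::{heine_borel,polish_space} => 'a => bool" and H :: "'a set" and G :: "'a => real"
assumes le_refl: "le x x"
 and le_trans: "le x y ==> le y z ==> le x z"
 and closed_le: "closed {(x, y). le x y}"
 and closed_H: "closed H"
 and gauge: "gauge_for le H G"
 and nnb: "null_non_branching le H"
 and wconv: "weakly_convex le H"
begin

abbreviation "Hi == inner_part le H"

text \<open>All assumptions are self-dual when the gauge changes sign together with the order. A
  statement on lower ends or predecessors therefore yields its dual by interpreting the locale once
  more.\<close>

lemma reverse: "null_rays (%x y. le y x) H (%x. - G x)"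
proof
have "closed (prod.swap -` {(x, y). le x y})"
 by(intro closed_vimage closed_le continuous_on_swap)
moreover have "prod.swap -` {(x, y). le x y} = {(x, y). le y x}" by auto
ultimately show "closed {(x, y). le y x}" by simp
show "null_non_branching (%x y. le y x) H"
 using nnb unfolding null_non_branching_def by simp
qed (auto intro:le_refl le_trans closed_H gauge_for_reverse gauge weakly_convex_reverse wconv)

lemma Hi_subset: "Hi <= H" by(auto simp:inner_part_def)

lemma closed_below: "closed {x. le x y}"
proof -
have "closed ((%x. (x, y)) -` {(x, y). le x y})"
 by(intro closed_vimage closed_le continuous_intros)
thus ?thesis by(simp add:vimage_def)
qed

lemma closed_above: "closed {x. le y x}"
proof -
have "closed ((%x. (y, x)) -` {(x, y). le x y})"
 by(intro closed_vimage closed_le continuous_intros)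
thus ?thesis by(simp add:vimage_def)
qed

lemma strictly_between_inner:
"x:H ==> y:H ==> z:H ==> le x z ==> le z y ==> x ~= z ==> y ~= z ==> z:Hi"
unfolding inner_part_def initial_points_def final_points_def by blast

lemma gauge_strict_mono:
"causal_curve le I ga ==> inj_on ga I ==> ga ` I <= Hi ==> strict_mono_on I (G o ga)"
"causal_curve le I ga ==> inj_on ga I ==> ga ` I <= Hi ==> continuous_on I (G o ga)"
using gauge unfolding gauge_for_def by blast+

text \<open>On a causal loop every arc would be causal in both directions, and the gauge would be
both increasing and decreasing along it.\<close>

lemma le_antisym:
assumes x: "x:H" and y: "y:H" and xy: "le x y" and yx: "le y x"
shows "x = y"
proof (rule ccontr)
assume ne: "x ~= y"
obtain ga where g: "causal_curve le {0..1} ga" "ga ` {0..1} <= H" "ga 0 = x" "ga 1 = y"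
 using wconv x y xy ne unfolding weakly_convex_def by metis
have rel: "le (ga s) (ga t)" if "s:{0..1}" "t:{0..1}" for s t
proof -
 have "le (ga s) y" "le x (ga t)"
  using g that le_refl unfolding causal_curve_def
  by(metis atLeastAtMost_iff order_le_less zero_le_one order_refl)+
 thus ?thesis using yx le_trans by blast
qed
have "path ga" using g by(auto simp:path_def causal_curve_def)
then obtain q where q: "arc q" "path_image q <= path_image ga" "q 0 = x" "q 1 = y"
 using path_contains_arc_metric[of ga] g ne by(metis pathstart_def pathfinish_def)
have q': "q s:ga ` {0..1}" if "s:{0..1}" for s
 using q(2) that by(auto simp:path_image_def)
have rq: "le (q s) (q t)" if "s:{0..1}" "t:{0..1}" for s t
 using q'[OF that(1)] q'[OF that(2)] rel by auto
have inner: "q s:Hi" if s: "s:{0..1}" for s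
proof -
 have "le x (q s)" "le (q s) x" "le y (q s)" "le (q s) y"
  using rq s q(3,4) by(metis atLeastAtMost_iff zero_le_one order_refl)+
 moreover have "q s:H" using q'[OF s] g(2) by auto
 ultimately show ?thesis
  using x y ne unfolding inner_part_def initial_points_def final_points_def
  by(cases "q s = x") auto
qed
have inj: "inj_on q {0..1}" and cont: "continuous_on {0..1} q"
 using q(1) by(auto simp:arc_def path_def)
have nc: "~ q constant_on {0..1}" "~ (%t. q (1-t)) constant_on {0..1}"
 using q(3,4) ne unfolding constant_on_def
 by(metis atLeastAtMost_iff diff_zero order_refl zero_le_one diff_self)+
have "causal_curve le {0..1} q"
 using rq cont nc by(auto simp:causal_curve_def is_interval_cc)
hence 1: "G (q 0) < G (q 1)"
 using gauge_strict_mono(1)[of "{0..1}" q] inner inj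
 by(auto simp:image_subset_iff dest!:strict_mono_onD[of _ _ 0 1])
have "causal_curve le {0..1} (%t. q (1-t))"
 using rq nc cont by(auto simp:causal_curve_def is_interval_cc
   intro!:continuous_on_compose2[OF cont] continuous_intros)
moreover have "inj_on (%t. q (1-t)) {0..1}"
 by(rule inj_onI) (use inj_onD[OF inj] in fastforce)
ultimately have 2: "G (q 1) < G (q 0)"
 using gauge_strict_mono(1)[of "{0..1}" "%t. q (1-t)"] inner
 by(auto simp:image_subset_iff dest!:strict_mono_onD[of _ _ 0 1])
show False using 1 2 by simp
qed

text \<open>The arc extracted from a causal curve lies in its image, so its points are pairwise
  comparable, but in an unknown order. For fixed \<open>s\<close>, the later parameters whose points
  lie above, respectively below, \<open>q s\<close> form closed sets that cover
  \<open>{s<..1}\<close> and are disjoint by antisymmetry and injectivity. Connectedness leaves only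
  one of them, and it is the first because it contains 1.\<close>

lemma causal_arc_exists:
assumes x: "x:H" and y: "y:H" and xy: "le x y" and ne: "x ~= y"
obtains ga where "causal_arc le H ga x y"
proof -
obtain ga where g: "causal_curve le {0..1} ga" "ga ` {0..1} <= H" "ga 0 = x" "ga 1 = y"
 using wconv x y xy ne unfolding weakly_convex_def by metis
have mono: "le (ga s) (ga t)" if "s:{0..1}" "t:{0..1}" "s <= t" for s t
 using g that le_refl unfolding causal_curve_def by(cases "s = t") auto
have "path ga" using g by(auto simp:path_def causal_curve_def)
then obtain q where q: "arc q" "path_image q <= path_image ga" "q 0 = x" "q 1 = y"
 using path_contains_arc_metric[of ga] g ne by(metis pathstart_def pathfinish_def)
have q': "q s:ga ` {0..1}" if "s:{0..1}" for s
 using q(2) that by(auto simp:path_image_def)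
have qH: "q s:H" if "s:{0..1}" for s using q'[OF that] g(2) by auto
have inj: "inj_on q {0..1}" and cont: "continuous_on {0..1} q"
 using q(1) by(auto simp:arc_def path_def)
have comp: "le (q s) (q t) \<or> le (q t) (q s)" if "s:{0..1}" "t:{0..1}" for s t
 using q'[OF that(1)] q'[OF that(2)] mono by(auto, meson linear)
have top: "le (q s) y" if "s:{0..1}" for s
 using q'[OF that] mono[of _ 1] g(4) by auto
have "le (q s) (q t)" if st: "s:{0..1}" "t:{0..1}" "s <= t" for s t
proof (cases "s = t")
 case True thus ?thesis by(simp add:le_refl)
next
 case False
 hence s: "0 <= s" "s < t" "t <= 1" using st by auto
 have eq: False if "u:{s<..1}" "le (q s) (q u)" "le (q u) (q s)" for u
 proof -
  have "u:{0..1}" using that s by auto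
  hence "q s = q u" using that st qH le_antisym by blast
  thus False using inj_onD[OF inj _ st(1) \<open>u:{0..1}\<close>] that(1) by auto
 qed
 have cs: "continuous_on {s<..1} q" using cont s by(auto intro:continuous_on_subset)
 let ?A = "{s<..1} Int q -` {v. le (q s) v}" and ?B = "{s<..1} Int q -` {v. le v (q s)}"
 have "closedin (top_of_set {s<..1}) ?A" "closedin (top_of_set {s<..1}) ?B"
  using continuous_closedin_preimage[OF cs] closed_above closed_below by blast+
 moreover have "{s<..1} <= ?A Un ?B"
 proof
  fix u assume "u:{s<..1}"
  thus "u:?A Un ?B" using comp[OF st(1), of u] s by simp
 qed
 moreover have "?A Int ?B = {}"
  unfolding disjoint_iff using eq by(metis IntD1 IntD2 mem_Collect_eq vimageD)
 moreover have "1:?A" using s top[OF st(1)] q(4) by simp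
 ultimately have "?B = {}"
  using connected_closedin_cover[OF connected_Ioc, of s 1 ?A ?B] by(metis empty_iff)
 hence "t ~: ?B" by blast
 hence "~ le (q t) (q s)" using s by simp
 thus ?thesis using comp[OF st(1,2)] by blast
qed
thus thesis
 using that[of q] inj cont qH q(3,4) unfolding causal_arc_def by(simp add:image_subset_iff)
qed

text \<open>A point common to both halves lies below and above \<open>c\<close> and hence equals
  \<open>c\<close>; so concatenation keeps injectivity.\<close>

lemma causal_arc_join:
assumes "causal_arc le H p x c" and "causal_arc le H q c y"
shows "causal_arc le H (p +++ q) x y" and "(p +++ q) (1/2) = c"
proof -
note P = assms(1)[unfolded causal_arc_def] and Q = assms(2)[unfolded causal_arc_def]
have pc: "le (p s) c" "p s:H" if "s:{0..1}" for s
 using P that by(metis atLeastAtMost_iff order_refl zero_le_one, blast)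
have cq: "le c (q s)" "q s:H" if "s:{0..1}" for s
 using Q that by(metis atLeastAtMost_iff order_refl zero_le_one, blast)
have lt: "le ((p +++ q) s) ((p +++ q) t) & (p +++ q) s ~= (p +++ q) t"
 if st: "s:{0..1}" "t:{0..1}" "s < t" for s t
proof -
 consider "t <= 1/2" | "s <= 1/2" "1/2 < t" | "1/2 < s" by linarith
 thus ?thesis
 proof cases
  case 1
  hence m: "2 * s:{0..1}" "2*t:{0..1}" "2 * s < 2*t" using st by auto
  hence "p (2 * s) ~= p (2*t)" using P inj_on_eq_iff[of p "{0..1}" "2 * s" "2*t"] by simp
  thus ?thesis using 1 st P m by(auto simp:joinpaths_def)
 next
  case 2
  have m: "2 * s:{0..1}" "2*t - 1:{0..1}" using st 2 by auto
  have l: "le (p (2 * s)) c" "le c (q (2*t - 1))" using pc cq m by auto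
  moreover have "p (2 * s) ~= q (2*t - 1)"
  proof
   assume e: "p (2 * s) = q (2*t - 1)"
   hence "q (2*t - 1) = c"
    using l cq(2)[OF m(2)] le_antisym pc(2)[of 1] P by(metis atLeastAtMost_iff order_refl zero_le_one)
   hence "2*t - 1 = 0" using Q m by(metis atLeastAtMost_iff inj_on_def order_refl zero_le_one)
   thus False using 2 by simp
  qed
  ultimately show ?thesis using 2 le_trans by(auto simp:joinpaths_def)
 next
  case 3
  hence m: "2 * s - 1:{0..1}" "2*t - 1:{0..1}" "2 * s - 1 < 2*t - 1" using st by auto
  hence "q (2 * s - 1) ~= q (2*t - 1)"
   using Q inj_on_eq_iff[of q "{0..1}" "2 * s - 1" "2*t - 1"] by simp
  thus ?thesis using 3 st Q m by(auto simp:joinpaths_def)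
 qed
qed
have "continuous_on {0..1} (p +++ q)"
 using P Q path_join_imp[of p q] by(simp add:path_def pathstart_def pathfinish_def)
moreover have "(p +++ q) ` {0..1} <= H"
 using pc cq by(auto simp:joinpaths_def)
moreover have "inj_on (p +++ q) {0..1}"
 by(rule linorder_inj_onI) (use lt in auto)
moreover have "le ((p +++ q) s) ((p +++ q) t)" if "s:{0..1}" "t:{0..1}" "s <= t" for s t
 using lt[OF that(1,2)] le_refl that(3) by(cases "s = t") auto
ultimately show "causal_arc le H (p +++ q) x y"
 using P Q unfolding causal_arc_def by(auto simp:joinpaths_def)
show "(p +++ q) (1/2) = c" using P by(simp add:joinpaths_def)
qed

text \<open>As \<open>c\<close> is not initial, arcs from \<open>c\<close> to \<open>x\<close> and
  from \<open>c\<close> to \<open>y\<close> can be prolonged backwards by one and the same arc from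
  some \<open>w\<close>. The two curves agree at the parameters 0 and 1/2, so non-branching puts one
  image inside the other, and the last point of the contained curve lies below the last point of the
  other.\<close>

lemma comparable_above:
assumes c: "c:Hi" and x: "x:H" "le c x" and y: "y:H" "le c y"
shows "le x y \<or> le y x"
proof (cases "x = c \<or> y = c")
case True thus ?thesis using x y by auto
next
case False
obtain w where w: "w:H" "le w c" "w ~= c"
 using c unfolding inner_part_def initial_points_def by auto
have cH: "c:H" using c Hi_subset by auto
obtain p where p: "causal_arc le H p w c" using causal_arc_exists w cH by metis
obtain q1 where q1: "causal_arc le H q1 c x" using causal_arc_exists x cH False by metis
obtain q2 where q2: "causal_arc le H q2 c y" using causal_arc_exists y cH False by metis
note j1 = causal_arc_join[OF p q1] and j2 = causal_arc_join[OF p q2]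
have "(p +++ q1) ` {0..1} <= (p +++ q2) ` {0..1} \<or> (p +++ q2) ` {0..1} <= (p +++ q1) ` {0..1}"
 using nnb[unfolded null_non_branching_def, THEN conjunct1, unfolded forward_null_non_branching_def,
   rule_format, of "p +++ q1" "p +++ q2"]
  causal_arc_curve[OF j1(1)] causal_arc_curve[OF j2(1)] j1 j2
 unfolding causal_arc_def by auto
moreover have "x:(p +++ q1) ` {0..1}" "y:(p +++ q2) ` {0..1}"
 using j1(1) j2(1) unfolding causal_arc_def by(metis atLeastAtMost_iff image_eqI order_refl zero_le_one)+
moreover have "le z y" if "causal_arc le H r w y" "z:r ` {0..1}" for r y z
 using that unfolding causal_arc_def by auto
hence "ALL z:(p +++ q1) ` {0..1}. le z x" "ALL z:(p +++ q2) ` {0..1}. le z y"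
 using j1(1) j2(1) by blast+
ultimately show ?thesis by blast
qed

lemma comparable_below:
assumes "c:Hi" "x:H" "le x c" "y:H" "le y c"
shows "le x y \<or> le y x"
proof -
interpret rev: null_rays "%x y. le y x" H "%x. - G x" by(rule reverse)
show ?thesis using rev.comparable_above[of c x y] assms by(auto simp:inner_part_reverse[of le])
qed

lemma in_ray_iff: "x:ray le H c <-> x:H & c:H & (le x c \<or> le c x)"
by(auto simp:ray_def causally_related_def)

lemma in_open_ray_iff: "x:open_ray le H c <-> x:Hi & x:ray le H c"
using Hi_subset by(auto simp:ray_def open_ray_def)

text \<open>Points on different sides of \<open>c\<close> are comparable through \<open>c\<close>,
  points on the same side by non-branching.\<close>

lemma ray_total:
assumes c: "c:Hi" and x: "x:ray le H c" and y: "y:ray le H c"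
shows "le x y \<or> le y x"
using comparable_above[OF c, of x y] comparable_below[OF c, of x y] x y le_trans
unfolding in_ray_iff by blast

lemma ray_self: "c:Hi ==> c:ray le H c"
using Hi_subset by(auto simp:in_ray_iff le_refl)

lemma ray_eq:
assumes c: "c:Hi" and d: "d:open_ray le H c"
shows "ray le H d = ray le H c"
proof (intro set_eqI iffI)
have d': "d:Hi" "d:ray le H c" using d by(auto simp:in_open_ray_iff)
have cd: "c:ray le H d" using d' c Hi_subset by(auto simp:in_ray_iff)
fix x
show "x:ray le H c" if "x:ray le H d"
 using ray_total[OF d'(1) that cd] that d' by(auto simp:in_ray_iff)
show "x:ray le H d" if "x:ray le H c"
 using ray_total[OF c that d'(2)] that d' by(auto simp:in_ray_iff)
qed

lemma open_ray_eq:
assumes c: "c:Hi" and d: "d:open_ray le H c"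
shows "open_ray le H d = open_ray le H c"
using ray_eq[OF assms] by(auto simp:in_open_ray_iff)

lemma causal_arc_inner:
assumes g: "causal_arc le H ga x y" and s: "s:{0<..<1}"
shows "ga s:Hi"
proof (rule strictly_between_inner[of x y])
note g' = g[unfolded causal_arc_def]
show "x:H" "y:H" "ga s:H" using g' s by auto
show "le x (ga s)" "le (ga s) y"
 using g' s by(metis atLeastAtMost_iff greaterThanLessThan_iff less_imp_le order_refl zero_le_one)+
show "x ~= ga s" "y ~= ga s"
 using g' s by(metis atLeastAtMost_iff greaterThanLessThan_iff less_imp_le order_refl zero_le_one inj_onD less_irrefl)+
qed

text \<open>The parameters whose points lie above \<open>p\<close> and those whose points lie below
  \<open>p\<close> form closed non-empty sets that cover the interval, so they share a parameter;
  antisymmetry identifies its point with \<open>p\<close>.\<close>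

lemma causal_arc_image:
assumes g: "causal_arc le H ga x y" and p: "p:H" "le x p" "le p y"
 and tot: "!!s. s:{0..1} ==> le p (ga s) \<or> le (ga s) p"
shows "p:ga ` {0..1}"
proof -
note g' = g[unfolded causal_arc_def]
let ?A = "{0..1} Int ga -` {v. le p v}" and ?B = "{0..1} Int ga -` {v. le v p}"
have c: "continuous_on {0..1} ga" using g' by simp
have "closedin (top_of_set {0..1}) ?A" "closedin (top_of_set {0..1}) ?B"
 using continuous_closedin_preimage[OF c] closed_above closed_below by blast+
moreover have "{0..1} <= ?A Un ?B" using tot by blast
moreover have "1:?A" "0:?B" using g' p by auto
ultimately have "?A Int ?B ~= {}"
 using connected_closedin_cover[OF connected_Icc, of 0 1 ?A ?B] by(metis empty_iff)
then obtain s where "s:{0..1}" "le p (ga s)" "le (ga s) p" by blast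
moreover have "ga s:H" using g' \<open>s:{0..1}\<close> by auto
ultimately show ?thesis using le_antisym p by blast
qed

lemma gauge_inner_arc:
assumes x: "x:Hi" and y: "y:Hi" and xy: "le x y" "x ~= y"
obtains ga where "causal_arc le H ga x y" "ga ` {0..1} <= Hi" "strict_mono_on {0..1} (G o ga)"
 "continuous_on {0..1} (G o ga)"
proof -
obtain ga where g: "causal_arc le H ga x y" using causal_arc_exists x y xy Hi_subset by blast
have "ga s:Hi" if "s:{0..1}" for s
 using causal_arc_inner[OF g, of s] x y g that
 by(cases "s = 0 \<or> s = 1") (auto simp:causal_arc_def)
hence im: "ga ` {0..1} <= Hi" by auto
have "inj_on ga {0..1}" using g by(simp add:causal_arc_def)
thus thesis
 using that[OF g im] gauge_strict_mono[OF causal_arc_curve[OF g] _ im] by blast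
qed

lemma gauge_less:
assumes "x:Hi" "y:Hi" "le x y" "x ~= y"
shows "G x < G y"
proof -
obtain ga where g: "causal_arc le H ga x y" "strict_mono_on {0..1} (G o ga)"
 using gauge_inner_arc[OF assms] by metis
thus ?thesis by(fastforce simp:strict_mono_on_def causal_arc_def)
qed

lemma gauge_ivt:
assumes "x:Hi" "y:Hi" "le x y" "G x <= g" "g <= G y"
obtains z where "z:Hi" "le x z" "le z y" "G z = g"
proof (cases "x = y")
case True
thus ?thesis using that[of x] assms le_refl by auto
next
case False
obtain ga where g: "causal_arc le H ga x y" "ga ` {0..1} <= Hi" "continuous_on {0..1} (G o ga)"
 using gauge_inner_arc[OF assms(1-3) False] by metis
obtain s where s: "s:{0..1}" "G (ga s) = g"
 using IVT'[of "G o ga" 0 g 1] g assms by(auto simp:causal_arc_def)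
have "le x (ga s)" "le (ga s) y" using g(1) s(1) by(auto simp:causal_arc_def)
moreover have "ga s:Hi" using g(2) s(1) by blast
ultimately show thesis using that[of "ga s"] s(2) by simp
qed

lemma gauge_le_iff:
assumes c: "c:Hi" and x: "x:open_ray le H c" and y: "y:open_ray le H c"
shows "G x <= G y <-> le x y"
proof -
have r: "x:ray le H c" "y:ray le H c" and i: "x:Hi" "y:Hi"
 using x y by(auto simp:in_open_ray_iff)
show ?thesis
 using ray_total[OF c r] gauge_less[OF i] gauge_less[OF i(2,1)] le_refl by fastforce
qed

text \<open>If \<open>c\<close> lies strictly between \<open>x\<close> and \<open>y\<close>, an
  arbitrary arc from \<open>x\<close> to \<open>y\<close> may follow another ray with the same two
  end-points. Joining two arcs at \<open>c\<close> keeps it on the ray of \<open>c\<close>.\<close>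

lemma ray_arc:
assumes c: "c:Hi" and x: "x:ray le H c" and y: "y:ray le H c"
 and xy: "le x y" and ne: "x ~= y"
obtains ga where "causal_arc le H ga x y" "ga ` {0..1} <= ray le H c"
proof -
have H: "x:H" "y:H" "c:H" using x y c Hi_subset by(auto simp:in_ray_iff)
have bet: "le x (ga s)" "le (ga s) y" "ga s:H" if "causal_arc le H ga x y" "s:{0..1}" for ga s x y
 using that by(auto simp:causal_arc_def)
consider "le y c" | "le c x" | "le x c" "le c y" "x ~= c" "y ~= c"
 using x y le_refl by(auto simp:in_ray_iff)
thus thesis
proof cases
 case 1
 obtain ga where g: "causal_arc le H ga x y" using causal_arc_exists H xy ne by metis
 have "ga s:ray le H c" if "s:{0..1}" for s
  using bet[OF g that] 1 H le_trans[of "ga s" y c] by(simp add:in_ray_iff)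
 thus thesis by(intro that[OF g]) blast
next
 case 2
 obtain ga where g: "causal_arc le H ga x y" using causal_arc_exists H xy ne by metis
 have "ga s:ray le H c" if "s:{0..1}" for s
  using bet[OF g that] 2 H le_trans[of c x "ga s"] by(simp add:in_ray_iff)
 thus thesis by(intro that[OF g]) blast
next
 case 3
 obtain p where p: "causal_arc le H p x c" using causal_arc_exists H 3 by metis
 obtain q where q: "causal_arc le H q c y" using causal_arc_exists H 3 by metis
 show thesis
  by(rule that[OF causal_arc_join(1)[OF p q]])
   (use bet[OF p] bet[OF q] H in "auto simp:in_ray_iff joinpaths_def")
qed
qed

end

section \<open>Gauge coordinates on a single ray\<close>

context null_rays
begin

definition J :: "'a => real set" where "J c = G ` open_ray le H c"
definition IA :: "'a => real set" where "IA c = gauge_ext le H G c ` ray le H c"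
text \<open>This is \<open>Psi\<close> without the shift by \<open>G c\<close>: the coordinate is
  then the same for all inner points of a ray.\<close>

definition PT :: "'a => real => 'a" where "PT c = the_inv_into (ray le H c) (gauge_ext le H G c)"

abbreviation "GE == gauge_ext le H G"
abbreviation "Ry == ray le H"
abbreviation "OpR == open_ray le H"

lemma OR_subset: "OpR c <= Ry c" "OpR c <= Hi"
by(auto simp:in_open_ray_iff)

lemma R_subset: "Ry c <= H"
by(auto simp:in_ray_iff)

lemma OR_D: "x:OpR c ==> x:Ry c" "x:OpR c ==> x:Hi" "x:OpR c ==> x:H"
using Hi_subset by(auto simp:in_open_ray_iff)

lemma OR_self: "c:Hi ==> c:OpR c"
by(simp add:in_open_ray_iff ray_self)

lemma J_self: "c:Hi ==> G c:J c"
using OR_self by(auto simp:J_def)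

lemma J_ray_eq: "c:Hi ==> d:OpR c ==> J d = J c"
by(simp add:J_def open_ray_eq)

lemma GE_ray_eq: "c:Hi ==> d:OpR c ==> GE d = GE c"
by(simp add:gauge_ext_def open_ray_eq fun_eq_iff)

lemma OR_le: "c:Hi ==> x:OpR c ==> y:Hi ==> le x y \<or> le y x ==> y:OpR c"
using ray_eq[of c x] Hi_subset in_open_ray_iff in_ray_iff by(metis subsetD)

text \<open>The point below \<open>x\<close> may be an end-point of the ray, but the middle of an
  arc from it to \<open>x\<close> is an inner point.\<close>

lemma J_lower:
assumes c: "c:Hi" and x: "x:OpR c"
shows "EX y:OpR c. G y < G x"
proof -
have xi: "x:Hi" using x by(simp add:in_open_ray_iff)
then obtain w where w: "w:H" "le w x" "w ~= x"
 unfolding inner_part_def initial_points_def by auto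
obtain ga where g: "causal_arc le H ga w x" using causal_arc_exists w xi Hi_subset by blast
have i: "ga (1/2):Hi" by(rule causal_arc_inner[OF g]) simp
have "le (ga (1/2)) (ga 1)"
 using g unfolding causal_arc_def by(elim conjE) (drule bspec[of _ _ "1/2"], simp, drule bspec[of _ _ 1], simp_all)
moreover have "ga 1 = x" "inj_on ga {0..1}" using g unfolding causal_arc_def by simp_all
moreover have "ga (1/2) ~= ga 1" using inj_onD[of ga "{0..1}" "1/2" 1] calculation by auto
ultimately have l: "le (ga (1/2)) x" "ga (1/2) ~= x" by auto
have "ga (1/2):OpR c" using OR_le[OF c x i] l by blast
thus ?thesis using gauge_less[OF i xi l] by blast
qed

lemma J_upper:
assumes c: "c:Hi" and x: "x:OpR c"
shows "EX y:OpR c. G x < G y"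
proof -
interpret rev: null_rays "%x y. le y x" H "%x. - G x" by(rule reverse)
show ?thesis using rev.J_lower[of c x] assms by(simp add:inner_part_reverse[of le] open_ray_reverse[of le])
qed

lemma J_ivt:
assumes c: "c:Hi" and x: "x:OpR c" and y: "y:OpR c" and g: "G x <= g" "g <= G y"
obtains z where "z:OpR c" "le x z" "le z y" "G z = g"
proof -
have "le x y" using gauge_le_iff[OF c x y] g by linarith
then obtain z where z: "z:Hi" "le x z" "le z y" "G z = g"
 using gauge_ivt[of x y g] x y g by(auto simp:in_open_ray_iff)
thus thesis using that OR_le[OF c x z(1)] by blast
qed

lemma J_interval: assumes c: "c:Hi" shows "is_interval (J c)"
unfolding is_interval_1
proof (intro ballI allI impI)
fix a b x assume "a:J c" "b:J c" "a <= x & x <= b"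
then obtain p q where "p:OpR c" "q:OpR c" "G p <= x" "x <= G q" unfolding J_def by auto
then obtain z where "z:OpR c" "G z = x" using J_ivt[OF c] by metis
thus "x:J c" unfolding J_def by auto
qed

lemma J_open: assumes c: "c:Hi" shows "open (J c)"
unfolding open_contains_ball
proof
fix g assume g: "g:J c"
obtain l u where lu: "l:J c" "u:J c" "l < g" "g < u"
proof -
 obtain p where p: "p:OpR c" "g = G p" using g unfolding J_def by auto
 obtain a b where "a:OpR c" "b:OpR c" "G a < G p" "G p < G b"
  using J_lower[OF c p(1)] J_upper[OF c p(1)] by blast
 thus thesis using that[of "G a" "G b"] p(2) unfolding J_def by auto
qed
have "ball g (min (g - l) (u - g)) <= J c"
proof
 fix x assume "x:ball g (min (g - l) (u - g))"
 hence "l <= x" "x <= u" by(auto simp:dist_real_def abs_less_iff)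
 thus "x:J c" using J_interval[OF c] lu unfolding is_interval_1 by blast
qed
thus "EX e>0. ball g e <= J c" using lu by(intro exI[of _ "min (g - l) (u - g)"]) auto
qed

lemma J_nonempty: "c:Hi ==> J c ~= {}"
using J_self by blast

text \<open>A point that is both initial and final is comparable with itself only, so it would
  coincide with the inner point \<open>c\<close>.\<close>

lemma not_inner_cases:
assumes "x:Ry c" "c:Hi"
obtains "x:OpR c" | "x:initial_points le H" "x ~: final_points le H"
 | "x:final_points le H" "x ~: initial_points le H"
proof -
have "~ (x:initial_points le H & x:final_points le H)"
proof
 assume a: "x:initial_points le H & x:final_points le H"
 hence "x = c" using assms Hi_subset
  unfolding in_ray_iff initial_points_def final_points_def by blast
 thus False using a assms by(simp add:inner_part_def)
qed
moreover have "x:Hi ==> x:OpR c" using assms by(simp add:in_open_ray_iff)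
ultimately show thesis using that assms R_subset unfolding inner_part_def by blast
qed

lemma initial_le:
assumes c: "c:Hi" and x: "x:Ry c" "x:initial_points le H" and p: "p:Ry c"
shows "le x p"
using ray_total[OF c x(1) p] x p R_subset le_refl unfolding initial_points_def by blast

lemma final_ge:
assumes c: "c:Hi" and x: "x:Ry c" "x:final_points le H" and p: "p:Ry c"
shows "le p x"
using ray_total[OF c x(1) p] x p R_subset le_refl unfolding final_points_def by blast

text \<open>The second gauge condition bounds \<open>G\<close> from below along one arc from
  \<open>x\<close> to \<open>c\<close>. Every \<open>p\<close> on the open ray lies above some
  interior point of this arc: otherwise \<open>p\<close> would lie below all of them and, the order
  being closed, below the initial point \<open>x\<close>.\<close>

lemma J_bdd_below:
assumes c: "c:Hi" and x: "x:Ry c" "x:initial_points le H"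
shows "bdd_below (J c)"
proof -
have xc: "x ~= c" using x c by(auto simp:inner_part_def)
have "le x c" using initial_le[OF c x ray_self[OF c]] .
then obtain ga where g: "causal_arc le H ga x c"
 using causal_arc_exists x c xc Hi_subset R_subset by blast
have inn: "ga ` {0<..<1} <= Hi" using causal_arc_inner[OF g] by blast
have H': "ga ` {0..1} <= H" and g0: "ga 0 = x" "ga 1 = c" and cont: "continuous_on {0..1} ga"
 using g unfolding causal_arc_def by simp_all
have lec: "le (ga s) c" if "s:{0..1}" for s
 using g that unfolding causal_arc_def by auto
obtain L where L: "ALL s:{0<..<1}. L <= G (ga s)"
 using gauge_for_bdd(2)[OF gauge causal_arc_curve[OF g] H' inn] unfolding bdd_below_def by auto
have "L <= G p" if p: "p:OpR c" for p
proof -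
 have sOR: "ga s:OpR c" if "s:{0<..<1}" for s
  using OR_le[OF c OR_self[OF c], of "ga s"] inn lec[of s] that by(simp add:image_subset_iff)
 have "EX s:{0<..<1}. le (ga s) p"
 proof (rule ccontr)
  assume n: "~ (EX s:{0<..<1}. le (ga s) p)"
  have "{0<..<1} <= {0..1} Int ga -` {v. le p v}"
  proof
   fix s :: real assume s: "s:{0<..<1}"
   hence "le p (ga s)" using n sOR[OF s] ray_total[OF c, of p "ga s"] p OR_subset by blast
   thus "s:{0..1} Int ga -` {v. le p v}" using s by simp
  qed
  moreover have "closed ({0..1} Int ga -` {v. le p v})"
   by(intro continuous_closed_preimage cont closed_above) simp
  ultimately have "closure {0<..<1::real} <= {0..1} Int ga -` {v. le p v}"
   by(rule closure_minimal)
  moreover have "(0::real):closure {0<..<1}" by simp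
  ultimately have "0:ga -` {v. le p v}" by blast
  hence "le p x" using g0 by simp
  moreover have "p:H" "x ~= p" using p x OR_subset Hi_subset by(auto simp:inner_part_def)
  ultimately show False using x(2) unfolding initial_points_def by blast
 qed
 then obtain s where s: "s:{0<..<1}" "le (ga s) p" by blast
 hence "G (ga s) <= G p" using gauge_le_iff[OF c sOR[OF s(1)] p] by blast
 thus ?thesis using L s(1) by fastforce
qed
thus ?thesis unfolding J_def by(intro bdd_belowI[of _ L]) blast
qed

lemma J_bdd_above:
assumes c: "c:Hi" and x: "x:Ry c" "x:final_points le H"
shows "bdd_above (J c)"
proof -
interpret rev: null_rays "%x y. le y x" H "%x. - G x" by(rule reverse)
have "bdd_below (rev.J c)"
 using rev.J_bdd_below[of c x] assms
 by(simp add:inner_part_reverse[of le] ray_reverse[of le] initial_points_reverse[of le])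
moreover have "rev.J c = uminus ` J c"
 by(simp add:rev.J_def J_def open_ray_reverse[of le] image_image)
ultimately show ?thesis by(simp add:bdd_below_uminus)
qed

lemma GE_inner: "x:Hi ==> GE c x = G x"
by(auto simp:gauge_ext_def inner_part_def)

lemma GE_initial: "x:initial_points le H ==> GE c x = Inf (J c)"
by(simp add:gauge_ext_def J_def)

lemma GE_final: "x:final_points le H ==> x ~: initial_points le H ==> GE c x = Sup (J c)"
by(simp add:gauge_ext_def J_def)

lemma J_gt_Inf: "c:Hi ==> g:J c ==> bdd_below (J c) ==> Inf (J c) < g"
using J_lower unfolding J_def by(metis (no_types, lifting) cInf_lower image_iff order_le_less_trans)

lemma J_lt_Sup: "c:Hi ==> g:J c ==> bdd_above (J c) ==> g < Sup (J c)"
using J_upper unfolding J_def by(metis (no_types, lifting) cSup_upper image_iff order_less_le_trans)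

lemma GE_less:
assumes c: "c:Hi" and x: "x:Ry c" and y: "y:Ry c" and xy: "le x y" "x ~= y"
shows "GE c x < GE c y"
proof -
have xH: "x:H" "y:H" using x y R_subset by auto
have nf: "x ~: final_points le H" "y ~: initial_points le H"
 using xy xH unfolding initial_points_def final_points_def by blast+
have cJ: "G c:J c" using J_self c .
consider "x:OpR c" "y:OpR c" | "x:initial_points le H" "y:OpR c"
 | "x:OpR c" "y:final_points le H" | "x:initial_points le H" "y:final_points le H"
 using not_inner_cases[OF x c] not_inner_cases[OF y c] nf by metis
thus ?thesis
proof cases
 case 1 thus ?thesis using gauge_less[OF _ _ xy] OR_subset by(simp add:GE_inner subset_eq)
next
 case 2
 hence "Inf (J c) < G y" using J_gt_Inf[OF c _ J_bdd_below[OF c x]] by(auto simp:J_def)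
 thus ?thesis using 2 OR_subset by(simp add:GE_inner GE_initial subset_eq)
next
 case 3
 hence "G x < Sup (J c)" using J_lt_Sup[OF c _ J_bdd_above[OF c y]] by(auto simp:J_def)
 thus ?thesis using 3 nf OR_subset by(simp add:GE_inner GE_final subset_eq)
next
 case 4
 hence "Inf (J c) < G c" "G c < Sup (J c)"
  using J_lt_Sup[OF c cJ J_bdd_above[OF c y]] J_gt_Inf[OF c cJ J_bdd_below[OF c x]] by auto
 thus ?thesis using 4 nf by(simp add:GE_initial GE_final)
qed
qed

lemma GE_le_iff:
assumes c: "c:Hi" and x: "x:Ry c" and y: "y:Ry c"
shows "GE c x <= GE c y <-> le x y"
using ray_total[OF c x y] GE_less[OF c x y] GE_less[OF c y x] le_refl by fastforce

lemma GE_inj: assumes c: "c:Hi" shows "inj_on (GE c) (Ry c)"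
proof (rule inj_onI)
fix x y assume "x:Ry c" "y:Ry c" "GE c x = GE c y"
thus "x = y"
 using GE_le_iff[OF c, of x y] GE_le_iff[OF c, of y x] le_antisym R_subset by fastforce
qed

lemma PT_GE: "c:Hi ==> x:Ry c ==> PT c (GE c x) = x"
unfolding PT_def by(rule the_inv_into_f_f[OF GE_inj])

lemma PT_mem: "c:Hi ==> g:IA c ==> PT c g:Ry c"
unfolding PT_def IA_def by(rule the_inv_into_into[OF GE_inj]) auto

lemma GE_PT: "c:Hi ==> g:IA c ==> GE c (PT c g) = g"
unfolding PT_def IA_def by(rule f_the_inv_into_f[OF GE_inj]) auto

lemma GE_mem: "x:Ry c ==> GE c x:IA c"
by(simp add:IA_def)

lemma J_subset_IA: "J c <= IA c"
proof
fix g assume "g:J c"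
then obtain x where "x:OpR c" "g = G x" unfolding J_def by auto
hence "x:Ry c" "g = GE c x" using OR_D GE_inner by auto
thus "g:IA c" unfolding IA_def by blast
qed

lemma PT_G: "c:Hi ==> x:OpR c ==> PT c (G x) = x"
using PT_GE[of c x] GE_inner[of x c] OR_D by metis

lemma PT_J: "c:Hi ==> g:J c ==> PT c g:OpR c & G (PT c g) = g"
unfolding J_def using PT_G by auto

text \<open>Together with \<open>J_subset_IA\<close> this says that \<open>IA c\<close> arises from
  the open interval \<open>J c\<close> by adding at most a least and a greatest element.\<close>

lemma IA_between_J:
assumes c: "c:Hi" and x: "x:Ry c" and y: "y:Ry c" and g: "GE c x < g" "g < GE c y"
shows "g:J c"
proof -
have "EX u:J c. u <= g"
 using x c
proof (cases rule: not_inner_cases)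
 case 1 thus ?thesis using g OR_subset by(intro bexI[of _ "G x"]) (auto simp:GE_inner J_def subset_eq)
next
 case 2
 have "Inf (J c) < g" using g 2 by(simp add:GE_initial)
 thus ?thesis using cInf_lessD[OF J_nonempty[OF c]] by(meson less_imp_le)
next
 case 3
 hence "le y x" using final_ge[OF c x _ y] by blast
 thus ?thesis using GE_le_iff[OF c y x] g by linarith
qed
moreover have "EX v:J c. g <= v"
 using y c
proof (cases rule: not_inner_cases)
 case 1 thus ?thesis using g OR_subset by(intro bexI[of _ "G y"]) (auto simp:GE_inner J_def subset_eq)
next
 case 3
 have "g < Sup (J c)" using g 3 by(simp add:GE_final)
 thus ?thesis using less_cSupD[OF J_nonempty[OF c]] by(meson less_imp_le)
next
 case 2
 hence "le y x" using initial_le[OF c y _ x] by blast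
 thus ?thesis using GE_le_iff[OF c y x] g by linarith
qed
ultimately show ?thesis using J_interval[OF c] unfolding is_interval_1 by blast
qed

lemma IA_interval: assumes c: "c:Hi" shows "is_interval (IA c)"
unfolding is_interval_1
proof (intro ballI allI impI; elim conjE)
fix a b x assume ab: "a:IA c" "b:IA c" "a <= x" "x <= b"
then obtain p q where "p:Ry c" "q:Ry c" "a = GE c p" "b = GE c q" unfolding IA_def by auto
thus "x:IA c"
 using IA_between_J[OF c, of p q x] J_subset_IA ab by(cases "x = a \<or> x = b") auto
qed

lemma IA_convex: "c:Hi ==> convex (IA c)"
using IA_interval is_interval_convex_1 by blast

lemma ray_dense:
assumes c: "c:Hi" and x: "x:Ry c" and y: "y:Ry c" and g: "GE c x < g" "g < GE c y"
obtains z where "z:OpR c" "GE c z = g" "~ le z x" "~ le y z"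
proof -
have "g:J c" using IA_between_J[OF assms] .
then obtain z where z: "z:OpR c" "G z = g" using PT_J[OF c] by blast
hence zg: "GE c z = g" "z:Ry c" using GE_inner OR_D by auto
thus thesis using that[OF z(1)] GE_le_iff[OF c] x y g by fastforce
qed

lemma gauge_ext_reverse:
assumes c: "c:Hi" and x: "x:Ry c"
shows "gauge_ext (%x y. le y x) H (%x. - G x) c x = - GE c x"
using x c
proof (cases rule: not_inner_cases)
case 1
hence "x:Hi" using OR_subset by blast
thus ?thesis
 by(auto simp:gauge_ext_def initial_points_reverse[of le] final_points_reverse[of le] inner_part_def)
next
case 2
thus ?thesis
 by(simp add:gauge_ext_def initial_points_reverse[of le] final_points_reverse[of le] open_ray_reverse[of le]
   Inf_real_def image_image)
next
case 3
thus ?thesis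
 by(simp add:gauge_ext_def initial_points_reverse[of le] final_points_reverse[of le] open_ray_reverse[of le]
   Inf_real_def image_image)
qed

text \<open>Choose a point \<open>z\<close> of the ray with value between \<open>a\<close> and
  \<open>GE c w\<close>. Then \<open>w\<close> is not below \<open>z\<close>; as the order is
  closed, the points not below \<open>z\<close> form a neighbourhood of \<open>w\<close>, and on the
  ray their values exceed that of \<open>z\<close>. If \<open>w\<close> is the least point of the
  ray, the bound is immediate.\<close>

lemma GE_lower_semicontinuous:
assumes c: "c:Hi" and w: "w:Ry c" and a: "a < GE c w"
shows "\<forall>\<^sub>F v in at w within Ry c. a < GE c v"
proof (cases "EX x:Ry c. GE c x < GE c w")
case True
then obtain x where x: "x:Ry c" "GE c x < GE c w" by blast
obtain z where z: "z:OpR c" "GE c z = (max a (GE c x)+GE c w)/2" "~ le w z"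
proof -
 have "GE c x < (max a (GE c x)+GE c w)/2" "(max a (GE c x)+GE c w)/2 < GE c w"
  using a x(2) by(auto simp:max_def field_simps)
 thus thesis using ray_dense[OF c x(1) w] that by metis
qed
have "open (- {v. le v z})" using closed_below by(simp add:open_Compl)
hence "\<forall>\<^sub>F v in at w within Ry c. v : - {v. le v z}"
 using z(3) by(intro topological_tendstoD[OF tendsto_ident_at]) auto
moreover have "\<forall>\<^sub>F v in at w within Ry c. v:Ry c"
 by(simp add:eventually_at_filter)
ultimately show ?thesis
proof eventually_elim
 case (elim v)
 hence "~ GE c v <= GE c z" using GE_le_iff[OF c, of v z] z(1) OR_subset by auto
 thus ?case using z(2) a x(2) by(auto simp:field_simps max_def split:if_splits)
qed
next
case False
hence "GE c w <= GE c v" if "v:Ry c" for v using that by fastforce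
moreover have "\<forall>\<^sub>F v in at w within Ry c. v:Ry c"
 by(simp add:eventually_at_filter)
ultimately show ?thesis using a by(auto elim!:eventually_mono intro:less_le_trans)
qed

lemma GE_continuous: assumes c: "c:Hi" shows "continuous_on (Ry c) (GE c)"
unfolding continuous_on_def
proof (intro ballI order_tendstoI)
fix w a assume w: "w:Ry c"
show "\<forall>\<^sub>F v in at w within Ry c. a < GE c v" if "a < GE c w"
 using GE_lower_semicontinuous[OF c w that] .
show "\<forall>\<^sub>F v in at w within Ry c. GE c v < a" if "GE c w < a"
proof -
 interpret rev: null_rays "%x y. le y x" H "%x. - G x" by(rule reverse)
 have "\<forall>\<^sub>F v in at w within Ry c. - a < gauge_ext (%x y. le y x) H (%x. - G x) c v"
  using rev.GE_lower_semicontinuous[of c w "- a"] c w that gauge_ext_reverse[OF c w]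
  by(simp add:inner_part_reverse[of le] ray_reverse[of le])
 moreover have "\<forall>\<^sub>F v in at w within Ry c. v:Ry c"
  by(simp add:eventually_at_filter)
 ultimately show ?thesis
  by eventually_elim (simp add:gauge_ext_reverse[OF c])
qed
qed

text \<open>A non-degenerate segment is the image of an arc inside the ray.\<close>

lemma segment_compact:
assumes c: "c:Hi" and x: "x:Ry c" and y: "y:Ry c"
shows "compact {p:Ry c. le x p & le p y}"
proof (cases "le x y & x ~= y")
case True
then obtain ga where g: "causal_arc le H ga x y" "ga ` {0..1} <= Ry c"
 using ray_arc[OF c x y] by metis
have "{p:Ry c. le x p & le p y} = ga ` {0..1}"
proof (intro subset_antisym subsetI)
 fix p assume p: "p:{p:Ry c. le x p & le p y}"
 show "p:ga ` {0..1}"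
  by(rule causal_arc_image[OF g(1)]) (use p R_subset g(2) ray_total[OF c] in blast)+
next
 fix p assume "p:ga ` {0..1}"
 thus "p:{p:Ry c. le x p & le p y}"
  using g unfolding causal_arc_def by auto
qed
thus ?thesis using g(1) by(simp add:causal_arc_def compact_continuous_image)
next
case False
hence "{p:Ry c. le x p & le p y} <= {x}"
 using le_antisym le_trans x y R_subset by blast
thus ?thesis by(meson finite.emptyI finite_imp_compact finite_insert finite_subset)
qed

text \<open>On a compact segment the inverse of a continuous injection is continuous. It remains to
  choose a segment that is a neighbourhood of \<open>g\<close> relative to
  \<open>IA c\<close>.\<close>

lemma PT_continuous: assumes c: "c:Hi" shows "continuous_on (IA c) (PT c)"
unfolding continuous_on_def
proof
fix g assume g: "g:IA c"
define S where "S x y = {p:Ry c. le x p & le p y}" for x y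
obtain l where l: "l:Ry c" "GE c l <= g" "(EX u:IA c. u < g) ==> GE c l < g"
 using PT_mem[OF c] GE_PT[OF c] g by(metis order_refl less_imp_le)
obtain r where r: "r:Ry c" "g <= GE c r" "(EX u:IA c. g < u) ==> g < GE c r"
 using PT_mem[OF c] GE_PT[OF c] g by(metis order_refl less_imp_le)
have "continuous_on (S l r) (GE c)"
 using GE_continuous[OF c] by(rule continuous_on_subset) (auto simp:S_def)
moreover have "compact (S l r)" unfolding S_def by(rule segment_compact[OF c l(1) r(1)])
moreover have "ALL p:S l r. PT c (GE c p) = p" by(auto simp:S_def PT_GE[OF c])
ultimately have "continuous_on (GE c ` S l r) (PT c)" by(rule continuous_on_inv)
moreover have eq: "GE c ` S l r = IA c Int {GE c l..GE c r}"
 unfolding S_def IA_def using GE_le_iff[OF c] l(1) r(1) by auto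
ultimately have t: "(PT c \<longlongrightarrow> PT c g) (at g within IA c Int {GE c l..GE c r})"
 using g l(2) r(2) unfolding continuous_on_def by auto
\<comment> \<open>If \<open>g\<close> is the least element of \<open>IA c\<close>, the segment
  starts at \<open>g\<close> itself, and any number below \<open>g\<close> serves as the open bound;
  dually for \<open>hi\<close>.\<close>
define lo where "lo = (if GE c l < g then GE c l else g - 1)"
define hi where "hi = (if g < GE c r then GE c r else g+1)"
have "at g within IA c = at g within IA c Int {GE c l..GE c r}"
proof (rule at_within_nhd[where S = "{lo<..<hi}"])
 show "g:{lo<..<hi}" by(auto simp:lo_def hi_def)
 show "open {lo<..<hi}" by simp
 have "GE c l <= u" "u <= GE c r" if "u:IA c" "lo < u" "u < hi" for u
 proof -
  show "GE c l <= u"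
   using l(2,3) that(1,2) unfolding lo_def by(cases "GE c l < g") force+
  show "u <= GE c r"
   using r(2,3) that(1,3) unfolding hi_def by(cases "g < GE c r") force+
 qed
 thus "IA c Int {lo<..<hi} - {g} = IA c Int {GE c l..GE c r} Int {lo<..<hi} - {g}" by auto
qed
thus "(PT c \<longlongrightarrow> PT c g) (at g within IA c)" using t by simp
qed

end

text \<open>Continuous curves on a compact interval are bounded, so the boundedness built into
  \<open>cfunspace\<close> is no restriction.\<close>

lemma mem_curve_space_iff:
fixes H :: "'a::metric_space set"
shows "ga:mspace (curve_space H) <->
  ga:extensional {0..1} & ga ` {0..1} <= H & continuous_on {0..1} ga"
proof -
have "continuous_map (top_of_set {0..1}) (mtopology_of (submetric euclidean_metric H)) ga <->
  continuous_on {0..1} ga & ga ` {0..1} <= H"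
 by(auto simp:mtopology_of_submetric continuous_map_in_subtopology)
moreover have "Metric_space.mbounded (mspace (submetric euclidean_metric H)) (mdist (submetric euclidean_metric H)) (ga ` {0..1})"
 if "continuous_on {0..1} ga" "ga ` {0..1} <= H"
proof -
 interpret M: Metric_space "mspace (submetric euclidean_metric H)" "mdist (submetric euclidean_metric H)" by(rule Metric_space_mspace_mdist)
 have "compact (ga ` {0..1})" using that by(simp add:compact_continuous_image)
 hence "bounded (ga ` {0..1})" by(rule compact_imp_bounded)
 then obtain x e where "ALL y:ga ` {0..1}. dist x y <= e" unfolding bounded_def by auto
 hence b: "!!y z. y:ga ` {0..1} ==> z:ga ` {0..1} ==> dist y z <= e+e"
  by(metis add_mono dist_commute dist_triangle order_trans)
 show ?thesis
  unfolding M.mbounded_alt using that b by(auto simp:image_subset_iff intro!:exI[of _ "2*e"])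
qed
ultimately show ?thesis
 unfolding curve_space_def by(auto simp:PiE_def Pi_iff)
qed

section \<open>\<open>G\<close>-causal curves in gauge coordinates\<close>

context null_rays
begin

definition ray_curve :: "'a => real => real => real => 'a" where
"ray_curve c a b = restrict (%t. PT c ((1-t)*a+t*b)) {0..1}"

lemma IA_convex_comb:
assumes "c:Hi" "a:IA c" "b:IA c" "t:{0..1}"
shows "(1-t)*a+t*b:IA c"
using convexD_alt[OF IA_convex[OF assms(1)] assms(2,3), of t] assms(4) by simp

lemma ray_curve_curve:
assumes c: "c:Hi" and ab: "a:IA c" "b:IA c"
shows "ray_curve c a b:mspace (curve_space H)"
proof -
have "continuous_on {0..1} (%t. PT c ((1-t)*a+t*b))"
 by(rule continuous_on_compose2[OF PT_continuous[OF c]])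
  (use IA_convex_comb[OF c ab] in "auto intro!:continuous_intros")
moreover have "PT c ((1-t)*a+t*b):H" if "t:{0..1}" for t
 using PT_mem[OF c IA_convex_comb[OF c ab that]] R_subset by blast
ultimately show ?thesis
 unfolding mem_curve_space_iff ray_curve_def
 by(auto simp:image_subset_iff cong: continuous_on_cong_simp)
qed

lemma ray_curve_G_causal:
assumes c: "c:Hi" and ab: "a:IA c" "b:IA c" "a <= b"
shows "ray_curve c a b:G_causal_curves le H G"
proof (cases "a = b")
case True
have "ray_curve c a b constant_on {0..1}"
 unfolding constant_on_def ray_curve_def True by(auto simp:algebra_simps)
thus ?thesis using ray_curve_curve[OF c ab(1,2)] by(simp add:G_causal_curves_def)
next
case False
hence lt: "a < b" using ab by simp
let ?f = "%t. (1-t)*a+t*b"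
let ?ga = "ray_curve c a b"
have curve: "?ga:mspace (curve_space H)" using ray_curve_curve[OF c ab(1,2)] .
have IAf: "?f t:IA c" if "t:{0..1}" for t using IA_convex_comb[OF c ab(1,2) that] .
have g: "?ga t = PT c (?f t)" "?ga t:Ry c" "GE c (?ga t) = ?f t" if "t:{0..1}" for t
 using that PT_mem[OF c IAf] GE_PT[OF c IAf] by(simp_all add:ray_curve_def)
have f_less: "?f s < ?f t" if "s < t" for s t
proof -
 have "?f t - ?f s = (t - s)*(b - a)" by(simp add:algebra_simps)
 thus ?thesis using that lt by(metis diff_gt_0_iff_gt mult_pos_pos)
qed
have "causal_curve le {0..1} ?ga"
 unfolding causal_curve_def
proof (intro conjI ballI impI)
 show "is_interval {0..1::real}" by(rule is_interval_cc)
 show "continuous_on {0..1} ?ga" using curve by(simp add:mem_curve_space_iff)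
 have "?ga 0 ~= ?ga 1" using g(3)[of 0] g(3)[of 1] lt by auto
 thus "~ ?ga constant_on {0..1}" unfolding constant_on_def
  by(metis atLeastAtMost_iff order_refl zero_le_one)
 fix s t :: real assume st: "s:{0..1}" "t:{0..1}" "s < t"
 show "le (?ga s) (?ga t)"
  using GE_le_iff[OF c g(2)[OF st(1)] g(2)[OF st(2)]] g(3)[OF st(1)] g(3)[OF st(2)] f_less[OF st(3)]
  by simp
qed
moreover have inn: "?ga t:Hi & G (?ga t) = a+(b - a)*t" if t: "t:{0<..<1}" for t
proof -
 have 01: "GE c (?ga 0) = a" "GE c (?ga 1) = b" "?ga 0:Ry c" "?ga 1:Ry c"
  using g(2,3)[of 0] g(2,3)[of 1] by auto
 have "?f t:J c"
  by(rule IA_between_J[OF c 01(3,4)]) (use 01 f_less[of 0 t] f_less[of t 1] t in auto)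
 hence "PT c (?f t):OpR c" "G (PT c (?f t)) = ?f t" using PT_J[OF c] by blast+
 thus ?thesis using g(1)[of t] t OR_D(2)[of "PT c (?f t)" c] by(simp add:algebra_simps)
qed
moreover have "EX A B. ALL t:{0<..<1}. G (?ga t) = A+B*t"
 by(rule exI[of _ a], rule exI[of _ "b - a"]) (use inn in auto)
ultimately show ?thesis
 using curve unfolding G_causal_curves_def by auto
qed

lemma ray_curve_ends:
"ray_curve c a b 0 = PT c a" "ray_curve c a b 1 = PT c b"
by(simp_all add:ray_curve_def)

text \<open>The definition makes \<open>G\<close> affine at interior times only, and the curve may
  start or stop at an end-point of the ray. Continuity of \<open>GE\<close> extends the affine
  formula to the closed parameter interval.\<close>

lemma G_causal_affine:
assumes g: "ga:G_causal_curves le H G" and s: "s:{0..1}" "ga s:Hi" and t: "t:{0..1}"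
shows "ga t:Ry (ga s)"
 and "GE (ga s) (ga t) = (1-t)*GE (ga s) (ga 0)+t*GE (ga s) (ga 1)"
proof -
let ?c = "ga s"
have "(ALL t:{0..1}. ga t:Ry ?c) &
  (ALL t:{0..1}. GE ?c (ga t) = (1-t)*GE ?c (ga 0)+t*GE ?c (ga 1))"
proof (cases "ga constant_on {0..1}")
 case True
 hence e: "ga t = ?c" if "t:{0..1}" for t
  using that s unfolding constant_on_def by(metis)
 thus ?thesis using ray_self[OF s(2)] e[of 0] e[of 1] by(simp add:algebra_simps)
next
 case False
 then obtain A B where c: "causal_curve le {0..1} ga" "ga ` {0<..<1} <= Hi"
  "!!t. t:{0<..<1} ==> G (ga t) = A+B*t" "ga:mspace (curve_space H)"
  using g unfolding G_causal_curves_def by auto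
 have cont: "continuous_on {0..1} ga" and H': "ga ` {0..1} <= H"
  using c(4) by(auto simp:mem_curve_space_iff)
 have r: "ga t:Ry ?c" if t: "t:{0..1}" for t
 proof -
  have "le (ga t) ?c \<or> le ?c (ga t)"
   using c(1) s(1) t le_refl unfolding causal_curve_def by(metis linorder_neqE_linordered_idom)
  thus ?thesis using H' s(1) t by(auto simp:in_ray_iff)
 qed
 have "continuous_on {0..1} (%t. GE ?c (ga t) - (A+B*t))"
  by(intro continuous_intros continuous_on_compose2[OF GE_continuous[OF s(2)] cont]) (use r in auto)
 hence *: "continuous_on (closure {0<..<1}) (%t. GE ?c (ga t) - (A+B*t))" by simp
 have "GE ?c (ga t) - (A+B*t) = 0" if "t:{0<..<1}" for t
  using c(2,3) that GE_inner by fastforce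
 hence "GE ?c (ga t) - (A+B*t) = 0" if "t:{0..1}" for t
  using continuous_constant_on_closure[OF *, of 0 t] that by auto
 hence e: "GE ?c (ga t) = A+B*t" if "t:{0..1}" for t using that by fastforce
 show ?thesis using r e e[of 0] e[of 1] by(auto simp:algebra_simps)
qed
thus "ga t:Ry ?c" "GE ?c (ga t) = (1-t)*GE ?c (ga 0)+t*GE ?c (ga 1)"
 using t by blast+
qed

end

section \<open>The Borel sets of the curve space\<close>

lemma curve_dist_le:
fixes H :: "'a::metric_space set"
assumes "f:mspace (curve_space H)" "g:mspace (curve_space H)"
shows "mdist (curve_space H) f g <= a <-> (ALL t:{0..1}. dist (f t) (g t) <= a)"
using assms unfolding curve_space_def by(subst cfunspace_mdist_le) auto

lemma openin_curve_space:
"openin (mtopology_of (curve_space H)) U <->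
  U <= mspace (curve_space H) &
  (ALL f:U. EX r>0. ALL g:mspace (curve_space H). mdist (curve_space H) f g < r --> g:U)"
proof -
interpret M: Metric_space "mspace (curve_space H)" "mdist (curve_space H)"
 by(rule Metric_space_mspace_mdist)
show ?thesis
 unfolding mtopology_of_def M.openin_mtopology subset_iff M.in_mball by blast
qed

lemma space_borel_curves [simp]: "space (borel_curves H) = mspace (curve_space H)"
unfolding borel_curves_def by(rule space_measure_of) (auto simp:openin_curve_space)

lemma sets_borel_curves:
"sets (borel_curves H) = sigma_sets (mspace (curve_space H)) {U. openin (mtopology_of (curve_space H)) U}"
unfolding borel_curves_def by(rule sets_measure_of) (auto simp:openin_curve_space)

lemma measurable_curve_eval:
fixes H :: "'a::metric_space set"
assumes t: "t:{0..1}"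
shows "(%ga. ga t):borel_curves H ->M borel_on H"
proof (rule measurable_restrict_space2)
show "(%ga. ga t):space (borel_curves H) \<rightarrow> H"
 using t by(simp add:mem_curve_space_iff image_subset_iff)
show "(%ga. ga t):bmeas (borel_curves H)"
proof (rule borel_measurableI)
 fix U :: "'a set" assume U: "open U"
 have "openin (mtopology_of (curve_space H)) ((%ga. ga t) -` U Int mspace (curve_space H))"
  unfolding openin_curve_space
 proof (intro conjI ballI)
  fix f assume f: "f:(%ga. ga t) -` U Int mspace (curve_space H)"
  then obtain e where e: "e > 0" "ball (f t) e <= U" using U open_contains_ball by(metis IntD1 vimageD)
  have "g t:U" if "g:mspace (curve_space H)" "mdist (curve_space H) f g < e" for g
   using curve_dist_le[of f H g "mdist (curve_space H) f g"] f that t e by force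
  thus "EX r>0. ALL g:mspace (curve_space H). mdist (curve_space H) f g < r -->
    g:(%ga. ga t) -` U Int mspace (curve_space H)"
   using e(1) by(intro exI[of _ e]) auto
 qed auto
 thus "(%ga. ga t) -` U Int space (borel_curves H):sets (borel_curves H)"
  unfolding sets_borel_curves space_borel_curves by(intro sigma_sets.Basic) simp
qed
qed

lemma sets_Collect_ball_countable:
assumes "countable I" and "!!i. i:I ==> {x:space M. P i x}:sets M"
shows "{x:space M. ALL i:I. P i x}:sets M"
proof -
have "{x:space M. ALL i:I. P i x} = space M - (\<Union>i\<in>I. space M - {x:space M. P i x})" by auto
also have "... : sets M"
 using assms by(intro sets.Diff sets.top sets.countable_UN') auto
finally show ?thesis .
qed

text \<open>A curve is located up to \<open>1/k\<close> by the points of a countable dense set near its values on a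
partition of \<open>[0,1]\<close>; this makes the curve space second countable.\<close>

lemma measurable_into_curves:
fixes H :: "'a::{metric_space,second_countable_topology} set"
assumes sp: "f:space M \<rightarrow> mspace (curve_space H)"
 and ev: "!!t. t:{0..1} ==> (%om. f om t):bmeas M"
shows "f:M ->M borel_curves H"
proof -
obtain D :: "'a set" where D: "countable D" "!!X. open X ==> X ~= {} ==> EX d:D. d:X"
 using countable_dense_setE by metis
\<comment> \<open>Only rational times are tested: this keeps \<open>W k cs\<close> measurable, and
  by continuity the rational times control the uniform distance.\<close>
define P :: "nat => nat => real set" where
 "P n i = {real i/real n..(real i+1)/real n} Int {0<..<1} Int Rats" for n i
define W where "W k cs = {ga:mspace (curve_space H). ALL i<length cs. ALL q:P (length cs) i.
  dist (ga q) (cs ! i) <= 1/real k}" for k :: nat and cs :: "'a list"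
have W_meas: "{om:space M. f om:W k cs}:sets M" for k cs
proof -
 have cP: "countable (P n i)" for n i unfolding P_def by(auto intro:countable_subset[OF _ countable_rat])
 have "{om:space M. f om:W k cs} = {om:space M. ALL i:{..<length cs}. ALL q:P (length cs) i.
   dist (f om q) (cs ! i) <= 1/real k}"
  using sp unfolding W_def by auto
 also have "... : sets M"
 proof (intro sets_Collect_ball_countable cP countable_finite finite_lessThan)
  fix i q assume "q:P (length cs) i"
  hence [measurable]: "(%om. f om q):bmeas M" by(intro ev) (auto simp:P_def)
  show "{om:space M. dist (f om q) (cs ! i) <= 1/real k}:sets M" by measurable
 qed
 finally show ?thesis .
qed
have close: "mdist (curve_space H) ga de <= 2/real k"
 if "ga:W k cs" "de:W k cs" "cs ~= []" for ga de k cs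
proof -
 let ?n = "length cs"
 have m: "ga:mspace (curve_space H)" "de:mspace (curve_space H)" using that by(auto simp:W_def)
 have q: "dist (ga q) (de q) <= 2/real k" if "q:{0<..<1} Int Rats" for q
 proof -
  define i where "i = nat \<lfloor>q*?n\<rfloor>"
  have n: "0 < ?n" using \<open>cs ~= []\<close> by simp
  have i: "real i <= q*?n" "q*?n < real i+1"
   using that n by(auto simp:i_def of_nat_nat floor_less_iff)
  have "q*?n < ?n" using that n by simp
  hence "i < ?n" using i by linarith
  moreover have "q:P ?n i" using that i n by(auto simp:P_def field_simps)
  ultimately have "dist (ga q) (cs ! i) <= 1/real k" "dist (de q) (cs ! i) <= 1/real k"
   using \<open>ga:W k cs\<close> \<open>de:W k cs\<close> by(auto simp:W_def)
  thus ?thesis using dist_triangle2[of "ga q" "de q" "cs ! i"] by simp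
 qed
 have cl: "closure ({0<..<1} Int Rats) = {0..1::real}"
  by(subst closure_open_Int_superset) (auto simp:Rats_closure_real)
 have "continuous_on {0..1} (%t. dist (ga t) (de t))"
  using m by(auto simp:mem_curve_space_iff intro!:continuous_intros)
 hence "dist (ga t) (de t) <= 2/real k" if "t:{0..1}" for t
  using continuous_le_on_closure[of "{0<..<1} Int Rats" "%t. dist (ga t) (de t)" t "2/real k"] cl q that by auto
 thus ?thesis using curve_dist_le[OF m] by blast
qed
have ex: "EX cs. cs ~= [] & set cs <= D & ga:W k cs" if g: "ga:mspace (curve_space H)" and k: "k > 0" for ga k
proof -
 have "uniformly_continuous_on {0..1} ga"
  using g by(auto simp:mem_curve_space_iff intro!:compact_uniformly_continuous)
 then obtain d where d: "d > 0" "!!s t. s:{0..1} ==> t:{0..1} ==> dist s t < d ==>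
   dist (ga s) (ga t) < 1/(2*real k)"
  unfolding uniformly_continuous_on_def using k by(metis divide_pos_pos mult_pos_pos of_nat_0_less_iff zero_less_numeral zero_less_one)
 obtain n where n: "n > 0" "1/real n < d"
  using d(1) by(metis nat_approx_posE zero_less_Suc inverse_eq_divide)
 have "ALL i. EX c:D. dist (ga (real i/real n)) c < 1/(2*real k)"
 proof
  fix i
  have "ga (real i/real n):ball (ga (real i/real n)) (1/(2*real k))" using k by simp
  then obtain c where "c:D" "c:ball (ga (real i/real n)) (1/(2*real k))"
   using D(2)[OF open_ball] by(metis empty_iff)
  thus "EX c:D. dist (ga (real i/real n)) c < 1/(2*real k)" by auto
 qed
 then obtain c where c: "!!i. c i:D" "!!i. dist (ga (real i/real n)) (c i) < 1/(2*real k)" by metis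
 have "ga:W k (map c [0..<n])"
  unfolding W_def
 proof (intro CollectI conjI allI impI ballI g)
  fix i q assume i: "i < length (map c [0..<n])" and q: "q:P (length (map c [0..<n])) i"
  have in01: "real i/real n:{0..1}" "q:{0..1}" using i q by(auto simp:P_def)
  have "\<bar>q - real i/real n\<bar> <= 1/real n"
   using q n by(auto simp:P_def add_divide_distrib abs_le_iff)
  hence "dist q (real i/real n) < d" using n by(simp add:dist_real_def)
  hence "dist (ga q) (ga (real i/real n)) < 1/(2*real k)" using d(2) in01 by blast
  hence "dist (ga q) (c i) <= 1/(2*real k)+1/(2*real k)"
   using c(2)[of i] dist_triangle[of "ga q" "c i" "ga (real i/real n)"] by linarith
  thus "dist (ga q) (map c [0..<n] ! i) <= 1/real k" using i by simp
 qed
 thus ?thesis using c(1) n by(intro exI[of _ "map c [0..<n]"]) auto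
qed
show ?thesis
 unfolding borel_curves_def
proof (rule measurable_measure_of)
 show "{U. openin (mtopology_of (curve_space H)) U} <= Pow (mspace (curve_space H))"
  by(auto simp:openin_curve_space)
 show "f:space M \<rightarrow> mspace (curve_space H)" by(rule sp)
 fix U assume "U:{U. openin (mtopology_of (curve_space H)) U}"
 hence U: "U <= mspace (curve_space H)"
  "!!g. g:U ==> EX r>0. ALL h:mspace (curve_space H). mdist (curve_space H) g h < r --> h:U"
  by(auto simp:openin_curve_space)
 define A where "A = {(k, cs). set cs <= D & W k cs <= U}"
 have "A <= UNIV \<times> lists D" by(auto simp:A_def)
 hence cA: "countable A" by(rule countable_subset) (intro countable_SIGMA countable_lists D(1), simp)
 have "U = (\<Union>(k, cs)\<in>A. W k cs)"
 proof (intro subset_antisym subsetI)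
  fix g assume g: "g:U"
  then obtain r where r: "r > 0" "!!h. h:mspace (curve_space H) ==> mdist (curve_space H) g h < r ==> h:U"
   using U(2) by blast
  obtain k where k: "k > 0" "1/real k < r/2"
   using r(1) by(metis nat_approx_posE zero_less_Suc inverse_eq_divide half_gt_zero)
  obtain cs where cs: "cs ~= []" "set cs <= D" "g:W k cs" using ex[of g k] g U(1) k by blast
  have "h:U" if h: "h:W k cs" for h
  proof -
   have "mdist (curve_space H) g h < r" using close[OF cs(3) h cs(1)] k by simp
   thus ?thesis using r(2)[of h] h by(auto simp:W_def)
  qed
  thus "g:(\<Union>(k, cs)\<in>A. W k cs)" using cs by(auto simp:A_def)
 qed (auto simp:A_def)
 hence "f -` U Int space M = (\<Union>(k, cs)\<in>A. {om:space M. f om:W k cs})" by auto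
 also have "... : sets M"
  by(rule sets.countable_UN'[OF cA]) (use W_meas in auto)
 finally show "f -` U Int space M:sets M" .
qed
qed

section \<open>Borel selections from compact relations\<close>

text \<open>The point minimizing successively the distances to a dense sequence is unique, and every step
preserves measurability.\<close>

primrec sel_rel :: "('a \<times> 'b::metric_space) set => (nat => 'b) => nat => 'a => 'b set" where
"sel_rel S d 0 x = {y. (x, y):S}"
| "sel_rel S d (Suc k) x = {y:sel_rel S d k x. ALL y':sel_rel S d k x. dist y (d k) <= dist y' (d k)}"

lemma compact_section:
fixes S :: "('a::metric_space \<times> 'b::metric_space) set"
assumes "compact S" shows "compact {y. (x, y):S}"
proof -
have "{y. (x, y):S} = snd ` (S Int {x} \<times> UNIV)" by force
moreover have "compact (S Int {x} \<times> UNIV)" by(intro compact_Int_closed assms closed_Times) auto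
ultimately show ?thesis by(simp add:compact_continuous_image continuous_on_snd)
qed

lemma compact_sel_rel:
fixes S :: "('a::metric_space \<times> 'b::metric_space) set"
assumes S: "compact S"
shows "compact (sel_rel S d k x) & (sel_rel S d k x ~= {} <-> x:fst ` S)"
proof (induction k)
case 0
show ?case using compact_section[OF S, of x] by force
next
case (Suc k)
show ?case
proof (cases "sel_rel S d k x = {}")
 case True
 thus ?thesis using Suc by auto
next
 case False
 obtain y where y: "y:sel_rel S d k x" "!!y'. y':sel_rel S d k x ==> dist y (d k) <= dist y' (d k)"
  using continuous_attains_inf[OF conjunct1[OF Suc] False, of "%y. dist y (d k)"]
   continuous_on_dist[OF continuous_on_id continuous_on_const] by blast
 have "sel_rel S d (Suc k) x = sel_rel S d k x Int cball (d k) (dist y (d k))"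
  using y by(auto simp:dist_commute intro:order_trans)
 hence "compact (sel_rel S d (Suc k) x)" using Suc by(simp add:compact_Int_closed)
 moreover have "y:sel_rel S d (Suc k) x" using y by simp
 ultimately show ?thesis using Suc False by auto
qed
qed

text \<open>The minimizers of the distance to \<open>d k\<close> all miss \<open>F\<close> exactly
  if stage \<open>k\<close> misses \<open>F\<close> or some rational radius separates: the ball of
  this radius around \<open>d k\<close> meets the stage, but not inside \<open>F\<close>. The
  induction runs over all closed \<open>F\<close> because these balls are intersected with
  \<open>F\<close>.\<close>

lemma sel_rel_meets_borel:
fixes S :: "('a::metric_space \<times> 'b::metric_space) set"
assumes S: "compact S" and F: "closed F"
shows "{x. sel_rel S d k x Int F ~= {}}:sets borel"
using F
proof (induction k arbitrary: F)
case 0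
have "{x. sel_rel S d 0 x Int F ~= {}} = fst ` (S Int UNIV \<times> F)" by force
moreover have "compact (S Int UNIV \<times> F)" by(intro compact_Int_closed S closed_Times 0) auto
ultimately show ?case by(simp add:compact_continuous_image continuous_on_fst compact_imp_closed borel_closed)
next
case (Suc k)
define N where "N c = {x. sel_rel S d k x Int cball (d k) c ~= {}} - {x. sel_rel S d k x Int (F Int cball (d k) c) ~= {}}" for c
have N: "N c:sets borel" for c unfolding N_def by(intro sets.Diff Suc.IH closed_Int Suc.prems) auto
have "{x. sel_rel S d (Suc k) x Int F ~= {}} = {x. sel_rel S d k x Int F ~= {}} - (\<Union>q\<in>Rats. N q)"
proof (intro set_eqI iffI)
 fix x assume "x:{x. sel_rel S d (Suc k) x Int F ~= {}}"
 then obtain y where y: "y:sel_rel S d k x" "y:F" "!!y'. y':sel_rel S d k x ==> dist y (d k) <= dist y' (d k)"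
  by auto
 have "x ~: N c" for c
 proof
  assume "x:N c"
  then obtain y' where "y':sel_rel S d k x" "dist (d k) y' <= c" "sel_rel S d k x Int (F Int cball (d k) c) = {}"
   by(auto simp:N_def)
  moreover have "y:cball (d k) c" using y(3)[of y'] calculation by(simp add:dist_commute)
  ultimately show False using y by blast
 qed
 thus "x:{x. sel_rel S d k x Int F ~= {}} - (\<Union>q\<in>Rats. N q)" using y by blast
next
 fix x assume x: "x:{x. sel_rel S d k x Int F ~= {}} - (\<Union>q\<in>Rats. N q)"
 have cp: "compact (sel_rel S d k x Int F)" using compact_sel_rel[OF S] Suc.prems compact_Int_closed by blast
 have "sel_rel S d k x Int F ~= {}" using x by blast
 then obtain y where y: "y:sel_rel S d k x" "y:F" "!!y'. y':sel_rel S d k x Int F ==> dist y (d k) <= dist y' (d k)"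
  using continuous_attains_inf[OF cp, of "%y. dist y (d k)"]
   continuous_on_dist[OF continuous_on_id continuous_on_const] by blast
 have "dist y (d k) <= dist y' (d k)" if y': "y':sel_rel S d k x" for y'
 proof (rule ccontr)
  assume "~ dist y (d k) <= dist y' (d k)"
  then obtain q where q: "q:Rats" "dist y' (d k) < q" "q < dist y (d k)" using Rats_dense_in_real[of "dist y' (d k)" "dist y (d k)"] by auto
  have "sel_rel S d k x Int (F Int cball (d k) q) = {}" using y(3) q by(fastforce simp:dist_commute)
  moreover have "y':sel_rel S d k x Int cball (d k) q" using y' q by(simp add:dist_commute)
  ultimately have "x:N q" unfolding N_def by blast
  thus False using x q(1) by blast
 qed
 thus "x:{x. sel_rel S d (Suc k) x Int F ~= {}}" using y by auto
qed
also have "... : sets borel"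
 by(intro sets.Diff Suc.IH Suc.prems sets.countable_UN' countable_rat) (use N in auto)
finally show ?case .
qed

lemma borel_measurable_closedI:
fixes f :: "'a => 'b::topological_space"
assumes "!!F. closed F ==> f -` F Int space M:sets M"
shows "f:bmeas M"
proof (rule borel_measurableI)
fix U :: "'b set" assume "open U"
hence "space M - (f -` (- U) Int space M):sets M" using assms by(intro sets.Diff) auto
moreover have "space M - (f -` (- U) Int space M) = f -` U Int space M" by auto
ultimately show "f -` U Int space M:sets M" by simp
qed

lemma dense_sequence:
obtains d :: "nat => 'a::{metric_space,second_countable_topology}"
where "!!y e. 0 < e ==> EX k. dist y (d k) < e"
proof -
obtain D :: "'a set" where D: "countable D" "!!X. open X ==> X ~= {} ==> EX d:D. d:X"
 by(rule countable_dense_setE) (rule that, assumption+)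
have "D ~= {}" using D(2)[of UNIV] by auto
have "EX k. dist y (from_nat_into D k) < e" if e: "0 < e" for y e
proof -
 have "ball y e ~= {}" using e by simp
 then obtain c where c: "c:D" "c:ball y e" using D(2)[OF open_ball] by blast
 obtain k where "from_nat_into D k = c" using from_nat_into_surj[OF D(1) c(1)] by blast
 thus ?thesis using c(2) by auto
qed
thus thesis by(rule that)
qed

theorem compact_selection:
fixes S :: "('a::metric_space \<times> 'b::{heine_borel,second_countable_topology}) set"
assumes S: "compact S"
obtains f where "f:bmeas borel" "!!x. x:fst ` S ==> (x, f x):S"
proof -
obtain d :: "nat => 'b" where d: "!!y e. 0 < e ==> EX k. dist y (d k) < e"
 by(rule dense_sequence) (rule that, assumption)
have dec: "sel_rel S d (Suc k) x <= sel_rel S d k x" for k x by auto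
have nest: "(\<Inter>k. sel_rel S d k x Int F) ~= {}" if "!!k. sel_rel S d k x Int F ~= {}" "closed F" for x F
proof (rule compact_nest)
 show "compact (sel_rel S d k x Int F)" for k using compact_sel_rel[OF S] that(2) compact_Int_closed by blast
 show "sel_rel S d n x Int F <= sel_rel S d m x Int F" if "m <= n" for m n
  using lift_Suc_antimono_le[of "%k. sel_rel S d k x", OF dec that] by blast
qed (use that in blast)
have uniq: "y = y'" if "!!k. y:sel_rel S d k x" "!!k. y':sel_rel S d k x" for x y y'
proof (rule ccontr)
 assume "y ~= y'"
 have eq: "dist y (d k) = dist y' (d k)" for k
  using that(1)[of "Suc k"] that(2)[of "Suc k"] by(auto intro:antisym)
 have "0 < dist y y'/2" using \<open>y ~= y'\<close> by simp
 from d[OF this, of y] obtain k where k: "dist y (d k) < dist y y'/2" by(rule exE)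
 have "dist y y' <= dist y (d k)+dist y' (d k)" by(rule dist_triangle2)
 thus False using k eq[of k] by simp
qed
define f where "f x = (if x:fst ` S then (THE y. ALL k. y:sel_rel S d k x) else d 0)" for x
have f: "f x:sel_rel S d k x" if x: "x:fst ` S" for x k
proof -
 have "sel_rel S d k x Int UNIV ~= {}" for k using compact_sel_rel[OF S, of d k x] x by simp
 then obtain y where y: "ALL k. y:sel_rel S d k x" using nest[of x UNIV] by auto
 have "EX! y. ALL k. y:sel_rel S d k x" using y uniq by blast
 hence "ALL k. (THE y. ALL k. y:sel_rel S d k x):sel_rel S d k x" by(rule theI')
 thus ?thesis using x by(simp add:f_def)
qed
have dom: "fst ` S:sets borel"
 using S by(simp add:compact_continuous_image continuous_on_fst compact_imp_closed borel_closed)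
have "f:bmeas borel"
proof (rule borel_measurable_closedI)
 fix F :: "'b set" assume F: "closed F"
 \<comment> \<open>The nested stages shrink to a single point, so this point lies in
   \<open>F\<close> iff every stage meets \<open>F\<close>.\<close>
 have "f -` F Int space borel = (fst ` S Int (\<Inter>k. {x. sel_rel S d k x Int F ~= {}})) Un (if d 0:F then - fst ` S else {})"
 proof (intro set_eqI iffI)
  fix x assume x: "x:f -` F Int space borel"
  show "x:(fst ` S Int (\<Inter>k. {x. sel_rel S d k x Int F ~= {}})) Un (if d 0:F then - fst ` S else {})"
  proof (cases "x:fst ` S")
   case True
   thus ?thesis using f[OF True] x by auto
  next
   case False
   thus ?thesis using x by(simp add:f_def)
  qed
 next
  fix x assume x: "x:(fst ` S Int (\<Inter>k. {x. sel_rel S d k x Int F ~= {}})) Un (if d 0:F then - fst ` S else {})"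
  show "x:f -` F Int space borel"
  proof (cases "x:fst ` S")
   case True
   hence "!!k. sel_rel S d k x Int F ~= {}" using x by(auto split:if_splits)
   hence "(\<Inter>k. sel_rel S d k x Int F) ~= {}" by(intro nest F)
   then obtain y where y: "!!k. y:sel_rel S d k x" "y:F" by auto
   have "f x = y" by(rule uniq[OF f[OF True] y(1)])
   thus ?thesis using \<open>y:F\<close> by simp
  next
   case False
   thus ?thesis using x by(auto simp:f_def split:if_splits)
  qed
 qed
 also have "... : sets borel"
  using dom sel_rel_meets_borel[OF S F] by(intro sets.Un sets.Int sets.countable_INT') (auto intro:borel_comp)
 finally show "f -` F Int space borel:sets borel" .
qed
moreover have "(x, f x):S" if "x:fst ` S" for x using f[OF that, of 0] by simp
ultimately show thesis by(rule that)
qed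

section \<open>Measurability along rays\<close>

context null_rays
begin

lemma H_borel [measurable]: "H:sets borel" using closed_H by simp

lemma closed_le_pairs: "closed {(x, y). x:H & y:H & le x y}"
proof -
have "{(x, y). x:H & y:H & le x y} = {(x, y). le x y} Int H \<times> H" by auto
thus ?thesis by(simp add:closed_Int closed_le closed_Times closed_H)
qed

text \<open>The lower bound \<open>ep\<close> cuts out a neighbourhood of the diagonal; the pairs of
  distinct related points thereby become a countable union of compact sets.\<close>

lemma compact_le_pairs:
"compact {(x, y). x:H & y:H & le x y & x:cball o' r & y:cball o' r & ep <= dist x y}"
proof -
have "{(x, y). x:H & y:H & le x y & x:cball o' r & y:cball o' r & ep <= dist x y} =
 (cball o' r \<times> cball o' r) Int ({(x, y). x:H & y:H & le x y} Int {p. ep <= dist (fst p) (snd p)})" by auto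
moreover have "closed {p :: 'a \<times> 'a. ep <= dist (fst p) (snd p)}"
 by(intro closed_Collect_le continuous_intros)
ultimately show ?thesis
 by(auto intro!:compact_Int_closed compact_Times closed_Int closed_le_pairs)
qed

lemma final_borel [measurable]: "final_points le H:sets borel"
proof -
define C where "C n = {(x, y). x:H & y:H & le x y & x:cball undefined (real n) &
  y:cball undefined (real n) & 1/real (Suc n) <= dist x y}" for n :: nat
have "final_points le H = H - (\<Union>n. fst ` C n)"
proof (intro set_eqI iffI)
 fix x assume "x:final_points le H"
 thus "x:H - (\<Union>n. fst ` C n)"
  unfolding final_points_def C_def by auto
next
 fix x assume x: "x:H - (\<Union>n. fst ` C n)"
 have "False" if y: "y:H" "le x y" "y ~= x" for y
 proof -
  obtain n1 where n1: "1/real (Suc n1) < dist x y"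
   using y(3) by(metis nat_approx_posE zero_less_dist_iff)
  obtain n2 :: nat where n2: "max (dist undefined x) (dist undefined y) <= real n2" using real_arch_simple by blast
  let ?n = "max n1 n2"
  have "1/real (Suc ?n) <= 1/real (Suc n1)" by(intro divide_left_mono) auto
  hence "(x, y):C ?n" using n1 n2 x y by(auto simp:C_def)
  hence "x:fst ` C ?n" by force
  thus False using x by blast
 qed
 thus "x:final_points le H" using x unfolding final_points_def by blast
qed
moreover have "compact (fst ` C n)" for n
 unfolding C_def by(intro compact_continuous_image continuous_intros compact_le_pairs)
ultimately show ?thesis by(auto simp:compact_imp_closed borel_closed)
qed

lemma initial_borel [measurable]: "initial_points le H:sets borel"
proof -
interpret rev: null_rays "%x y. le y x" H "%x. - G x" by(rule reverse)
show ?thesis using rev.final_borel by(simp add:final_points_reverse[of le])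
qed

lemma Hi_borel [measurable]: "Hi:sets borel"
unfolding inner_part_def by measurable

text \<open>A gauge is Borel on the inner part and arbitrary elsewhere; this is a Borel function on
  the whole space.\<close>

definition Gb :: "'a => real" where "Gb x = (if x:Hi then G x else 0)"

lemma Gb_measurable [measurable]: "Gb:bmeas borel"
proof -
have "G:bmeas (restrict_space borel Hi)" using gauge by(simp add:gauge_for_def)
hence "(%x. ind Hi x *\<^sub>R G x):bmeas borel"
 by(subst (asm) borel_measurable_restrict_space_iff) auto
moreover have "(%x. ind Hi x *\<^sub>R G x) = Gb" by(auto simp:Gb_def)
ultimately show ?thesis by simp
qed

text \<open>For a dense sequence \<open>d\<close>, select for each \<open>z\<close> a point of its
  ray within \<open>1/(j+1)\<close> of \<open>d i\<close>, if there is one in a given ball, and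
  \<open>z\<close> itself otherwise. The relations are compact, so the selections are Borel, and all
  of them together are dense in every ray.\<close>

lemma dense_in_ray_exists:
"EX s :: nat => 'a => 'a. (ALL i. s i:bmeas borel) & (ALL i. ALL z:H. s i z:Ry z) &
  (ALL z:H. ALL w:Ry z. ALL ep>0. EX i. dist (s i z) w < ep)"
proof -
obtain d :: "nat => 'a" where d: "!!y e. 0 < e ==> EX k. dist y (d k) < e"
 by(rule dense_sequence) (rule that, assumption)
define S where "S n i j = {(z, w). z:cball undefined (real n) & w:cball undefined (real n) &
  z:H & w:H & (le z w \<or> le w z) & dist w (d i) <= 1/real (Suc j)}" for n i j
have "compact (S n i j)" for n i j
proof -
 have "S n i j = (cball undefined (real n) \<times> cball undefined (real n)) Int
  (({(x, y). x:H & y:H & le x y} Un prod.swap -` {(x, y). x:H & y:H & le x y}) Int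
  {p. dist (snd p) (d i) <= 1/real (Suc j)})" by(auto simp:S_def)
 moreover have "closed {p :: 'a \<times> 'a. dist (snd p) (d i) <= 1/real (Suc j)}"
  by(intro closed_Collect_le continuous_intros)
 moreover have "closed (prod.swap -` {(x, y). x:H & y:H & le x y})"
  by(intro closed_vimage closed_le_pairs continuous_on_swap)
 ultimately show ?thesis
  by(auto intro!:compact_Int_closed compact_Times closed_Int closed_Un closed_le_pairs)
qed
hence "ALL n i j. EX f. f:bmeas borel & (ALL x:fst ` S n i j. (x, f x):S n i j)"
 using compact_selection by metis
then obtain f where f: "!!n i j. f n i j:bmeas borel" "!!n i j x. x:fst ` S n i j ==> (x, f n i j x):S n i j"
 by metis
define s where "s m z = (let n = fst (prod_decode m); i = fst (prod_decode (snd (prod_decode m)));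
  j = snd (prod_decode (snd (prod_decode m))) in if z:fst ` S n i j then f n i j z else z)" for m z
show ?thesis
proof (intro exI[of _ s] conjI allI ballI impI)
 show "s m:bmeas borel" for m
 proof -
  have [measurable]: "fst ` S n i j:sets borel" for n i j
   using \<open>compact (S n i j)\<close> by(simp add:compact_continuous_image continuous_on_fst compact_imp_closed borel_closed)
  note [measurable] = f(1)
  show ?thesis unfolding s_def Let_def by measurable
 qed
 show "s m z:Ry z" if "z:H" for m z
 proof -
  define n i j where "n = fst (prod_decode m)" "i = fst (prod_decode (snd (prod_decode m)))" "j = snd (prod_decode (snd (prod_decode m)))"
  show ?thesis
  proof (cases "z:fst ` S n i j")
   case True
   hence "s m z = f n i j z" by(simp add:s_def n_i_j_def)
   moreover have "(z, f n i j z):S n i j" using f(2) True .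
   ultimately show ?thesis by(auto simp:in_ray_iff S_def)
  next
   case False
   hence "s m z = z" by(simp add:s_def n_i_j_def)
   thus ?thesis using that le_refl by(simp add:in_ray_iff)
  qed
 qed
 fix z w and ep :: real assume z: "z:H" and w: "w:Ry z" and e: "ep > 0"
 obtain j where j: "1/real (Suc j) < ep/2" using e by(metis nat_approx_posE half_gt_zero)
 have "0 < 1/real (Suc j)" by simp
 from d[OF this, of w] obtain i where i: "dist w (d i) < 1/real (Suc j)" by(rule exE)
 obtain n :: nat where n: "max (dist undefined z) (dist undefined w) <= real n" using real_arch_simple by blast
 have "(z, w):S n i j" using z w n i by(auto simp:S_def in_ray_iff)
 hence zS: "z:fst ` S n i j" by force
 hence "dist (f n i j z) (d i) <= 1/real (Suc j)" using f(2)[OF zS] by(simp add:S_def)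
 hence "dist (f n i j z) w < ep" using i j dist_triangle2[of "f n i j z" w "d i"] by linarith
 hence "dist (s (prod_encode (n, prod_encode (i, j))) z) w < ep" using zS by(simp add:s_def)
 thus "EX m. dist (s m z) w < ep" by blast
qed
qed

definition rs :: "nat => 'a => 'a" where
"rs = (SOME s. (ALL i. s i:bmeas borel) & (ALL i. ALL z:H. s i z:Ry z) &
  (ALL z:H. ALL w:Ry z. ALL ep>0. EX i. dist (s i z) w < ep))"

lemma rs_measurable [measurable]: "rs i:bmeas borel"
and rs_mem: "z:H ==> rs i z:Ry z"
and rs_dense: "z:H ==> w:Ry z ==> ep > 0 ==> EX i. dist (rs i z) w < ep"
using someI_ex[OF dense_in_ray_exists] unfolding rs_def by blast+

lemma inner_near:
assumes z: "z:Hi" and w: "w:Ry z" and e: "ep > 0"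
shows "EX v:OpR z. dist v w < ep & \<bar>G v - GE z w\<bar> < ep"
proof (cases "w:OpR z")
case True
thus ?thesis using e GE_inner[OF OR_D(2)[OF True]] by(intro bexI[of _ w]) auto
next
case False
have wz: "w ~= z" using False OR_self[OF z] by blast
have ne: "GE z w ~= GE z z" using inj_onD[OF GE_inj[OF z] _ w ray_self[OF z]] wz by blast
let ?h = "%s. (1 - s)*GE z w+s*GE z z"
have hJ: "?h s:J z" if s: "0 < s" "s < 1" for s
proof -
 have *: "?h s = GE z w+s*(GE z z - GE z w)" "?h s = GE z z+(1 - s)*(GE z w - GE z z)"
  by(simp_all add:algebra_simps)
 show ?thesis
 proof (cases "GE z w < GE z z")
  case True
  hence "0 < s*(GE z z - GE z w)" "(1 - s)*(GE z w - GE z z) < 0"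
   using s by(auto simp:mult_pos_neg)
  thus ?thesis using IA_between_J[OF z w ray_self[OF z], of "?h s"] * by linarith
 next
  case False
  hence "s*(GE z z - GE z w) < 0" "0 < (1 - s)*(GE z w - GE z z)"
   using s ne by(auto simp:mult_pos_neg)
  thus ?thesis using IA_between_J[OF z ray_self[OF z] w, of "?h s"] * by linarith
 qed
qed
have "continuous_on (IA z) (PT z)" by(rule PT_continuous[OF z])
then obtain d where d: "d > 0" "!!g. g:IA z ==> dist g (GE z w) < d ==> dist (PT z g) (PT z (GE z w)) < ep"
 using GE_mem[OF w] e unfolding continuous_on_iff by blast
define M where "M = \<bar>GE z z - GE z w\<bar> + 1"
define s where "s = min (1/2) (min d ep/(2*M))"
have M: "M > 0" by(simp add:M_def)
have s: "0 < s" "s < 1" using d e M by(auto simp:s_def)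
have "\<bar>?h s - GE z w\<bar> = s * \<bar>GE z z - GE z w\<bar>"
 using s by(simp add:abs_mult[symmetric, of s] algebra_simps) (simp add:abs_mult flip: right_diff_distrib)
also have "... <= s*M" using s by(intro mult_left_mono) (auto simp:M_def)
also have "... <= min d ep/(2*M)*M" using M by(intro mult_right_mono) (auto simp:s_def)
also have "... = min d ep/2" using M by simp
also have "... < min d ep" using d e by linarith
finally have c: "\<bar>?h s - GE z w\<bar> < min d ep" .
have "PT z (?h s):OpR z" "G (PT z (?h s)) = ?h s" using PT_J[OF z hJ[OF s]] by auto
moreover have "dist (PT z (?h s)) w < ep"
 using d(2)[of "?h s"] c hJ[OF s] J_subset_IA PT_GE[OF z w] by(auto simp:dist_real_def)
ultimately show ?thesis using c by(intro bexI[of _ "PT z (?h s)"]) auto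
qed

text \<open>The sequence is dense in the closed ray and may hit end-points. Close to an inner point,
  however, its gauge values lie in the open set \<open>J z\<close>, which forces inner points;
  end-points are approximated through inner points near them.\<close>

lemma rs_near:
assumes z: "z:Hi" and w: "w:Ry z" and e: "ep > 0"
shows "EX i. rs i z:OpR z & dist (rs i z) w < ep & \<bar>G (rs i z) - GE z w\<bar> < ep"
proof -
obtain v where v: "v:OpR z" "dist v w < ep/2" "\<bar>G v - GE z w\<bar> < ep/2"
 using inner_near[OF z w, of "ep/2"] e by auto
have vR: "v:Ry z" "v:Hi" using OR_D v(1) by auto
obtain e' where e': "e' > 0" "ball (G v) e' <= J z"
 using J_open[OF z] v(1) unfolding J_def open_contains_ball by blast
obtain d where d: "d > 0" "!!x. x:Ry z ==> dist x v < d ==> dist (GE z x) (GE z v) < min e' (ep/2)"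
 using GE_continuous[OF z] vR(1) e e' unfolding continuous_on_iff by(metis half_gt_zero min_less_iff_conj)
have zH: "z:H" using z Hi_subset by auto
obtain i where i: "dist (rs i z) v < min d (ep/2)" using rs_dense[OF zH vR(1), of "min d (ep/2)"] d e by auto
have c: "\<bar>GE z (rs i z) - G v\<bar> < e'" "\<bar>GE z (rs i z) - G v\<bar> < ep/2"
 using d(2)[OF rs_mem[OF zH], of i] i GE_inner[OF vR(2)] by(auto simp:dist_real_def)
hence "GE z (rs i z):J z" using e'(2) by(auto simp:dist_real_def abs_minus_commute subset_iff)
hence O: "rs i z:OpR z" using PT_J[OF z] PT_GE[OF z rs_mem[OF zH]] by metis
hence "G (rs i z) = GE z (rs i z)" using GE_inner OR_D by metis
moreover have "dist (rs i z) w < ep" using i v(2) dist_triangle[of "rs i z" w v] by simp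
moreover have "\<bar>GE z (rs i z) - GE z w\<bar> < ep" using c(2) v(3) by linarith
ultimately show ?thesis using O by(intro exI[of _ i]) auto
qed

lemma rs_inner: "z:Hi ==> rs i z:Hi ==> rs i z:OpR z"
using rs_mem Hi_subset by(auto simp:in_open_ray_iff)

text \<open>Replaces a quantifier over the uncountable ray by one over \<open>nat\<close>, so that
  the ends of \<open>J z\<close> depend on \<open>z\<close> in a Borel way.\<close>

lemma J_less_iff: "z:Hi ==> (EX g:J z. g < c) <-> (EX i. rs i z:Hi & Gb (rs i z) < c)"
proof
assume z: "z:Hi" and "EX g:J z. g < c"
then obtain w where w: "w:OpR z" "G w < c" by(auto simp:J_def)
obtain i where "rs i z:OpR z" "\<bar>G (rs i z) - GE z w\<bar> < c - G w"
 using rs_near[OF z OR_D(1)[OF w(1)], of "c - G w"] w by auto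
thus "EX i. rs i z:Hi & Gb (rs i z) < c"
 using GE_inner[OF OR_D(2)[OF w(1)]] OR_D(2) by(intro exI[of _ i]) (auto simp:Gb_def)
next
assume "z:Hi" "EX i. rs i z:Hi & Gb (rs i z) < c"
thus "EX g:J z. g < c" using rs_inner unfolding J_def Gb_def by auto
qed

lemma J_greater_iff: "z:Hi ==> (EX g:J z. c < g) <-> (EX i. rs i z:Hi & c < Gb (rs i z))"
proof
assume z: "z:Hi" and "EX g:J z. c < g"
then obtain w where w: "w:OpR z" "c < G w" by(auto simp:J_def)
obtain i where "rs i z:OpR z" "\<bar>G (rs i z) - GE z w\<bar> < G w - c"
 using rs_near[OF z OR_D(1)[OF w(1)], of "G w - c"] w by auto
thus "EX i. rs i z:Hi & c < Gb (rs i z)"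
 using GE_inner[OF OR_D(2)[OF w(1)]] OR_D(2) by(intro exI[of _ i]) (auto simp:Gb_def)
next
assume "z:Hi" "EX i. rs i z:Hi & c < Gb (rs i z)"
thus "EX g:J z. c < g" using rs_inner unfolding J_def Gb_def by auto
qed

definition lo :: "'a => real" where "lo z = (if z:Hi & bdd_below (J z) then Inf (J z) else 0)"
definition up :: "'a => real" where "up z = (if z:Hi & bdd_above (J z) then Sup (J z) else 0)"

lemma bdd_below_J_iff: "z:Hi ==> bdd_below (J z) <-> (EX n::nat. ~ (EX i. rs i z:Hi & Gb (rs i z) < - real n))"
proof -
have "bdd_below (J z) <-> (EX n::nat. ALL g:J z. - real n <= g)"
proof
 assume "bdd_below (J z)"
 then obtain L where L: "!!g. g:J z ==> L <= g" by(meson bdd_below_def)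
 obtain n where "- L <= real n" using real_arch_simple by blast
 thus "EX n::nat. ALL g:J z. - real n <= g" using L by(intro exI[of _ n]) force
qed (auto intro:bdd_belowI)
thus "z:Hi ==> ?thesis" by(simp add:J_less_iff[symmetric] not_less)
qed

lemma bdd_above_J_iff: "z:Hi ==> bdd_above (J z) <-> (EX n::nat. ~ (EX i. rs i z:Hi & real n < Gb (rs i z)))"
proof -
have "bdd_above (J z) <-> (EX n::nat. ALL g:J z. g <= real n)"
proof
 assume "bdd_above (J z)"
 then obtain L where L: "!!g. g:J z ==> g <= L" by(meson bdd_above_def)
 obtain n where "L <= real n" using real_arch_simple by blast
 thus "EX n::nat. ALL g:J z. g <= real n" using L by(intro exI[of _ n]) force
qed (auto intro:bdd_aboveI)
thus "z:Hi ==> ?thesis" by(simp add:J_greater_iff[symmetric] not_less)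
qed

lemma bdd_J_borel [measurable]: "{z:Hi. bdd_below (J z)}:sets borel" "{z:Hi. bdd_above (J z)}:sets borel"
proof -
have "{z:Hi. bdd_below (J z)} = {z. z:Hi & (EX n::nat. ~ (EX i. rs i z:Hi & Gb (rs i z) < - real n))}"
 by(intro Collect_cong conj_cong refl bdd_below_J_iff)
also have "... : sets borel" by measurable
finally show "{z:Hi. bdd_below (J z)}:sets borel" .
have "{z:Hi. bdd_above (J z)} = {z. z:Hi & (EX n::nat. ~ (EX i. rs i z:Hi & real n < Gb (rs i z)))}"
 by(intro Collect_cong conj_cong refl bdd_above_J_iff)
also have "... : sets borel" by measurable
finally show "{z:Hi. bdd_above (J z)}:sets borel" .
qed

lemma lo_measurable [measurable]: "lo:bmeas borel"
proof (rule borel_measurableI_less)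
fix c
have "lo z < c <-> z:{z:Hi. bdd_below (J z)} & (EX i. rs i z:Hi & Gb (rs i z) < c) \<or>
  z ~: {z:Hi. bdd_below (J z)} & 0 < c" for z
 using cInf_less_iff[OF J_nonempty, of z c] J_less_iff[of z c]
 by(cases "z:Hi"; cases "bdd_below (J z)") (simp_all add:lo_def)
hence "{z:space borel. lo z < c} = {z. z:{z:Hi. bdd_below (J z)} & (EX i. rs i z:Hi & Gb (rs i z) < c) \<or>
  z ~: {z:Hi. bdd_below (J z)} & 0 < c}" by simp
also have "... : sets borel" by measurable
finally show "{z:space borel. lo z < c}:sets borel" .
qed

lemma up_measurable [measurable]: "up:bmeas borel"
proof (rule borel_measurableI_greater)
fix c
have "c < up z <-> z:{z:Hi. bdd_above (J z)} & (EX i. rs i z:Hi & c < Gb (rs i z)) \<or>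
  z ~: {z:Hi. bdd_above (J z)} & c < 0" for z
 using less_cSup_iff[OF J_nonempty, of z c] J_greater_iff[of z c]
 by(cases "z:Hi"; cases "bdd_above (J z)") (simp_all add:up_def)
hence "{z:space borel. c < up z} = {z. z:{z:Hi. bdd_above (J z)} & (EX i. rs i z:Hi & c < Gb (rs i z)) \<or>
  z ~: {z:Hi. bdd_above (J z)} & c < 0}" by simp
also have "... : sets borel" by measurable
finally show "{z:space borel. c < up z}:sets borel" .
qed

text \<open>A jointly Borel function of all pairs that agrees with \<open>GE z x\<close> if
  \<open>z\<close> is inner and \<open>x\<close> is on its ray; the other values are
  meaningless.\<close>

definition Gx :: "'a => 'a => real" where
"Gx z x = (if x:initial_points le H then lo z else if x:final_points le H then up z else Gb x)"

lemma Gx_measurable [measurable]: "(%p. Gx (fst p) (snd p)):bmeas (borel OM borel)"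
unfolding Gx_def by measurable

lemma GE_eq_Gx:
assumes z: "z:Hi" and x: "x:Ry z" shows "GE z x = Gx z x"
using x z
proof (cases rule: not_inner_cases)
case 1
hence "x:Hi" using OR_D(2) by blast
thus ?thesis by(simp add:Gx_def Gb_def GE_inner inner_part_def)
next
case 2
thus ?thesis using J_bdd_below[OF z x] z by(simp add:Gx_def GE_initial lo_def)
next
case 3
thus ?thesis using J_bdd_above[OF z x] z by(simp add:Gx_def GE_final up_def)
qed

section \<open>End-points of the rays and the Borel inverse coordinate\<close>

definition has_init :: "'a => bool" where "has_init z <-> (EX x:Ry z. x:initial_points le H)"
definition has_fin :: "'a => bool" where "has_fin z <-> (EX x:Ry z. x:final_points le H)"

definition below_pairs :: "nat => ('a \<times> 'a) set" where
"below_pairs n = {(z, v). EX w:H Int cball undefined (real n). le w z & le w v}"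

lemma below_pairs_borel [measurable]: "below_pairs n:sets borel"
proof -
define C where "C r = {p. (fst (fst p):cball undefined r & snd (fst p):cball undefined r) & snd p:cball undefined (real n) & snd p:H &
  le (snd p) (fst (fst p)) & le (snd p) (snd (fst p))}" for r
have "compact (C r)" for r
proof -
 have cl: "closed ((%p::('a\<times>'a)\<times>'a. (snd p, f (fst p))) -` {(x, y). le x y})" if "continuous_on UNIV f" for f :: "'a\<times>'a => 'a"
  by(intro closed_vimage closed_le continuous_intros continuous_on_compose2[OF that]) auto
 have "C r = ((cball undefined r \<times> cball undefined r) \<times> cball undefined (real n)) Int (UNIV \<times> H Int
  ((%p. (snd p, fst (fst p))) -` {(x, y). le x y} Int (%p. (snd p, snd (fst p))) -` {(x, y). le x y}))"
  by(auto simp:C_def)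
 also have "compact ..."
  by(intro compact_Int_closed compact_Times compact_cball closed_Int closed_Times closed_UNIV closed_H
   cl[of fst] cl[of snd] continuous_on_fst continuous_on_snd continuous_on_id)
 finally show ?thesis .
qed
hence "fst ` C r:sets borel" for r
 by(simp add:compact_continuous_image continuous_on_fst compact_imp_closed borel_closed)
moreover have "below_pairs n = (\<Union>r::nat. fst ` C (real r))"
proof (intro set_eqI iffI)
 fix p assume "p:below_pairs n"
 then obtain w where w: "w:H Int cball undefined (real n)" "le w (fst p)" "le w (snd p)" by(auto simp:below_pairs_def)
 obtain r :: nat where "max (dist undefined (fst p)) (dist undefined (snd p)) <= real r" using real_arch_simple by blast
 hence "(p, w):C (real r)" using w by(auto simp:C_def)
 thus "p:(\<Union>r::nat. fst ` C (real r))" by force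
qed (auto simp:C_def below_pairs_def)
ultimately show ?thesis by auto
qed

text \<open>An initial point of the ray lies below all of it and inside some ball. Conversely, lower
  bounds of \<open>z\<close> are pairwise comparable, so finitely many points \<open>rs j z\<close>
  have a common lower bound in the ball; compactness yields one for the whole sequence, density one
  for the whole ray, and antisymmetry makes it initial.\<close>

lemma has_init_iff:
assumes z: "z:Hi"
shows "has_init z <-> (EX n. ALL i. (z, rs i z):below_pairs n)"
proof
have zH: "z:H" using z Hi_subset by auto
assume "has_init z"
then obtain x where x: "x:Ry z" "x:initial_points le H" by(auto simp:has_init_def)
obtain n :: nat where "dist undefined x <= real n" using real_arch_simple by blast
thus "EX n. ALL i. (z, rs i z):below_pairs n"
 using initial_le[OF z x] rs_mem[OF zH] ray_self[OF z] x(1) R_subset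
 by(intro exI[of _ n]) (auto simp:below_pairs_def intro!:bexI[of _ x])
next
have zH: "z:H" using z Hi_subset by auto
assume "EX n. ALL i. (z, rs i z):below_pairs n"
then obtain n where n: "ALL i. (z, rs i z):below_pairs n" by(rule exE)
have n: "EX w. w:H Int cball undefined (real n) & le w z & le w (rs i z)" for i
 using spec[OF n, of i] unfolding below_pairs_def by auto
define N where "N i = {w. w:H Int cball undefined (real n) & le w z & (ALL j<=i. le w (rs j z))}" for i :: nat
have ne: "N i ~= {}" for i
proof (induction i)
 case 0 thus ?case using n[of 0] by(auto simp:N_def)
next
 case (Suc i)
 then obtain w where w: "w:H" "w:cball undefined (real n)" "le w z" "ALL j<=i. le w (rs j z)" by(auto simp:N_def)
 obtain w' where w': "w':H" "w':cball undefined (real n)" "le w' z" "le w' (rs (Suc i) z)" using n[of "Suc i"] by auto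
 have "le w w' \<or> le w' w" using comparable_below[OF z] w w' by blast
 thus ?case
 proof
  assume "le w w'"
  hence "le w (rs (Suc i) z)" using w'(4) by(rule le_trans)
  hence "w:N (Suc i)" using w by(auto simp:N_def le_Suc_eq)
  thus ?thesis by blast
 next
  assume "le w' w"
  hence "le w' (rs j z)" if "j <= i" for j using w(4) that le_trans by blast
  hence "w':N (Suc i)" using w' by(auto simp:N_def le_Suc_eq)
  thus ?thesis by blast
 qed
qed
have "(\<Inter>i. N i) ~= {}"
proof (rule compact_nest)
 fix i
 have "N i = cball undefined (real n) Int (H Int {w. le w z} Int (\<Inter>j\<in>{..i}. {w. le w (rs j z)}))" by(auto simp:N_def)
 thus "compact (N i)" by(auto intro!:compact_Int_closed closed_Int closed_H closed_below closed_INT)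
qed (use ne in "auto simp:N_def")
then obtain w where w: "w:H" "le w z" "!!i. le w (rs i z)" by(auto simp:N_def)
have min: "le w v" if v: "v:Ry z" for v
proof (rule ccontr)
 assume "~ le w v"
 moreover have "open (- {v. le w v})" using closed_above by(simp add:open_Compl)
 ultimately obtain e where "e > 0" "ball v e <= - {v. le w v}" by(metis ComplI mem_Collect_eq open_contains_ball)
 thus False using rs_dense[OF zH v, of e] w(3) by(auto simp:dist_commute subset_iff)
qed
have "w:initial_points le H"
 unfolding initial_points_def
proof (intro CollectI conjI notI)
 assume "EX x:H. le x w & x ~= w"
 then obtain x where x: "x:H" "le x w" "x ~= w" by auto
 hence "x:Ry z" using le_trans[OF x(2) w(2)] zH by(auto simp:in_ray_iff)
 thus False using min le_antisym w(1) x by blast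
qed (rule w)
thus "has_init z" using w zH by(auto simp:has_init_def in_ray_iff)
qed

lemma has_init_measurable [measurable]: "{z:Hi. has_init z}:sets borel"
proof -
have "{z:Hi. has_init z} = {z. z:Hi & (EX n. ALL i. (z, rs i z):below_pairs n)}" using has_init_iff by auto
also have "... : sets borel"
 using below_pairs_borel unfolding borel_prod[symmetric] by measurable
finally show ?thesis .
qed

lemma has_fin_measurable [measurable]: "{z:Hi. has_fin z}:sets borel"
proof -
interpret rev: null_rays "%x y. le y x" H "%x. - G x" by(rule reverse)
show ?thesis using rev.has_init_measurable
 by(simp add:rev.has_init_def has_fin_def inner_part_reverse[of le] ray_reverse[of le] initial_points_reverse[of le])
qed

definition IA_pairs :: "('a \<times> real) set" where "IA_pairs = {(z, g). z:Hi & g:IA z}"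

lemma IA_iff:
assumes z: "z:Hi"
shows "g:IA z <-> (EX i j. rs i z:Hi & Gb (rs i z) < g & rs j z:Hi & g < Gb (rs j z)) \<or>
 has_init z & g = lo z \<or> has_fin z & g = up z"
proof -
have "g:J z <-> (EX a:J z. a < g) & (EX b:J z. g < b)"
proof
 assume "g:J z"
 then obtain x where "x:OpR z" "g = G x" by(auto simp:J_def)
 thus "(EX a:J z. a < g) & (EX b:J z. g < b)" using J_lower[OF z] J_upper[OF z] by(auto simp:J_def)
next
 assume "(EX a:J z. a < g) & (EX b:J z. g < b)"
 thus "g:J z" using mem_is_interval_1_I[OF J_interval[OF z]] by(meson less_imp_le)
qed
hence "g:J z <-> (EX i j. rs i z:Hi & Gb (rs i z) < g & rs j z:Hi & g < Gb (rs j z))"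
 using J_less_iff[OF z] J_greater_iff[OF z] by auto
moreover have "g:IA z <-> g:J z \<or> has_init z & g = lo z \<or> has_fin z & g = up z"
proof
 assume "g:IA z"
 then obtain x where x: "x:Ry z" "g = GE z x" by(auto simp:IA_def)
 from x(1) z show "g:J z \<or> has_init z & g = lo z \<or> has_fin z & g = up z"
 proof (cases rule: not_inner_cases)
  case 1 thus ?thesis using x GE_inner OR_D by(auto simp:J_def)
 qed (use x GE_eq_Gx[OF z x(1)] in "auto simp:has_init_def has_fin_def Gx_def")
next
 assume "g:J z \<or> has_init z & g = lo z \<or> has_fin z & g = up z"
 thus "g:IA z"
 proof (elim disjE conjE)
  assume "g:J z" thus ?thesis using J_subset_IA by blast
 next
  assume "has_init z" "g = lo z"
  then obtain x where "x:Ry z" "x:initial_points le H" "g = lo z" by(auto simp:has_init_def)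
  thus ?thesis using GE_mem[of x z] GE_eq_Gx[OF z, of x] by(simp add:Gx_def)
 next
  assume "has_fin z" "g = up z"
  then obtain x where x: "x:Ry z" "x:final_points le H" "g = up z" by(auto simp:has_fin_def)
  moreover have "x ~: initial_points le H" using not_inner_cases[OF x(1) z] x(2) OR_D(2)
   by(metis DiffD2 UnCI inner_part_def)
  ultimately show ?thesis using GE_mem[of x z] GE_eq_Gx[OF z, of x] by(simp add:Gx_def)
 qed
qed
ultimately show ?thesis by blast
qed

lemma IA_pairs_borel [measurable]: "IA_pairs:sets (borel OM borel)"
proof -
have "IA_pairs = {p:space (borel OM borel). fst p:Hi & ((EX i j. rs i (fst p):Hi & Gb (rs i (fst p)) < snd p & rs j (fst p):Hi & snd p < Gb (rs j (fst p))) \<or>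
 fst p:{z:Hi. has_init z} & snd p = lo (fst p) \<or> fst p:{z:Hi. has_fin z} & snd p = up (fst p))}"
 using IA_iff by(auto simp:IA_pairs_def space_pair_measure)
also have "... : sets (borel OM borel)" by measurable
finally show ?thesis .
qed

definition PB :: "'a \<times> real => 'a" where "PB p = (if p:IA_pairs then PT (fst p) (snd p) else fst p)"

lemma PB_measurable [measurable]: "PB:bmeas (borel OM borel)"
proof (rule borel_measurable_closedI)
fix F :: "'a set" assume F: "closed F"
show "PB -` F Int space (borel OM borel):sets (borel OM borel)"
proof (cases "F = {}")
 case False
 have key: "PT z g:F <-> (ALL k::nat. EX i. rs i z:Hi & \<bar>Gb (rs i z) - g\<bar> < 1/real (Suc k) & infdist (rs i z) F < 1/real (Suc k))"
  if z: "z:Hi" and g: "g:IA z" for z g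
 proof
  assume PF: "PT z g:F"
  show "ALL k::nat. EX i. rs i z:Hi & \<bar>Gb (rs i z) - g\<bar> < 1/real (Suc k) & infdist (rs i z) F < 1/real (Suc k)"
  proof
   fix k :: nat
   obtain i where i: "rs i z:OpR z" "dist (rs i z) (PT z g) < 1/real (Suc k)" "\<bar>G (rs i z) - g\<bar> < 1/real (Suc k)"
    using rs_near[OF z PT_mem[OF z g], of "1/real (Suc k)"] GE_PT[OF z g] by auto
   thus "EX i. rs i z:Hi & \<bar>Gb (rs i z) - g\<bar> < 1/real (Suc k) & infdist (rs i z) F < 1/real (Suc k)"
    using infdist_le[OF PF, of "rs i z"] OR_D(2)[OF i(1)] by(intro exI[of _ i]) (auto simp:Gb_def)
  qed
 next
  assume "ALL k::nat. EX i. rs i z:Hi & \<bar>Gb (rs i z) - g\<bar> < 1/real (Suc k) & infdist (rs i z) F < 1/real (Suc k)"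
  then obtain i where i: "!!k::nat. rs (i k) z:Hi" "!!k. \<bar>Gb (rs (i k) z) - g\<bar> < 1/real (Suc k)" "!!k. infdist (rs (i k) z) F < 1/real (Suc k)"
   by metis
  define v where "v k = rs (i k) z" for k
  have v: "v k:OpR z" "\<bar>G (v k) - g\<bar> < 1/real (Suc k)" for k
   using i(1,2)[of k] rs_inner[OF z] by(auto simp:v_def Gb_def)
  have lim0: "(%k. 1/real (Suc k)) ----> 0" by(rule LIMSEQ_Suc[OF lim_1_over_n])
  have "(%k. G (v k) - g) ----> 0"
   by(rule tendsto_rabs_zero_cancel, rule tendsto_sandwich[OF _ _ tendsto_const lim0])
    (use v(2) in "auto intro!:always_eventually less_imp_le simp del:of_nat_Suc")
  hence Gv: "(%k. G (v k)) ----> g" by(simp add:LIM_zero_iff)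
  have "(%k. PT z (G (v k))) ----> PT z g"
  proof (rule continuous_on_tendsto_compose[OF PT_continuous[OF z] Gv g])
   show "\<forall>\<^sub>F k in sequentially. G (v k):IA z"
    by(intro always_eventually allI subsetD[OF J_subset_IA]) (use v(1) in "auto simp:J_def")
  qed
  hence "v ----> PT z g" using PT_G[OF z v(1)] by simp
  hence "(%k. infdist (v k) F) ----> infdist (PT z g) F" by(rule tendsto_infdist)
  moreover have "(%k. infdist (v k) F) ----> 0"
   by(rule tendsto_sandwich[OF _ _ tendsto_const lim0])
    (intro always_eventually allI infdist_nonneg less_imp_le[OF i(3)[folded v_def]])+
  ultimately have "infdist (PT z g) F = 0" using LIMSEQ_unique by blast
  thus "PT z g:F" using in_closed_iff_infdist_zero[OF F False] by blast
 qed
 have [measurable]: "(%x. infdist x F):bmeas borel"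
  by(intro borel_measurable_continuous_onI continuous_intros)
 have [measurable]: "F:sets borel" using F by simp
 have "PB -` F Int space (borel OM borel) = {p:space (borel OM borel). (p:IA_pairs &
   (ALL k::nat. EX i. rs i (fst p):Hi & \<bar>Gb (rs i (fst p)) - snd p\<bar> < 1/real (Suc k) & infdist (rs i (fst p)) F < 1/real (Suc k))) \<or>
   (p ~: IA_pairs & fst p:F)}"
 proof (intro set_eqI)
  fix p :: "'a \<times> real"
  show "p:PB -` F Int space (borel OM borel) <-> p:{p:space (borel OM borel). (p:IA_pairs &
   (ALL k::nat. EX i. rs i (fst p):Hi & \<bar>Gb (rs i (fst p)) - snd p\<bar> < 1/real (Suc k) & infdist (rs i (fst p)) F < 1/real (Suc k))) \<or>
   (p ~: IA_pairs & fst p:F)}"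
  proof (cases "p:IA_pairs")
   case True
   hence "fst p:Hi" "snd p:IA (fst p)" by(auto simp:IA_pairs_def)
   from key[OF this] show ?thesis using True by(simp add:PB_def space_pair_measure del:of_nat_Suc)
  qed (simp add:PB_def space_pair_measure)
 qed
 also have "... : sets (borel OM borel)" by measurable
 finally show ?thesis .
qed simp
qed

end

section \<open>Entropy bounds\<close>

text \<open>The positive and negative parts of \<open>rh*ln rh\<close> integrated against
  \<open>M\<close> equal those of \<open>ln rh\<close> integrated against \<open>mu\<close>; the
  entropy estimates work with the latter, where potentials can be compared pointwise.\<close>

lemma (in sigma_finite_measure) Ent_cases:
assumes mu: "prob_space mu" and sets: "sets mu = sets M" and ac: "absolutely_continuous M mu"
obtains rh where "rh:bmeas M" "!!x. 0 <= rh x" "density M (%x. ennreal (rh x)) = mu"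
 "AE x in mu. 0 < rh x"
 "Ent mu M = (if (nn_integral mu (%x. ennreal (ln (rh x)))) < \<infinity>
   then enn2ereal (nn_integral mu (%x. ennreal (ln (rh x)))) - enn2ereal (nn_integral mu (%x. ennreal (- ln (rh x)))) else \<infinity>)"
proof -
interpret mu: prob_space mu by fact
define rh where "rh x = enn2real (RN_deriv M mu x)" for x
have m[measurable]: "rh:bmeas M" unfolding rh_def by measurable
have rn: "density M (RN_deriv M mu) = mu" using density_RN_deriv ac sets by blast
have fin: "AE x in M. RN_deriv M mu x = ennreal (rh x)"
 using RN_deriv_finite[OF mu.sigma_finite_measure_axioms ac sets]
 by eventually_elim (simp add:rh_def less_top)
have den: "density M (%x. ennreal (rh x)) = mu"
 using density_cong[of "RN_deriv M mu" M "%x. ennreal (rh x)"] fin rn by simp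
have int: "nn_integral mu f = nn_integral M (%x. ennreal (rh x)*f x)" if "f:bmeas M" for f
 using that by(subst den[symmetric], subst nn_integral_density) auto
have pos: "nn_integral mu (%x. ennreal (ln (rh x))) = nn_integral M (%x. ennreal (rh x*ln (rh x)))"
 by(subst int) (auto simp:ennreal_mult' rh_def)
have neg: "nn_integral mu (%x. ennreal (- ln (rh x))) = nn_integral M (%x. ennreal (- (rh x*ln (rh x))))"
 by(subst int) (auto simp:ennreal_mult'[symmetric] rh_def)
have "AE x in mu. 0 < rh x"
 by(subst den[symmetric], subst AE_density) (auto simp:rh_def)
moreover have "Ent mu M = (if (nn_integral mu (%x. ennreal (ln (rh x)))) < \<infinity>
   then enn2ereal (nn_integral mu (%x. ennreal (ln (rh x)))) - enn2ereal (nn_integral mu (%x. ennreal (- ln (rh x)))) else \<infinity>)"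
 unfolding Ent_def Let_def pos neg rn by(simp add:rh_def)
ultimately show thesis using that[of rh] m den by(auto simp:rh_def)
qed

lemma Uent_pos_ac:
assumes "Uent K mu m > 0"
shows "absolutely_continuous m mu"
proof -
have "density m (RN_deriv m mu) = mu"
 using assms by(auto simp:Uent_def Ent_def Let_def split:if_splits)
thus ?thesis by(metis absolutely_continuousI_density borel_measurable_RN_deriv)
qed

lemma nn_integral_le_of_emeasure_le:
assumes e: "e:nu ->M M" and W: "W:bmeas nu"
 and le: "!!B. B:sets M ==> nn_integral nu (%om. W om*ind B (e om)) <= em M B"
 and f: "f:bmeas M"
shows "nn_integral nu (%om. W om*f (e om)) <= nn_integral M f"
proof -
note [measurable] = e W f
have "nn_integral nu (%om. W om*f (e om)) = nn_integral (distr (density nu W) M e) f"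
 by(subst nn_integral_distr) (auto simp:nn_integral_density)
also have "... <= nn_integral M f"
proof (rule nn_integral_mono_measure)
 show "distr (density nu W) M e <= M"
 proof (rule le_measure[THEN iffD2])
  show "sets (distr (density nu W) M e) = sets M" by simp
  show "ALL B:sets (distr (density nu W) M e). em (distr (density nu W) M e) B <= em M B"
  proof
   fix B assume "B:sets (distr (density nu W) M e)"
   hence B[measurable]: "B:sets M" by simp
   have "em (distr (density nu W) M e) B = nn_integral nu (%om. W om*ind (e -` B Int space nu) om)"
    by(simp add:emeasure_distr emeasure_density)
   also have "... = nn_integral nu (%om. W om*ind B (e om))"
    by(intro nn_integral_cong) (auto split:split_indicator)
   finally show "em (distr (density nu W) M e) B <= em M B" using le[OF B] by simp
  qed
 qed
qed simp
finally show ?thesis .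
qed

text \<open>If \<open>r\<close> is the density of the push-forward, then \<open>e\<^sup>V r\<close> has integral at most 1, and
\<open>log s \<le> s - 1\<close> gives \<open>log r \<le> e\<^sup>V r - 1 - V\<close>.\<close>

lemma (in sigma_finite_measure) Uent_ge:
assumes nu: "prob_space nu" and e[measurable]: "e:nu ->M M" and K: "K > 0"
 and V: "integrable nu V"
 and le: "!!B. B:sets M ==> nn_integral nu (%om. ennreal (exp (V om))*ind B (e om)) <= em M B"
shows "ennreal (exp ((\<integral>om. V om \<partial>nu)/K)) <= Uent K (distr nu M e) M"
proof -
interpret nu: prob_space nu by fact
have [measurable]: "V:bmeas nu" using V by simp
let ?mu = "distr nu M e"
have pmu: "prob_space ?mu" by(rule nu.prob_space_distr) simp
have ac: "absolutely_continuous M ?mu"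
 unfolding absolutely_continuous_def
proof
 fix B assume B: "B:null_sets M"
 hence [measurable]: "B:sets M" by auto
 have "nn_integral nu (%om. ennreal (exp (V om))*ind B (e om)) = 0"
  using le[of B] B by auto
 hence "AE om in nu. e om ~: B"
  by(subst (asm) nn_integral_0_iff_AE) (auto split:split_indicator elim!:eventually_mono)
 hence "{om:space nu. e om:B}:null_sets nu" by(subst (asm) AE_iff_null) auto
 moreover have "{om:space nu. e om:B} = e -` B Int space nu" by auto
 ultimately show "B:null_sets ?mu" by(simp add:null_sets_distr_iff)
qed
obtain rh where rh[measurable]: "rh:bmeas M" and nn: "!!x. 0 <= rh x"
 and den: "density M (%x. ennreal (rh x)) = ?mu" and pos: "AE x in ?mu. 0 < rh x"
 and Ent: "Ent ?mu M = (if (nn_integral ?mu (%x. ennreal (ln (rh x)))) < \<infinity>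
   then enn2ereal (nn_integral ?mu (%x. ennreal (ln (rh x)))) - enn2ereal (nn_integral ?mu (%x. ennreal (- ln (rh x)))) else \<infinity>)"
 using Ent_cases[OF pmu _ ac] by auto
define P where "P = nn_integral ?mu (%x. ennreal (ln (rh x)))"
define Q where "Q = nn_integral ?mu (%x. ennreal (- ln (rh x)))"
have P: "P = nn_integral nu (%om. ennreal (ln (rh (e om))))" and Q: "Q = nn_integral nu (%om. ennreal (- ln (rh (e om))))"
 unfolding P_def Q_def by(subst nn_integral_distr; simp)+
have pos': "AE om in nu. 0 < rh (e om)" using pos by(subst (asm) AE_distr_iff) auto
have one: "nn_integral nu (%om. ennreal (exp (V om)*rh (e om))) <= 1"
proof -
 have "nn_integral nu (%om. ennreal (exp (V om))*ennreal (rh (e om))) <= nn_integral M (%x. ennreal (rh x))"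
  by(rule nn_integral_le_of_emeasure_le[OF e _ le]) auto
 also have "... = em (density M (%x. ennreal (rh x))) (space M)"
  by(subst emeasure_density) (auto intro!:nn_integral_cong)
 also have "... = 1" using den prob_space.emeasure_space_1[OF pmu] by simp
 finally show ?thesis using nn by(simp add:ennreal_mult')
qed
have i1: "integrable nu (%om. exp (V om)*rh (e om))"
 using nn one by(intro integrableI_nonneg) (auto simp:order_le_less_trans[OF one])
have ln_le: "AE om in nu. ln (rh (e om)) <= exp (V om)*rh (e om) - 1 - V om"
 using pos'
proof eventually_elim
 case (elim om)
 have "ln (exp (V om)*rh (e om)) <= exp (V om)*rh (e om) - 1" using elim by(intro ln_le_minus_one) simp
 thus ?case using elim by(simp add:ln_mult)
qed
have "P <= nn_integral nu (%om. ennreal (exp (V om)*rh (e om) + \<bar>V om\<bar>))"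
 unfolding P by(intro nn_integral_mono_AE) (use ln_le in eventually_elim, auto intro!:ennreal_leI)
also have "... < \<infinity>"
 using i1 V nn by(subst nn_integral_eq_integral) (auto intro!:integrable_add integrable_abs add_nonneg_nonneg mult_nonneg_nonneg)
finally have Pfin: "P < \<infinity>" .
show ?thesis
proof (cases "Q = \<infinity>")
 case True
 hence "Ent ?mu M = -\<infinity>" using Ent Pfin unfolding P_def[symmetric] Q_def[symmetric]
  by(cases P) (auto simp:infinity_ereal_def[symmetric])
 thus ?thesis by(simp add:Uent_def)
next
 case False
 have i2: "integrable nu (%om. ln (rh (e om)))"
  unfolding real_integrable_def using P Q Pfin False by auto
 have "Ent ?mu M = ereal (enn2real P - enn2real Q)"
  using Ent Pfin False unfolding P_def[symmetric] Q_def[symmetric] by(cases P; cases Q) auto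
 also have "enn2real P - enn2real Q = (\<integral>om. ln (rh (e om)) \<partial>nu)"
  using real_lebesgue_integral_def[OF i2] P Q by simp
 finally have E: "Ent ?mu M = ereal (\<integral>om. ln (rh (e om)) \<partial>nu)" .
 have "(\<integral>om. ln (rh (e om)) \<partial>nu) <= (\<integral>om. exp (V om)*rh (e om) - 1 - V om \<partial>nu)"
  using i1 i2 V ln_le by(intro integral_mono_AE) auto
 also have "... = (\<integral>om. exp (V om)*rh (e om) \<partial>nu) - 1 - (\<integral>om. V om \<partial>nu)"
  using i1 V by(simp add:nu.prob_space)
 also have "(\<integral>om. exp (V om)*rh (e om) \<partial>nu) <= 1"
 proof -
  have "ennreal (\<integral>om. exp (V om)*rh (e om) \<partial>nu) <= 1"
   using one nn i1 by(subst nn_integral_eq_integral[symmetric]) auto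
  thus ?thesis by simp
 qed
 finally have "(\<integral>om. V om \<partial>nu) <= - (\<integral>om. ln (rh (e om)) \<partial>nu)" by simp
 hence "(\<integral>om. V om \<partial>nu)/K <= - (\<integral>om. ln (rh (e om)) \<partial>nu)/K"
  using K by(intro divide_right_mono) auto
 thus ?thesis by(simp add:Uent_def E ennreal_leI)
qed
qed

text \<open>\<open>Uent_ge\<close> for the constant potential \<open>- ln c\<close>.\<close>

lemma (in sigma_finite_measure) Uent_ge_of_bounded:
assumes mu: "prob_space mu" and sets: "sets mu = sets M" and c: "c > 0" and K: "K > 0"
 and le: "!!B. B:sets M ==> em mu B <= ennreal c*em M B"
shows "ennreal ((1/c) powr (1/K)) <= Uent K mu M"
proof -
interpret mu: prob_space mu by fact
have "(%x. x):mu ->M M" using sets by(simp add:measurable_ident_sets)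
moreover have "distr mu M (%x. x) = mu" using sets by(intro distr_id2) simp
moreover have "nn_integral mu (%om. ennreal (exp (- ln c))*ind B om) <= em M B" if "B:sets M" for B
proof -
 have "nn_integral mu (%om. ennreal (exp (- ln c))*ind B om) = ennreal (1/c)*em mu B"
  using that sets c by(subst nn_integral_cmult_indicator) (auto simp:exp_minus inverse_eq_divide)
 also have "... <= ennreal (1/c)*(ennreal c*em M B)" by(intro mult_left_mono le that) simp
 also have "... = em M B" using c by(simp add:mult.assoc[symmetric] ennreal_mult'[symmetric])
 finally show ?thesis .
qed
ultimately have "ennreal (exp ((\<integral>om. - ln c \<partial>mu)/K)) <= Uent K mu M"
 using Uent_ge[of mu "%x. x" K "%_. - ln c"] mu K by simp
thus ?thesis using c by(simp add:mu.prob_space powr_def ln_div)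
qed

text \<open>On \<open>S\<close> one has \<open>- ln rh <= 1/(c*rh) - 1 + ln c\<close>, and the
  integral of \<open>1/(c*rh)\<close> over \<open>S\<close> against \<open>mu\<close> is at most
  \<open>em M S / c <= 1\<close>. This is Jensen's inequality, sharp for uniform measures.\<close>

lemma (in sigma_finite_measure) Uent_le_of_concentrated:
assumes mu: "prob_space mu" and sets: "sets mu = sets M" and c: "c > 0" and K: "K > 0"
 and S[measurable]: "S:sets M" and Sc: "em M S <= ennreal c" and conc: "AE x in mu. x:S"
shows "Uent K mu M <= ennreal (c powr (1/K))"
proof (cases "absolutely_continuous M mu")
case False
hence "~ Uent K mu M > 0" using Uent_pos_ac by blast
thus ?thesis by simp
next
case True
interpret mu: prob_space mu by fact
obtain rh where rh[measurable]: "rh:bmeas M" and nn: "!!x. 0 <= rh x"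
 and den: "density M (%x. ennreal (rh x)) = mu" and pos: "AE x in mu. 0 < rh x"
 and Ent: "Ent mu M = (if (nn_integral mu (%x. ennreal (ln (rh x)))) < \<infinity>
   then enn2ereal (nn_integral mu (%x. ennreal (ln (rh x)))) - enn2ereal (nn_integral mu (%x. ennreal (- ln (rh x)))) else \<infinity>)"
 using Ent_cases[OF mu sets True] by auto
have [measurable]: "rh:bmeas mu" "S:sets mu"
 using rh S sets by(simp_all add:measurable_cong_sets[OF sets refl])
define P where "P = nn_integral mu (%x. ennreal (ln (rh x)))"
define Q where "Q = nn_integral mu (%x. ennreal (- ln (rh x)))"
have one: "nn_integral mu (%x. ennreal (ind S x/(c*rh x))) <= 1"
proof -
 have "nn_integral mu (%x. ennreal (ind S x/(c*rh x))) =
   nn_integral M (%x. ennreal (rh x)*ennreal (ind S x/(c*rh x)))"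
  by(subst den[symmetric], subst nn_integral_density) auto
 also have "... <= nn_integral M (%x. ennreal (1/c)*ind S x)"
 proof (intro nn_integral_mono)
  fix x
  have "rh x*(ind S x/(c*rh x)) <= 1/c*ind S x"
   using nn[of x] c by(cases "rh x = 0") (auto split:split_indicator)
  thus "ennreal (rh x)*ennreal (ind S x/(c*rh x)) <= ennreal (1/c)*ind S x"
   using nn[of x] c by(simp add:ennreal_mult'[symmetric] ennreal_indicator[symmetric] del:ennreal_indicator)
 qed
 also have "... = ennreal (1/c)*em M S" by(simp add:nn_integral_cmult_indicator)
 also have "... <= ennreal (1/c)*ennreal c" by(intro mult_left_mono Sc) simp
 also have "... = 1" using c by(simp add:ennreal_mult'[symmetric])
 finally show ?thesis .
qed
have i1: "integrable mu (%x. ind S x/(c*rh x))"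
 using nn c by(intro integrableI_nonneg) (auto simp:order_le_less_trans[OF one])
have ln_ge: "AE x in mu. - ln (rh x) <= ind S x/(c*rh x) - 1+ln c"
 using pos conc
proof eventually_elim
 case (elim x)
 have "ln (1/(c*rh x)) <= 1/(c*rh x) - 1" using elim c by(intro ln_le_minus_one) simp
 thus ?case using elim c by(simp add:ln_div ln_mult)
qed
have "Q <= nn_integral mu (%x. ennreal (ind S x/(c*rh x) + \<bar>ln c\<bar>))"
 unfolding Q_def by(intro nn_integral_mono_AE) (use ln_ge in eventually_elim, auto intro!:ennreal_leI)
also have "... < \<infinity>"
 using i1 nn c by(subst nn_integral_eq_integral) (auto intro!:integrable_add)
finally have Qfin: "Q < \<infinity>" .
show ?thesis
proof (cases "P = \<infinity>")
 case True
 thus ?thesis using Ent unfolding P_def[symmetric] by(simp add:Uent_def)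
next
 case False
 have i2: "integrable mu (%x. ln (rh x))"
  unfolding real_integrable_def using P_def Q_def Qfin False by auto
 have "Ent mu M = ereal (enn2real P - enn2real Q)"
  using Ent Qfin False unfolding P_def[symmetric] Q_def[symmetric] by(cases P; cases Q) (auto simp:less_top)
 also have "enn2real P - enn2real Q = (\<integral>x. ln (rh x) \<partial>mu)"
  using real_lebesgue_integral_def[OF i2] by(simp add:P_def Q_def)
 finally have E: "Ent mu M = ereal (\<integral>x. ln (rh x) \<partial>mu)" .
 have "(\<integral>x. - ln (rh x) \<partial>mu) <= (\<integral>x. ind S x/(c*rh x) - 1+ln c \<partial>mu)"
  using i1 i2 ln_ge by(intro integral_mono_AE) auto
 also have "... = (\<integral>x. ind S x/(c*rh x) \<partial>mu) - 1+ln c"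
  using i1 by(simp add:mu.prob_space)
 also have "(\<integral>x. ind S x/(c*rh x) \<partial>mu) <= 1"
 proof -
  have "ennreal (\<integral>x. ind S x/(c*rh x) \<partial>mu) <= 1"
   using one nn c i1 by(subst nn_integral_eq_integral[symmetric]) auto
  thus ?thesis by simp
 qed
 finally have "- (\<integral>x. ln (rh x) \<partial>mu) <= ln c" by simp
 hence "- (\<integral>x. ln (rh x) \<partial>mu)/K <= ln c/K" using K by(intro divide_right_mono) auto
 hence "exp (- (\<integral>x. ln (rh x) \<partial>mu)/K) <= c powr (1/K)" using c by(simp add:powr_def)
 thus ?thesis by(simp add:Uent_def E ennreal_leI)
qed
qed

section \<open>Comparing measures on intervals\<close>

text \<open>The end-points are running minima and maxima of an enumeration of the rationals in
  \<open>C\<close> together with the least and the greatest element of \<open>C\<close>, if they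
  exist; this treats open, closed and unbounded intervals at once.\<close>

lemma interval_exhaustion:
fixes C :: "real set"
assumes C: "is_interval C" "C ~= {}"
shows "EX a b. decseq a & incseq b & (ALL i. a i:C) & (ALL i. b i:C) & (ALL i. a i <= b i) &
 C = (\<Union>i::nat. {a i..b i})"
proof -
have mem: "x:C" if "u:C" "v:C" "u <= x" "x <= v" for u v x
 using mem_is_interval_1_I[OF C(1) that] .
define D where "D = C Int (Rats Un {x:C. ALL y:C. x <= y} Un {x:C. ALL y:C. y <= x})"
have "finite {x:C. ALL y:C. x <= y}"
proof (cases "EX p:C. ALL y:C. p <= y")
 case True
 then obtain p where "p:C" "ALL y:C. p <= y" by blast
 hence "{x:C. ALL y:C. x <= y} <= {p}" by(blast intro:antisym)
 thus ?thesis by(rule finite_subset) simp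
next
 case False
 hence "{x:C. ALL y:C. x <= y} = {}" by blast
 thus ?thesis by(metis finite.emptyI)
qed
moreover have "finite {x:C. ALL y:C. y <= x}"
proof (cases "EX p:C. ALL y:C. y <= p")
 case True
 then obtain p where "p:C" "ALL y:C. y <= p" by blast
 hence "{x:C. ALL y:C. y <= x} <= {p}" by(blast intro:antisym)
 thus ?thesis by(rule finite_subset) simp
next
 case False
 hence "{x:C. ALL y:C. y <= x} = {}" by blast
 thus ?thesis by(metis finite.emptyI)
qed
ultimately have cD: "countable D"
 unfolding D_def by(intro countable_Int2 countable_Un) (auto intro:countable_rat countable_finite)
have lower: "EX d:D. d <= x" if x: "x:C" for x
proof (cases "ALL y:C. x <= y")
 case True thus ?thesis using x by(auto simp:D_def)
next
 case False
 then obtain y where y: "y:C" "y < x" by auto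
 obtain q where "q:Rats" "y < q" "q < x" using Rats_dense_in_real[OF y(2)] by auto
 thus ?thesis using mem[OF y(1) x, of q] by(auto simp:D_def intro!:bexI[of _ q])
qed
have upper: "EX d:D. x <= d" if x: "x:C" for x
proof (cases "ALL y:C. y <= x")
 case True thus ?thesis using x by(auto simp:D_def)
next
 case False
 then obtain y where y: "y:C" "x < y" by auto
 obtain q where "q:Rats" "x < q" "q < y" using Rats_dense_in_real[OF y(2)] by auto
 thus ?thesis using mem[OF x y(1), of q] by(auto simp:D_def intro!:bexI[of _ q])
qed
have ne: "D ~= {}" using lower C(2) by auto
define e where "e = from_nat_into D"
have e: "range e = D" unfolding e_def using ne cD by(rule range_from_nat_into)
define a where "a i = Min (e ` {..i})" for i
define b where "b i = Max (e ` {..i})" for i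
have fin: "finite (e ` {..i})" "e ` {..i} ~= {}" for i by auto
have ab: "a i:D" "b i:D" "a i <= b i" for i
 using Min_in[OF fin, of i] Max_in[OF fin, of i] e Min_le[OF fin(1) Max_in[OF fin], of i]
 unfolding a_def b_def by blast+
show ?thesis
proof (intro exI conjI allI)
 show "decseq a" unfolding decseq_def a_def by(auto intro!:Min_antimono)
 show "incseq b" unfolding incseq_def b_def by(auto intro!:Max_mono)
 show "a i:C" "b i:C" "a i <= b i" for i using ab[of i] by(auto simp:D_def)
 show "C = (\<Union>i. {a i..b i})"
 proof (intro subset_antisym subsetI)
  fix x assume x: "x:C"
  obtain i j where ij: "e i <= x" "x <= e j" using lower[OF x] upper[OF x] e by(metis rangeE)
  have "a (max i j) <= e i" unfolding a_def by(intro Min_le) auto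
  moreover have "e j <= b (max i j)" unfolding b_def by(intro Max_ge) auto
  ultimately show "x:(\<Union>i. {a i..b i})" using ij by(intro UN_I[of "max i j"]) auto
 qed (use ab in "auto simp:D_def intro:mem")
qed
qed

lemma interval_borel [measurable]:
fixes C :: "real set"
assumes "is_interval C"
shows "C:sets borel"
proof (cases "C = {}")
case False
obtain a b where "C = (\<Union>i::nat. {a i..b i})" using interval_exhaustion[OF assms False] by blast
thus ?thesis by auto
qed simp

lemma emeasure_interval_le:
fixes C :: "real set"
assumes M: "sets M = sets borel" and C: "is_interval C"
 and le: "!!a b. a:C ==> b:C ==> a <= b ==> em M {a..b} <= X"
shows "em M C <= X"
proof (cases "C = {}")
case False
obtain a b where ab: "decseq a" "incseq b" "ALL i. a i:C" "ALL i. b i:C" "ALL i. a i <= b i"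
 "C = (\<Union>i::nat. {a i..b i})" using interval_exhaustion[OF C False] by blast
have "{a i..b i} <= {a (Suc i)..b (Suc i)}" for i
 using decseq_SucD[OF ab(1), of i] incseq_SucD[OF ab(2), of i] by simp
hence "incseq (%i. {a i..b i})" by(rule incseq_SucI)
hence "(SUP i. em M {a i..b i}) = em M (\<Union>i. {a i..b i})"
 by(intro SUP_emeasure_incseq) (simp_all add:M image_subset_iff)
hence "(SUP i. em M {a i..b i}) = em M C" by(simp only: ab(6)[symmetric])
moreover have "(SUP i. em M {a i..b i}) <= X"
 by(intro SUP_least le) (use ab in blast)+
ultimately show ?thesis by simp
qed simp

text \<open>Compact intervals exhaust all intervals, an open set is the disjoint union of countably
  many open intervals, and outer regularity of the finite measure \<open>M2\<close> leads to Borel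
  sets.\<close>

lemma finite_measure_le_of_intervals:
fixes M1 M2 :: "real measure"
assumes sets: "sets M1 = sets borel" "sets M2 = sets borel" and fin: "em M2 UNIV ~= \<infinity>"
 and le: "!!a b. a <= b ==> em M1 {a..b} <= em M2 {a..b}"
 and B: "B:sets borel"
shows "em M1 B <= em M2 B"
proof -
have interval: "em M1 C <= em M2 C" if C: "is_interval C" for C
proof (rule emeasure_interval_le[OF sets(1) C])
 fix a b assume ab: "a:C" "b:C" "a <= b"
 have "{a..b} <= C" using mem_is_interval_1_I[OF C ab(1,2)] by auto
 hence "em M2 {a..b} <= em M2 C" using interval_borel[OF C] sets(2) by(intro emeasure_mono) auto
 thus "em M1 {a..b} <= em M2 C" using le[OF ab(3)] by(rule order_trans[rotated])
qed
have op: "em M1 U <= em M2 U" if U: "open U" for U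
proof -
 have ci: "is_interval c" "open c" if "c:components U" for c
  using that in_components_connected is_interval_connected_1 open_components[OF U] by blast+
 have cc: "countable (components U)"
  by(rule countable_disjoint_open_subsets)
   (use ci(2) pairwise_disjoint_components[of U] in "auto simp:pairwise_def disjnt_def")
 have disj: "disjoint_family_on (%c. c) (components U)"
  using pairwise_disjoint_components[of U] by(auto simp:disjoint_family_on_def pairwise_def disjnt_def)
 have "em M U = nn_integral (count_space (components U)) (%c. em M c)" if "sets M = sets borel" for M :: "real measure"
  using emeasure_UN_countable[of "components U" "%c. c" M] ci cc disj that Union_components[of U] by auto
 thus ?thesis using sets interval ci by(auto intro!:nn_integral_mono)
qed
have "em M2 B = (INF U \<in> {U. B <= U & open U}. em M2 U)"
 using fin sets(2) B by(intro outer_regular) (auto simp:space_borel dest:sets_eq_imp_space_eq)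
also have "em M1 B <= ..."
proof (rule INF_greatest)
 fix U assume U: "U:{U. B <= U & open U}"
 hence "em M1 B <= em M1 U" using sets(1) by(intro emeasure_mono) auto
 thus "em M1 B <= em M2 U" using op U by(auto intro:order_trans)
qed
finally show ?thesis .
qed

text \<open>The local form: \<open>M2\<close> may have infinite mass near the ends of
  \<open>S\<close>, as happens on unbounded rays. The comparison is made on compact subintervals
  that exhaust \<open>S\<close>.\<close>

lemma emeasure_le_of_intervals:
fixes M1 M2 :: "real measure"
assumes sets: "sets M1 = sets borel" "sets M2 = sets borel" and S: "is_interval S"
 and fin: "!!a b. a:S ==> b:S ==> em M2 {a..b} ~= \<infinity>"
 and le: "!!a b. a:S ==> b:S ==> a <= b ==> em M1 {a..b} <= em M2 {a..b}"
 and B: "B:sets borel" "B <= S"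
shows "em M1 B <= em M2 B"
proof (cases "S = {}")
case False
obtain a b where ab: "decseq a" "incseq b" "ALL i. a i:S" "ALL i. b i:S" "ALL i. a i <= b i"
 "S = (\<Union>i::nat. {a i..b i})" using interval_exhaustion[OF S False] by blast
have [measurable]: "B:sets M1" "B:sets M2" "!!c d. {c..d}:sets M1" "!!c d. {c..d}:sets M2"
 using B sets by auto
have part: "em M1 (B Int {a i..b i}) <= em M2 (B Int {a i..b i})" for i
proof -
 let ?N1 = "density M1 (ind {a i..b i})" and ?N2 = "density M2 (ind {a i..b i})"
 have e: "em ?N1 X = em M1 (X Int {a i..b i})" "em ?N2 X = em M2 (X Int {a i..b i})"
  if "X:sets borel" for X
 proof -
  have [measurable]: "X:sets M1" "X:sets M2" using that sets by auto
  show "em ?N1 X = em M1 (X Int {a i..b i})"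
   by(subst emeasure_density) (simp_all add:Int_commute flip: indicator_inter_arith)
  show "em ?N2 X = em M2 (X Int {a i..b i})"
   by(subst emeasure_density) (simp_all add:Int_commute flip: indicator_inter_arith)
 qed
 have "em ?N1 B <= em ?N2 B"
 proof (rule finite_measure_le_of_intervals)
  show "sets ?N1 = sets borel" "sets ?N2 = sets borel" using sets by auto
  show "em ?N2 UNIV ~= \<infinity>" using e(2)[of UNIV] fin[of "a i" "b i"] ab(3,4) by simp
  fix c d :: real assume "c <= d"
  have i: "{c..d} Int {a i..b i} = {max c (a i)..min d (b i)}" by auto
  have "em M1 {max c (a i)..min d (b i)} <= em M2 {max c (a i)..min d (b i)}"
  proof (cases "max c (a i) <= min d (b i)")
   case True
   hence "max c (a i):S" "min d (b i):S"
    using mem_is_interval_1_I[OF S ab(3)[rule_format, of i] ab(4)[rule_format, of i]] by auto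
   thus ?thesis using le True by blast
  qed simp
  thus "em ?N1 {c..d} <= em ?N2 {c..d}" using e i by simp
 qed (rule B(1))
 thus ?thesis using e[OF B(1)] by simp
qed
have "{a i..b i} <= {a (Suc i)..b (Suc i)}" for i
 using decseq_SucD[OF ab(1)] incseq_SucD[OF ab(2)] by simp
hence inc: "incseq (%i. B Int {a i..b i})"
 by(intro incseq_SucI) blast
have U: "(\<Union>i. B Int {a i..b i}) = B" using ab(6) B(2) by auto
have "em M1 B = (SUP i. em M1 (B Int {a i..b i}))"
 using SUP_emeasure_incseq[of "%i. B Int {a i..b i}" M1] inc U by(auto simp:image_subset_iff)
also have "... <= (SUP i. em M2 (B Int {a i..b i}))" by(intro SUP_mono) (use part in blast)
also have "... = em M2 B"
 using SUP_emeasure_incseq[of "%i. B Int {a i..b i}" M2] inc U by(auto simp:image_subset_iff)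
finally show ?thesis .
qed (use B in auto)

section \<open>Brunn--Minkowski inequalities on the line\<close>

lemma powr_mean_le:
fixes a b :: real
assumes p: "p >= 1" and ab: "a >= 0" "b >= 0" and th: "0 < th" "th < 1"
shows "(th*a+(1 - th)*b) powr p <= th*a powr p+(1 - th)*b powr p"
proof -
consider "a = 0" | "b = 0" | "0 < a" "0 < b" using ab by linarith
thus ?thesis
proof cases
 case 1
 have "(1 - th) powr p <= (1 - th) powr 1" using p th by(intro powr_mono') auto
 thus ?thesis using 1 th ab by(simp add:powr_mult mult_right_mono)
next
 case 2
 have "th powr p <= th powr 1" using p th by(intro powr_mono') auto
 thus ?thesis using 2 th ab by(simp add:powr_mult mult_right_mono)
next
 case 3
 have "convex_on {0<..} (%x::real. x powr p)" using p by(rule powr_convex)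
 from convex_onD[OF this, of "1 - th" a b] show ?thesis using 3 th by simp
qed
qed

text \<open>The pointwise form of Minkowski's inequality in \<open>L\<^sup>n\<close>: it becomes an equality after
integration when \<open>th\<close> is proportional to the norm of the first summand.\<close>

lemma powr_add_le_weighted:
fixes a b :: real
assumes n: "n >= 1" and ab: "a >= 0" "b >= 0" and A: "A > 0" and B: "B > 0"
shows "(a+b) powr n <= (A+B) powr (n - 1)*(a powr n*A powr (1 - n)+b powr n*B powr (1 - n))"
proof -
let ?th = "A/(A+B)"
have th: "0 < ?th" "?th < 1" "1 - ?th = B/(A+B)" using A B by(auto simp:field_simps)
have "(a+b) powr n = (?th*(a*(A+B)/A)+(1 - ?th)*(b*(A+B)/B)) powr n"
proof -
 have "?th*(a*(A+B)/A) = a" "(1 - ?th)*(b*(A+B)/B) = b"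
  using A B unfolding th(3) by auto
 thus ?thesis by simp
qed
also have "... <= ?th*(a*(A+B)/A) powr n+(1 - ?th)*(b*(A+B)/B) powr n"
 using A B ab by(intro powr_mean_le n th) auto
also have "... = (A+B) powr (n - 1)*(a powr n*A powr (1 - n)+b powr n*B powr (1 - n))"
proof -
 have *: "x/(A+B)*(y*(A+B)/x) powr n = (A+B) powr (n - 1)*(y powr n*x powr (1 - n))"
  if "x > 0" "y >= 0" for x y
 proof -
  have e: "(y*(A+B)/x) powr n = y powr n*(A+B) powr n/x powr n"
   using that A B by(simp add:powr_mult powr_divide)
  show ?thesis unfolding e using that A B by(simp add:powr_diff)
 qed
 show ?thesis unfolding th(3) using *[OF A ab(1)] *[OF B ab(2)] by(simp add:distrib_left)
qed
finally show ?thesis .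
qed

text \<open>The pointwise inequality is integrated with the bounds \<open>A\<close> and
  \<open>B\<close> of the two norms as weights. It requires positive weights; a vanishing bound
  means that the function is zero almost everywhere.\<close>

lemma minkowski_nn_integral:
fixes a b :: "'a => real"
assumes n: "n >= 1" and [measurable]: "a:bmeas M" "b:bmeas M"
 and nn: "!!x. a x >= 0" "!!x. b x >= 0" and AB: "A >= 0" "B >= 0"
 and a: "nn_integral M (%x. ennreal (a x powr n)) <= ennreal (A powr n)"
 and b: "nn_integral M (%x. ennreal (b x powr n)) <= ennreal (B powr n)"
shows "nn_integral M (%x. ennreal ((a x+b x) powr n)) <= ennreal ((A+B) powr n)"
proof -
consider "A = 0" | "B = 0" | "A > 0" "B > 0" using AB by linarith
thus ?thesis
proof cases
 case 1
 hence "nn_integral M (%x. ennreal (a x powr n)) = 0" using a by simp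
 hence "AE x in M. ennreal (a x powr n) = 0" by(subst (asm) nn_integral_0_iff_AE) auto
 hence "AE x in M. a x = 0" by eventually_elim (use nn in auto)
 hence "nn_integral M (%x. ennreal ((a x+b x) powr n)) = nn_integral M (%x. ennreal (b x powr n))"
  by(intro nn_integral_cong_AE) (auto elim!:eventually_mono)
 thus ?thesis using b 1 by simp
next
 case 2
 hence "nn_integral M (%x. ennreal (b x powr n)) = 0" using b by simp
 hence "AE x in M. ennreal (b x powr n) = 0" by(subst (asm) nn_integral_0_iff_AE) auto
 hence "AE x in M. b x = 0" by eventually_elim (use nn in auto)
 hence "nn_integral M (%x. ennreal ((a x+b x) powr n)) = nn_integral M (%x. ennreal (a x powr n))"
  by(intro nn_integral_cong_AE) (auto elim!:eventually_mono)
 thus ?thesis using a 2 by simp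
next
 case 3
 have *: "A powr n*A powr (1 - n) = A" "B powr n*B powr (1 - n) = B"
  "(A+B) powr (n - 1)*(A+B) = (A+B) powr n"
  using 3 by(simp_all add:powr_diff field_simps)
 have "nn_integral M (%x. ennreal ((a x+b x) powr n)) <=
   nn_integral M (%x. ennreal ((A+B) powr (n - 1)*A powr (1 - n))*ennreal (a x powr n) +
      ennreal ((A+B) powr (n - 1)*B powr (1 - n))*ennreal (b x powr n))"
  by(intro nn_integral_mono)
    (use powr_add_le_weighted[OF n nn 3] in \<open>auto simp:ennreal_mult'[symmetric] ennreal_plus[symmetric]
     algebra_simps simp del:ennreal_plus intro!:ennreal_leI\<close>)
 also have "... = ennreal ((A+B) powr (n - 1)*A powr (1 - n))*nn_integral M (%x. ennreal (a x powr n)) +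
      ennreal ((A+B) powr (n - 1)*B powr (1 - n))*nn_integral M (%x. ennreal (b x powr n))"
  by(simp add:nn_integral_add nn_integral_cmult)
 also have "... <= ennreal ((A+B) powr (n - 1)*A powr (1 - n))*ennreal (A powr n) +
      ennreal ((A+B) powr (n - 1)*B powr (1 - n))*ennreal (B powr n)"
  by(intro add_mono mult_left_mono a b) auto
 also have "... = ennreal ((A+B) powr (n - 1)*(A powr n*A powr (1 - n)+B powr n*B powr (1 - n)))"
  by(simp add:ennreal_mult'[symmetric] ennreal_plus[symmetric] algebra_simps del:ennreal_plus)
 also have "... = ennreal ((A+B) powr n)" using*by simp
 finally show ?thesis .
qed
qed

text \<open>Densities \<open>h = k\<^sup>n\<^sup>-\<^sup>1\<close> with \<open>k\<close> concave.  The intervals are parametrized by the fraction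
of their mass.\<close>

lemma concave_weight_local:
fixes k1 k2 L1 L2 t n :: real
assumes n: "n > 1" and k: "k1 > 0" "k2 > 0" and L: "L1 >= 0" "L2 >= 0" and t: "0 < t" "t < 1"
shows "((1-t)*L1 powr (1/n)+t*L2 powr (1/n)) powr n <=
  ((1-t)*k1+t*k2) powr (n - 1) *
   ((1-t)*L1/k1 powr (n - 1)+t*L2/k2 powr (n - 1))"
proof -
have *: "(s*L powr (1/n)) powr n*(s*k) powr (1 - n) = s*L/k powr (n - 1)"
 if "s > 0" "L >= 0" "k > 0" for s L k
 using that n by(simp add:powr_mult powr_powr powr_diff field_simps)
show ?thesis
 using powr_add_le_weighted[of n "(1-t)*L1 powr (1/n)" "t*L2 powr (1/n)" "(1-t)*k1" "t*k2"]
  *[of "1 - t" L1 k1] *[of t L2 k2] n k L t by simp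
qed

text \<open>A zero at an interior point \<open>x\<close> would lie strictly between \<open>p\<close>
  and a point \<open>y\<close> of \<open>S\<close> beyond \<open>x\<close>; concavity with
  \<open>k p > 0\<close> and \<open>k y >= 0\<close> makes \<open>k x\<close> positive.\<close>

lemma concave_pos_interior:
fixes k :: "real => real"
assumes k: "concave_on S k" "!!x. x:S ==> 0 <= k x" and p: "p:S" "0 < k p"
 and x: "x:interior S"
shows "0 < k x"
proof (rule ccontr)
assume "~ 0 < k x"
hence x0: "k x = 0" using k(2)[of x] interior_subset x by force
hence "x ~= p" using p by auto
obtain e where e: "e > 0" "ball x e <= S" using x by(meson mem_interior)
define y where "y = x+(e/2) * sgn (x - p)"
have y: "y:S" using e by(intro subsetD[OF e(2)]) (auto simp:y_def dist_real_def abs_mult sgn_if)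
define s where "s = \<bar>x - p\<bar> / (\<bar>x - p\<bar> + e/2)"
have s: "0 < s" "s < 1" using \<open>x ~= p\<close> e unfolding s_def by(auto intro!:divide_pos_pos simp:divide_less_eq_1 add_pos_nonneg)
have d: "\<bar>x - p\<bar> + e/2 > 0" using e by linarith
have eq: "x = (1 - s)*p+s*y"
proof -
 have "(1 - s)*p+s*y - x = (p - x)+s*(y - p)" by(simp add:algebra_simps)
 also have "y - p = sgn (x - p)*(\<bar>x - p\<bar> + e/2)"
  using \<open>x ~= p\<close> by(auto simp:y_def sgn_if algebra_simps)
 also have "s*(sgn (x - p)*(\<bar>x - p\<bar> + e/2)) = x - p"
  using d unfolding s_def by(simp add:sgn_if)
 finally show ?thesis by simp
qed
have "(1 - s)*k p+s*k y <= k ((1 - s) *\<^sub>R p+s *\<^sub>R y)"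
 using concave_onD[OF k(1), of s p y] s p(1) y by simp
hence "(1 - s)*k p+s*k y <= 0" using eq x0 by simp
moreover have "(1 - s)*k p > 0" "s*k y >= 0" using s p k(2)[OF y] by auto
ultimately show False by linarith
qed

section \<open>From concave densities to interpolation inequalities\<close>

locale concave_density =
fixes S :: "real set" and k :: "real => real" and n :: real
assumes n: "n > 1" and S: "is_interval S" and conc: "concave_on S k"
 and nonneg: "!!x. x:S ==> 0 <= k x" and pos: "EX p:S. 0 < k p"
begin

text \<open>Put to 0 outside the interior, since a concave \<open>k\<close> may jump at the ends of
  \<open>S\<close>; these form a Lebesgue null set.\<close>

definition h where "h x = (if x:interior S then k x powr (n - 1) else 0)"

lemma k_pos: "x:interior S ==> 0 < k x"
using concave_pos_interior[OF conc nonneg] pos by blast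

lemma k_cont: "continuous_on (interior S) k"
proof -
have "convex_on (interior S) (%x. - k x)"
 using conc unfolding concave_on_def
 by(rule convex_on_subset) (use S interior_subset is_interval_convex_1 convex_interior in auto)
hence "continuous_on (interior S) (%x. - k x)"
 using convex_on_continuous open_interior by blast
thus ?thesis using continuous_on_minus by fastforce
qed

lemma h_cont: "continuous_on (interior S) h"
unfolding h_def using k_cont k_pos
by(auto cong: continuous_on_cong_simp intro!:continuous_intros simp:less_imp_neq[symmetric])

lemma h_meas [measurable]: "h:bmeas borel"
proof -
have "(%x. if x:interior S then h x else 0):bmeas borel"
 using h_cont by(intro borel_measurable_continuous_on_if) auto
moreover have "(%x. if x:interior S then h x else 0) = h" by(auto simp:h_def)
ultimately show ?thesis by simp
qed

lemma h_nonneg: "0 <= h x" by(simp add:h_def)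

lemma between_mem: "x:S ==> y:S ==> x <= z ==> z <= y ==> z:S"
using mem_is_interval_1_I[OF S] .

lemma between_interior: "x:S ==> y:S ==> x < z ==> z < y ==> z:interior S"
by(rule interiorI[of "{x<..<y}"]) (auto intro:between_mem[of x y])

text \<open>Midpoint concavity for \<open>z\<close> and its mirror image \<open>x+y-z\<close>, whose
  value is non-negative. The bound makes \<open>h\<close> integrable up to the ends of
  \<open>S\<close> that belong to \<open>S\<close>.\<close>

lemma bounded_on_segment:
assumes x: "x:S" and y: "y:S" and z: "z:{x..y}"
shows "k z <= 2*k ((x+y)/2)"
proof -
have zS: "z:S" "x+y - z:S" using between_mem[OF x y] z by auto
have "(1 - 1/2)*k z+1/2*k (x+y - z) <= k ((1 - 1/2) *\<^sub>R z+(1/2) *\<^sub>R (x+y - z))"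
 using concave_onD[OF conc, of "1/2" z "x+y - z"] zS by simp
also have "(1 - 1/2) *\<^sub>R z+(1/2) *\<^sub>R (x+y - z) = (x+y)/2" by(simp add:field_simps)
finally show ?thesis using nonneg[OF zS(2)] by simp
qed

lemma h_integrable:
assumes x: "x:S" and y: "y:S"
shows "set_integrable lborel {x..y} h"
unfolding set_integrable_def
proof (rule integrableI_bounded_set_indicator[where B = "(2*k ((x+y)/2)) powr (n - 1)"])
show "AE z in lborel. z:{x..y} --> norm (h z) <= (2*k ((x+y)/2)) powr (n - 1)"
proof (intro AE_I2 impI)
 fix z assume "z:{x..y}"
 thus "norm (h z) <= (2*k ((x+y)/2)) powr (n - 1)"
  using bounded_on_segment[OF x y, of z] n k_pos[of z]
  by(auto simp:h_def intro!:powr_mono2)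
qed
qed (auto simp:emeasure_lborel_Icc_eq)

lemma h_integrable_on:
assumes "x:S" "y:S"
shows "h integrable_on {x..y}"
using h_integrable[OF assms] by(rule set_borel_integral_eq_integral(1))

definition mass where "mass x y = integral {x..y} h"

lemma mass_nonneg: "x:S ==> y:S ==> 0 <= mass x y"
unfolding mass_def using h_integrable_on h_nonneg by(intro integral_nonneg) auto

lemma emeasure_density_Icc:
assumes "x:S" "y:S"
shows "em (density lborel (%z. ennreal (h z))) {x..y} = ennreal (mass x y)"
proof -
have "em (density lborel (%z. ennreal (h z))) {x..y} = nn_integral lborel (%z. ennreal (ind {x..y} z*h z))"
 by(subst emeasure_density) (auto intro!:nn_integral_cong split:split_indicator)
also have "... = ennreal (\<integral>z. ind {x..y} z*h z \<partial>lborel)"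
 using h_integrable[OF assms] h_nonneg
 by(intro nn_integral_eq_integral) (auto simp:set_integrable_def)
also have "(\<integral>z. ind {x..y} z*h z \<partial>lborel) = mass x y"
 using set_borel_integral_eq_integral(2)[OF h_integrable[OF assms]]
 by(simp add:mass_def set_lebesgue_integral_def)
finally show ?thesis .
qed

lemma mass_continuous: "x:S ==> y:S ==> continuous_on {x..y} (mass x)"
unfolding mass_def by(intro indefinite_integral_continuous_1 h_integrable_on)

lemma mass_deriv:
assumes x: "x:S" and y: "y:S" and z: "z:{x<..<y}"
shows "(mass x has_real_derivative h z) (at z)"
proof -
have "z:interior S" using between_interior[OF x y] z by auto
hence "isCont h z" using h_cont by(simp add:continuous_on_eq_continuous_at)
hence "((%u. integral {x..u} h) has_vector_derivative h z) (at z within {x..y} - {})"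
 using z by(intro integral_has_vector_derivative_continuous_at h_integrable_on x y)
  (auto intro:continuous_at_imp_continuous_at_within)
moreover have "at z within {x..y} - {} = at z"
 using z at_within_Icc_at[of x z y] by simp
ultimately show ?thesis
 unfolding mass_def has_real_derivative_iff_has_vector_derivative by simp
qed

lemma mass_strict:
assumes x: "x:S" and y: "y:S" and uv: "x <= u" "u < v" "v <= y"
shows "mass x u < mass x v"
proof (rule DERIV_pos_imp_increasing_open[OF uv(2)])
show "EX d. (mass x has_real_derivative d) (at z) & 0 < d" if "u < z" "z < v" for z
proof (intro exI conjI)
 show "(mass x has_real_derivative h z) (at z)" using mass_deriv[OF x y] that uv by simp
 have "z:interior S" using between_interior[OF x y] that uv by simp
 thus "0 < h z" using k_pos[of z] by(auto simp:h_def)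
qed
show "continuous_on {u..v} (mass x)"
 using mass_continuous[OF x y] by(rule continuous_on_subset) (use uv in auto)
qed

lemma mass_self: "mass x x = 0" by(simp add:mass_def)

text \<open>\<open>X\<close> inverts the distribution function normalized to total mass 1, so that
  \<open>X s\<close> leaves the fraction \<open>s\<close> of the mass on its left. A one-point
  interval is parametrized by a constant.\<close>

lemma mass_param:
assumes x: "x:S" and y: "y:S" and xy: "x <= y"
obtains X X' where "X 0 = x" "X 1 = y" "continuous_on {0..1} X" "!!s. s:{0..1} ==> X s:{x..y}"
 "!!s. 0 < s ==> s < 1 ==> (X has_real_derivative X' s) (at s)"
 "!!s. 0 < s ==> s < 1 ==> x < y ==> X s:{x<..<y} & X' s = mass x y/h (X s)"
 "x = y ==> X' = (%_. 0)"
proof (cases "x = y")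
case True
show thesis by(rule that[of "%_. x" "%_. 0"]) (use True in auto)
next
case False
hence lt: "x < y" using xy by simp
define L where "L = mass x y"
have L: "L > 0" using mass_strict[OF x y order_refl lt order_refl] by(simp add:L_def mass_self)
define F where "F u = mass x u/L" for u
have Fc: "continuous_on {x..y} F" unfolding F_def using L by(intro continuous_intros mass_continuous x y) auto
have Fs: "F u < F v" if "x <= u" "u < v" "v <= y" for u v
 using mass_strict[OF x y that] L by(simp add:F_def divide_strict_right_mono)
have F01: "F x = 0" "F y = 1" using L by(simp_all add:F_def mass_self L_def)
have Fi: "inj_on F {x..y}"
proof (rule linorder_inj_onI)
 fix u v assume "u < v" "u:{x..y}" "v:{x..y}"
 thus "F u ~= F v" using Fs[of u v] by simp
qed auto
have Fim: "F ` {x..y} = {0..1}"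
proof
 show "F ` {x..y} <= {0..1}"
 proof (rule image_subsetI)
  fix u assume u: "u:{x..y}"
  have "F x <= F u" using Fs[of x u] u by(cases "x = u") auto
  moreover have "F u <= F y" using Fs[of u y] u by(cases "u = y") auto
  ultimately show "F u:{0..1}" using F01 by simp
 qed
 show "{0..1} <= F ` {x..y}"
 proof
  fix s :: real assume "s:{0..1}"
  then obtain u where "x <= u" "u <= y" "F u = s" using IVT'[of F x s y] Fc F01 lt by auto
  thus "s:F ` {x..y}" by auto
 qed
qed
define X where "X = the_inv_into {x..y} F"
have XF: "X (F u) = u" if "u:{x..y}" for u unfolding X_def using the_inv_into_f_f[OF Fi that] .
have FX: "F (X s) = s" "X s:{x..y}" if "s:{0..1}" for s
 using f_the_inv_into_f[OF Fi, of s] the_inv_into_into[OF Fi, of s, OF _ order_refl] that Fim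
 unfolding X_def by auto
have Xc: "continuous_on {0..1} X"
 using continuous_on_inv[OF Fc compact_Icc, of X] XF Fim by auto
have X01: "X 0 = x" "X 1 = y" using XF[of x] XF[of y] F01 lt by auto
have Xin: "X s:{x<..<y}" if "0 < s" "s < 1" for s
 using FX[of s] F01 that by(cases "X s = x \<or> X s = y") auto
have der: "(X has_real_derivative L/h (X s)) (at s)" if s: "0 < s" "s < 1" for s
proof -
 have "X s:interior S" using between_interior[OF x y] Xin[OF s] by auto
 hence hp: "h (X s) > 0" using k_pos[of "X s"] by(auto simp:h_def)
 have "(F has_real_derivative h (X s)/L) (at (X s))"
  unfolding F_def using mass_deriv[OF x y Xin[OF s]] by(rule DERIV_cdivide)
 moreover have "isCont X s" using continuous_on_interior[OF Xc, of s] s by simp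
 ultimately have "(X has_real_derivative inverse (h (X s)/L)) (at s)"
  using hp L s by(intro DERIV_inverse_function[where a = 0 and b = 1 and f = F]) (auto intro:FX(1))
 thus ?thesis by simp
qed
show thesis
 by(rule that[of X "%s. L/h (X s)"]) (use X01 Xc FX der Xin False in "auto simp:L_def")
qed

text \<open>Points with equal mass fractions are interpolated: \<open>Z s\<close> runs through the
  target interval, and the mass up to \<open>Z s\<close> grows at the rate \<open>h (Z s)\<close>
  times the speed of \<open>Z\<close>. By \<open>concave_weight_local\<close> and concavity of
  \<open>k\<close> this rate is at least the left-hand side, which does not depend on
  \<open>s\<close>.\<close>

theorem brunn_minkowski:
assumes x: "x1:S" "x2:S" "x1 <= x2" and y: "y1:S" "y2:S" "y1 <= y2" and t: "0 < t" "t < 1"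
shows "((1-t)*mass x1 x2 powr (1/n)+t*mass y1 y2 powr (1/n)) powr n <=
  mass ((1-t)*x1+t*y1) ((1-t)*x2+t*y2)"
proof -
let ?L1 = "mass x1 x2" and ?L2 = "mass y1 y2"
let ?c = "((1-t)*?L1 powr (1/n)+t*?L2 powr (1/n)) powr n"
let ?z1 = "(1-t)*x1+t*y1" and ?z2 = "(1-t)*x2+t*y2"
obtain X X' where X: "X 0 = x1" "X 1 = x2" "continuous_on {0..1} X" "!!s. s:{0..1} ==> X s:{x1..x2}"
 and XD: "!!s. 0 < s ==> s < 1 ==> (X has_real_derivative X' s) (at s)"
 and X1: "!!s. 0 < s ==> s < 1 ==> x1 < x2 ==> X s:{x1<..<x2} & X' s = ?L1/h (X s)"
 and X0: "x1 = x2 ==> X' = (%_. 0)" by(rule mass_param[OF x]) (rule that, assumption+)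
obtain Y Y' where Y: "Y 0 = y1" "Y 1 = y2" "continuous_on {0..1} Y" "!!s. s:{0..1} ==> Y s:{y1..y2}"
 and YD: "!!s. 0 < s ==> s < 1 ==> (Y has_real_derivative Y' s) (at s)"
 and Y1: "!!s. 0 < s ==> s < 1 ==> y1 < y2 ==> Y s:{y1<..<y2} & Y' s = ?L2/h (Y s)"
 and Y0: "y1 = y2 ==> Y' = (%_. 0)" by(rule mass_param[OF y]) (rule that, assumption+)
define Z where "Z s = (1-t)*X s+t*Y s" for s
have zS: "?z1:S" "?z2:S"
 using convexD_alt[of S x1 y1 t] convexD_alt[of S x2 y2 t] x y t S by(auto simp:is_interval_convex_1)
have Zc: "continuous_on {0..1} Z" unfolding Z_def by(intro continuous_intros X Y)
have ZD: "(Z has_real_derivative (1-t)*X' s+t*Y' s) (at s)" if "0 < s" "s < 1" for s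
 unfolding Z_def by(auto intro!:derivative_eq_intros XD YD that)
have Zin: "Z s:{?z1..?z2}" if "s:{0..1}" for s
 using X(4)[OF that] Y(4)[OF that] t by(auto simp:Z_def intro!:add_mono mult_left_mono)
show ?thesis
proof (cases "x1 = x2 & y1 = y2")
 case True
 thus ?thesis using mass_nonneg[OF zS] n by(auto simp:mass_self)
next
 case False
 hence zlt: "?z1 < ?z2" using x y t
  by(cases "x1 = x2") (auto intro!:add_le_less_mono add_less_le_mono)
 have Zint: "Z s:{?z1<..<?z2}" if s: "0 < s" "s < 1" for s
 proof -
  have "x1 <= X s" "X s <= x2" "y1 <= Y s" "Y s <= y2" using X(4)[of s] Y(4)[of s] s by auto
  moreover have "x1 < X s & X s < x2 \<or> y1 < Y s & Y s < y2"
   using False X1[OF s] Y1[OF s] x y by(cases "x1 = x2") auto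
  ultimately consider "x1 < X s" "X s < x2" "y1 <= Y s" "Y s <= y2"
   | "x1 <= X s" "X s <= x2" "y1 < Y s" "Y s < y2" by blast
  thus ?thesis
  proof cases
   case 1
   thus ?thesis using t unfolding Z_def
    by(auto intro!:add_less_le_mono mult_strict_left_mono mult_left_mono)
  next
   case 2
   thus ?thesis using t unfolding Z_def
    by(auto intro!:add_le_less_mono mult_strict_left_mono mult_left_mono)
  qed
 qed
 have key: "?c <= h (Z s)*((1-t)*X' s+t*Y' s)" if s: "0 < s" "s < 1" for s
 proof -
  have ZI: "Z s:interior S" using between_interior[OF zS] Zint[OF s] by auto
  have XS: "X s:S" using X(4)[of s] between_mem[OF x(1,2)] s by simp
  have YS: "Y s:S" using Y(4)[of s] between_mem[OF y(1,2)] s by simp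
  have kZ: "(1-t)*k (X s)+t*k (Y s) <= k (Z s)"
   using concave_onD[OF conc, of t "X s" "Y s"] t XS YS by(simp add:Z_def)
  consider "x1 < x2" "y1 < y2" | "x1 = x2" "y1 < y2" | "x1 < x2" "y1 = y2" using False x y by linarith
  thus ?thesis
  proof cases
   case 1
   have XI: "X s:interior S" using X1[OF s 1(1)] between_interior[OF x(1,2)] by auto
   have YI: "Y s:interior S" using Y1[OF s 1(2)] between_interior[OF y(1,2)] by auto
   have "?c <= ((1-t)*k (X s)+t*k (Y s)) powr (n - 1) *
     ((1-t)*?L1/k (X s) powr (n - 1)+t*?L2/k (Y s) powr (n - 1))"
    by(intro concave_weight_local n k_pos XI YI mass_nonneg x y t)
   also have "... <= k (Z s) powr (n - 1) *
     ((1-t)*?L1/k (X s) powr (n - 1)+t*?L2/k (Y s) powr (n - 1))"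
    using kZ n t k_pos[OF XI] k_pos[OF YI] mass_nonneg[OF x(1,2)] mass_nonneg[OF y(1,2)]
    by(intro mult_right_mono powr_mono2 add_nonneg_nonneg divide_nonneg_nonneg) auto
   also have "... = h (Z s)*((1-t)*X' s+t*Y' s)"
    using X1[OF s 1(1)] Y1[OF s 1(2)] XI YI ZI by(simp add:h_def)
   finally show ?thesis .
  next
   \<comment> \<open>One interval is a point and contributes neither mass nor speed; what remains of
     concavity is \<open>t*k (Y s) <= k (Z s)\<close>.\<close>
   case 2
   have YI: "Y s:interior S" using Y1[OF s 2(2)] between_interior[OF y(1,2)] by auto
   have ky: "0 < k (Y s)" using k_pos[OF YI] .
   have "t*k (Y s) <= k (Z s)" using kZ nonneg[OF XS] t
    by(smt (verit) mult_nonneg_nonneg)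
   hence "(t*k (Y s)) powr (n - 1)*(t*?L2/k (Y s) powr (n - 1)) <=
     k (Z s) powr (n - 1)*(t*?L2/k (Y s) powr (n - 1))"
    using ky t n mass_nonneg[OF y(1,2)] by(intro mult_right_mono powr_mono2) auto
   moreover have "(t*k (Y s)) powr (n - 1)*(t*?L2/k (Y s) powr (n - 1)) = t powr n*?L2"
    using ky t by(simp add:powr_mult powr_diff)
   moreover have "?c = t powr n*?L2"
    using 2 n t mass_nonneg[OF y(1,2)] by(simp add:mass_self powr_mult powr_powr)
   moreover have "h (Z s)*((1-t)*X' s+t*Y' s) = k (Z s) powr (n - 1)*(t*?L2/k (Y s) powr (n - 1))"
    using X0 2 Y1[OF s 2(2)] YI ZI by(simp add:h_def)
   ultimately show ?thesis by simp
  next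
   case 3
   have XI: "X s:interior S" using X1[OF s 3(1)] between_interior[OF x(1,2)] by auto
   have kx: "0 < k (X s)" using k_pos[OF XI] .
   have "(1-t)*k (X s) <= k (Z s)" using kZ nonneg[OF YS] t
    by(smt (verit) mult_nonneg_nonneg)
   hence "((1-t)*k (X s)) powr (n - 1)*((1-t)*?L1/k (X s) powr (n - 1)) <=
     k (Z s) powr (n - 1)*((1-t)*?L1/k (X s) powr (n - 1))"
    using kx t n mass_nonneg[OF x(1,2)] by(intro mult_right_mono powr_mono2) auto
   moreover have "((1-t)*k (X s)) powr (n - 1)*((1-t)*?L1/k (X s) powr (n - 1)) = (1-t) powr n*?L1"
    using kx t by(simp add:powr_mult powr_diff)
   moreover have "?c = (1-t) powr n*?L1"
    using 3 n t mass_nonneg[OF x(1,2)] by(simp add:mass_self powr_mult powr_powr)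
   moreover have "h (Z s)*((1-t)*X' s+t*Y' s) = k (Z s) powr (n - 1)*((1-t)*?L1/k (X s) powr (n - 1))"
    using Y0 3 X1[OF s 3(1)] XI ZI by(simp add:h_def)
   ultimately show ?thesis by simp
  qed
 qed
 have "mass ?z1 (Z 0) - ?c*0 <= mass ?z1 (Z 1) - ?c*1"
 proof (rule DERIV_nonneg_imp_increasing_open[where f = "%s. mass ?z1 (Z s) - ?c * s"])
  show "EX d. ((%s. mass ?z1 (Z s) - ?c * s) has_real_derivative d) (at s) & 0 <= d"
   if s: "0 < s" "s < 1" for s
  proof (intro exI conjI)
   show "((%s. mass ?z1 (Z s) - ?c * s) has_real_derivative
     h (Z s)*((1-t)*X' s+t*Y' s) - ?c) (at s)"
    by(auto intro!:derivative_eq_intros DERIV_chain2[OF mass_deriv[OF zS Zint[OF s]] ZD[OF s]])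
   show "0 <= h (Z s)*((1-t)*X' s+t*Y' s) - ?c" using key[OF s] by simp
  qed
  show "continuous_on {0..1} (%s. mass ?z1 (Z s) - ?c * s)"
   by(intro continuous_intros continuous_on_compose2[OF mass_continuous[OF zS] Zc]) (use Zin in auto)
 qed simp
 thus ?thesis using X Y by(simp add:Z_def mass_self)
qed
qed

text \<open>The weights are \<open>n\<close>-th powers. On an interval of parameters, Minkowski's
  inequality in \<open>L^n\<close> bounds the mass of the interpolated weight by the left-hand side
  of the Brunn--Minkowski inequality, hence by the mass between the interpolated end-points. As the
  interpolation is monotone, preimages of intervals are intervals of parameters, and the comparison
  extends to Borel sets.\<close>

theorem push_forward_le:
fixes x y a b :: "real => real"
assumes t: "0 < t" "t < 1"
 and mono: "!!u v. 0 < u ==> u <= v ==> v < 1 ==> x u <= x v" "!!u v. 0 < u ==> u <= v ==> v < 1 ==> y u <= y v"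
 and mem: "!!u. 0 < u ==> u < 1 ==> x u:S" "!!u. 0 < u ==> u < 1 ==> y u:S"
 and meas [measurable]: "x:bmeas borel" "y:bmeas borel"
  "a:bmeas borel" "b:bmeas borel"
 and nn: "!!u. 0 <= a u" "!!u. 0 <= b u"
 and hx: "!!c d. c:S ==> d:S ==> nn_integral lborel (%u. ennreal (a u powr n)*ind {0<..<1} u*ind {c..d} (x u))
   <= em (density lborel (%z. ennreal (h z))) {c..d}"
 and hy: "!!c d. c:S ==> d:S ==> nn_integral lborel (%u. ennreal (b u powr n)*ind {0<..<1} u*ind {c..d} (y u))
   <= em (density lborel (%z. ennreal (h z))) {c..d}"
 and B: "B:sets borel"
shows "nn_integral lborel (%u. ennreal (((1-t)*a u+t*b u) powr n)*ind {0<..<1} u *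
   ind B ((1-t)*x u+t*y u)) <= em (density lborel (%z. ennreal (h z))) B"
proof -
let ?La = "density lborel (%z. ennreal (h z))"
define z where "z u = (1-t)*x u+t*y u" for u
define w where "w u = ((1-t)*a u+t*b u) powr n" for u
have [measurable]: "z:bmeas borel" "w:bmeas borel"
 unfolding z_def w_def by measurable
define ka where "ka = density lborel (%u. ennreal (w u)*ind {0<..<1} u)"
define M1 where "M1 = distr ka borel z"
have sk: "sets ka = sets borel" and sM: "sets M1 = sets borel" "sets ?La = sets borel"
 by(simp_all add:ka_def M1_def)
have em: "em ka X = nn_integral lborel (%u. ennreal (w u)*ind {0<..<1} u*ind X u)"
 if [measurable]: "X:sets borel" for X
proof -
 have "(%u. ennreal (w u)):bmeas lborel" by measurable
 moreover have "(ind {0<..<1::real} :: real => ennreal):bmeas lborel"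
  by(rule borel_measurable_indicator) simp
 ultimately have "(%u. ennreal (w u)*ind {0<..<1} u):bmeas lborel"
  by(rule borel_measurable_times_ennreal)
 thus ?thesis unfolding ka_def by(subst emeasure_density) auto
qed
have eM: "em M1 X = nn_integral lborel (%u. ennreal (w u)*ind {0<..<1} u*ind X (z u))"
 if X [measurable]: "X:sets borel" for X
proof -
 have "em M1 X = em ka (z -` X)"
  unfolding M1_def by(subst emeasure_distr) (auto simp:ka_def)
 also have "... = nn_integral lborel (%u. ennreal (w u)*ind {0<..<1} u*ind X (z u))"
  by(subst em) (auto simp:measurable_sets_borel[OF _ X] intro!:nn_integral_cong split:split_indicator)
 finally show ?thesis .
qed
have zmono: "z u <= z v" if "0 < u" "u <= v" "v < 1" for u v
 unfolding z_def using mono(1)[OF that] mono(2)[OF that] t by(intro add_mono mult_left_mono) auto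
have seg: "em ka {v1..v2} <= em ?La {z v1..z v2}" if v: "0 < v1" "v1 <= v2" "v2 < 1" for v1 v2
proof -
 have xS: "x v1:S" "x v2:S" "x v1 <= x v2" and yS: "y v1:S" "y v2:S" "y v1 <= y v2"
  using mem mono v by auto
 let ?V = "density lborel (ind {v1..v2})"
 have part: "nn_integral ?V (%u. ennreal ((s*f u) powr n)) <= ennreal ((s*mass (g v1) (g v2) powr (1/n)) powr n)"
  if s: "0 < s" and [measurable]: "f:bmeas borel" "g:bmeas borel"
   and f: "!!u. 0 <= f u" and g: "g v1:S" "g v2:S"
   "!!u v. 0 < u ==> u <= v ==> v < 1 ==> g u <= g v"
   and hg: "!!c d. c:S ==> d:S ==> nn_integral lborel (%u. ennreal (f u powr n)*ind {0<..<1} u*ind {c..d} (g u))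
    <= em ?La {c..d}" for s f g
 proof -
  have "nn_integral ?V (%u. ennreal ((s*f u) powr n)) = nn_integral lborel (%u. ennreal (s powr n)*(ennreal (f u powr n)*ind {v1..v2} u))"
   using s f by(subst nn_integral_density)
    (auto intro!:nn_integral_cong simp:powr_mult ennreal_mult' split:split_indicator)
  also have "... = ennreal (s powr n)*nn_integral lborel (%u. ennreal (f u powr n)*ind {v1..v2} u)"
   by(rule nn_integral_cmult) measurable
  also have "nn_integral lborel (%u. ennreal (f u powr n)*ind {v1..v2} u) <=
    nn_integral lborel (%u. ennreal (f u powr n)*ind {0<..<1} u*ind {g v1..g v2} (g u))"
   using v g(3) by(intro nn_integral_mono) (auto split:split_indicator)
  also have "... <= ennreal (mass (g v1) (g v2))" using hg[OF g(1,2)] emeasure_density_Icc[OF g(1,2)] by simp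
  finally show ?thesis
   using s n mass_nonneg[OF g(1,2)]
   by(simp add:mult_left_mono powr_mult powr_powr ennreal_mult')
 qed
 have "em ka {v1..v2} = nn_integral ?V (%u. ennreal (((1-t)*a u+t*b u) powr n))"
  using v by(subst em, simp, subst nn_integral_density)
   (auto intro!:nn_integral_cong simp:w_def split:split_indicator)
 also have "... <= ennreal (((1-t)*mass (x v1) (x v2) powr (1/n)+t*mass (y v1) (y v2) powr (1/n)) powr n)"
  using t n nn mass_nonneg[OF xS(1,2)] mass_nonneg[OF yS(1,2)]
  by(intro minkowski_nn_integral part[OF _ _ _ _ xS(1,2) mono(1) hx] part[OF _ _ _ _ yS(1,2) mono(2) hy]) auto
 also have "... <= ennreal (mass (z v1) (z v2))"
  unfolding z_def by(intro ennreal_leI brunn_minkowski xS yS t)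
 also have "... = em ?La {z v1..z v2}"
 proof (rule emeasure_density_Icc[symmetric])
  show "z v1:S" "z v2:S" unfolding z_def
   using convexD_alt[of S "x v1" "y v1" t] convexD_alt[of S "x v2" "y v2" t] xS yS t S
   by(auto simp:is_interval_convex_1)
 qed
 finally show ?thesis .
qed
have "em M1 (B Int S) <= em ?La (B Int S)"
proof (rule emeasure_le_of_intervals[OF sM S])
 show "em ?La {c..d} ~= \<infinity>" if "c:S" "d:S" for c d
  using emeasure_density_Icc[OF that] by simp
 show "B Int S:sets borel" using B interval_borel[OF S] by auto
 fix c d assume cd: "c:S" "d:S" "c <= d"
 define E where "E = {u. 0 < u & u < 1 & c <= z u & z u <= d}"
 have "is_interval E" unfolding is_interval_1
 proof (intro ballI allI impI)
  fix u v r assume "u:E" "v:E" "u <= r & r <= v"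
  thus "r:E" using zmono[of u r] zmono[of r v] by(auto simp:E_def)
 qed
 have "em M1 {c..d} = em ka E"
  using interval_borel[OF \<open>is_interval E\<close>]
  by(subst eM, simp, subst em, simp) (auto intro!:nn_integral_cong simp:E_def split:split_indicator)
 also have "... <= em ?La {c..d}"
 proof (rule emeasure_interval_le[OF sk \<open>is_interval E\<close>])
  fix v1 v2 assume v: "v1:E" "v2:E" "v1 <= v2"
  hence "em ka {v1..v2} <= em ?La {z v1..z v2}" by(intro seg) (auto simp:E_def)
  also have "... <= em ?La {c..d}" using v by(intro emeasure_mono) (auto simp:E_def)
  finally show "em ka {v1..v2} <= em ?La {c..d}" .
 qed
 finally show "em M1 {c..d} <= em ?La {c..d}" .
qed simp
moreover have "em M1 (B Int S) = em M1 B"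
proof -
 have "z u:S" if "0 < u" "u < 1" for u
  using convexD_alt[of S "x u" "y u" t] mem[OF that] t S unfolding z_def by(auto simp:is_interval_convex_1)
 thus ?thesis using B interval_borel[OF S]
  by(simp add:eM) (auto intro!:nn_integral_cong split:split_indicator)
qed
moreover have "em ?La (B Int S) <= em ?La B"
 using B by(intro emeasure_mono) auto
ultimately show ?thesis using eM[OF B] by(simp add:z_def w_def)
qed

end

section \<open>From Brunn--Minkowski inequalities to a concave density\<close>

lemma dini_nondecreasing:
fixes f :: "real => real"
assumes ab: "a <= b" and cont: "continuous_on {a..b} f"
 and dini: "!!x et de. a <= x ==> x < b ==> et > 0 ==> de > 0 ==>
   EX y. x < y & y < x+de & y <= b & f y - f x > - et*(y - x)"
shows "f a <= f b"
proof (rule ccontr)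
assume n: "~ f a <= f b"
hence lt: "a < b" using ab by(cases "a = b") auto
\<comment> \<open>Half the mean rate of descent: the tilted function \<open>g\<close> still drops
  from \<open>a\<close> to \<open>b\<close>, but after the last point where it is at least
  \<open>v\<close> the hypothesis provides a later point where it is even larger.\<close>
define et where "et = (f a - f b)/(2*(b - a))"
have eta: "et > 0" using n lt by(simp add:et_def)
define g where "g x = f x+et*(x - a)" for x
define v where "v = (g a+g b)/2"
have "et*(b - a) = (f a - f b)/2" using lt by(simp add:et_def field_simps)
hence gab: "g b < v" "v < g a" using n by(simp_all add:g_def v_def field_simps)
have gc: "continuous_on {a..b} g" unfolding g_def by(intro continuous_intros cont)
define C where "C = {x:{a..b}. v <= g x}"
have Ceq: "C = {a..b} Int g -` {v..}" by(auto simp:C_def)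
have "closed C" unfolding Ceq by(intro continuous_closed_preimage gc) auto
moreover have "bounded C" unfolding Ceq by(intro bounded_Int) simp
ultimately have cC: "compact C" by(simp add:compact_eq_bounded_closed)
have "a:C" using ab gab by(simp add:C_def)
then obtain c where c: "c:C" "!!x. x:C ==> x <= c" using compact_attains_sup[OF cC] by blast
have cb: "a <= c" "c < b" "v <= g c" using c(1) gab by(auto simp:C_def less_le)
obtain y where y: "c < y" "y <= b" "f y - f c > - et*(y - c)"
 using dini[OF cb(1,2) eta zero_less_one] by blast
hence "g y > g c" by(simp add:g_def algebra_simps)
hence "y:C" using y cb by(simp add:C_def)
thus False using c(2) y(1) by fastforce
qed

text \<open>The inequality is assumed for rational data and charged intervals only, since on the
  rays it is obtained outside a null set that has to serve all intervals at once.
  \<open>tails\<close> is what excludes gaps in the support.\<close>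

locale bm_measure =
fixes J :: "real set" and lam :: "real measure" and n :: real
assumes n: "n > 1" and J: "open J" "is_interval J"
 and lam: "sets lam = sets borel"
 and fin: "!!a b. a:J ==> b:J ==> em lam {a..b} ~= \<infinity>"
 and tails: "!!c. c:J ==> em lam (J Int {..<c}) > 0" "!!c. c:J ==> em lam (J Int {c<..}) > 0"
 and bm: "!!a0 b0 a1 b1 t. a0:Rats ==> b0:Rats ==> a1:Rats ==> b1:Rats ==> t:Rats ==>
  a0:J ==> b1:J ==> a0 <= b0 ==> b0 < a1 ==> a1 <= b1 ==> 0 < t ==> t < 1 ==>
  0 < measure lam {a0..b0} ==> 0 < measure lam {a1..b1} ==>
  ((1-t)*measure lam {a0..b0} powr (1/n)+t*measure lam {a1..b1} powr (1/n)) powr n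
   <= measure lam {(1-t)*a0+t*a1..(1-t)*b0+t*b1}"
begin

abbreviation "m a b == measure lam {a..b}"

lemma Jmem: "a:J ==> b:J ==> a <= x ==> x <= b ==> x:J"
using mem_is_interval_1_I[OF J(2)] .

lemma sets_lam [measurable, simp]: "X:sets borel ==> X:sets lam" by(simp add:lam)

lemma em: "a:J ==> b:J ==> em lam {a..b} = ennreal (m a b)"
using fin[of a b] by(simp add:emeasure_eq_ennreal_measure)

lemma fm: "a:J ==> b:J ==> {a..b}:fmeasurable lam"
using fin[of a b] by(auto simp:fmeasurable_def less_top)

lemma m_mono: "a:J ==> b:J ==> {c..d} <= {a..b} ==> m c d <= m a b"
by(intro measure_mono_fmeasurable fm) auto

text \<open>Countably many short rational intervals cover \<open>X\<close>; if all of them were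
  null, so would be \<open>X\<close>.\<close>

lemma tiny:
assumes X: "open X" "X <= J" "em lam X > 0" and d: "de > 0"
shows "EX p:Rats. EX q:Rats. p <= q & q - p <= de & {p..q} <= X & 0 < m p q"
proof (rule ccontr)
assume n: "~ ?thesis"
define P where "P = {(p, q). p:Rats & q:Rats & p <= q & q - p <= de & {p..q} <= X}"
have cP: "countable P"
 by(rule countable_subset[of _ "Rats \<times> Rats"]) (auto simp:P_def intro:countable_rat)
have "{p..q}:null_sets lam" if "(p, q):P" for p q
proof -
 have P: "p:Rats" "q:Rats" "p <= q" "q - p <= de" "{p..q} <= X" using that by(simp_all add:P_def)
 hence "~ 0 < m p q" using n by blast
 hence "m p q = 0" using measure_nonneg[of lam "{p..q}"] by linarith
 moreover have "p:{p..q}" "q:{p..q}" using P(3) by auto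
 ultimately have pq: "p:J" "q:J" "m p q = 0"
  using subsetD[OF X(2)] subsetD[OF P(5)] by simp_all
 thus ?thesis using em[OF pq(1,2)] by(auto simp:null_sets_def)
qed
hence "(\<Union>r\<in>P. {fst r..snd r}):null_sets lam"
 by(intro null_sets_UN' cP) auto
moreover have "X <= (\<Union>r\<in>P. {fst r..snd r})"
proof
 fix x assume "x:X"
 then obtain e where e: "e > 0" "ball x e <= X" using X(1) open_contains_ball by blast
 define e' where "e' = min e de/2"
 have e': "e' > 0" "e' < e" "2*e' <= de" using e d by(auto simp:e'_def)
 obtain p where p: "p:Rats" "x - e' < p" "p < x" using Rats_dense_in_real[of "x - e'" x] e' by auto
 obtain q where q: "q:Rats" "x < q" "q < x+e'" using Rats_dense_in_real[of x "x+e'"] e' by auto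
 have "{p..q} <= ball x e" using p q e' by(auto simp:dist_real_def abs_less_iff)
 hence "(p, q):P" using p q e e' by(auto simp:P_def)
 thus "x:(\<Union>r\<in>P. {fst r..snd r})" using p q by force
qed
ultimately have "em lam X = 0"
 using X(1) by(metis (no_types, lifting) borel_open null_sets_subset null_setsD1 sets_lam)
thus False using X(3) by simp
qed

text \<open>By \<open>tails\<close> there are short charged intervals to the left of
  \<open>c\<close> and to the right of \<open>d\<close>; a suitable rational interpolation between
  them is charged and lands inside \<open>{c..d}\<close>.\<close>

lemma full:
assumes cd: "c:J" "d:J" "c < d"
shows "0 < m c d"
proof -
define de where "de = (d - c)/2"
have d: "de > 0" using cd by(simp add:de_def)
obtain p q where p: "p:Rats" "q:Rats" "p <= q" "q - p <= de" "{p..q} <= J Int {..<c}" "0 < m p q"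
 using tiny[OF open_Int[OF J(1) open_lessThan] Int_lower1 tails(1)[OF cd(1)] d] by blast
obtain p' q' where p': "p':Rats" "q':Rats" "p' <= q'" "q' - p' <= de" "{p'..q'} <= J Int {d<..}" "0 < m p' q'"
 using tiny[OF open_Int[OF J(1) open_greaterThan] Int_lower1 tails(2)[OF cd(2)] d] by blast
have in1: "p:J" "q < c" "q':J" "d < p'" using p p' by auto
have lt: "p < c" "c < d" "d < p'" "q < p'" using in1 p cd by auto
\<comment> \<open>These bounds place the interpolated left end in the first half of
  \<open>{c..d}\<close>; the interpolated length is at most \<open>de\<close>, which is half the
  length of \<open>{c..d}\<close>.\<close>
have "(c - p)/(p' - p) < ((c+d)/2 - p)/(p' - p)"
 using lt by(intro divide_strict_right_mono) auto
then obtain t where t: "t:Rats" "(c - p)/(p' - p) < t" "t < ((c+d)/2 - p)/(p' - p)"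
 using Rats_dense_in_real by blast
have "0 < (c - p)/(p' - p)" using lt by(intro divide_pos_pos) auto
moreover have "((c+d)/2 - p)/(p' - p) < 1" using lt by(subst divide_less_eq_1_pos) auto
ultimately have t01: "0 < t" "t < 1" using t by auto
have z1: "c < (1-t)*p+t*p'" "(1-t)*p+t*p' < (c+d)/2"
 using t lt by(auto simp:field_simps)
have "(1-t)*(q - p)+t*(q' - p') <= (1-t)*de+t*de"
 using p p' t01 by(intro add_mono mult_left_mono) auto
hence "(1-t)*q+t*q' <= (1-t)*p+t*p'+de" by(simp add:algebra_simps)
hence z2: "(1-t)*q+t*q' <= d" using z1 by(simp add:de_def field_simps)
have "0 < ((1-t)*m p q powr (1/n)+t*m p' q' powr (1/n)) powr n"
proof -
 have "0 < (1-t)*m p q powr (1/n)" "0 < t*m p' q' powr (1/n)" using t01 p(6) p'(6) by simp_all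
 thus ?thesis by simp
qed
also have "... <= m ((1-t)*p+t*p') ((1-t)*q+t*q')"
 by(intro bm) (use p p' t t01 in1 lt in auto)
also have "... <= m c d" by(intro m_mono cd) (use z1 z2 in auto)
finally show ?thesis .
qed

lemma rational_approx:
assumes x: "(x::real) < y"
shows "EX q. ALL i::nat. q i:Rats & x < q i & q i < y & q i < x+1/real (Suc i)"
proof -
have "ALL i::nat. EX q:Rats. x < q & q < min y (x+1/real (Suc i))"
 using Rats_dense_in_real[of x "min y (x+1/real (Suc i))" for i] x by auto
thus ?thesis by(metis min_less_iff_conj)
qed

lemma rational_approx_lim:
assumes "ALL i::nat. x < q i & q i < x+1/real (Suc i)"
shows "q ----> x"
proof (rule tendsto_sandwich[of "%_. x" q sequentially "%i. x+1/real (Suc i)"])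
show "(%i. x+1/real (Suc i)) ----> x"
 using tendsto_add[OF tendsto_const lim_1_over_n[THEN LIMSEQ_Suc]] by fastforce
qed (use assms in "auto intro!:always_eventually intro:less_imp_le")

text \<open>Continuity from above; openness of \<open>J\<close> leaves room for enlarging the
  interval within finite mass.\<close>

lemma m_outer:
assumes ab: "a:J" "b:J" "a <= b" and C: "!!ep. ep > 0 ==> a - ep:J ==> b+ep:J ==> C <= m (a - ep) (b+ep)"
shows "C <= m a b"
proof -
obtain e1 where e1: "e1 > 0" "ball a e1 <= J" using J(1) ab(1) open_contains_ball by blast
obtain e2 where e2: "e2 > 0" "ball b e2 <= J" using J(1) ab(2) open_contains_ball by blast
define ep where "ep i = min e1 e2/real (Suc (Suc i))" for i
have ep: "ep i > 0" "ep i < e1" "ep i < e2" for i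
proof -
 have mp: "min e1 e2 > 0" using e1 e2 by simp
 thus "ep i > 0" by(simp add:ep_def)
 have "ep i <= min e1 e2/2" unfolding ep_def using mp by(intro divide_left_mono) auto
 thus "ep i < e1" "ep i < e2" using mp by linarith+
qed
have eJ: "a - ep i:J" "b+ep i:J" for i
 using e1 e2 ep[of i] by(auto simp:subset_iff dist_real_def)
have dec: "ep (Suc i) <= ep i" for i using e1 e2 unfolding ep_def by(intro divide_left_mono) auto
have lim: "ep ----> 0"
 unfolding ep_def using LIMSEQ_Suc[OF LIMSEQ_Suc[OF lim_const_over_n]] by fastforce
have "(%i. m (a - ep i) (b+ep i)) ----> measure lam (\<Inter>i. {a - ep i..b+ep i})"
proof (rule Lim_measure_decseq)
 show "decseq (%i. {a - ep i..b+ep i})"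
  using dec by(intro decseq_SucI) (auto intro:order_trans)
 show "em lam {a - ep i..b+ep i} ~= \<infinity>" for i using fin[OF eJ[of i]] .
qed auto
also have "(\<Inter>i. {a - ep i..b+ep i}) = {a..b}"
proof (intro subset_antisym subsetI)
 fix x assume "x:(\<Inter>i. {a - ep i..b+ep i})"
 hence "!!i. a - ep i <= x" "!!i. x <= b+ep i" by auto
 moreover have "(%i. a - ep i) ----> a - 0" "(%i. b+ep i) ----> b+0" by(intro tendsto_intros lim)+
 ultimately show "x:{a..b}"
  using LIMSEQ_le_const2[of "%i. a - ep i" a x] LIMSEQ_le_const[of "%i. b+ep i" b x] by auto
next
 fix x assume x: "x:{a..b}"
 have "a - ep i <= x & x <= b+ep i" for i using ep(1)[of i] x by auto
 thus "x:(\<Inter>i. {a - ep i..b+ep i})" by auto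
qed
finally show ?thesis by(rule LIMSEQ_le_const) (use C ep eJ in auto)
qed

text \<open>The intervals are enlarged to rational ones, which are charged by \<open>full\<close>,
  and the limit is taken from outside with \<open>m_outer\<close>. Approximation from outside is
  essential, as continuity of \<open>m\<close> is only derived from this lemma.\<close>

lemma bm_real:
assumes J': "a0:J" "b1:J" and o: "a0 <= b0" "b0 < a1" "a1 <= b1" and t: "0 < t" "t < 1"
shows "((1-t)*m a0 b0 powr (1/n)+t*m a1 b1 powr (1/n)) powr n
   <= m ((1-t)*a0+t*a1) ((1-t)*b0+t*b1)"
proof -
have conv: "(1-t)*x+t*y:J" if "x:J" "y:J" for x y
 using convexD_alt[of J x y t] that J(2) t by(simp add:is_interval_convex_1)
have JJ: "b0:J" "a1:J" using Jmem[OF J'] o by auto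
obtain lo where lo: "lo:J" "lo < a0"
proof -
 obtain e where "e > 0" "ball a0 e <= J" using J(1) J'(1) open_contains_ball by blast
 thus thesis using that[of "a0 - e/2"] by(auto simp:subset_iff dist_real_def)
qed
obtain hi where hi: "hi:J" "b1 < hi"
proof -
 obtain e where "e > 0" "ball b1 e <= J" using J(1) J'(2) open_contains_ball by blast
 thus thesis using that[of "b1+e/2"] by(auto simp:subset_iff dist_real_def)
qed
define md where "md = (b0+a1)/2"
have md: "b0 < md" "md < a1" using o by(auto simp:md_def)
\<comment> \<open>Left end-points are negated because \<open>rational_approx\<close> approximates
  from above; \<open>md\<close> keeps the two enlarged intervals apart.\<close>
obtain A0 where A0: "ALL i::nat. A0 i:Rats & - a0 < A0 i & A0 i < - lo & A0 i < - a0+1/real (Suc i)"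
 using rational_approx[of "- a0" "- lo"] lo by auto
obtain B0 where B0: "ALL i::nat. B0 i:Rats & b0 < B0 i & B0 i < md & B0 i < b0+1/real (Suc i)"
 using rational_approx[OF md(1)] by auto
obtain A1 where A1: "ALL i::nat. A1 i:Rats & - a1 < A1 i & A1 i < - md & A1 i < - a1+1/real (Suc i)"
 using rational_approx[of "- a1" "- md"] md by auto
obtain B1 where B1: "ALL i::nat. B1 i:Rats & b1 < B1 i & B1 i < hi & B1 i < b1+1/real (Suc i)"
 using rational_approx[OF hi(2)] by auto
obtain T where T: "ALL i::nat. T i:Rats & t < T i & T i < 1 & T i < t+1/real (Suc i)"
 using rational_approx[OF t(2)] by auto
have lims: "A0 ----> - a0" "B0 ----> b0" "A1 ----> - a1" "B1 ----> b1" "T ----> t"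
 using A0 B0 A1 B1 T by(auto intro!:rational_approx_lim)
let ?f = "%s. ((1 - s)*m a0 b0 powr (1/n)+s*m a1 b1 powr (1/n)) powr n"
have step: "?f (T i) <= m ((1 - T i) * - A0 i+T i * - A1 i) ((1 - T i)*B0 i+T i*B1 i)" for i
proof -
 have i: "A0 i:Rats" "B0 i:Rats" "A1 i:Rats" "B1 i:Rats" "T i:Rats" "- a0 < A0 i" "A0 i < - lo"
  "b0 < B0 i" "B0 i < md" "- a1 < A1 i" "A1 i < - md" "b1 < B1 i" "B1 i < hi" "t < T i" "T i < 1"
  using A0 B0 A1 B1 T by blast+
 have mJ: "- A0 i:J" "B0 i:J" "- A1 i:J" "B1 i:J"
  using i o md by(auto intro!:Jmem[OF lo(1) hi(1)])
 have "m a0 b0 <= m (- A0 i) (B0 i)" "m a1 b1 <= m (- A1 i) (B1 i)"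
  using mJ i by(auto intro!:m_mono)
 hence "?f (T i) <= ((1 - T i)*m (- A0 i) (B0 i) powr (1/n)+T i*m (- A1 i) (B1 i) powr (1/n)) powr n"
  using i t n by(intro powr_mono2 add_mono mult_left_mono add_nonneg_nonneg mult_nonneg_nonneg) auto
 also have "... <= m ((1 - T i) * - A0 i+T i * - A1 i) ((1 - T i)*B0 i+T i*B1 i)"
  by(rule bm) (use i o md t mJ full[of "- A0 i" "B0 i"] full[of "- A1 i" "B1 i"] in auto)
 finally show ?thesis .
qed
show ?thesis
proof (rule m_outer)
 show "(1-t)*a0+t*a1:J" "(1-t)*b0+t*b1:J" using conv J' JJ by auto
 show "(1-t)*a0+t*a1 <= (1-t)*b0+t*b1" using o t by(intro add_mono mult_left_mono) auto
 fix ep :: real assume e: "ep > 0" "(1-t)*a0+t*a1 - ep:J" "(1-t)*b0+t*b1+ep:J"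
 have "(%i. (1 - T i) * - A0 i+T i * - A1 i) ----> (1-t) * - (- a0)+t * - (- a1)"
  by(intro tendsto_intros lims)
 hence "\<forall>\<^sub>F i in sequentially. (1-t)*a0+t*a1 - ep < (1 - T i) * - A0 i+T i * - A1 i"
  by(rule order_tendstoD) (use e in simp)
 moreover have "(%i. (1 - T i)*B0 i+T i*B1 i) ----> (1-t)*b0+t*b1"
  by(intro tendsto_intros lims)
 hence "\<forall>\<^sub>F i in sequentially. (1 - T i)*B0 i+T i*B1 i < (1-t)*b0+t*b1+ep"
  by(rule order_tendstoD) (use e in simp)
 ultimately have ev: "\<forall>\<^sub>F i in sequentially. ?f (T i) <= m ((1-t)*a0+t*a1 - ep) ((1-t)*b0+t*b1+ep)"
 proof eventually_elim
  case (elim i)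
  have "m ((1 - T i) * - A0 i+T i * - A1 i) ((1 - T i)*B0 i+T i*B1 i) <=
    m ((1-t)*a0+t*a1 - ep) ((1-t)*b0+t*b1+ep)"
   by(intro m_mono e) (use elim in auto)
  thus ?case using step[of i] by linarith
 qed
 have "(%i. ?f (T i)) ----> ?f t"
 proof (intro tendsto_powr' tendsto_intros lims disjI2 conjI)
  have "T i < 1" "0 < T i" for i using T t less_trans by blast+
  thus "\<forall>\<^sub>F i in sequentially. 0 <= (1 - T i)*m a0 b0 powr (1/n)+T i*m a1 b1 powr (1/n)"
   by(intro always_eventually allI add_nonneg_nonneg mult_nonneg_nonneg) (auto intro:less_imp_le)
 qed (use n in "auto intro!:always_eventually")
 thus "?f t <= m ((1-t)*a0+t*a1 - ep) ((1-t)*b0+t*b1+ep)"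
  by(rule tendsto_upperbound[OF _ ev]) simp
qed
qed

lemma J_right: "x:J ==> EX y:J. x < y"
proof -
assume "x:J"
then obtain e where "e > 0" "ball x e <= J" using J(1) open_contains_ball by blast
thus ?thesis by(intro bexI[of _ "x+e/2"]) (auto simp:subset_iff dist_real_def)
qed

text \<open>Interpolating an atom at \<open>x\<close> with the one-point interval at
  \<open>y\<close> would produce atoms at all points between them, uncountably many inside an
  interval of finite mass.\<close>

lemma no_atom:
assumes x: "x:J"
shows "m x x = 0"
proof (rule ccontr)
assume "m x x ~= 0"
hence c: "0 < m x x" by(simp add:less_le)
obtain y where y: "y:J" "x < y" using J_right[OF x] by blast
have pos: "0 < m z z" if z: "x < z" "z < y" for z
proof -
 define t where "t = (z - x)/(y - x)"
 have t: "0 < t" "t < 1" using z by(auto simp:t_def)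
 have "t*(y - x) = z - x" using z by(simp add:t_def)
 hence zt: "(1-t)*x+t*y = z" by(simp add:algebra_simps)
 have "0 < (1-t)*m x x powr (1/n)" "0 <= t*m y y powr (1/n)"
  using t c by(simp_all del:atLeastAtMost_singleton)
 hence "0 < ((1-t)*m x x powr (1/n)+t*m y y powr (1/n)) powr n"
  by(simp del:atLeastAtMost_singleton)
 also have "... <= m ((1-t)*x+t*y) ((1-t)*x+t*y)"
  by(intro bm_real x y t) auto
 finally show ?thesis by(simp only: zt)
qed
let ?M = "density lam (ind {x..y})"
interpret M: finite_measure ?M
 by(rule finite_measureI) (use fin[OF x y(1)] in "simp add:emeasure_density cong: nn_integral_cong_simp")
have "{x<..<y} <= {z. measure ?M {z} ~= 0}"
proof
 fix z assume z: "z:{x<..<y}"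
 have "em ?M {z} = em lam {z..z}"
 proof -
  have "em ?M {z} = nn_integral lam (%u. ind {z..z} u)"
   using z by(subst emeasure_density) (auto intro!:nn_integral_cong split:split_indicator)
  thus ?thesis by(subst nn_integral_indicator[symmetric]) auto
 qed
 hence "measure ?M {z} = m z z" by(simp add:measure_def)
 thus "z:{z. measure ?M {z} ~= 0}" using pos[of z] z by auto
qed
hence "countable {x<..<y}" using M.countable_support countable_subset by blast
thus False using uncountable_open_interval y(2) by blast
qed

lemma m_add:
assumes "a:J" "c:J" "a <= b" "b <= c"
shows "m a c = m a b+m b c"
proof -
have b: "b:J" using Jmem[OF assms(1,2)] assms by blast
have "m a c = measure lam ({a..b} Un {b..c})" using assms by(simp add:ivl_disj_un)
also have "... = m a b+m b c - measure lam ({a..b} Int {b..c})"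
 using fm[OF assms(1) b] fm[OF b assms(2)] measure_Un3[of "{a..b}" lam "{b..c}"] by simp
also have "{a..b} Int {b..c} = {b..b}" using assms by auto
finally show ?thesis using no_atom[OF b] by simp
qed

lemma m_small:
assumes x: "x:J" and e: "e > 0"
shows "EX et>0. x - et:J & x+et:J & m (x - et) (x+et) < e"
proof (rule ccontr)
assume n: "~ ?thesis"
have "e <= m x x" by(rule m_outer[OF x x order_refl]) (use n in "force simp:not_less")
thus False using no_atom[OF x] e by simp
qed

lemma m_continuous:
assumes a: "a:J" and b: "b:J"
shows "continuous_on {a..b} (m a)"
unfolding continuous_on_iff
proof (intro ballI allI impI)
fix x e assume x: "x:{a..b}" and e: "(0::real) < e"
have xJ: "x:J" using Jmem[OF a b] x by auto
obtain et where h: "et > 0" "x - et:J" "x+et:J" "m (x - et) (x+et) < e" using m_small[OF xJ e] by blast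
have "dist (m a y) (m a x) < e" if y: "y:{a..b}" "dist y x < et" for y
proof -
 have yJ: "y:J" using Jmem[OF a b] y by auto
 have yb: "x - et <= y" "y <= x+et" using y by(auto simp:dist_real_def abs_less_iff)
 show ?thesis
 proof (cases "x <= y")
  case True
  hence "m a y = m a x+m x y" using m_add[OF a yJ] x by simp
  moreover have "m x y <= m (x - et) (x+et)" by(intro m_mono h) (use yb True h in auto)
  ultimately show ?thesis using h by(simp add:dist_real_def)
 next
  case False
  hence "m a x = m a y+m y x" using m_add[OF a xJ] y by simp
  moreover have "m y x <= m (x - et) (x+et)" by(intro m_mono h) (use yb False h in auto)
  ultimately show ?thesis using h by(simp add:dist_real_def)
 qed
qed
thus "EX d>0. ALL y:{a..b}. dist y x < d --> dist (m a y) (m a x) < e" using h(1) by blast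
qed

text \<open>The lower right derivative of the distribution function; it takes values in
  \<open>ereal\<close> until \<open>g_finite\<close>.\<close>

definition g :: "real => ereal" where
"g x = Liminf (at_right 0) (%ep. ereal (m x (x+ep)/ep))"

lemma g_ge: "eventually (%ep. C <= m x (x+ep)/ep) (at_right 0) ==> ereal C <= g x"
unfolding g_def by(intro Liminf_bounded) (auto elim!:eventually_mono)

lemma g_nonneg: "0 <= g x"
proof -
have "ereal 0 <= g x"
 by(rule g_ge) (auto simp:eventually_at_filter intro!:always_eventually divide_nonneg_nonneg)
thus ?thesis by(simp add:zero_ereal_def)
qed

lemma g_gt: "ereal al < g x ==> eventually (%ep. al <= m x (x+ep)/ep) (at_right 0)"
unfolding g_def by(drule less_LiminfD) (auto elim!:eventually_mono)

text \<open>The inequality for intervals of lengths \<open>s*ep\<close> and \<open>r*ep\<close>,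
  divided by \<open>ep\<close>. The free choice of \<open>s\<close> and \<open>r\<close> is what
  later turns it into concavity of \<open>k\<close>.\<close>

lemma g_key:
assumes xy: "x:J" "y:J" "x < y" and t: "0 < t" "t < 1" and sr: "0 < s" "0 < r"
 and ab: "0 <= al" "0 <= be"
 and al: "eventually (%ep. al <= m x (x+ep)/ep) (at_right 0)"
 and be: "eventually (%ep. be <= m y (y+ep)/ep) (at_right 0)"
shows "ereal (((1-t)*(s*al) powr (1/n)+t*(r*be) powr (1/n)) powr n/((1-t) * s+t*r))
 <= g ((1-t)*x+t*y)"
proof (rule g_ge)
let ?z = "(1-t)*x+t*y" and ?c = "(1-t) * s+t*r"
let ?M = "((1-t)*(s*al) powr (1/n)+t*(r*be) powr (1/n)) powr n"
have c: "?c > 0" using t sr by(simp add:add_pos_pos)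
obtain d1 where d1: "d1 > 0" "!!ep. 0 < ep ==> ep < d1 ==> al <= m x (x+ep)/ep"
 using al by(auto simp:eventually_at_right_field)
obtain d2 where d2: "d2 > 0" "!!ep. 0 < ep ==> ep < d2 ==> be <= m y (y+ep)/ep"
 using be by(auto simp:eventually_at_right_field)
obtain w where w: "w:J" "y < w" using J_right[OF xy(2)] by blast
define d where "d = min (min (d1 / s) (d2/r)) (min ((y - x) / s) ((w - y)/r))"
have d: "d > 0" using d1 d2 xy w sr by(simp add:d_def)
have main: "?M <= m ?z (?z+ep*?c)/ep" if e: "0 < ep" "ep < d" for ep
proof -
 have lt: "s*ep < d1" "r*ep < d2" "s*ep < y - x" "r*ep < w - y"
  using e sr by(auto simp:d_def field_simps)
 have p: "0 < s*ep" "0 < r*ep" using e sr by auto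
 have yJ: "y+r*ep:J" using Jmem[OF xy(2) w(1)] lt p by auto
 have 1: "s*al*ep <= m x (x+s*ep)" using d1(2)[OF p(1) lt(1)] p by(simp add:field_simps)
 have 2: "r*be*ep <= m y (y+r*ep)" using d2(2)[OF p(2) lt(2)] p by(simp add:field_simps)
 have "ep*?M = ((1-t)*(s*al*ep) powr (1/n)+t*(r*be*ep) powr (1/n)) powr n"
 proof -
  have "(1-t)*(s*al*ep) powr (1/n)+t*(r*be*ep) powr (1/n) =
   ((1-t)*(s*al) powr (1/n)+t*(r*be) powr (1/n))*ep powr (1/n)"
   using sr ab e by(simp add:powr_mult algebra_simps)
  thus ?thesis using sr ab e t n by(simp add:powr_mult powr_powr add_nonneg_nonneg)
 qed
 also have "... <= ((1-t)*m x (x+s*ep) powr (1/n)+t*m y (y+r*ep) powr (1/n)) powr n"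
  using 1 2 t n sr ab e by(intro powr_mono2 add_mono mult_left_mono add_nonneg_nonneg mult_nonneg_nonneg) auto
 also have "... <= m ?z ((1-t)*(x+s*ep)+t*(y+r*ep))"
  by(rule bm_real) (use xy yJ lt p t in auto)
 also have "(1-t)*(x+s*ep)+t*(y+r*ep) = ?z+ep*?c" by(simp add:algebra_simps)
 finally show ?thesis using e by(simp add:field_simps)
qed
show "eventually (%ep. ?M/?c <= m ?z (?z+ep)/ep) (at_right 0)"
 unfolding eventually_at_right_field
proof (intro exI[of _ "d*?c"] conjI allI impI)
 show "0 < d*?c" using d c by simp
 fix ep assume e: "0 < ep" "ep < d*?c"
 have "?M <= m ?z (?z+ep/?c*?c)/(ep/?c)"
  by(rule main) (use e c pos_divide_less_eq[OF c] in simp_all)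
 moreover have "ep/?c*?c = ep" using c by simp
 moreover have "X/(ep/?c) = X/ep*?c" for X by simp
 ultimately have "?M <= m ?z (?z+ep)/ep*?c" by metis
 thus "?M/?c <= m ?z (?z+ep)/ep" using pos_divide_le_eq[OF c] by blast
qed
qed

lemma eventually_shift_up:
assumes "eventually P (at_right (0::real))" "de > 0"
shows "EX ep. 0 < ep & ep < de & P ep"
proof -
obtain b where "b > 0" "!!y. 0 < y ==> y < b ==> P y"
 using assms(1) by(auto simp:eventually_at_right_field)
thus ?thesis using assms(2) by(intro exI[of _ "min b de/2"]) (auto simp:min_def)
qed

text \<open>An infinite value at \<open>x\<close> spreads to all points between \<open>x\<close> and
  \<open>y\<close>, and then the mass of a subinterval exceeds every multiple of its length.\<close>

lemma g_finite:
assumes x: "x:J" shows "g x ~= \<infinity>"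
proof
assume inf: "g x = \<infinity>"
obtain y where y: "y:J" "x < y" using J_right[OF x] by blast
have g_inf: "g z = \<infinity>" if z: "x < z" "z < y" for z
proof (rule ccontr)
 assume "g z ~= \<infinity>"
 then obtain K where K: "g z = ereal K" "0 <= K" using g_nonneg[of z] by(cases "g z") auto
 define t where "t = (z - x)/(y - x)"
 have t: "0 < t" "t < 1" using z by(auto simp:t_def)
 have "t*(y - x) = z - x" using z by(simp add:t_def)
 hence zt: "(1-t)*x+t*y = z" by(simp add:algebra_simps)
 \<comment> \<open>Chosen so that \<open>g_key\<close>, with the bound 0 at \<open>y\<close>, reads
   \<open>K+1 <= K\<close>.\<close>
 define al where "al = (K+1)/(1-t) powr n"
 have a: "0 <= al" using K t by(simp add:al_def)
 have "ereal (((1-t)*(1*al) powr (1/n)+t*(1*0) powr (1/n)) powr n/((1-t)*1+t*1)) <= g ((1-t)*x+t*y)"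
 proof (rule g_key[OF x y(1,2) t _ _ a order_refl])
  show "eventually (%ep. al <= m x (x+ep)/ep) (at_right 0)" by(rule g_gt) (simp add:inf)
  show "eventually (%ep. 0 <= m y (y+ep)/ep) (at_right 0)"
   by(auto simp:eventually_at_filter intro!:always_eventually)
 qed auto
 hence "(1-t) powr n*al <= K" using K zt t a n by(simp add:powr_mult powr_powr)
 thus False using t by(simp add:al_def)
qed
define a where "a = x+(y - x)/3"
define b where "b = x+2*(y - x)/3"
have ab: "x < a" "a < b" "b < y" using y by(auto simp:a_def b_def field_simps)
have abJ: "a:J" "b:J" using Jmem[OF x y(1)] ab by auto
have large: "M*(b - a) <= m a b" for M
proof -
 have "m a a - M*a <= m a b - M*b"
 proof (rule dini_nondecreasing[where f = "%u. m a u - M*u"])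
  show "continuous_on {a..b} (%u. m a u - M*u)" by(intro continuous_intros m_continuous abJ)
  fix u et de :: real assume u: "a <= u" "u < b" "0 < et" "0 < de"
  have "eventually (%ep. M <= m u (u+ep)/ep) (at_right 0)"
   by(rule g_gt) (use g_inf[of u] u ab in simp)
  then obtain ep where e: "0 < ep" "ep < min de (b - u)" "M <= m u (u+ep)/ep"
   using eventually_shift_up[of _ "min de (b - u)"] u by auto
  have "u+ep:J" using Jmem[OF abJ] u e by auto
  hence "m a (u+ep) = m a u+m u (u+ep)" using m_add[OF abJ(1), of "u+ep" u] u e by auto
  hence "m a (u+ep) - M*(u+ep) - (m a u - M*u) >= 0" using e by(simp add:field_simps)
  moreover have "- et*ep < 0" using u e by simp
  ultimately show "EX v. u < v & v < u+de & v <= b & m a v - M * v - (m a u - M*u) > - et*(v - u)"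
   using e by(intro exI[of _ "u+ep"]) auto
 qed (use ab in auto)
 moreover have "m a a = 0" by(rule no_atom[OF abJ(1)])
 moreover have "M*(b - a) = M*b - M*a" by(simp add:algebra_simps)
 ultimately show ?thesis by linarith
qed
have "(m a b+1)/(b - a)*(b - a) <= m a b" using large .
thus False using ab by simp
qed

definition G where "G x = real_of_ereal (g x)"
definition k where "k x = G x powr (1/(n - 1))"

lemma G: "x:J ==> g x = ereal (G x)" "0 <= G x"
using g_finite g_nonneg[of x] unfolding G_def by(auto simp:ereal_real real_of_ereal_pos)

lemma k_nonneg: "0 <= k x" by(simp add:k_def)

lemma k_powr: "k x powr (n - 1) = G x"
using n G(2)[of x] by(cases "G x = 0") (auto simp:k_def powr_powr)

text \<open>\<open>g_key\<close> wants bounds that difference quotients eventually satisfy; numbers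
  just below the lower derivatives qualify, and continuity gives the limit.\<close>

lemma G_key:
assumes xy: "x:J" "y:J" "x < y" and t: "0 < t" "t < 1" and sr: "0 < s" "0 < r"
shows "((1-t)*(s*G x) powr (1/n)+t*(r*G y) powr (1/n)) powr n
 <= G ((1-t)*x+t*y)*((1-t) * s+t*r)"
proof -
let ?z = "(1-t)*x+t*y" and ?c = "(1-t) * s+t*r"
have zJ: "?z:J" using convexD_alt[of J x y t] xy J(2) t by(simp add:is_interval_convex_1)
have c: "?c > 0" using t sr by(simp add:add_pos_pos)
define A where "A i = max 0 (G x - 1/real (Suc i))" for i
define B where "B i = max 0 (G y - 1/real (Suc i))" for i
have ev: "eventually (%ep. max 0 (G u - 1/real (Suc i)) <= m u (u+ep)/ep) (at_right 0)" if "u:J" for u i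
proof -
 have "eventually (%ep. G u - 1/real (Suc i) <= m u (u+ep)/ep) (at_right 0)"
  by(rule g_gt) (simp add:G(1)[OF that])
 moreover have "eventually (%ep. 0 <= m u (u+ep)/ep) (at_right 0)"
  by(auto simp:eventually_at_filter intro!:always_eventually)
 ultimately show ?thesis by eventually_elim simp
qed
have "((1-t)*(s*A i) powr (1/n)+t*(r*B i) powr (1/n)) powr n <= G ?z*?c" for i
proof -
 have "ereal (((1-t)*(s*A i) powr (1/n)+t*(r*B i) powr (1/n)) powr n/?c) <= g ?z"
  by(rule g_key[OF xy t sr]) (use ev xy in "auto simp:A_def B_def")
 hence "((1-t)*(s*A i) powr (1/n)+t*(r*B i) powr (1/n)) powr n/?c <= G ?z"
  unfolding G(1)[OF zJ] ereal_less_eq .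
 thus ?thesis using pos_divide_le_eq[OF c] by blast
qed
moreover have "(%i. ((1-t)*(s*A i) powr (1/n)+t*(r*B i) powr (1/n)) powr n) ---->
  ((1-t)*(s*G x) powr (1/n)+t*(r*G y) powr (1/n)) powr n"
proof -
 have lim: "(%i. max 0 (G u - 1/real (Suc i))) ----> G u" for u
 proof -
  have "(%i. max 0 (G u - 1/real (Suc i))) ----> max 0 (G u - 0)"
   by(intro tendsto_intros LIMSEQ_Suc[OF lim_1_over_n])
  thus ?thesis using G(2)[of u] by(simp add:max_def)
 qed
 have nnA: "0 <= A i" "0 <= B i" for i by(auto simp:A_def B_def)
 have "(%i. (s*A i) powr (1/n)) ----> (s*G x) powr (1/n)"
  by(rule tendsto_powr'[OF tendsto_mult_left[OF lim[of x, folded A_def]] tendsto_const])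
   (use n sr nnA in "auto intro!:disjI2 always_eventually")
 moreover have "(%i. (r*B i) powr (1/n)) ----> (r*G y) powr (1/n)"
  by(rule tendsto_powr'[OF tendsto_mult_left[OF lim[of y, folded B_def]] tendsto_const])
   (use n sr nnA in "auto intro!:disjI2 always_eventually")
 ultimately have "(%i. (1-t)*(s*A i) powr (1/n)+t*(r*B i) powr (1/n)) ---->
   (1-t)*(s*G x) powr (1/n)+t*(r*G y) powr (1/n)"
  by(intro tendsto_add tendsto_mult_left)
 thus ?thesis
  by(rule tendsto_powr'[OF _ tendsto_const])
   (use n t in "auto intro!:disjI2 always_eventually add_nonneg_nonneg")
qed
ultimately show ?thesis by(intro LIMSEQ_le_const2) auto
qed

text \<open>The lengths are taken proportional to \<open>k x\<close> and \<open>k y\<close>. Since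
  \<open>k*G\<close> equals \<open>k powr n\<close>, the left-hand side of \<open>G_key\<close>
  becomes the \<open>n\<close>-th power of the mean \<open>M\<close>, while the interpolated length
  is \<open>M\<close> itself; hence \<open>M powr (n - 1)\<close> is at most \<open>G\<close> at the
  interpolated point. The summand \<open>sg\<close> keeps the lengths positive where
  \<open>k\<close> vanishes.\<close>

lemma k_concave: "concave_on J k"
unfolding concave_on_def
proof (rule convex_on_linorderI)
show "convex J" using J(2) by(simp add:is_interval_convex_1)
fix t x y :: real assume t: "0 < t" "t < 1" and xy: "x:J" "y:J" "x < y"
let ?z = "(1-t)*x+t*y"
define M where "M = (1-t)*k x+t*k y"
have M0: "0 <= M" using t k_nonneg by(simp add:M_def)
have kn: "(k u*G u) powr (1/n) = k u" for u
proof -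
 have "k u*G u = k u powr n" using k_powr[of u] k_nonneg[of u]
  by(metis (no_types, lifting) diff_add_cancel mult.commute powr_add powr_one)
 thus ?thesis using n k_nonneg[of u] by(simp add:powr_powr)
qed
have "M powr n <= G ?z*(M+sg)" if s: "sg > 0" for sg
proof -
 have "M powr n <= ((1-t)*((k x+sg)*G x) powr (1/n)+t*((k y+sg)*G y) powr (1/n)) powr n"
 proof (intro powr_mono2)
  have "k u <= ((k u+sg)*G u) powr (1/n)" for u
   using s n k_nonneg[of u] G(2)[of u] by(subst kn[symmetric]) (intro powr_mono2 mult_right_mono, auto)
  thus "M <= (1-t)*((k x+sg)*G x) powr (1/n)+t*((k y+sg)*G y) powr (1/n)"
   unfolding M_def using t by(intro add_mono mult_left_mono) auto
 qed (use n M0 in auto)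
 also have "... <= G ?z*((1-t)*(k x+sg)+t*(k y+sg))"
  by(intro G_key xy t) (use s k_nonneg in "auto simp:add_nonneg_pos")
 also have "(1-t)*(k x+sg)+t*(k y+sg) = M+sg" by(simp add:M_def algebra_simps)
 finally show ?thesis .
qed
hence le: "M powr n <= G ?z*M"
proof -
 have "(%i. G ?z*(M+1/real (Suc i))) ----> G ?z*(M+0)"
  by(intro tendsto_intros LIMSEQ_Suc[OF lim_1_over_n])
 thus ?thesis using \<open>!!sg. sg > 0 ==> M powr n <= G ?z*(M+sg)\<close>
  by(intro LIMSEQ_le_const[of _ "G ?z*M"]) auto
qed
have "M <= k ?z"
proof (cases "M = 0")
 case True thus ?thesis using k_nonneg by simp
next
 case False
 hence Mp: "M > 0" using M0 by simp
 have "M powr (n - 1) <= G ?z" using le Mp by(simp add:powr_diff field_simps)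
 hence "(M powr (n - 1)) powr (1/(n - 1)) <= k ?z" unfolding k_def using n by(intro powr_mono2) auto
 thus ?thesis using Mp n by(simp add:powr_powr)
qed
thus "- k ((1-t) *\<^sub>R x+t *\<^sub>R y) <= (1-t) * - k x+t * - k y" by(simp add:M_def)
qed

lemma k_continuous: "continuous_on J k"
proof -
have "continuous_on J (%x. - k x)"
 using convex_on_continuous[OF J(1)] k_concave unfolding concave_on_def by blast
thus ?thesis using continuous_on_minus by fastforce
qed

lemma G_continuous: "continuous_on J G"
proof -
have "continuous_on J (%x. k x powr (n - 1))"
 by(intro continuous_on_powr' continuous_intros k_continuous) (use n k_nonneg in auto)
thus ?thesis by(simp add:k_powr)
qed

text \<open>Only the lower limit of the difference quotients is known. The Dini criterion asks for
  just one good increment near each point: all small increments of \<open>m\<close> are large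
  enough, and some are small enough, so that both \<open>m a u - P u\<close> and
  \<open>P u - m a u\<close> are nondecreasing.\<close>

lemma m_integral:
assumes ab: "a:J" "b:J" "a <= b"
shows "m a b = integral {a..b} G"
proof -
have sub: "{a..b} <= J" using Jmem[OF ab(1,2)] by auto
have Gc: "continuous_on {a..b} G" using G_continuous sub by(rule continuous_on_subset)
define P where "P u = integral {a..u} G" for u
have P: "(P has_real_derivative G u) (at u within {a..b})" if "u:{a..b}" for u
 unfolding P_def by(rule integral_has_real_derivative[OF Gc that])
have Pc: "continuous_on {a..b} P" using P by(meson DERIV_continuous_on)
have Pq: "EX de>0. ALL v. u < v & v < u+de --> \<bar>P v - P u - G u*(v - u)\<bar> < et*(v - u)"
 if u: "a <= u" "u < b" "0 < et" for u et
proof -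
 have "((%v. (P v - P u)/(v - u)) \<longlongrightarrow> G u) (at u within {a..b})"
  using P[of u] u by(simp add:has_field_derivative_iff)
 hence "eventually (%v. dist ((P v - P u)/(v - u)) (G u) < et) (at u within {a..b})"
  by(rule tendstoD) (use u in simp)
 then obtain d where d: "d > 0" "!!v. v:{a..b} ==> v ~= u ==> dist v u < d ==> dist ((P v - P u)/(v - u)) (G u) < et"
  unfolding eventually_at by blast
 show ?thesis
 proof (intro exI[of _ "min d (b - u)"] conjI allI impI)
  show "0 < min d (b - u)" using d u by simp
  fix v assume v: "u < v & v < u+min d (b - u)"
  hence "\<bar>(P v - P u)/(v - u) - G u\<bar> < et" using d(2)[of v] u by(auto simp:dist_real_def)
  hence "\<bar>(P v - P u)/(v - u) - G u\<bar> * \<bar>v - u\<bar> < et*(v - u)" using v by simp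
  moreover have "(P v - P u)/(v - u)*(v - u) = P v - P u" using v by simp
  hence "((P v - P u)/(v - u) - G u)*(v - u) = P v - P u - G u*(v - u)"
   by(simp only: left_diff_distrib)
  ultimately show "\<bar>P v - P u - G u*(v - u)\<bar> < et*(v - u)"
   by(simp only: abs_mult[symmetric])
 qed
qed
have add:"m a v = m a u+m u v" if "a <= u" "u <= v" "v <= b" for u v
 using m_add[OF ab(1) _ that(1,2)] subsetD[OF sub, of v] that by simp
have "m a a - P a <= m a b - P b"
proof (rule dini_nondecreasing[where f = "%u. m a u - P u"])
 show "continuous_on {a..b} (%u. m a u - P u)" by(intro continuous_intros m_continuous ab Pc)
 fix u et de :: real assume u: "a <= u" "u < b" "0 < et" "0 < de"
 have uJ: "u:J" using sub u by auto
 obtain d where d: "d > 0" "!!v. u < v ==> v < u+d ==> \<bar>P v - P u - G u*(v - u)\<bar> < et/2*(v - u)"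
  using Pq[OF u(1,2), of "et/2"] u by auto
 have "eventually (%ep. G u - et/2 <= m u (u+ep)/ep) (at_right 0)"
  by(rule g_gt) (use u in "simp add:G(1)[OF uJ]")
 then obtain ep where e: "0 < ep" "ep < min (min d de) (b - u)" "G u - et/2 <= m u (u+ep)/ep"
  using eventually_shift_up[of _ "min (min d de) (b - u)"] u d by auto
 have "(G u - et/2)*ep <= m u (u+ep)" using e by(simp add:field_simps)
 moreover have "\<bar>P (u+ep) - P u - G u*ep\<bar> < et/2*ep" using d(2)[of "u+ep"] e by simp
 ultimately have "m u (u+ep) - (P (u+ep) - P u) > - et*ep"
  unfolding left_diff_distrib abs_less_iff by linarith
 thus "EX v. u < v & v < u+de & v <= b & m a v - P v - (m a u - P u) > - et*(v - u)"
  using e u add[of u "u+ep"] by(intro exI[of _ "u+ep"]) auto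
qed (use ab in auto)
moreover have "P a - m a a <= P b - m a b"
proof (rule dini_nondecreasing[where f = "%u. P u - m a u"])
 show "continuous_on {a..b} (%u. P u - m a u)" by(intro continuous_intros m_continuous ab Pc)
 fix u et de :: real assume u: "a <= u" "u < b" "0 < et" "0 < de"
 have uJ: "u:J" using sub u by auto
 obtain d where d: "d > 0" "!!v. u < v ==> v < u+d ==> \<bar>P v - P u - G u*(v - u)\<bar> < et/2*(v - u)"
  using Pq[OF u(1,2), of "et/2"] u by auto
 have "EX ep. 0 < ep & ep < min (min d de) (b - u) & m u (u+ep)/ep < G u+et/2"
 proof (rule ccontr)
  assume n: "~ ?thesis"
  have "eventually (%ep. G u+et/2 <= m u (u+ep)/ep) (at_right 0)"
   unfolding eventually_at_right_field
  proof (intro exI[of _ "min (min d de) (b - u)"] conjI allI impI)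
   show "0 < min (min d de) (b - u)" using u d by simp
   fix y assume "0 < y" "y < min (min d de) (b - u)"
   hence "~ m u (u+y)/y < G u+et/2" using n by blast
   thus "G u+et/2 <= m u (u+y)/y" by simp
  qed
  hence "ereal (G u+et/2) <= g u" by(rule g_ge)
  thus False using u by(simp add:G(1)[OF uJ])
 qed
 then obtain ep where e: "0 < ep" "ep < min (min d de) (b - u)" "m u (u+ep)/ep < G u+et/2" by blast
 have "m u (u+ep) < (G u+et/2)*ep" using e by(simp add:field_simps)
 moreover have "\<bar>P (u+ep) - P u - G u*ep\<bar> < et/2*ep" using d(2)[of "u+ep"] e by simp
 ultimately have "(P (u+ep) - P u) - m u (u+ep) > - et*ep"
  unfolding distrib_right abs_less_iff by linarith
 thus "EX v. u < v & v < u+de & v <= b & P v - m a v - (P u - m a u) > - et*(v - u)"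
  using e u add[of u "u+ep"] by(intro exI[of _ "u+ep"]) auto
qed (use ab in auto)
moreover have "P a = 0" "m a a = 0" using no_atom ab by(auto simp:P_def)
ultimately show ?thesis by(simp add:P_def)
qed

theorem density:
assumes B: "B:sets borel" "B <= J"
shows "em lam B = nn_integral lborel (%x. ennreal (k x powr (n - 1))*ind B x)"
proof -
define h where "h x = (if x:J then G x else 0)" for x
have [measurable]: "h:bmeas borel"
 unfolding h_def using G_continuous J by(intro borel_measurable_continuous_on_if) auto
let ?D = "density lborel (%x. ennreal (h x))"
have e: "em ?D {a..b} = ennreal (m a b)" if ab: "a:J" "b:J" "a <= b" for a b
proof -
 have sub: "{a..b} <= J" using Jmem[OF ab(1,2)] by auto
 have Gc: "continuous_on {a..b} G" using G_continuous sub by(rule continuous_on_subset)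
 have si: "set_integrable lborel {a..b} G" by(rule borel_integrable_atLeastAtMost'[OF Gc])
 have "em ?D {a..b} = nn_integral lborel (%x. ennreal (h x)*ind {a..b} x)"
  by(rule emeasure_density) measurable
 also have "... = nn_integral lborel (%x. ennreal (ind {a..b} x*G x))"
  using sub by(intro nn_integral_cong) (auto simp:h_def split:split_indicator)
 also have "... = ennreal (\<integral>x. ind {a..b} x*G x \<partial>lborel)"
  using si G(2) by(intro nn_integral_eq_integral) (auto simp:set_integrable_def)
 also have "(\<integral>x. ind {a..b} x*G x \<partial>lborel) = integral {a..b} G"
  using set_borel_integral_eq_integral(2)[OF si] by(simp add:set_lebesgue_integral_def)
 finally show ?thesis using m_integral[OF ab] by simp
qed
have "em lam B = em ?D B"
proof (rule antisym)
 have fin': "em ?D {a..b} ~= \<infinity>" if "a:J" "b:J" for a b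
  using e[OF that] by(cases "a <= b") auto
 show "em lam B <= em ?D B"
  by(rule emeasure_le_of_intervals[OF _ _ J(2) fin' _ B]) (auto simp:lam e em)
 show "em ?D B <= em lam B"
  by(rule emeasure_le_of_intervals[OF _ _ J(2) fin _ B]) (auto simp:lam e em)
qed
also have "... = nn_integral lborel (%x. ennreal (k x powr (n - 1))*ind B x)"
proof -
 have "em ?D B = nn_integral lborel (%x. ennreal (h x)*ind B x)"
  by(rule emeasure_density) (use B in measurable)
 also have "... = nn_integral lborel (%x. ennreal (k x powr (n - 1))*ind B x)"
  using B(2) by(intro nn_integral_cong) (auto simp:h_def k_powr split:split_indicator)
 finally show ?thesis .
qed
finally show ?thesis .
qed

end

section \<open>Conditional quantiles\<close>

lemma AE_le_of_nn_integral_le: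
fixes f g :: "'a => ennreal"
assumes [measurable]: "f:bmeas M" "g:bmeas M"
 and fin: "nn_integral M g < \<infinity>"
 and le: "!!C. C:sets M ==> nn_integral M (%x. f x*ind C x) <= nn_integral M (%x. g x*ind C x)"
shows "AE x in M. f x <= g x"
proof -
define C where "C = {x:space M. g x < f x}"
have [measurable]: "C:sets M" unfolding C_def by measurable
have "nn_integral M (%x. g x*ind C x) <= nn_integral M g"
 by(intro nn_integral_mono) (auto split:split_indicator)
hence gfin: "nn_integral M (%x. g x*ind C x) ~= \<infinity>" using fin by auto
hence ffin: "nn_integral M (%x. f x*ind C x) < top"
 using le[of C] by(auto simp:less_top[symmetric] top_unique)
have "nn_integral M (%x. f x*ind C x - g x*ind C x) =
  nn_integral M (%x. f x*ind C x) - nn_integral M (%x. g x*ind C x)"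
 by(rule nn_integral_diff[OF _ _ gfin]) (auto simp:C_def split:split_indicator)
also have "... = 0" using le[of C] ffin by(simp add:diff_eq_0_iff_ennreal)
finally have "AE x in M. f x*ind C x - g x*ind C x = 0"
 by(subst (asm) nn_integral_0_iff_AE) auto
thus ?thesis using AE_space
proof eventually_elim
 case (elim x)
 show ?case
 proof (rule ccontr)
  assume "~ f x <= g x"
  hence l: "g x < f x" by simp
  hence "f x - g x = 0" using elim by(simp add:C_def)
  thus False using l by(metis diff_gt_0_iff_gt_ennreal less_irrefl)
 qed
qed
qed

text \<open>The conditional probability of \<open>X <= q\<close> given \<open>al\<close>, obtained
  for each level \<open>q\<close> separately as a density with respect to the law of
  \<open>al\<close>; regularity in \<open>q\<close> is the subject of
  \<open>proper_cdf\<close>.\<close>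

definition cond_cdf :: "'w measure => 'a measure => ('w => 'a) => ('w => real) => real => 'a => ennreal" where
"cond_cdf P A al X q = RN_deriv (distr P A al) (distr (density P (ind {om:space P. X om <= q})) A al)"

text \<open>Everything is stated at rational levels, so that it can hold outside a single null
  set.\<close>

definition proper_cdf :: "(real => 'a => ennreal) => 'a => bool" where
"proper_cdf f a <-> (ALL p q::rat. p <= q --> f (of_rat p) a <= f (of_rat q) a) & (ALL q::rat. f (of_rat q) a <= 1) &
  (SUP k::nat. f (of_rat (of_nat k)) a) = 1 & (INF k::nat. f (of_rat (- of_nat k)) a) = 0"

definition quantile :: "(real => 'a => ennreal) => 'a => real => real" where
"quantile f a u = (if proper_cdf f a & 0 < u & u < 1
  then Inf (real_of_rat ` {q. ennreal u <= f (of_rat q) a}) else 0)"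

text \<open>The rational levels strictly above \<open>g\<close> do the work of right-continuity,
  which \<open>proper_cdf\<close> does not contain.\<close>

lemma quantile_le_iff:
assumes f: "proper_cdf f a" and u: "0 < u" "u < 1"
shows "quantile f a u <= g <-> (ALL q::rat. g < of_rat q --> ennreal u <= f (of_rat q) a)"
proof -
let ?S = "real_of_rat ` {q. ennreal u <= f (of_rat q) a}"
have mono: "f (of_rat p) a <= f (of_rat q) a" if "p <= q" for p q :: rat
 using f that by(simp add:proper_cdf_def)
have "ennreal u < (SUP k::nat. f (of_rat (of_nat k)) a)" using f u by(simp add:proper_cdf_def)
then obtain k :: nat where "ennreal u < f (of_rat (of_nat k)) a" unfolding less_SUP_iff by blast
hence ne: "?S ~= {}" by(auto intro!:exI[of _ "of_nat k"] less_imp_le)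
have "(INF k::nat. f (of_rat (- of_nat k)) a) < ennreal u" using f u by(simp add:proper_cdf_def)
then obtain l :: nat where l: "f (of_rat (- of_nat l)) a < ennreal u" unfolding INF_less_iff by blast
have lower: "of_rat (- of_nat l) <= r" if r: "r:?S" for r
proof -
 obtain q where q: "r = of_rat q" "ennreal u <= f (of_rat q) a" using r by auto
 have "~ q <= - of_nat l" using mono[of q "- of_nat l"] q(2) l by(meson leD order_trans)
 hence "- of_nat l <= q" by simp
 thus ?thesis unfolding q(1) of_rat_less_eq .
qed
hence bdd: "bdd_below ?S" by(rule bdd_belowI)
have Q: "quantile f a u = Inf ?S" using f u by(simp add:quantile_def)
show ?thesis
proof
 assume le: "quantile f a u <= g"
 show "ALL q::rat. g < of_rat q --> ennreal u <= f (of_rat q) a"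
 proof (intro allI impI)
  fix q :: rat assume "g < of_rat q"
  hence "Inf ?S < of_rat q" using le Q by simp
  then obtain r where "r:?S" "r < of_rat q" using cInf_lessD[OF ne] by blast
  then obtain p where p: "of_rat p < real_of_rat q" "ennreal u <= f (of_rat p) a" by auto
  hence "p <= q" by(simp add:of_rat_less less_imp_le)
  thus "ennreal u <= f (of_rat q) a" using order_trans[OF p(2) mono] by blast
 qed
next
 assume *: "ALL q::rat. g < of_rat q --> ennreal u <= f (of_rat q) a"
 show "quantile f a u <= g"
 proof (rule ccontr)
  assume "~ quantile f a u <= g"
  then obtain q where q: "g < of_rat q" "of_rat q < quantile f a u" using of_rat_dense[of g "quantile f a u"] by auto
  hence "of_rat q:?S" using*by auto
  hence "Inf ?S <= of_rat q" using bdd by(rule cInf_lower)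
  thus False using q(2) Q by simp
 qed
qed
qed

lemma quantile_mono:
assumes "0 < u" "u <= v" "v < 1"
shows "quantile f a u <= quantile f a v"
proof (cases "proper_cdf f a")
case True
have "ALL q::rat. quantile f a v < of_rat q --> ennreal v <= f (of_rat q) a"
 using quantile_le_iff[OF True, of v "quantile f a v"] assms by auto
hence "ALL q::rat. quantile f a v < of_rat q --> ennreal u <= f (of_rat q) a"
 using assms by(meson ennreal_leI order_trans)
thus ?thesis using quantile_le_iff[OF True, of u] assms by auto
qed (simp add:quantile_def)

lemma quantile_le:
assumes f: "proper_cdf f a" "proper_cdf f' a" and le: "!!q::rat. f' (of_rat q) a <= f (of_rat q) a"
 and u: "0 < u" "u < 1"
shows "quantile f a u <= quantile f' a u"
proof -
have "ALL q::rat. quantile f' a u < of_rat q --> ennreal u <= f' (of_rat q) a"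
 using quantile_le_iff[OF f(2) u, of "quantile f' a u"] by auto
hence "ALL q::rat. quantile f' a u < of_rat q --> ennreal u <= f (of_rat q) a"
 using le by(meson order_trans)
thus ?thesis using quantile_le_iff[OF f(1) u] by auto
qed

lemma measurable_proper_cdf:
assumes [measurable]: "!!q. f q:bmeas A"
shows "Measurable.pred A (proper_cdf f)"
unfolding proper_cdf_def by measurable

lemma measurable_quantile:
assumes f[measurable]: "!!q. f q:bmeas A"
shows "(%x. quantile f (fst x) (snd x)):bmeas (A OM borel)"
proof (rule borel_measurableI_le)
fix g
note [measurable] = measurable_proper_cdf[OF f]
have "{x:space (A OM borel). quantile f (fst x) (snd x) <= g} =
  {x:space (A OM borel). (proper_cdf f (fst x) & 0 < snd x & snd x < 1 &
   (ALL q::rat. g < of_rat q --> ennreal (snd x) <= f (of_rat q) (fst x))) \<or>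
   (~ (proper_cdf f (fst x) & 0 < snd x & snd x < 1) & 0 <= g)}"
 using quantile_le_iff[of f] by(auto simp:quantile_def)
also have "... : sets (A OM borel)" by measurable
finally show "{x:space (A OM borel). quantile f (fst x) (snd x) <= g}:sets (A OM borel)" .
qed

definition unif :: "real measure" where "unif = density lborel (ind {0<..<1})"

lemma sets_unif [measurable_cong, simp]: "sets unif = sets borel" by(simp add:unif_def)

lemma space_unif [simp]: "space unif = UNIV" by(simp add:unif_def)

lemma emeasure_unif: "B:sets borel ==> em unif B = em lborel (B Int {0<..<1})"
unfolding unif_def by(subst emeasure_density) (auto simp:Int_commute simp flip: indicator_inter_arith)

lemma prob_space_unif: "prob_space unif"
by(rule prob_spaceI) (simp add:emeasure_unif)

lemma nn_integral_unif:
"f:bmeas borel ==> nn_integral unif f = nn_integral lborel (%u. f u*ind {0<..<1} u)"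
unfolding unif_def by(subst nn_integral_density) (auto simp:mult.commute)

lemma AE_unif: "AE u in unif. 0 < u & u < 1"
unfolding unif_def by(subst AE_density) (auto simp:indicator_def)

context
fixes P :: "'w measure" and A :: "'a measure" and al :: "'w => 'a"
assumes P: "prob_space P" and al[measurable]: "al:P ->M A"
begin

interpretation P: prob_space P by(rule P)
interpretation sg: prob_space "distr P A al" by(rule P.prob_space_distr) measurable

lemma measurable_cond_cdf [measurable]: "cond_cdf P A al X q:bmeas A"
unfolding cond_cdf_def using borel_measurable_RN_deriv[of "distr P A al"] by simp

lemma cond_cdf:
assumes [measurable]: "X:bmeas P" "C:sets A"
shows "nn_integral (distr P A al) (%a. cond_cdf P A al X q a*ind C a) =
 em P {om:space P. al om:C & X om <= q}"
proof -
let ?N = "distr (density P (ind {om:space P. X om <= q})) A al"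
have N: "em ?N B = em P {om:space P. al om:B & X om <= q}" if [measurable]: "B:sets A" for B
proof -
 have "em ?N B = em (density P (ind {om:space P. X om <= q})) (al -` B Int space P)"
  by(subst emeasure_distr) auto
 also have "... = nn_integral P (%om. ind {om:space P. X om <= q} om*ind (al -` B Int space P) om)"
  by(rule emeasure_density) measurable
 also have "... = nn_integral P (%om. ind {om:space P. al om:B & X om <= q} om)"
  by(rule nn_integral_cong) (auto split:split_indicator)
 also have "... = em P {om:space P. al om:B & X om <= q}"
  by(rule nn_integral_indicator) measurable
 finally show ?thesis .
qed
have "absolutely_continuous (distr P A al) ?N"
 unfolding absolutely_continuous_def
proof
 fix B assume B: "B:null_sets (distr P A al)"
 hence [measurable]: "B:sets A" by auto
 have "em P (al -` B Int space P) = 0" using B by(auto simp:null_sets_def emeasure_distr)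
 moreover have "em P {om:space P. al om:B & X om <= q} <= em P (al -` B Int space P)"
  by(intro emeasure_mono) auto
 ultimately show "B:null_sets ?N" by(auto simp:null_sets_def N)
qed
hence "density (distr P A al) (cond_cdf P A al X q) = ?N"
 unfolding cond_cdf_def by(rule sg.density_RN_deriv) simp
hence "em ?N C = nn_integral (distr P A al) (%a. cond_cdf P A al X q a*ind C a)"
 by(subst emeasure_density[symmetric]) auto
thus ?thesis using N[of C] by simp
qed

lemma cond_cdf_le:
assumes [measurable]: "X:bmeas P" "Y:bmeas P"
 and le: "AE om in P. X om <= p --> Y om <= q"
shows "AE a in distr P A al. cond_cdf P A al X p a <= cond_cdf P A al Y q a"
proof (rule AE_le_of_nn_integral_le)
have "nn_integral (distr P A al) (%a. cond_cdf P A al Y q a) = nn_integral (distr P A al) (%a. cond_cdf P A al Y q a*ind (space A) a)"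
 by(intro nn_integral_cong) auto
also have "... < \<infinity>" by(subst cond_cdf) (auto simp:less_top[symmetric])
finally show "nn_integral (distr P A al) (%a. cond_cdf P A al Y q a) < \<infinity>" .
fix C assume "C:sets (distr P A al)"
hence [measurable]: "C:sets A" by simp
show "nn_integral (distr P A al) (%a. cond_cdf P A al X p a*ind C a) <= nn_integral (distr P A al) (%a. cond_cdf P A al Y q a*ind C a)"
 by(simp add:cond_cdf) (intro emeasure_mono_AE, use le in auto)
qed auto

lemma AE_proper_cdf:
assumes X[measurable]: "X:bmeas P"
shows "AE a in distr P A al. proper_cdf (cond_cdf P A al X) a"
proof -
let ?f = "cond_cdf P A al X"
let ?S = "%a. SUP k::nat. ?f (of_rat (of_nat k)) a" and ?T = "%a. INF k::nat. ?f (of_rat (- of_nat k)) a"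
let ?sg = "distr P A al"
have fint: "nn_integral ?sg (%a. ?f q a) = em P {om:space P. X om <= q}" for q
proof -
 have "nn_integral ?sg (%a. ?f q a) = nn_integral ?sg (%a. ?f q a*ind (space A) a)"
  by(intro nn_integral_cong) auto
 also have "... = em P {om:space P. al om:space A & X om <= q}" by(rule cond_cdf) auto
 also have "{om:space P. al om:space A & X om <= q} = {om:space P. X om <= q}"
  using measurable_space[OF al] by auto
 finally show ?thesis .
qed
have "AE a in ?sg. ALL p q::rat. p <= q --> ?f (of_rat p) a <= ?f (of_rat q) a"
 unfolding AE_all_countable
proof (intro allI)
 fix p q :: rat
 show "AE a in ?sg. p <= q --> ?f (of_rat p) a <= ?f (of_rat q) a"
 proof (cases "p <= q")
  case True
  hence "real_of_rat p <= of_rat q" by(simp add:of_rat_less_eq)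
  hence "AE a in ?sg. ?f (of_rat p) a <= ?f (of_rat q) a"
   by(intro cond_cdf_le) auto
  thus ?thesis by auto
 qed simp
qed
moreover have le1: "AE a in ?sg. ALL q::rat. ?f (of_rat q) a <= 1"
 unfolding AE_all_countable
proof
 fix q :: rat
 show "AE a in ?sg. ?f (of_rat q) a <= 1"
 proof (rule AE_le_of_nn_integral_le)
  fix C assume "C:sets ?sg"
  hence [measurable]: "C:sets A" by simp
  have "em P {om:space P. al om:C & X om <= of_rat q} <= em P (al -` C Int space P)"
   by(intro emeasure_mono) auto
  thus "nn_integral ?sg (%a. ?f (of_rat q) a*ind C a) <= nn_integral ?sg (%a. 1*ind C a)"
   by(simp add:cond_cdf emeasure_distr)
 qed (auto simp:sg.emeasure_space_1[simplified])
qed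
moreover have "AE a in ?sg. 1 <= ?S a"
proof (rule AE_le_of_nn_integral_le)
 have "nn_integral ?sg (%a. ?S a) <= nn_integral ?sg (%a. 1)"
 proof (rule nn_integral_mono_AE)
  show "AE a in ?sg. ?S a <= 1"
   using le1 by eventually_elim (rule SUP_least, blast)
 qed
 also have "... < \<infinity>" by(simp add:sg.emeasure_space_1[simplified])
 finally show "nn_integral ?sg (%a. ?S a) < \<infinity>" .
 fix C assume "C:sets ?sg"
 hence [measurable]: "C:sets A" by simp
 let ?D = "%k::nat. {om:space P. al om:C & X om <= real k}"
 have "(SUP k. em P (?D k)) = em P (\<Union>k. ?D k)"
  by(intro SUP_emeasure_incseq) (auto simp:incseq_def intro:order_trans)
 also have "(\<Union>k. ?D k) = al -` C Int space P" using real_arch_simple by auto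
 finally have "nn_integral ?sg (%a. 1*ind C a) = (SUP k. em P (?D k))" by(simp add:emeasure_distr)
 also have "... <= nn_integral ?sg (%a. ?S a*ind C a)"
 proof (rule SUP_least)
  fix k :: nat
  have "em P (?D k) = nn_integral ?sg (%a. ?f (of_rat (of_nat k)) a*ind C a)"
   by(subst cond_cdf) auto
  also have "... <= nn_integral ?sg (%a. ?S a*ind C a)"
   by(intro nn_integral_mono mult_right_mono SUP_upper) auto
  finally show "em P (?D k) <= nn_integral ?sg (%a. ?S a*ind C a)" .
 qed
 finally show "nn_integral ?sg (%a. 1*ind C a) <= nn_integral ?sg (%a. ?S a*ind C a)" .
qed auto
moreover have "AE a in ?sg. ?T a = 0"
proof -
 let ?D = "%k::nat. {om:space P. X om <= - real k}"
 have "nn_integral ?sg (%a. ?T a) <= (INF k::nat. em P (?D k))"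
 proof (rule INF_greatest)
  fix k :: nat
  have "nn_integral ?sg (%a. ?T a) <= nn_integral ?sg (%a. ?f (of_rat (- of_nat k)) a)"
   by(intro nn_integral_mono INF_lower) simp
  also have "... = em P (?D k)" by(simp add:fint of_rat_minus)
  finally show "nn_integral ?sg (%a. ?T a) <= em P (?D k)" .
 qed
 also have "... = em P (\<Inter>k. ?D k)"
  by(intro INF_emeasure_decseq) (auto simp:decseq_def intro:order_trans)
 also have "(\<Inter>k. ?D k) = {}"
 proof -
  have "EX k::nat. ~ x <= - real k" for x :: real
  proof -
   obtain k where "- x < real k" using reals_Archimedean2 by blast
   hence "~ x <= - real k" by linarith
   thus ?thesis by blast
  qed
  thus ?thesis by blast
 qed
 finally have "nn_integral ?sg (%a. ?T a) = 0" by simp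
 thus ?thesis by(subst (asm) nn_integral_0_iff_AE) auto
qed
ultimately show ?thesis
 unfolding proper_cdf_def
proof eventually_elim
 case (elim a)
 have "?S a <= 1" by(rule SUP_least) (use elim in blast)
 thus ?case using elim by(blast intro:antisym)
qed
qed

text \<open>Inverse transform sampling, carried out conditionally. Over \<open>a\<close>, the
  section of the preimage of \<open>C \<times> {..g}\<close> has as its length the infimum of the
  conditional distribution function over the rationals above \<open>g\<close>; integrated over
  \<open>C\<close> this infimum gives the joint probability of \<open>C\<close> and
  \<open>X <= g\<close>.\<close>

lemma distr_quantile:
assumes X[measurable]: "X:bmeas P"
shows "distr (distr P A al OM unif) (A OM borel) (%x. (fst x, quantile (cond_cdf P A al X) (fst x) (snd x)))
  = distr P (A OM borel) (%om. (al om, X om))"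
 (is "?L = ?R")
proof -
let ?f = "cond_cdf P A al X"
let ?sg = "distr P A al"
interpret unif: prob_space unif by(rule prob_space_unif)
let ?q = "%x. (fst x, quantile ?f (fst x) (snd x))"
interpret pr: pair_prob_space ?sg unif ..
note [measurable] = measurable_quantile[OF measurable_cond_cdf[of X]]
have qm[measurable]: "?q:?sg OM unif ->M A OM borel"
 using measurable_quantile[OF measurable_cond_cdf[of X]] by(intro measurable_Pair) (auto cong: measurable_cong_sets)
let ?E = "{C \<times> {..g} | C g. C:sets A & g:(UNIV::real set)}"
have rect: "em ?L (C \<times> {..g}) = em ?R (C \<times> {..g})" if C[measurable]: "C:sets A" for C g
proof -
 let ?V = "?q -` (C \<times> {..g}) Int space (?sg OM unif)"
 let ?I = "%a. INF q\<in>{q::rat. g < of_rat q}. ?f (of_rat q) a"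
 have "em ?L (C \<times> {..g}) = em (?sg OM unif) ?V"
  by(rule emeasure_distr) auto
 also have "... = nn_integral ?sg (%a. em unif (Pair a -` ?V))"
  by(rule unif.emeasure_pair_measure_alt) measurable
 also have "... = nn_integral ?sg (%a. ?I a*ind C a)"
 proof (rule nn_integral_cong_AE)
  show "AE a in ?sg. em unif (Pair a -` ?V)
   = ?I a*ind C a"
   using AE_proper_cdf[OF X] AE_space
  proof eventually_elim
   case (elim a)
   show ?case
   proof (cases "a:C")
    case True
    define v where "v = ?I a"
    obtain q0 :: rat where q0: "g < of_rat q0" using of_rat_dense[of g "g+1"] by auto
    have "v <= ?f (of_rat q0) a" unfolding v_def by(intro INF_lower) (use q0 in simp)
    also have "... <= 1" using elim by(simp add:proper_cdf_def)
    finally have "v <= 1" .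
    then obtain r where r: "v = ennreal r" "0 <= r" "r <= 1" by(cases v) (auto simp:top_unique)
    have "Pair a -` ?V
      = {u. quantile ?f a u <= g}"
     using True elim by(auto simp:space_pair_measure)
    moreover have mq: "{u. quantile ?f a u <= g}:sets borel"
     using measurable_Pair2[OF measurable_quantile[OF measurable_cond_cdf[of X]], of a] elim by simp
    ultimately have "em unif (Pair a -` ?V)
      = em lborel ({u. quantile ?f a u <= g} Int {0<..<1})" by(simp add:emeasure_unif)
    also have "{u. quantile ?f a u <= g} Int {0<..<1} = {u. 0 < u & u < 1 & u <= r}"
    proof -
     have "quantile ?f a u <= g <-> u <= r" if u: "0 < u" "u < 1" for u
     proof -
      have "quantile ?f a u <= g <-> ennreal u <= v"
       using quantile_le_iff[OF elim(1) u] by(auto simp:v_def le_INF_iff)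
      thus ?thesis using r u by simp
     qed
     thus ?thesis by auto
    qed
    also have "em lborel {u. 0 < u & u < 1 & u <= r} = ennreal r"
    proof (cases "r = 1")
     case True
     hence "{u. 0 < u & u < 1 & u <= r} = {0<..<1}" by auto
     thus ?thesis using True by simp
    next
     case False
     hence "{u. 0 < u & u < 1 & u <= r} = {0<..r}" using r by auto
     thus ?thesis using r by simp
    qed
    finally show ?thesis using True r v_def by simp
   next
    case False
    hence "Pair a -` ?V = {}" by auto
    thus ?thesis using False by simp
   qed
  qed
 qed
 also have "... = em P {om:space P. al om:C & X om <= g}"
 proof (rule antisym)
  let ?D = "%k::nat. {om:space P. al om:C & X om <= g+1/real (Suc k)}"
  have "nn_integral ?sg (%a. ?I a*ind C a) <= (INF k. em P (?D k))"
  proof (rule INF_greatest)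
   fix k
   obtain q :: rat where q: "g < of_rat q" "of_rat q < g+1/real (Suc k)"
    using of_rat_dense[of g "g+1/real (Suc k)"] by auto
   have "nn_integral ?sg (%a. ?I a*ind C a) <= nn_integral ?sg (%a. ?f (of_rat q) a*ind C a)"
    by(intro nn_integral_mono mult_right_mono INF_lower) (use q in auto)
   also have "... = em P {om:space P. al om:C & X om <= of_rat q}" by(rule cond_cdf) auto
   also have "... <= em P (?D k)" by(intro emeasure_mono) (use q in auto)
   finally show "nn_integral ?sg (%a. ?I a*ind C a) <= em P (?D k)" .
  qed
  also have "... = em P (\<Inter>k. ?D k)"
  proof (rule INF_emeasure_decseq)
   show "decseq ?D"
   proof (rule decseq_SucI)
    fix k
    have "1/real (Suc (Suc k)) <= 1/real (Suc k)" by(intro divide_left_mono) auto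
    thus "?D (Suc k) <= ?D k" by(auto simp del:of_nat_Suc)
   qed
  qed auto
  also have "(\<Inter>k. ?D k) = {om:space P. al om:C & X om <= g}"
  proof -
   have "x <= g" if "!!k. x <= g+1/real (Suc k)" for x
    using LIMSEQ_le_const[OF tendsto_add[OF tendsto_const LIMSEQ_Suc[OF lim_1_over_n]], of x g] that by auto
   moreover have "x <= g+1/real (Suc k)" if "x <= g" for x k
    using that by(rule order_trans) simp
   ultimately show ?thesis by blast
  qed
  finally show "nn_integral ?sg (%a. ?I a*ind C a)
    <= em P {om:space P. al om:C & X om <= g}" .
  \<comment> \<open>For the lower bound, the infimum is compared with the conditional distribution
    function at the real level \<open>g\<close> itself, which it dominates almost
    everywhere.\<close>
  have "AE a in ?sg. ALL q::rat. g < of_rat q --> ?f g a <= ?f (of_rat q) a"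
   unfolding AE_all_countable
  proof
   fix q :: rat
   show "AE a in ?sg. g < of_rat q --> ?f g a <= ?f (of_rat q) a"
   proof (cases "g < of_rat q")
    case True
    hence "AE a in ?sg. ?f g a <= ?f (of_rat q) a" by(intro cond_cdf_le) auto
    thus ?thesis by auto
   qed simp
  qed
  hence "AE a in ?sg. ?f g a*ind C a <= ?I a*ind C a"
   by eventually_elim (auto intro!:mult_right_mono INF_greatest)
  hence "nn_integral ?sg (%a. ?f g a*ind C a) <= nn_integral ?sg (%a. ?I a*ind C a)"
   by(rule nn_integral_mono_AE)
  thus "em P {om:space P. al om:C & X om <= g} <=
    nn_integral ?sg (%a. ?I a*ind C a)"
   by(simp add:cond_cdf)
 qed
 also have "... = em ?R (C \<times> {..g})"
  by(subst emeasure_distr) (auto intro!:arg_cong[where f = "em P"])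
 finally show ?thesis .
qed
have sets: "sets (A OM borel) = sigma_sets (space A \<times> UNIV) ?E"
proof -
 have "sets (A OM (borel::real measure)) = sets (sigma (space A) (sets A) OM sigma UNIV (range atMost))"
 proof (rule sets_pair_measure_cong)
  show "sets A = sets (sigma (space A) (sets A))" by simp
  show "sets borel = sets (sigma UNIV (range atMost :: real set set))" by(subst borel_eq_atMost) (rule refl)
 qed
 also have "... = sets (sigma (space A \<times> UNIV) {a \<times> b | a b. a:sets A & b:range (atMost :: real => real set)})"
 proof (rule arg_cong[where f = sets], rule sigma_prod)
  show "EX E<=sets A. countable E & space A = \<Union>E" by(rule exI[of _ "{space A}"]) auto
  show "sets A <= Pow (space A)" by(rule sets.space_closed)
  have "UNIV = (\<Union>k::nat. {..real k})" using real_arch_simple by auto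
  thus "EX E<=range atMost. countable E & (UNIV::real set) = \<Union>E"
   by(intro exI[of _ "range (%k::nat. {..real k})"]) auto
 qed simp
 also have "{a \<times> b | a b. a:sets A & b:range (atMost :: real => real set)} = ?E" by auto
 also have "sets (sigma (space A \<times> UNIV) ?E) = sigma_sets (space A \<times> UNIV) ?E"
  using sets.sets_into_space by(intro sets_measure_of) fastforce
 finally show ?thesis .
qed
show ?thesis
proof (rule measure_eqI_generator_eq[where E = ?E and \<Omega> = "space A \<times> UNIV" and A = "%k::nat. space A \<times> {..real k}"])
 show "Int_stable ?E"
 proof (rule Int_stableI)
  fix a b assume "a:?E" "b:?E"
  then obtain C g D h where ab: "a = C \<times> {..g}" "b = D \<times> {..h}" "C:sets A" "D:sets A" by auto
  have "a Int b = (C Int D) \<times> {..min g h}" unfolding ab(1,2) by auto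
  thus "a Int b:?E" using ab(3,4) by blast
 qed
 show "?E <= Pow (space A \<times> UNIV)" using sets.sets_into_space by fastforce
 show "em ?L X = em ?R X" if "X:?E" for X using that rect by auto
 show "sets ?L = sigma_sets (space A \<times> UNIV) ?E" "sets ?R = sigma_sets (space A \<times> UNIV) ?E"
  using sets by simp_all
 show "range (%k::nat. space A \<times> {..real k}) <= ?E" by auto
 show "(\<Union>k::nat. space A \<times> {..real k}) = space A \<times> UNIV" using real_arch_simple by auto
 have "prob_space ?L" by(rule pr.prob_space_distr) measurable
 thus "em ?L (space A \<times> {..real k}) ~= \<infinity>" for k
  using prob_space.axioms(1) finite_measure.emeasure_finite by fastforce
qed
qed

text \<open>One uniform variable is fed into both conditional quantile functions. This retains the
  two joint laws with \<open>al\<close>, makes both points monotone in the same parameter, and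
  respects the order, because \<open>X <= Y\<close> reverses the order of the distribution
  functions.\<close>

theorem conditional_monotone_coupling:
assumes X[measurable]: "X:bmeas P" and Y[measurable]: "Y:bmeas P"
 and le: "AE om in P. X om <= Y om"
shows "EX x y. (%p. x (fst p) (snd p)):bmeas (A OM borel) &
  (%p. y (fst p) (snd p)):bmeas (A OM borel) &
  (ALL a u v. 0 < u & u <= v & v < 1 --> x a u <= x a v & y a u <= (y a v :: real)) &
  (AE a in distr P A al. ALL u. 0 < u & u < 1 --> x a u <= (y a u :: real)) &
  distr (distr P A al OM unif) (A OM borel) (%p. (fst p, x (fst p) (snd p))) = distr P (A OM borel) (%om. (al om, X om)) &
  distr (distr P A al OM unif) (A OM borel) (%p. (fst p, y (fst p) (snd p))) = distr P (A OM borel) (%om. (al om, Y om))"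
proof (rule exI[of _ "quantile (cond_cdf P A al X)"], rule exI[of _ "quantile (cond_cdf P A al Y)"], intro conjI)
have "AE a in distr P A al. ALL q::rat. cond_cdf P A al Y (of_rat q) a <= cond_cdf P A al X (of_rat q) a"
 unfolding AE_all_countable
 by(intro allI cond_cdf_le) (use le in auto)
thus "AE a in distr P A al. ALL u. 0 < u & u < 1 -->
  quantile (cond_cdf P A al X) a u <= quantile (cond_cdf P A al Y) a u"
 using AE_proper_cdf[OF X] AE_proper_cdf[OF Y]
 by eventually_elim (auto intro!:quantile_le)
qed (use quantile_mono in "auto intro!:measurable_quantile measurable_cond_cdf distr_quantile")

end

section \<open>Disintegration along rays\<close>

locale ray_measure = null_rays le H G
for le :: "'a::{heine_borel,polish_space} => 'a => bool" and H :: "'a set" and G :: "'a => real" +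
fixes m :: "'a measure" and QQ :: "'a => 'a" and qq :: "'a measure" and ma :: "'a => 'a measure"
assumes radon: "radon_measure_on H m" and dis: "ray_disintegration le H m QQ qq ma"
begin

abbreviation "mq == completion qq"

lemma sets_m [measurable_cong]: "sets m = sets (borel_on H)"
using radon by(simp add:radon_measure_on_def)

lemma space_m [simp]: "space m = H"
using sets_eq_imp_space_eq[OF sets_m] by(simp add:space_restrict_space)

lemma m_iff: "B:sets m <-> B:sets borel & B <= H"
unfolding sets_m by(subst sets_restrict_space_iff) auto

lemma m_compact: "compact K ==> K <= H ==> em m K < \<infinity>"
using radon by(simp add:radon_measure_on_def)

lemma m_inner: "A:sets m ==> c < em m A ==> EX K. compact K & K <= A & c < em m K"
using radon unfolding radon_measure_on_def by(auto simp:less_SUP_iff)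

lemma H_ball: "compact (H Int cball undefined r)"
by(simp add:closed_H closed_Int_compact)

lemma sigma_finite_m: "sigma_finite_measure m"
proof
have "(\<Union>n::nat. H Int cball undefined (real n)) = H"
 using real_arch_simple by auto
moreover have "H Int cball undefined r:sets m" "em m (H Int cball undefined r) ~= \<infinity>" for r
 using m_compact[OF H_ball, of r] by(auto simp:m_iff)
ultimately show "EX A. countable A & A <= sets m & \<Union> A = space m & (ALL a:A. em m a ~= \<infinity>)"
 by(intro exI[of _ "range (%n::nat. H Int cball undefined (real n))"]) auto
qed

sublocale m: sigma_finite_measure m by(rule sigma_finite_m)

lemma Hi_m: "Hi:sets m" using Hi_subset by(simp add:m_iff)

lemma dis_parts:
shows QQ_fun: "QQ:Hi \<rightarrow> Hi"
 and QQ_rel': "ALL x:Hi. causally_related le H x (QQ x)"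
 and QQ_eq': "ALL x:Hi. ALL y:Hi. QQ x = QQ y <-> causally_related le H x y"
 and sets_qq: "sets qq = sets (borel_on (QQ ` Hi))"
 and prob_qq': "Hi ~= {} --> prob_space qq"
 and null_qq': "ALL C:null_sets qq. {x:Hi. QQ x:C}:null_sets (completion m)"
 and sets_ma': "ALL al:QQ ` Hi. sets (ma al) = sets (borel_on H)"
 and measurable_ma': "ALL B:sets (completion m).
   (%al. em (completion (ma al)) B):bmeas (completion qq)"
 and AE_ma: "AE al in qq. AE x in ma al. x:Hi & QQ x = al"
 and formula': "ALL B:sets (completion m). ALL C:sets (completion qq). B <= Hi -->
   em (completion m) {x:B. QQ x:C} =
    (\<integral>\<^sup>+al\<in>C. em (completion (ma al)) B \<partial>completion qq)"
 and ma_compact': "ALL K. compact K & K <= H --> (EX c>0. AE al in qq. em (ma al) K <= ennreal c)"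
by -(insert dis[unfolded ray_disintegration_def ray_quotient_map_def], (elim conjE, assumption)+)

lemmas QQ_in = funcset_mem[OF QQ_fun]
and QQ_rel = bspec[OF QQ_rel']
and QQ_eq = bspec[OF bspec[OF QQ_eq']]
and prob_qq = mp[OF prob_qq']
and null_qq = bspec[OF null_qq']
and sets_ma = bspec[OF sets_ma']

lemma ma_compact: "compact K ==> K <= H ==> EX c>0. AE al in qq. em (ma al) K <= ennreal c"
using ma_compact' by simp

lemma space_qq [simp]: "space qq = QQ ` Hi"
using sets_eq_imp_space_eq[OF sets_qq] by(simp add:space_restrict_space)

lemma space_ma: "al:QQ ` Hi ==> space (ma al) = H"
using sets_eq_imp_space_eq[OF sets_ma] by(simp add:space_restrict_space)

lemma sets_ma_iff: "al:QQ ` Hi ==> B:sets (ma al) <-> B:sets m"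
by(simp add:sets_ma sets_m)

lemma Q_Hi: "al:QQ ` Hi ==> al:Hi" using QQ_in by auto

lemma QQ_iff: "x:Hi ==> al:QQ ` Hi ==> QQ x = al <-> x:OpR al"
proof -
assume x: "x:Hi" and a: "al:QQ ` Hi"
then obtain y where y: "y:Hi" "al = QQ y" by auto
have "QQ al = QQ y" using QQ_eq[OF Q_Hi[OF a] y(1)] QQ_rel[OF y(1)] y(2) by(auto simp:causally_related_def)
hence "QQ x = al <-> QQ x = QQ al" using y by simp
also have "... <-> x:OpR al" using QQ_eq[OF x Q_Hi[OF a]] x by(simp add:open_ray_def)
finally show ?thesis .
qed

lemma QQ_self: "x:Hi ==> x:OpR (QQ x)" using QQ_iff[of x "QQ x"] by auto

lemma QQ_cong: "x:Hi ==> y:Hi ==> y:Ry x ==> QQ y = QQ x"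
using QQ_eq[of y x] Hi_subset by(auto simp:in_ray_iff causally_related_def)

lemma measurable_ma_completion:
assumes "B:sets m" shows "(%al. em (ma al) B):bmeas mq"
proof -
have "(%al. em (completion (ma al)) B):bmeas mq"
 by(rule bspec[OF measurable_ma']) (use assms in simp)
thus ?thesis
 by(rule measurable_cong[THEN iffD1, rotated]) (use assms sets_ma_iff in auto)
qed

lemma AE_qq_iff: "(AE al in mq. P al) <-> (AE al in qq. P al)" by(rule AE_completion_iff)

lemma fibre_formula0:
assumes "B:sets m" "B <= Hi" "C:sets mq"
shows "em (completion m) {x:B. QQ x:C} = nn_integral mq (%al. em (ma al) B*ind C al)"
proof -
have "em (completion m) {x:B. QQ x:C} = (\<integral>\<^sup>+al\<in>C. em (completion (ma al)) B \<partial>mq)"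
 using bspec[OF bspec[OF formula' sets_completionI_sets[OF assms(1)]] assms(3)] assms(2) by simp
also have "... = nn_integral mq (%al. em (ma al) B*ind C al)"
 by(rule nn_integral_cong) (use assms sets_ma_iff in auto)
finally show ?thesis .
qed

text \<open>A set that is not measurable has \<open>emeasure\<close> 0.  If a fibre were not measurable, then neither would
be its complement in \<open>B\<close>; by the disintegration formula \<open>B\<close> would then be a null set.\<close>

lemma fibre_measurable:
assumes B: "B:sets m" "B <= Hi" and C: "C:sets mq"
shows "{x:B. QQ x:C}:sets (completion m)"
proof (rule ccontr)
let ?D = "space mq - C"
assume n: "{x:B. QQ x:C} ~: sets (completion m)"
have "{x:B. QQ x:C} = B - {x:B. QQ x:?D}" using B by auto
have n': "{x:B. QQ x:?D} ~: sets (completion m)"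
proof
 assume "{x:B. QQ x:?D}:sets (completion m)"
 hence "B - {x:B. QQ x:?D}:sets (completion m)" by(rule sets.Diff[OF sets_completionI_sets[OF B(1)]])
 thus False using n \<open>{x:B. QQ x:C} = B - {x:B. QQ x:?D}\<close> by simp
qed
have "nn_integral mq (%al. em (ma al) B*ind C al) = 0" "nn_integral mq (%al. em (ma al) B*ind ?D al) = 0"
 using fibre_formula0[OF B C] fibre_formula0[OF B sets.compl_sets[OF C]] n n'
 by(simp_all add:emeasure_notin_sets)
moreover have [measurable]: "(%al. em (ma al) B):bmeas mq" "C:sets mq"
 using measurable_ma_completion B C by auto
moreover have "(%al. em (ma al) B*ind ?D al):bmeas mq"
 using C by(intro borel_measurable_times_ennreal measurable_ma_completion[OF B(1)] borel_measurable_indicator sets.compl_sets)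
ultimately have "nn_integral mq (%al. em (ma al) B*ind C al+em (ma al) B*ind ?D al) = 0"
 by(subst nn_integral_add) auto
also have "nn_integral mq (%al. em (ma al) B*ind C al+em (ma al) B*ind ?D al) =
  nn_integral mq (%al. em (ma al) B*ind (space mq) al)"
 by(rule nn_integral_cong) (auto split:split_indicator)
also have "... = em (completion m) {x:B. QQ x:space mq}" by(rule fibre_formula0[symmetric, OF B sets.top])
also have "{x:B. QQ x:space mq} = B" using B by auto
finally have "B:null_sets m" using B by auto
hence "{x:B. QQ x:C}:sets (completion m)" by(intro null_sets_completion) auto
thus False using n by blast
qed

text \<open>Preimages under \<open>QQ\<close> are measurable for the completion only; this lemma and
  \<open>fibre_outer\<close> replace them by members of \<open>sets m\<close> of the same
  measure.\<close>

lemma fibre_inner: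
assumes "B:sets m" "B <= Hi" "C:sets mq"
shows "EX E:sets m. E <= {x:B. QQ x:C} & em m E = nn_integral mq (%al. em (ma al) B*ind C al)"
proof (intro bexI conjI)
note F = fibre_measurable[OF assms]
let ?E = "main_part m {x:B. QQ x:C}"
show "?E:sets m" using F by simp
show "?E <= {x:B. QQ x:C}" using main_part_null_part_Un[OF F] by blast
show "em m ?E = nn_integral mq (%al. em (ma al) B*ind C al)"
 using F fibre_formula0[OF assms] by simp
qed

lemma fibre_outer:
assumes "B:sets m" "B <= Hi" "C:sets mq"
shows "EX E:sets m. {x:B. QQ x:C} <= E & em m E = nn_integral mq (%al. em (ma al) B*ind C al)"
proof -
note F = fibre_measurable[OF assms]
obtain E where "{x:B. QQ x:C} <= E" "E:sets m" "em (completion m) {x:B. QQ x:C} = em m E"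
 by(rule completion_upper[OF F]) (rule that, assumption+)
thus ?thesis unfolding fibre_formula0[OF assms] by(intro bexI[of _ E]) simp_all
qed

text \<open>The almost everywhere properties of conditional measures, collected for work on a single
  ray. Balls around one point are enough for local finiteness, since closed balls are
  compact.\<close>

definition good :: "'a => bool" where
"good al <-> al:QQ ` Hi & (AE x in ma al. x:OpR al) & (ALL n::nat. em (ma al) (H Int cball undefined (real n)) < \<infinity>)"

lemma AE_good: "AE al in qq. good al"
proof -
have "AE al in qq. em (ma al) (H Int cball undefined (real n)) < \<infinity>" for n :: nat
proof -
 obtain c where "AE al in qq. em (ma al) (H Int cball undefined (real n)) <= ennreal c"
  using ma_compact[OF H_ball] by blast
 thus ?thesis by eventually_elim (simp add:le_less_trans)
qed
hence "AE al in qq. ALL n::nat. em (ma al) (H Int cball undefined (real n)) < \<infinity>"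
 by(subst AE_all_countable) blast
moreover have "AE al in qq. al:QQ ` Hi" using AE_space[of qq] by simp
ultimately show ?thesis using AE_ma
proof eventually_elim
 case (elim al)
 have "AE x in ma al. x:OpR al" using elim(3) by eventually_elim (use elim(2) QQ_iff in auto)
 thus ?case using elim by(simp add:good_def)
qed
qed

lemma goodD: "good al ==> al:QQ ` Hi" "good al ==> al:Hi" "good al ==> AE x in ma al. x:OpR al"
using Q_Hi by(auto simp:good_def)

text \<open>The conditional measure in gauge coordinates; \<open>ma_eq\<close> recovers
  \<open>ma\<close> from it.\<close>

definition lam :: "'a => real measure" where "lam al = distr (ma al) borel Gb"

lemma sets_lam [simp, measurable_cong]: "sets (lam al) = sets borel" by(simp add:lam_def)

lemma slab_m [measurable]: "S:sets borel ==> {x:Hi. Gb x:S}:sets m"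
proof -
assume [measurable]: "S:sets borel"
have "{x. x:Hi & Gb x:S}:sets borel" by measurable
thus ?thesis using Hi_subset by(auto simp:m_iff)
qed

lemma lam_eq:
assumes g: "good al" and S: "S:sets borel"
shows "em (lam al) S = em (ma al) {x:Hi. Gb x:S}"
proof -
have Gm: "Gb:bmeas (ma al)"
 by(subst measurable_cong_sets[OF sets_ma[OF goodD(1)[OF g]] refl]) (rule measurable_restrict_space1[OF Gb_measurable])
have "em (lam al) S = em (ma al) (Gb -` S Int space (ma al))"
 unfolding lam_def using Gm S by(rule emeasure_distr)
also have "... = em (ma al) {x:Hi. Gb x:S}"
proof (rule emeasure_eq_AE)
 show "AE x in ma al. x:Gb -` S Int space (ma al) <-> x:{x:Hi. Gb x:S}"
  using goodD(3)[OF g] AE_space by eventually_elim (auto dest:OR_D)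
 show "Gb -` S Int space (ma al):sets (ma al)" using Gm S by(rule measurable_sets)
 show "{x:Hi. Gb x:S}:sets (ma al)" using slab_m[OF S] sets_ma_iff goodD(1)[OF g] by blast
qed
finally show ?thesis .
qed

lemma J_borel [measurable]: "c:Hi ==> J c:sets borel" using J_open by simp

lemma PT_preimage_borel:
assumes c: "c:Hi" and B: "B:sets m"
shows "{g:J c. PT c g:B}:sets borel"
proof -
have [measurable]: "B:sets borel" "J c:sets borel" using B c by(auto simp:m_iff)
have "{g:J c. PT c g:B} = {g. g:J c & PB (c, g):B}"
 using J_subset_IA c by(auto simp:PB_def IA_pairs_def)
also have "... : sets borel" by measurable
finally show ?thesis .
qed

lemma ma_eq:
assumes g: "good al" and B: "B:sets m"
shows "em (ma al) B = em (lam al) {g:J al. PT al g:B}"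
unfolding lam_eq[OF g PT_preimage_borel[OF goodD(2)[OF g] B]]
proof (rule emeasure_eq_AE)
show "AE x in ma al. x:B <-> x:{x:Hi. Gb x:{g:J al. PT al g:B}}"
 using goodD(3)[OF g]
proof eventually_elim
 case (elim x)
 thus ?case using PT_G[OF goodD(2)[OF g] elim] OR_D(2)[OF elim] by(auto simp:Gb_def J_def)
qed
show "B:sets (ma al)" "{x:Hi. Gb x:{g:J al. PT al g:B}}:sets (ma al)"
 using sets_ma_iff[OF goodD(1)[OF g]] slab_m[OF PT_preimage_borel[OF goodD(2)[OF g] B]] B by auto
qed

lemma lam_J:
assumes g: "good al" and S: "S:sets borel"
shows "em (lam al) (S Int J al) = em (lam al) S"
proof -
have SJ: "S Int J al:sets borel" using S J_borel goodD(2)[OF g] by blast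
show ?thesis unfolding lam_eq[OF g S] lam_eq[OF g SJ]
proof (rule emeasure_eq_AE)
 show "AE x in ma al. x:{x:Hi. Gb x:S Int J al} <-> x:{x:Hi. Gb x:S}"
  using goodD(3)[OF g] by eventually_elim (auto dest:OR_D simp:Gb_def J_def)
qed (use sets_ma_iff[OF goodD(1)[OF g]] slab_m[OF S] slab_m[OF SJ] in auto)
qed

text \<open>The part of the ray with coordinates in \<open>{a..b}\<close> is compact and so inside a
  ball of finite conditional mass; \<open>a\<close> and \<open>b\<close> may be the coordinates of
  end-points.\<close>

lemma lam_compact:
assumes g: "good al" and ab: "a:IA al" "b:IA al"
shows "em (lam al) {a..b} < \<infinity>"
proof -
note h = goodD(2)[OF g]
have sub: "{a..b} <= IA al" by(intro subsetI mem_is_interval_1_I[OF IA_interval[OF h] ab]) auto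
have "compact (PT al ` {a..b})"
 by(intro compact_continuous_image continuous_on_subset[OF PT_continuous[OF h] sub]) auto
hence "bounded (PT al ` {a..b})" by(rule compact_imp_bounded)
then obtain r where r: "ALL x:PT al ` {a..b}. dist undefined x <= r" unfolding bounded_any_center[of _ undefined] by(rule exE)
obtain n :: nat where "r <= real n" using real_arch_simple by blast
have n: "PT al ` {a..b} <= cball undefined (real n)"
proof
 fix x assume "x:PT al ` {a..b}"
 hence "dist undefined x <= r" using r by blast
 thus "x:cball undefined (real n)" using \<open>r <= real n\<close> by simp
qed
have "em (lam al) {a..b} = em (ma al) {x:Hi. Gb x:{a..b}}" by(rule lam_eq[OF g]) simp
also have "... <= em (ma al) (H Int cball undefined (real n))"
proof (rule emeasure_mono_AE)
 show "AE x in ma al. x:{x:Hi. Gb x:{a..b}} --> x:H Int cball undefined (real n)"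
  using goodD(3)[OF g]
 proof eventually_elim
  case (elim x)
  have "x:PT al ` {a..b}" if "Gb x:{a..b}"
   using that PT_G[OF h elim] OR_D(2)[OF elim] by(intro image_eqI[of _ _ "G x"]) (auto simp:Gb_def)
  thus ?case using n OR_D(3)[OF elim] by blast
 qed
 show "H Int cball undefined (real n):sets (ma al)" using sets_ma_iff[OF goodD(1)[OF g]] by(auto simp:m_iff)
qed
also have "... < \<infinity>" using g by(simp add:good_def)
finally show ?thesis .
qed

lemma measurable_lam:
assumes S: "S:sets borel" shows "(%al. em (lam al) S):bmeas mq"
proof -
have Gm: "Gb:bmeas (borel_on H)" by(rule measurable_restrict_space1[OF Gb_measurable])
hence m: "Gb -` S Int H:sets m"
 using measurable_sets[OF Gm S] by(simp add:space_restrict_space sets_m Int_commute)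
have "em (lam al) S = em (ma al) (Gb -` S Int H)" if a: "al:QQ ` Hi" for al
proof -
 have "Gb:bmeas (ma al)" using Gm by(simp add:measurable_cong_sets[OF sets_ma[OF a] refl])
 thus ?thesis unfolding lam_def using S a by(subst emeasure_distr) (auto simp:space_ma)
qed
thus ?thesis using measurable_ma_completion[OF m] by(subst measurable_cong) auto
qed

lemma slab_formula:
assumes S: "S:sets borel"
shows "nn_integral mq (%al. em (ma al) {x:Hi. Gb x:S}*ind C al) = nn_integral mq (%al. em (lam al) S*ind C al)"
proof (rule nn_integral_cong_AE)
show "AE al in mq. em (ma al) {x:Hi. Gb x:S}*ind C al = em (lam al) S*ind C al"
 unfolding AE_qq_iff using AE_good by eventually_elim (simp add:lam_eq S)
qed

end

section \<open>Consequences of the null energy condition\<close>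

text \<open>Selections from the compact pieces are glued by using the first piece whose projection
  contains \<open>x\<close>.\<close>

lemma sigma_compact_selection:
fixes S :: "nat => ('a::metric_space \<times> 'b::{heine_borel,second_countable_topology}) set"
assumes S: "!!k. compact (S k)"
shows "EX f:bmeas borel. ALL k. ALL x:fst ` S k. EX k. (x, f x):S k"
proof -
have "ALL k. EX f. f:bmeas borel & (ALL x:fst ` S k. (x, f x):S k)"
proof
 fix k
 obtain f where "f:bmeas borel" "!!x. x:fst ` S k ==> (x, f x):S k"
  by(rule compact_selection[OF S]) (rule that, assumption+)
 thus "EX f. f:bmeas borel & (ALL x:fst ` S k. (x, f x):S k)" by blast
qed
from choice[OF this] obtain f where f: "!!k. f k:bmeas borel" "!!k x. x:fst ` S k ==> (x, f k x):S k"
 by blast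
have [measurable]: "fst ` S k:sets borel" for k
 using S by(simp add:compact_continuous_image continuous_on_fst compact_imp_closed borel_closed)
define g where "g x = f (LEAST k. x:fst ` S k) x" for x
have "g:bmeas borel"
 unfolding g_def by(rule measurable_compose_countable[OF f(1)]) measurable
moreover have "(x, g x):S (LEAST k. x:fst ` S k)" if "x:fst ` S k" for x k
 unfolding g_def by(rule f(2)) (rule LeastI[of "%k. x:fst ` S k", OF that])
ultimately show ?thesis by blast
qed

lemma le_pairs_measurable:
fixes le :: "'a::{second_countable_topology,metric_space} => 'a => bool"
assumes le: "closed {(x, y). le x y}"
shows "{p:H \<times> H. le (fst p) (snd p)}:sets (borel_on H OM borel_on H)"
proof -
have "fst:borel_on H OM borel_on H ->M borel"
 by(rule measurable_compose[OF measurable_fst]) (simp add:measurable_restrict_space1)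
moreover have "snd:borel_on H OM borel_on H ->M borel"
 by(rule measurable_compose[OF measurable_snd]) (simp add:measurable_restrict_space1)
ultimately have "(%p. (fst p, snd p)):borel_on H OM borel_on H ->M borel"
 by(rule borel_measurable_Pair)
from measurable_sets[OF this borel_closed[OF le]]
have "(%p. (fst p, snd p)) -` {(x, y). le x y} Int H \<times> H:sets (borel_on H OM borel_on H)"
 by(simp add:space_pair_measure space_restrict_space)
moreover have "(%p. (fst p, snd p)) -` {(x, y). le x y} Int H \<times> H = {p:H \<times> H. le (fst p) (snd p)}" by auto
ultimately show ?thesis by simp
qed

text \<open>The form in which the energy condition is used: causally related random points take the
  place of a coupling.\<close>

lemma NCe_plan:
fixes le :: "'a::{heine_borel,polish_space} => 'a => bool"
assumes nce: "NCe le H G m N" and le: "closed {(x, y). le x y}"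
 and P: "prob_space P" and f: "f0:P ->M borel_on H" "f1:P ->M borel_on H" and c: "AE om in P. le (f0 om) (f1 om)"
shows "EX nu:OptGeo le H G (distr P (borel_on H) f0) (distr P (borel_on H) f1). ALL t:{0..1}.
  ennreal (1-t)*Uent (N-1) (distr P (borel_on H) f0) m+ennreal t*Uent (N-1) (distr P (borel_on H) f1) m
   <= Uent (N-1) (curve_marginal H nu t) m"
proof -
interpret P: prob_space P by fact
have ff: "(%om. (f0 om, f1 om)):P ->M borel_on H OM borel_on H" using f by measurable
let ?pr = "distr P (borel_on H OM borel_on H) (%om. (f0 om, f1 om))"
let ?S = "{p:H \<times> H. le (fst p) (snd p)}"
interpret pr: prob_space ?pr by(rule P.prob_space_distr[OF ff])
have "AE om in P. (f0 om, f1 om):?S"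
 using c AE_space by eventually_elim (use measurable_space[OF f(1)] measurable_space[OF f(2)] in "auto simp:space_restrict_space")
hence "AE p in ?pr. p:?S"
 using AE_distr_iff[OF ff, of "%p. p:?S"] le_pairs_measurable[OF le, of H] by(simp add:space_pair_measure space_restrict_space)
hence "em ?pr ?S = 1"
 using le_pairs_measurable[OF le, of H] by(intro pr.emeasure_eq_1_AE) auto
hence "?pr:causal_couplings le H (distr P (borel_on H) f0) (distr P (borel_on H) f1)"
 using f ff pr.prob_space_axioms by(auto simp:causal_couplings_def distr_distr comp_def)
hence ne: "causal_couplings le H (distr P (borel_on H) f0) (distr P (borel_on H) f1) ~= {}" by blast
show ?thesis
 by(intro nce[unfolded NCe_def, THEN spec, THEN spec, THEN mp] conjI P.prob_space_distr f ne) simp_all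
qed

lemma OptGeoD:
assumes "nu:OptGeo le H G mu0 mu1"
shows "sets nu = sets (borel_curves H)" "prob_space nu" "curve_marginal H nu 0 = mu0" "curve_marginal H nu 1 = mu1"
 "AE ga in nu. ga:G_causal_curves le H G"
using assms by(auto simp:OptGeo_def)

lemma curve_eval:
assumes "nu:OptGeo le H G mu0 mu1" "t:{0..1}"
shows "(%ga. ga t):nu ->M borel_on H"
using measurable_curve_eval[OF assms(2), of H] OptGeoD(1)[OF assms(1)] by(simp cong: measurable_cong_sets)

lemma (in prob_space) AE_ex:
assumes "AE om in M. P om" shows "EX om. P om"
proof (rule ccontr)
assume "\<nexists>om. P om"
thus False using AE_contr[OF assms] by simp
qed

text \<open>A plan between the Dirac masses at \<open>x\<close> and \<open>y\<close> is concentrated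
  on \<open>G\<close>-causal curves from \<open>x\<close> to \<open>y\<close>; so there is one, and
  as \<open>x\<close> and \<open>y\<close> differ it is not of the degenerate constant kind.\<close>

lemma weakly_convex_if_NCe:
fixes le :: "'a::{heine_borel,polish_space} => 'a => bool"
assumes nce: "NCe le H G m N" and le: "closed {(x, y). le x y}"
shows "weakly_convex le H"
unfolding weakly_convex_def
proof (intro ballI impI)
fix x y assume xy: "x:H" "y:H" "le x y & x ~= y"
let ?P = "return (count_space UNIV) ()"
interpret P: prob_space ?P by(rule prob_space_return) simp
have "(%_. x):?P ->M borel_on H" "(%_. y):?P ->M borel_on H" using xy by(auto simp:space_restrict_space)
from NCe_plan[OF nce le P.prob_space_axioms this] xy
obtain nu where nu: "nu:OptGeo le H G (distr ?P (borel_on H) (%_. x)) (distr ?P (borel_on H) (%_. y))" by auto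
interpret nu: prob_space nu by(rule OptGeoD(2)[OF nu])
have AE: "AE ga in nu. ga t = z"
 if t: "t:{0..1}" and z: "z:H" and eq: "curve_marginal H nu t = distr ?P (borel_on H) (%_. z)" for t z
proof -
 have m: "{w:space (borel_on H). w = z}:sets (borel_on H)"
  unfolding sets_restrict_space by(rule image_eqI[of _ _ "{z}"]) (auto simp:space_restrict_space)
 have "AE w in distr ?P (borel_on H) (%_. z). w = z"
  by(subst AE_distr_iff[OF _ m]) (use z in "auto simp:space_restrict_space")
 thus ?thesis unfolding eq[symmetric] AE_distr_iff[OF curve_eval[OF nu t] m] .
qed
have "AE ga in nu. ga:G_causal_curves le H G & ga 0 = x & ga 1 = y"
 using AE[OF _ xy(1) OptGeoD(3)[OF nu]] AE[OF _ xy(2) OptGeoD(4)[OF nu]] OptGeoD(5)[OF nu]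
 by(auto intro:AE_conjI)
hence "EX ga. ga:G_causal_curves le H G & ga 0 = x & ga 1 = y" by(rule nu.AE_ex)
then obtain ga where g: "ga:G_causal_curves le H G" "ga 0 = x" "ga 1 = y" by blast
have "~ ga constant_on {0..1}" using g xy(3) by(force simp:constant_on_def)
thus "EX ga. causal_curve le {0..1} ga & ga ` {0..1} <= H & ga 0 = x & ga 1 = y"
 using g by(intro exI[of _ ga]) (auto simp:G_causal_curves_def mem_curve_space_iff)
qed

lemma restrict_mem_curve_space:
fixes f :: "real => 'a::metric_space"
assumes "continuous_on {0..1} f" "f ` {0..1} <= H"
shows "restrict f {0..1}:mspace (curve_space H)"
using assms continuous_on_cong[of "{0..1}" "{0..1}" "restrict f {0..1}" f] by(simp add:mem_curve_space_iff)

lemma reverse_mem_curve_space: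
fixes H :: "'a::metric_space set"
assumes "ga:mspace (curve_space H)"
shows "restrict (%t. ga (1-t)) {0..1}:mspace (curve_space H)"
proof (rule restrict_mem_curve_space)
have g: "continuous_on {0..1} ga" "ga ` {0..1} <= H" using assms by(simp_all add:mem_curve_space_iff)
show "continuous_on {0..1} (%t. ga (1-t))"
 by(rule continuous_on_compose2[OF g(1)]) (auto intro!:continuous_intros)
show "(%t. ga (1-t)) ` {0..1} <= H" using g(2) by(auto simp:image_subset_iff)
qed

lemma G_causal_curves_reverse:
assumes "ga:G_causal_curves le H G"
shows "restrict (%t. ga (1-t)) {0..1}:G_causal_curves (%x y. le y x) H (%x. - G x)"
proof -
let ?ga = "restrict (%t. ga (1-t)) {0..1}"
have g: "ga:mspace (curve_space H)" using assms by(simp add:G_causal_curves_def)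
have m: "?ga:mspace (curve_space H)" by(rule reverse_mem_curve_space[OF g])
show ?thesis
proof (cases "ga constant_on {0..1}")
 case True
 hence "?ga constant_on {0..1}" by(auto simp:constant_on_def)
 thus ?thesis using m by(simp add:G_causal_curves_def)
next
 case False
 then obtain a b where c: "causal_curve le {0..1} ga" and i: "ga ` {0<..<1} <= inner_part le H"
  and ab: "ALL t:{0<..<1}. G (ga t) = a+b*t"
  using assms by(auto simp:G_causal_curves_def)
 have "causal_curve (%x y. le y x) {0..1} (%t. ga (1-t))"
  using causal_curve_reverse01[of "%x y. le y x"] c by simp
 hence "causal_curve (%x y. le y x) {0..1} ?ga"
  using m unfolding causal_curve_def constant_on_def mem_curve_space_iff by auto
 moreover have "?ga ` {0<..<1} <= inner_part (%x y. le y x) H"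
  using i by(auto simp:inner_part_reverse[of le])
 moreover have "ALL t:{0<..<1}. - G (?ga t) = (- a - b)+b*t"
  using ab by(auto simp:algebra_simps)
 ultimately show ?thesis using m unfolding G_causal_curves_def by blast
qed
qed

text \<open>Couplings are transposed, and plans are pushed forward under time reversal of
  curves.\<close>

lemma NCe_reverse:
fixes le :: "'a::{heine_borel,polish_space} => 'a => bool"
assumes nce: "NCe le H G m N" and le: "closed {(x, y). le x y}"
shows "NCe (%x y. le y x) H (%x. - G x) m N"
unfolding NCe_def
proof (intro allI impI, elim conjE)
fix mu0 mu1 assume mu: "prob_space mu0" "prob_space mu1" and "causal_couplings (%x y. le y x) H mu0 mu1 ~= {}"
then obtain pr where pr: "sets pr = sets (borel_on H OM borel_on H)" "prob_space pr"
  "distr pr (borel_on H) fst = mu0" "distr pr (borel_on H) snd = mu1"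
  "em pr {p:H \<times> H. le (snd p) (fst p)} = 1"
 by(auto simp:causal_couplings_def)
interpret pr: prob_space pr by fact
have fs: "fst:pr ->M borel_on H" "snd:pr ->M borel_on H"
 by(simp_all add:measurable_cong_sets[OF pr(1) refl])
have "{p:H \<times> H. le (snd p) (fst p)}:sets pr" using pr(5) emeasure_notin_sets by fastforce
hence "AE p in pr. p:{p:H \<times> H. le (snd p) (fst p)}"
 using pr(5) by(intro pr.AE_prob_1) (simp add:measure_def)
hence "AE p in pr. le (snd p) (fst p)" by eventually_elim simp
from NCe_plan[OF nce le pr(2) fs(2,1) this] obtain nu where
 nu: "nu:OptGeo le H G mu1 mu0" and U: "!!t. t:{0..1} ==> ennreal (1-t)*Uent (N-1) mu1 m+ennreal t*Uent (N-1) mu0 m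
   <= Uent (N-1) (curve_marginal H nu t) m" unfolding pr(3,4) by auto
define T where "T ga = restrict (%t. ga (1-t)) {0..1}" for ga :: "real => 'a"
have sp: "space nu = mspace (curve_space H)"
 using sets_eq_imp_space_eq[OF OptGeoD(1)[OF nu]] by(simp add:space_borel_curves)
have T: "T:nu ->M borel_curves H"
proof (rule measurable_into_curves)
 show "T:space nu \<rightarrow> mspace (curve_space H)"
  unfolding sp T_def by(intro funcsetI reverse_mem_curve_space)
 show "(%ga. T ga t):bmeas nu" if "t:{0..1}" for t
 proof -
  have "1 - t:{0..1}" using that by auto
  from measurable_compose[OF curve_eval[OF nu this] measurable_restrict_space1[OF measurable_ident]]
  show ?thesis using that by(simp add:T_def)
 qed
qed
interpret nu: prob_space nu by(rule OptGeoD(2)[OF nu])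
have marg: "curve_marginal H (distr nu (borel_curves H) T) t = curve_marginal H nu (1-t)" if "t:{0..1}" for t
 by(subst distr_distr[OF measurable_curve_eval[OF that] T]) (use that in "simp add:comp_def T_def")
have "AE ga in distr nu (borel_curves H) T. ga:G_causal_curves (%x y. le y x) H (%x. - G x)"
proof -
 \<comment> \<open>\<open>AE_distr_iff\<close> would require a measurable set of
   \<open>G\<close>-causal curves; instead a measurable null set is carried over by the involution
   \<open>T\<close>.\<close>
 obtain N0 where N0: "N0:null_sets nu" "{ga:space nu. ga ~: G_causal_curves le H G} <= N0"
  using OptGeoD(5)[OF nu] by(auto elim!:AE_E simp:null_sets_def)
 have TT: "T (T ga) = ga" and Tm: "T ga:mspace (curve_space H)" if "ga:mspace (curve_space H)" for ga
 proof -
  show "T (T ga) = ga" using that by(intro ext) (auto simp:T_def mem_curve_space_iff extensional_def)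
  show "T ga:mspace (curve_space H)" using measurable_space[OF T] that sp by(simp add:space_borel_curves)
 qed
 have T': "T:borel_curves H ->M nu"
  using T by(simp add:measurable_cong_sets[OF OptGeoD(1)[OF nu] refl] measurable_cong_sets[OF refl OptGeoD(1)[OF nu]])
 let ?N = "T -` N0 Int mspace (curve_space H)"
 have N: "?N:sets (borel_curves H)"
  using measurable_sets[OF T', of N0] N0(1) by(auto simp:space_borel_curves)
 have "N0 <= mspace (curve_space H)" using sets.sets_into_space[of N0 nu] N0(1) unfolding sp by blast
 hence "T -` ?N Int space nu = N0"
  unfolding sp by(intro set_eqI iffI) (use TT in force, use TT Tm in "auto simp:subset_iff")
 hence "em (distr nu (borel_curves H) T) ?N = 0" using emeasure_distr[OF T N] N0(1) by auto
 moreover have "{ga:space (distr nu (borel_curves H) T). ~ ga:G_causal_curves (%x y. le y x) H (%x. - G x)} <= ?N"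
 proof
  fix ga assume "ga:{ga:space (distr nu (borel_curves H) T). ~ ga:G_causal_curves (%x y. le y x) H (%x. - G x)}"
  hence g: "ga:mspace (curve_space H)" "ga ~: G_causal_curves (%x y. le y x) H (%x. - G x)" by(simp_all add:space_borel_curves)
  hence "T ga ~: G_causal_curves le H G" using G_causal_curves_reverse[of "T ga" le H G] TT[OF g(1)] by(auto simp:T_def)
  thus "ga:?N" using N0(2) Tm[OF g(1)] g(1) unfolding sp by blast
 qed
 ultimately show ?thesis using N by(intro AE_I[of _ _ ?N]) simp_all
qed
hence "distr nu (borel_curves H) T:OptGeo (%x y. le y x) H (%x. - G x) mu0 mu1"
 using OptGeoD[OF nu] marg[of 0] marg[of 1] nu.prob_space_distr[OF T] by(simp add:OptGeo_def)
thus "EX nu:OptGeo (%x y. le y x) H (%x. - G x) mu0 mu1. ALL t:{0..1}.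
  ennreal (1-t)*Uent (N-1) mu0 m+ennreal t*Uent (N-1) mu1 m <= Uent (N-1) (curve_marginal H nu t) m"
proof (rule bexI[rotated], intro ballI)
 fix t :: real assume t: "t:{0..1}"
 hence "1 - t:{0..1}" by auto
 from U[OF this] show "ennreal (1-t)*Uent (N-1) mu0 m+ennreal t*Uent (N-1) mu1 m
   <= Uent (N-1) (curve_marginal H (distr nu (borel_curves H) T) t) m"
  using marg[OF t] by(simp add:add.commute)
qed
qed

section \<open>Borel choices of later and of intermediate points\<close>

context null_rays
begin

lemma above_selection:
"EX f:bmeas borel. ALL x:H. x ~: final_points le H --> f x:H & le x (f x) & f x ~= x"
proof -
define S where "S k = {(x, y). x:H & y:H & le x y & x:cball undefined (real k) &
  y:cball undefined (real k) & 1/real (Suc k) <= dist x y}" for k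
have "compact (S k)" for k unfolding S_def by(rule compact_le_pairs)
then obtain f where f: "f:bmeas borel" "ALL k. ALL x:fst ` S k. EX k. (x, f x):S k"
 using sigma_compact_selection[of S] by blast
have "f x:H & le x (f x) & f x ~= x" if x: "x:H" "x ~: final_points le H" for x
proof -
 obtain y where y: "y:H" "le x y" "y ~= x" using x by(auto simp:final_points_def)
 obtain n1 where n1: "1/real (Suc n1) < dist x y"
  using y(3) nat_approx_posE[of "dist x y"] by auto
 obtain n2 :: nat where n2: "max (dist undefined x) (dist undefined y) <= real n2" using real_arch_simple by blast
 let ?n = "max n1 n2"
 have "1/real (Suc ?n) <= 1/real (Suc n1)" by(intro divide_left_mono) auto
 hence "(x, y):S ?n" using n1 n2 x y by(auto simp:S_def)
 hence "x:fst ` S ?n" by force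
 then obtain k where "(x, f x):S k" using f(2) by blast
 thus ?thesis by(auto simp:S_def)
qed
thus ?thesis using f(1) by blast
qed

text \<open>Bounding both distances from below keeps the compact pieces away from \<open>x\<close>
  and \<open>y\<close>, so the selected points are inner. That some piece contains the given pair
  follows from the middle of an arc.\<close>

lemma middle_selection:
"EX f:bmeas borel. ALL x:H. ALL y:H. le x y & x ~= y --> f (x, y):Hi & le x (f (x, y)) & le (f (x, y)) y"
proof -
define S where "S k = {((x, y), z). x:H & y:H & z:H & le x z & le z y & x:cball undefined (real k) &
  y:cball undefined (real k) & z:cball undefined (real k) & 1/real (Suc k) <= dist x z & 1/real (Suc k) <= dist z y}" for k
have "compact (S k)" for k
proof -
 let ?B = "cball (undefined :: 'a) (real k)"
 have cl: "closed ((%p::('a\<times>'a)\<times>'a. (f p, g p)) -` {(x, y). x:H & y:H & le x y})"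
  if "continuous_on UNIV f" "continuous_on UNIV g" for f g :: "('a\<times>'a)\<times>'a => 'a"
  by(intro closed_vimage closed_le_pairs continuous_on_Pair that)
 have "S k = ((?B \<times> ?B) \<times> ?B) Int (((%p. (fst (fst p), snd p)) -` {(x, y). x:H & y:H & le x y} Int
   (%p. (snd p, snd (fst p))) -` {(x, y). x:H & y:H & le x y}) Int
   ({p. 1/real (Suc k) <= dist (fst (fst p)) (snd p)} Int {p. 1/real (Suc k) <= dist (snd p) (snd (fst p))}))"
  by(auto simp:S_def)
 also have "compact ..."
  by(intro compact_Int_closed compact_Times compact_cball closed_Int cl closed_Collect_le continuous_on_dist
   continuous_on_fst continuous_on_snd continuous_on_id continuous_on_const)
 finally show ?thesis .
qed
then obtain f where f: "f:bmeas borel" "ALL k. ALL x:fst ` S k. EX k. (x, f x):S k"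
 using sigma_compact_selection[of S] by blast
have "f (x, y):Hi & le x (f (x, y)) & le (f (x, y)) y" if x: "x:H" and y: "y:H" and xy: "le x y" "x ~= y" for x y
proof -
 obtain ga where g: "causal_arc le H ga x y" using causal_arc_exists[OF x y xy] by blast
 define z where "z = ga (1/2)"
 note g' = g[unfolded causal_arc_def]
 have h: "(0::real):{0..1}" "(1/2::real):{0..1}" "(1::real):{0..1}" by auto
 have le': "ALL s:{0..1}. ALL t:{0..1}. s <= t --> le (ga s) (ga t)" and inj: "inj_on ga {0..1}" using g' by blast+
 have z: "z:H" "le x z" "le z y" "z ~= x" "z ~= y"
  using g' h le'[rule_format, OF h(1,2)] le'[rule_format, OF h(2,3)] inj_onD[OF inj _ h(2,1)] inj_onD[OF inj _ h(2,3)]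
  unfolding z_def by auto
 obtain n1 where n1: "1/real (Suc n1) < min (dist x z) (dist z y)"
  using z(4,5) nat_approx_posE[of "min (dist x z) (dist z y)"] by auto
 obtain n2 :: nat where n2: "max (dist undefined x) (max (dist undefined y) (dist undefined z)) <= real n2" using real_arch_simple by blast
 let ?n = "max n1 n2"
 have "1/real (Suc ?n) <= 1/real (Suc n1)" by(intro divide_left_mono) auto
 hence "((x, y), z):S ?n" using n1 n2 x y z by(auto simp:S_def)
 hence "(x, y):fst ` S ?n" by force
 then obtain k where "((x, y), f (x, y)):S k" using f(2) by blast
 hence k: "f (x, y):H" "le x (f (x, y))" "le (f (x, y)) y" "1/real (Suc k) <= dist x (f (x, y))"
  "1/real (Suc k) <= dist (f (x, y)) y" by(auto simp:S_def simp del:of_nat_Suc)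
 have "0 < 1/real (Suc k)" by simp
 hence "x ~= f (x, y)" "y ~= f (x, y)" using k(4,5) by(auto simp del:of_nat_Suc)
 thus ?thesis using strictly_between_inner[OF x y k(1,2,3)] k by blast
qed
thus ?thesis using f(1) by blast
qed

end

section \<open>Test measures for the energy condition\<close>

locale nce_rays = ray_measure le H G m QQ qq ma
for le :: "'a::{heine_borel,polish_space} => 'a => bool" and H :: "'a set" and G :: "'a => real"
 and m :: "'a measure" and QQ :: "'a => 'a" and qq :: "'a measure" and ma :: "'a => 'a measure" +
fixes N :: real
assumes N: "2 < N" and nce: "NCe le H G m N"
 and ends: "initial_points le H Int final_points le H:null_sets m"
begin

lemma reverse_nce: "nce_rays (%x y. le y x) H (%x. - G x) m QQ qq ma N"
proof -
interpret rev: null_rays "%x y. le y x" H "%x. - G x" by(rule reverse)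
show ?thesis
proof
 show "radon_measure_on H m" by(rule radon)
 show "ray_disintegration (%x y. le y x) H m QQ qq ma"
  using dis by(simp add:ray_disintegration_def ray_quotient_map_def inner_part_reverse[of le] causally_related_reverse[of le])
 show "NCe (%x y. le y x) H (%x. - G x) m N" by(rule NCe_reverse[OF nce closed_le])
 show "initial_points (%x y. le y x) H Int final_points (%x y. le y x) H:null_sets m"
  using ends by(simp add:initial_points_reverse[of le] final_points_reverse[of le] Int_commute)
qed (rule N)
qed

lemma plan:
assumes "prob_space P" "f0:P ->M borel_on H" "f1:P ->M borel_on H" "AE om in P. le (f0 om) (f1 om)"
obtains nu where "nu:OptGeo le H G (distr P (borel_on H) f0) (distr P (borel_on H) f1)"
 "!!t. t:{0..1} ==> ennreal (1-t)*Uent (N-1) (distr P (borel_on H) f0) m +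
   ennreal t*Uent (N-1) (distr P (borel_on H) f1) m <= Uent (N-1) (curve_marginal H nu t) m"
using NCe_plan[OF nce closed_le assms] by blast

lemma AE_curve_iff:
assumes "nu:OptGeo le H G mu0 mu1" "t:{0..1}" "E:sets m"
shows "(AE x in curve_marginal H nu t. x:E) <-> (AE ga in nu. ga t:E)"
 and "(AE x in curve_marginal H nu t. x ~: E) <-> (AE ga in nu. ga t ~: E)"
proof -
have "{x:space (borel_on H). x:E}:sets (borel_on H)" "{x:space (borel_on H). x ~: E}:sets (borel_on H)"
 using assms(3) unfolding sets_m by measurable
from AE_distr_iff[OF curve_eval[OF assms(1,2)] this(1)] AE_distr_iff[OF curve_eval[OF assms(1,2)] this(2)]
show "(AE x in curve_marginal H nu t. x:E) <-> (AE ga in nu. ga t:E)"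
  "(AE x in curve_marginal H nu t. x ~: E) <-> (AE ga in nu. ga t ~: E)" by simp_all
qed

lemma AE_transfer:
assumes "f:P ->M borel_on H" "E:sets m" "AE om in P. f om:E"
shows "AE x in distr P (borel_on H) f. x:E"
proof -
have "{x:space (borel_on H). x:E}:sets (borel_on H)"
 using assms(2) unfolding sets_m by measurable
from AE_distr_iff[OF assms(1) this] assms(3) show ?thesis by simp
qed

lemma AE_curve_null:
assumes nu: "nu:OptGeo le H G mu0 mu1" and t: "t:{0..1}" and E: "E:null_sets m"
 and U: "0 < Uent (N-1) (curve_marginal H nu t) m"
shows "AE ga in nu. ga t ~: E"
proof -
have "E:null_sets (curve_marginal H nu t)"
 using Uent_pos_ac[OF U] E unfolding absolutely_continuous_def by blast
hence "AE x in curve_marginal H nu t. x ~: E" by(rule AE_not_in)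
thus ?thesis using AE_curve_iff(2)[OF nu t] E by auto
qed

text \<open>Prepares the arguments by contradiction: a positive \<open>U\<close> at one end makes
  the intermediate measure absolutely continuous at every time at which this end has positive
  weight.\<close>

lemma uniform_facts:
assumes K: "compact K" "K <= H" "0 < em m K"
shows "prob_space (uniform_measure m K)" "(%x. x):uniform_measure m K ->M borel_on H"
 "distr (uniform_measure m K) (borel_on H) (%x. x) = uniform_measure m K" "AE x in uniform_measure m K. x:K"
 "0 < Uent (N-1) (uniform_measure m K) m"
proof -
have fin: "em m K < \<infinity>" by(rule m_compact[OF K(1,2)])
have Km: "K:sets m" using K by(auto simp:m_iff compact_imp_closed)
show p: "prob_space (uniform_measure m K)" using K fin by(intro prob_space_uniform_measure) auto
have s: "sets (uniform_measure m K) = sets (borel_on H)" by(simp add:sets_m)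
show "(%x. x):uniform_measure m K ->M borel_on H" using s by(rule measurable_ident_sets)
show "distr (uniform_measure m K) (borel_on H) (%x. x) = uniform_measure m K" using s by(intro distr_id2) simp
show "AE x in uniform_measure m K. x:K" using Km fin by(intro AE_uniform_measureI) auto
have e: "em m K = ennreal (measure m K)" using fin by(intro emeasure_eq_ennreal_measure) simp
hence M: "0 < measure m K" using K(3) by simp
hence c: "0 < 1/measure m K" by simp
have "ennreal ((1/(1/measure m K)) powr (1/(N-1))) <= Uent (N-1) (uniform_measure m K) m"
proof (rule m.Uent_ge_of_bounded[OF p _ c])
 fix B assume B: "B:sets m"
 have "em (uniform_measure m K) B = em m (K Int B)/em m K" using B Km by simp
 also have "... <= em m B/em m K" using B by(intro divide_right_mono_ennreal emeasure_mono) auto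
 also have "... = ennreal (1/measure m K)*em m B"
  unfolding e divide_ennreal_def inverse_ennreal[OF M] by(simp add:mult.commute inverse_eq_divide)
 finally show "em (uniform_measure m K) B <= ennreal (1/measure m K)*em m B" .
qed (use N in simp_all)
moreover have "0 < (1/(1/measure m K)) powr (1/(N-1))" using c by simp
ultimately show "0 < Uent (N-1) (uniform_measure m K) m" by(meson ennreal_less_zero_iff less_le_trans)
qed

end

section \<open>Null end-points and mass near the ends of rays\<close>

context nce_rays
begin

text \<open>Level sets are disjoint, and on each of countably many bounded pieces, which have finite
  measure, only countably many can be charged.\<close>

lemma countable_positive_levels:
assumes f: "f:bmeas m"
shows "countable {s::real. 0 < em m {x:H. f x = s}}"
proof -
define M where "M n = distr (density m (ind (H Int cball undefined (real n)))) borel f" for n :: nat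
have B: "H Int cball undefined (real n):sets m" for n by(auto simp:m_iff)
have em: "em (M n) {s} = em m (H Int cball undefined (real n) Int {x:H. f x = s})" for n s
proof -
 have L: "{x:H. f x = s}:sets m" using measurable_sets[OF f, of "{s}"] by(simp add:vimage_def Collect_conj_eq Int_commute)
 have "em (M n) {s} = em (density m (ind (H Int cball undefined (real n)))) {x:H. f x = s}"
  unfolding M_def using f by(subst emeasure_distr) (auto simp:vimage_def Collect_conj_eq Int_commute)
 also have "... = em m (H Int cball undefined (real n) Int {x:H. f x = s})"
  using L B by(subst emeasure_density) (auto simp:nn_integral_indicator simp flip: indicator_inter_arith)
 finally show ?thesis .
qed
have fm: "finite_measure (M n)" for n
proof
 have HH: "H:sets m" using sets.top[of m] by simp
 have "em (M n) (space (M n)) = em (density m (ind (H Int cball undefined (real n)))) H"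
  unfolding M_def using f by(subst emeasure_distr) simp_all
 also have "... = em m (H Int cball undefined (real n) Int H)"
  using B HH by(subst emeasure_density) (auto simp:nn_integral_indicator simp flip: indicator_inter_arith)
 also have "H Int cball undefined (real n) Int H = H Int cball undefined (real n)" by auto
 finally have "em (M n) (space (M n)) = em m (H Int cball undefined (real n))" .
 thus "em (M n) (space (M n)) ~= \<infinity>" using m_compact[OF H_ball, of "real n"] by simp
qed
have "{s. 0 < em m {x:H. f x = s}} <= (\<Union>n. {s. measure (M n) {s} ~= 0})"
proof
 fix s assume "s:{s. 0 < em m {x:H. f x = s}}"
 moreover have "(\<Union>n. H Int cball undefined (real n) Int {x:H. f x = s}) = {x:H. f x = s}"
  using real_arch_simple by auto
 moreover have L: "{x:H. f x = s}:sets m" using measurable_sets[OF f, of "{s}"] by(simp add:vimage_def Collect_conj_eq Int_commute)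
 moreover have "range (%n. H Int cball undefined (real n) Int {x:H. f x = s}) <= sets m" using sets.Int[OF B L] by blast
 ultimately have "EX n. em m (H Int cball undefined (real n) Int {x:H. f x = s}) ~= 0"
  using emeasure_UN_eq_0[of m "%n. H Int cball undefined (real n) Int {x:H. f x = s}"] by(intro ccontr[of "EX n. _ n"]) auto
 then obtain n where "em m (H Int cball undefined (real n) Int {x:H. f x = s}) ~= 0" by(rule exE)
 hence "measure (M n) {s} ~= 0"
  using em[of n s] finite_measure.emeasure_eq_measure[OF fm, of n "{s}"] by auto
 thus "s:(\<Union>n. {s. measure (M n) {s} ~= 0})" by blast
qed
moreover have "countable (\<Union>n. {s. measure (M n) {s} ~= 0})"
 by(intro countable_UN countableI_type finite_measure.countable_support fm)
ultimately show ?thesis by(rule countable_subset)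
qed

lemma borel_into_H:
assumes "f:bmeas borel" "!!x. x:H ==> f x:H" "sets P = sets m"
shows "f:P ->M borel_on H"
proof (rule measurable_restrict_space2)
show "f:space P \<rightarrow> H" using assms(2) sets_eq_imp_space_eq[OF assms(3)] by auto
show "f:bmeas P"
 unfolding measurable_cong_sets[OF assms(3)[unfolded sets_m] refl] by(rule measurable_restrict_space1[OF assms(1)])
qed

text \<open>If initial points had positive measure, then moving a part of them along the rays would produce
measures that are concentrated on the disjoint sets of all points at given \<open>G\<close>-distance from the initial
point of their ray; uncountably many of these sets would have positive measure.\<close>

lemma initial_null: "initial_points le H:null_sets m"
proof (rule ccontr)
assume neg: "initial_points le H ~: null_sets m"
define A where "A = initial_points le H - final_points le H"
have AH: "A <= H" by(auto simp:A_def initial_points_def)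
have Am: "A:sets m" using AH by(auto simp:m_iff A_def)
have im: "initial_points le H:sets m" using initial_borel by(simp add:m_iff initial_points_def)
have "em m A ~= 0"
proof
 assume "em m A = 0"
 hence "A Un (initial_points le H Int final_points le H):null_sets m" using Am ends by(intro null_sets.Un) auto
 moreover have "A Un (initial_points le H Int final_points le H) = initial_points le H" by(auto simp:A_def)
 ultimately show False using neg by simp
qed
obtain ab where ab[measurable]: "ab:bmeas borel"
 and ab': "ALL x:H. x ~: final_points le H --> ab x:H & le x (ab x) & ab x ~= x" using above_selection by blast
obtain mi where mi: "mi:bmeas borel"
 and mi': "ALL x:H. ALL y:H. le x y & x ~= y --> mi (x, y):Hi & le x (mi (x, y)) & le (mi (x, y)) y"
 using middle_selection by blast
\<comment> \<open>An initial point may start several rays; an inner point above it fixes one of them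
  in a Borel way.\<close>
define z where "z x = mi (x, ab x)" for x
have z_m[measurable]: "z:bmeas borel"
 unfolding z_def by(rule measurable_compose[OF _ mi]) measurable
have z: "z x:Hi" "x:Ry (z x)" "GE (z x) x = lo (z x)" "lo (z x) < G (z x)" if x: "x:A" for x
proof -
 have xH: "x:H" "x ~: final_points le H" "x:initial_points le H" using x AH by(auto simp:A_def)
 hence "ab x:H" "le x (ab x)" "ab x ~= x" using ab' by auto
 hence zz: "z x:Hi" "le x (z x)" unfolding z_def using mi' xH(1) by auto
 thus 1: "z x:Hi" and 2: "x:Ry (z x)" using xH Hi_subset by(auto simp:in_ray_iff)
 show 3: "GE (z x) x = lo (z x)" using GE_eq_Gx[OF 1 2] xH by(simp add:Gx_def)
 have "z x ~= x" using 1 xH by(auto simp:inner_part_def)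
 hence "GE (z x) x < GE (z x) (z x)" using GE_less[OF 1 2 ray_self[OF 1] zz(2)] by simp
 thus "lo (z x) < G (z x)" using 3 GE_inner[OF 1] by simp
qed
\<comment> \<open>On a set of positive measure all points can be moved by one common amount
  \<open>c\<close> of gauge.\<close>
define E where "E k = {x:A. lo (z x)+1/real (Suc k) < Gb (z x)}" for k
have Em: "E k:sets m" for k
proof -
 have "E k = A Int {x. lo (z x)+1/real (Suc k) < Gb (z x)}" by(auto simp:E_def)
 moreover have "{x. lo (z x)+1/real (Suc k) < Gb (z x)}:sets borel" by measurable
 ultimately show ?thesis using Am AH by(auto simp:m_iff)
qed
have "(\<Union>k. E k) = A"
proof (intro antisym subsetI)
 fix x assume x: "x:A"
 obtain k where "1/real (Suc k) < G (z x) - lo (z x)" using z(4)[OF x] nat_approx_posE[of "G (z x) - lo (z x)"] by auto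
 hence "x:E k" using x z(1)[OF x] by(simp add:E_def Gb_def)
 thus "x:(\<Union>k. E k)" by blast
qed (auto simp:E_def)
then obtain k where k: "em m (E k) ~= 0" using emeasure_UN_eq_0[of m E] Em \<open>em m A ~= 0\<close> by auto
define c where "c = 1/real (Suc k)"
have c: "0 < c" by(simp add:c_def)
obtain K where K: "compact K" "K <= E k" "0 < em m K" using m_inner[OF Em, of 0 k] k by(auto simp:zero_less_iff_neq_zero)
have KA: "K <= A" using K(2) by(auto simp:E_def)
hence KH: "K <= H" using AH by blast
define y where "y x = (if x:K then PB (z x, lo (z x)+c) else x)" for x
have [measurable]: "K:sets borel" using K(1) by(simp add:compact_imp_closed)
have y_m: "y:bmeas borel" unfolding y_def by measurable
\<comment> \<open>The inner points at gauge distance \<open>s\<close> above \<open>lo\<close>; the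
  value -1 keeps all other points off the levels \<open>s > 0\<close>.\<close>
define T where "T s = {p:H. (if p:Hi then Gb p - lo p else -1) = s}" for s
have lev: "(%p. if p:Hi then Gb p - lo p else -1):bmeas borel" by measurable
hence Tm: "T s:sets m" for s
 using measurable_sets[OF lev, of "{s}"] unfolding T_def by(auto simp:m_iff vimage_def intro!:sets.Int[of H borel, simplified Collect_conj_eq])
have y: "y x:OpR (z x)" "le x (y x)" "y x:T c" if x: "x:K" for x
proof -
 have xA: "x:A" using x KA by blast
 note zx = z[OF xA]
 have "x:E k" using x K(2) by blast
 hence "lo (z x)+c < G (z x)" using zx(1) by(simp add:E_def c_def Gb_def)
 hence J: "lo (z x)+c:J (z x)"
  using IA_between_J[OF zx(1,2) ray_self[OF zx(1)], of "lo (z x)+c"] zx(3) c GE_inner[OF zx(1)] by simp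
 hence "(z x, lo (z x)+c):IA_pairs" using J_subset_IA zx(1) by(auto simp:IA_pairs_def)
 hence yx: "y x = PT (z x) (lo (z x)+c)" using x by(simp add:y_def PB_def)
 hence G: "G (y x) = lo (z x)+c" using PT_J[OF zx(1) J] by auto
 show O: "y x:OpR (z x)" using yx PT_J[OF zx(1) J] by auto
 show "le x (y x)" using initial_le[OF zx(1,2) _ OR_D(1)[OF O]] xA by(simp add:A_def)
 have "J (y x) = J (z x)" using J_ray_eq[OF zx(1) O] by simp
 hence "lo (y x) = lo (z x)" using OR_D(2)[OF O] zx(1) by(simp add:lo_def)
 thus "y x:T c" using G OR_D(2,3)[OF O] by(simp add:T_def Gb_def)
qed
let ?P = "uniform_measure m K"
note P = uniform_facts[OF K(1) KH K(3)]
have yH: "y x:H" if "x:H" for x using y(1) OR_D(3) that by(cases "x:K") (auto simp:y_def)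
have y_P: "y:?P ->M borel_on H" by(rule borel_into_H[OF y_m yH]) (simp_all add:uniform_measure_def)
have "AE x in ?P. le x (y x)" using P(4) by eventually_elim (rule y(2))
then obtain nu where nu: "nu:OptGeo le H G (distr ?P (borel_on H) (%x. x)) (distr ?P (borel_on H) y)"
 and U: "!!t. t:{0..1} ==> ennreal (1-t)*Uent (N-1) (distr ?P (borel_on H) (%x. x)) m +
   ennreal t*Uent (N-1) (distr ?P (borel_on H) y) m <= Uent (N-1) (curve_marginal H nu t) m"
 using plan[OF P(1,2) y_P] by blast
have zo: "(0::real):{0..1}" "(1::real):{0..1}" by auto
have KT: "K:sets m" using KH by(simp add:m_iff)
have a0: "AE ga in nu. ga 0:K"
 unfolding AE_curve_iff(1)[OF nu zo(1) KT, symmetric] OptGeoD(3)[OF nu] by(rule AE_transfer[OF P(2) KT P(4)])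
have "AE x in ?P. y x:T c" using P(4) by eventually_elim (rule y(3))
hence a1: "AE ga in nu. ga 1:T c"
 unfolding AE_curve_iff(1)[OF nu zo(2) Tm, symmetric] OptGeoD(4)[OF nu] by(rule AE_transfer[OF y_P Tm])
have pos: "0 < em m (T s)" if s: "0 < s" "s < c" for s
proof (rule ccontr)
 assume "~ 0 < em m (T s)"
 hence null: "T s:null_sets m" using Tm by auto
 \<comment> \<open>The curves move from gauge value \<open>lo p\<close> to \<open>lo p+c\<close>, so
   at time \<open>s/c\<close> they are in \<open>T s\<close>. Absolute continuity at this time,
   inherited from the positive \<open>U\<close> at time 0, forbids that if \<open>T s\<close> is
   null.\<close>
 define t where "t = s/c"
 have t: "0 < t" "t < 1" "t*c = s" using s c by(auto simp:t_def)
 have "0 < ennreal (1-t)*Uent (N-1) (distr ?P (borel_on H) (%x. x)) m"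
  using P(5) t by(simp add:P(3) ennreal_zero_less_mult_iff)
 also have "... <= Uent (N-1) (curve_marginal H nu t) m" using U[of t] t by(meson atLeastAtMost_iff add_increasing2 le_less order_trans zero_le add.commute le_add1 le_iff_add)
 finally have "AE ga in nu. ga t ~: T s" using t by(intro AE_curve_null[OF nu _ null]) auto
 hence "AE ga in nu. False"
  using a0 a1 OptGeoD(5)[OF nu]
 proof eventually_elim
  case (elim ga)
  define p where "p = ga 1"
  have p: "p:Hi" "p:H" "Gb p - lo p = c" using elim(3) c by(auto simp:T_def p_def split:if_splits)
  have t01: "t:{0..1}" using t by auto
  have g0: "ga 0:initial_points le H" using elim(2) KA by(auto simp:A_def)
  have r0: "ga 0:Ry p" using G_causal_affine(1)[OF elim(4) zo(2) _ zo(1)] p(1) by(simp add:p_def)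
  have rt: "ga t:Ry p" using G_causal_affine(1)[OF elim(4) zo(2) _ t01] p(1) by(simp add:p_def)
  have e0: "GE p (ga 0) = lo p" using GE_eq_Gx[OF p(1) r0] g0 by(simp add:Gx_def)
  have e1: "GE p p = lo p+c" using GE_inner[OF p(1)] p by(simp add:Gb_def)
  have "GE p (ga t) = (1-t)*lo p+t*(lo p+c)"
   using G_causal_affine(2)[OF elim(4) zo(2) _ t01] p(1) e0 e1 by(simp add:p_def)
  hence et: "GE p (ga t) = lo p+s" using t(3) by(simp add:algebra_simps)
  hence "GE p (ga t):J p" using IA_between_J[OF p(1) r0 ray_self[OF p(1)]] e0 e1 s by simp
  hence O: "ga t:OpR p" using PT_J[OF p(1)] PT_GE[OF p(1) rt] by metis
  have "J (ga t) = J p" using J_ray_eq[OF p(1) O] by simp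
  hence "lo (ga t) = lo p" using OR_D(2)[OF O] p(1) by(simp add:lo_def)
  moreover have "G (ga t) = lo p+s" using et GE_inner[OF OR_D(2)[OF O]] by simp
  ultimately have "ga t:T s" using OR_D(2,3)[OF O] by(simp add:T_def Gb_def)
  thus False using elim(1) by simp
 qed
 thus False using prob_space.AE_ex[OF OptGeoD(2)[OF nu]] by blast
qed
have "(%p. if p:Hi then Gb p - lo p else -1):bmeas m"
 unfolding measurable_cong_sets[OF sets_m refl] by(rule measurable_restrict_space1[OF lev])
from countable_positive_levels[OF this] have "countable {s. 0 < em m (T s)}" by(simp add:T_def)
moreover have "{0<..<c} <= {s. 0 < em m (T s)}" using pos by auto
ultimately show False using uncountable_open_interval[of 0 c] c countable_subset by blast
qed

lemma borel_mq: "A:sets borel ==> {al:QQ ` Hi. al:A}:sets mq"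
by(rule sets_completionI_sets) (auto simp:sets_qq sets_restrict_space Collect_conj_eq)

lemma inner_of_between:
assumes g: "ga:G_causal_curves le H G" and i: "ga 0:Hi" "ga 1:Hi" and t: "t:{0..1}"
shows "ga t:OpR (ga 0)" "G (ga t) = (1-t)*G (ga 0)+t*G (ga 1)"
proof -
have z: "(0::real):{0..1}" "(1::real):{0..1}" by auto
note a = G_causal_affine[OF g z(1) i(1) t]
have r1: "ga 1:OpR (ga 0)" using G_causal_affine(1)[OF g z(1) i(1) z(2)] i(2) by(simp add:in_open_ray_iff)
have e: "GE (ga 0) (ga t) = (1-t)*G (ga 0)+t*G (ga 1)" using a(2) GE_inner i by simp
have "convex (J (ga 0))" using J_interval[OF i(1)] by(simp add:is_interval_convex_1)
moreover have "G (ga 0):J (ga 0)" "G (ga 1):J (ga 0)" using r1 OR_self[OF i(1)] by(auto simp:J_def)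
ultimately have "(1-t)*G (ga 0)+t*G (ga 1):J (ga 0)"
 using convexD[of "J (ga 0)" "G (ga 0)" "G (ga 1)" "1 - t" t] t by simp
thus 1: "ga t:OpR (ga 0)" using PT_J[OF i(1)] PT_GE[OF i(1) a(1)] e by metis
show "G (ga t) = (1-t)*G (ga 0)+t*G (ga 1)" using e GE_inner[OF OR_D(2)[OF 1]] by simp
qed

text \<open>If the conditional measures charged no neighbourhood of the initial ends of a non-negligible family of rays,
then transporting mass towards these ends would instantaneously leave the support.\<close>

lemma left_tail:
"AE al in qq. (EX g:J al. g < b) & em (lam al) {..<b} = 0 --> em (lam al) UNIV = 0"
proof -
\<comment> \<open>The rays that violate the claim; reaching below \<open>b\<close> is expressed
  through the dense sequence so that \<open>C\<close> is measurable for the completion.\<close>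
define C where "C = {al:QQ ` Hi. al:{al. EX i. rs i al:Hi & Gb (rs i al) < b}} Int {al:space mq. em (lam al) {..<b} = 0}"
have "{al. EX i. rs i al:Hi & Gb (rs i al) < b}:sets borel" by measurable
moreover have "{al:space mq. em (lam al) {..<b} = 0}:sets mq"
 using measurable_sets[OF measurable_lam[of "{..<b}"], of "{0}"] by(simp add:vimage_def Collect_conj_eq Int_commute)
ultimately have C: "C:sets mq" unfolding C_def by(intro sets.Int borel_mq)
have Hi: "{x:Hi. Gb x:UNIV} = Hi" by simp
define I where "I = nn_integral mq (%al. em (lam al) UNIV*ind C al)"
have "I = 0"
proof (rule ccontr)
 assume "I ~= 0"
 obtain E where E: "E:sets m" "E <= {x:Hi. QQ x:C}" "em m E = I"
  using fibre_inner[OF Hi_m order_refl C] slab_formula[of UNIV C] unfolding Hi I_def by auto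
 obtain K where K: "compact K" "K <= E" "0 < em m K"
  using m_inner[OF E(1), of 0] E(3) \<open>I ~= 0\<close> by(auto simp:zero_less_iff_neq_zero)
 have KH: "K <= H" using K(2) E(1) by(auto simp:m_iff)
 have Km: "K:sets m" using K(1) KH by(simp add:m_iff compact_imp_closed)
 have Ki: "x:Hi" "QQ x:C" if "x:K" for x using that K(2) E(2) by auto
 let ?L = "{x:Hi. Gb x:{..<b}}"
 have "?L <= Hi" by blast
 from fibre_outer[OF slab_m this C] obtain Z where Z: "Z:sets m" "{x:?L. QQ x:C} <= Z"
  and Ze: "em m Z = nn_integral mq (%al. em (ma al) ?L*ind C al)" by auto
 have "em m Z = nn_integral mq (%al. em (lam al) {..<b}*ind C al)" unfolding Ze by(rule slab_formula) simp
 also have "... = nn_integral mq (%al. 0)" by(rule nn_integral_cong) (simp add:C_def split:split_indicator)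
 finally have Zn: "Z:null_sets m" using Z(1) by auto
 \<comment> \<open>Moves a point to the first member of the dense sequence on its ray that lies
   below \<open>b\<close>; a curve that starts there remains below \<open>b\<close> for a short
   time.\<close>
 define f where "f x = (if x:K then rs (LEAST i. rs i x:Hi & Gb (rs i x) < b) x else x)" for x
 have [measurable]: "K:sets borel" using K(1) by(simp add:compact_imp_closed)
 have "(%x. rs (LEAST i. rs i x:Hi & Gb (rs i x) < b) x):bmeas borel"
  by(rule measurable_compose_countable[OF rs_measurable]) measurable
 hence f_m: "f:bmeas borel" unfolding f_def by measurable
 have f: "f x:OpR x" "G (f x) < b" if x: "x:K" for x
 proof -
  have "EX g:J (QQ x). g < b" using Ki(2)[OF x] J_less_iff[OF QQ_in[OF Ki(1)[OF x]], of b] by(auto simp:C_def)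
  moreover have "J (QQ x) = J x"
   using J_ray_eq[OF QQ_in[OF Ki(1)[OF x]] QQ_self[OF Ki(1)[OF x]]] by simp
  ultimately have "EX i. rs i x:Hi & Gb (rs i x) < b" using J_less_iff[OF Ki(1)[OF x], of b] by simp
  hence "f x:Hi & Gb (f x) < b" unfolding f_def using x by(auto intro:LeastI2_ex)
  moreover have "f x:Ry x" using x rs_mem KH by(auto simp:f_def)
  ultimately show "f x:OpR x" "G (f x) < b" by(auto simp:in_open_ray_iff Gb_def)
 qed
 let ?P = "uniform_measure m K"
 note P = uniform_facts[OF K(1) KH K(3)]
 have fH: "f x:H" if "x:H" for x using f(1) OR_D(3) that by(cases "x:K") (auto simp:f_def)
 have f_P: "f:?P ->M borel_on H" by(rule borel_into_H[OF f_m fH]) (simp_all add:uniform_measure_def)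
 have "Z:null_sets ?P" using Uent_pos_ac[OF P(5)] Zn unfolding absolutely_continuous_def by blast
 hence "AE x in ?P. x ~: Z" by(rule AE_not_in)
 hence "AE x in ?P. le (f x) x" using P(4)
 proof eventually_elim
  case (elim x)
  have xi: "x:Hi" "QQ x:C" by(rule Ki[OF elim(2)])+
  hence "~ G x < b" using elim(1) Z(2) by(auto simp:Gb_def)
  hence "G (f x) <= G x" using f(2)[OF elim(2)] by simp
  thus ?case using gauge_le_iff[OF xi(1) f(1)[OF elim(2)] OR_self[OF xi(1)]] by simp
 qed
 then obtain nu where nu: "nu:OptGeo le H G (distr ?P (borel_on H) f) (distr ?P (borel_on H) (%x. x))"
  and U: "!!t. t:{0..1} ==> ennreal (1-t)*Uent (N-1) (distr ?P (borel_on H) f) m +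
    ennreal t*Uent (N-1) (distr ?P (borel_on H) (%x. x)) m <= Uent (N-1) (curve_marginal H nu t) m"
  using plan[OF P(1) f_P P(2)] by blast
 have zo: "(0::real):{0..1}" "(1::real):{0..1}" by auto
 have a1: "AE ga in nu. ga 1:K"
  unfolding AE_curve_iff(1)[OF nu zo(2) Km, symmetric] OptGeoD(4)[OF nu] by(rule AE_transfer[OF P(2) Km P(4)])
 have Lm: "?L:sets m" by(rule slab_m) simp
 have "AE x in ?P. f x:?L" using P(4)
 proof eventually_elim
  case (elim x) thus ?case using f[OF elim] OR_D(2)[OF f(1)[OF elim]] by(simp add:Gb_def)
 qed
 hence a0: "AE ga in nu. ga 0:?L"
  unfolding AE_curve_iff(1)[OF nu zo(1) Lm, symmetric] OptGeoD(3)[OF nu] by(rule AE_transfer[OF f_P Lm])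
 \<comment> \<open>Countably many times tending to 0 suffice: each curve is still below
   \<open>b\<close> at one of them. The positive \<open>U\<close> at time 1 makes the measure at
   each of these times absolutely continuous, even if the initial measure is singular.\<close>
 have "AE ga in nu. ga (1/real (Suc k)) ~: Z" for k
 proof (rule AE_curve_null[OF nu _ Zn])
  let ?t = "1/real (Suc k)"
  show t: "?t:{0..1}" by auto
  have "0 < ennreal ?t*Uent (N-1) (distr ?P (borel_on H) (%x. x)) m"
   unfolding P(3) using P(5) by(simp add:ennreal_zero_less_mult_iff del:of_nat_Suc)
  also have "... <= Uent (N-1) (curve_marginal H nu ?t) m" using U[OF t] by(rule order_trans[rotated]) simp
  finally show "0 < Uent (N-1) (curve_marginal H nu ?t) m" .
 qed
 hence "AE ga in nu. ALL k. ga (1/real (Suc k)) ~: Z" by(subst AE_all_countable) blast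
 hence "AE ga in nu. False" using a0 a1 OptGeoD(5)[OF nu]
 proof eventually_elim
  case (elim ga)
  have i: "ga 0:Hi" "ga 1:Hi" "QQ (ga 1):C" "G (ga 0) < b" using elim(2) Ki[OF elim(3)] by(auto simp:Gb_def)
  define D where "D = \<bar>G (ga 1) - G (ga 0)\<bar> + 1"
  have D: "0 < D" by(simp add:D_def)
  obtain k where k: "1/real (Suc k) < (b - G (ga 0))/D" using nat_approx_posE[of "(b - G (ga 0))/D"] i(4) D by auto
  let ?t = "1/real (Suc k)"
  have t: "?t:{0..1}" by auto
  note r = inner_of_between[OF elim(4) i(1,2) t]
  have "?t*(G (ga 1) - G (ga 0)) <= ?t*D" unfolding D_def by(intro mult_left_mono) auto
  also have "... < b - G (ga 0)" using k D by(simp add:pos_less_divide_eq del:of_nat_Suc)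
  finally have "G (ga ?t) < b" unfolding r(2) by(simp add:algebra_simps del:of_nat_Suc)
  moreover have "ga ?t:Hi" using r(1) OR_D(2) by blast
  moreover have "QQ (ga ?t) = QQ (ga 1)"
  proof -
   have "ga 1:Ry (ga 0)" using inner_of_between(1)[OF elim(4) i(1,2) zo(2)] OR_D(1) by blast
   thus ?thesis using QQ_cong[OF i(1,2)] QQ_cong[OF i(1) \<open>ga ?t:Hi\<close> OR_D(1)[OF r(1)]] by simp
  qed
  ultimately have "ga ?t:Z" using Z(2) i(3) by(auto simp:Gb_def)
  thus False using elim(1) by blast
 qed
 thus False using prob_space.AE_ex[OF OptGeoD(2)[OF nu]] by blast
qed
moreover have "(%al. em (lam al) UNIV*ind C al):bmeas mq"
 by(intro borel_measurable_times_ennreal measurable_lam borel_measurable_indicator C) simp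
ultimately have "AE al in mq. em (lam al) UNIV*ind C al = 0"
 unfolding I_def by(subst (asm) nn_integral_0_iff_AE) auto
hence "AE al in qq. em (lam al) UNIV*ind C al = 0" unfolding AE_qq_iff .
thus ?thesis using AE_space
proof eventually_elim
 case (elim al)
 hence a: "al:QQ ` Hi" by simp
 show ?case
 proof
  assume "(EX g:J al. g < b) & em (lam al) {..<b} = 0"
  hence "al:C" using a J_less_iff[OF Q_Hi[OF a], of b] by(simp add:C_def)
  thus "em (lam al) UNIV = 0" using elim(1) by simp
 qed
qed
qed

lemma right_tail:
"AE al in qq. (EX g:J al. b < g) & em (lam al) {b<..} = 0 --> em (lam al) UNIV = 0"
proof -
interpret rev: nce_rays "%x y. le y x" H "%x. - G x" m QQ qq ma N by(rule reverse_nce)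
have inn: "inner_part (%x y. le y x) H = Hi" by(rule inner_part_reverse)
show ?thesis using rev.left_tail[of "- b"] AE_good rev.AE_good
proof eventually_elim
 case (elim al)
 have J: "rev.J al = uminus ` J al" by(auto simp:rev.J_def J_def open_ray_reverse[of le])
 have "rev.Gb x = - Gb x" for x by(simp add:rev.Gb_def Gb_def inn)
 hence l: "em (rev.lam al) S = em (lam al) T" if "S:sets borel" "T:sets borel" "!!x. - x:S <-> x:T" for S T
  using rev.lam_eq[OF elim(3) that(1)] lam_eq[OF elim(2) that(2)] that(3) by(simp add:inn)
 have "em (rev.lam al) {..<-b} = em (lam al) {b<..}" "em (rev.lam al) UNIV = em (lam al) UNIV"
  by(intro l; simp)+
 thus ?case using elim(1) by(auto simp:J)
qed
qed

end

section \<open>Brunn--Minkowski inequalities on the rays\<close>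

lemma AE_pair_prob:
assumes M1: "prob_space M1" and M2: "prob_space M2" and P: "AE x in M1. P x" and Q: "AE y in M2. Q y"
shows "AE p in M1 OM M2. P (fst p) & Q (snd p)"
proof -
interpret M1: prob_space M1 by fact
interpret M2: prob_space M2 by fact
obtain N1 where N1: "{x:space M1. ~ P x} <= N1" "em M1 N1 = 0" "N1:sets M1" by(rule AE_E[OF P])
obtain N2 where N2: "{x:space M2. ~ Q x} <= N2" "em M2 N2 = 0" "N2:sets M2" by(rule AE_E[OF Q])
have "N1 \<times> space M2:null_sets (M1 OM M2)" "space M1 \<times> N2:null_sets (M1 OM M2)"
 using N1 N2 by(auto simp:null_sets_def M2.emeasure_pair_measure_Times)
hence "AE p in M1 OM M2. p ~: N1 \<times> space M2" "AE p in M1 OM M2. p ~: space M1 \<times> N2"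
 by(auto intro:AE_not_in)
thus ?thesis using AE_space
 by eventually_elim (use N1(1) N2(1) in "auto simp:space_pair_measure")
qed

lemma distr_pair_fst':
assumes M2: "prob_space M2" and s: "sets M1 = sets N"
shows "distr (M1 OM M2) N fst = M1"
proof -
have "distr (M1 OM M2) N fst = distr (M1 OM M2) M1 fst" by(rule distr_cong) (simp_all add:s)
thus ?thesis using prob_space.distr_pair_fst[OF M2] by simp
qed

lemma distr_pair_snd:
assumes M1: "prob_space M1" and M2: "prob_space M2" and s: "sets M2 = sets N"
shows "distr (M1 OM M2) N snd = M2"
proof (rule measure_eqI)
interpret M1: prob_space M1 by fact
interpret M2: prob_space M2 by fact
fix A assume A: "A:sets (distr (M1 OM M2) N snd)"
hence A': "A:sets M2" using s by simp
have "snd:M1 OM M2 ->M N" using s by(simp add:measurable_cong_sets[OF refl s[symmetric]])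
hence "em (distr (M1 OM M2) N snd) A = em (M1 OM M2) (space M1 \<times> A)"
 using A sets.sets_into_space[OF A'] by(subst emeasure_distr) (auto simp:space_pair_measure intro!:arg_cong2[where f=emeasure])
thus "em (distr (M1 OM M2) N snd) A = em M2 A"
 using A' by(simp add:M2.emeasure_pair_measure_Times M1.emeasure_space_1)
qed (use s in simp)

context nce_rays
begin

text \<open>A probability kernel on the quotient space; off \<open>C\<close> it is a Dirac mass at a
  dummy point, to have a probability measure everywhere.\<close>

definition cond :: "'a set => 'a set => 'a => 'a measure" where
"cond C S al = (if al:C then uniform_measure (ma al) S else return (borel_on H) (SOME x. x:H))"

lemma cond_kernel:
assumes C: "C:sets mq" and S: "S:sets m" and H: "H ~= {}"
 and pos: "!!al. al:C ==> em (ma al) S ~= 0 & em (ma al) S ~= \<infinity>"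
shows "cond C S:mq ->M prob_algebra (borel_on H)"
proof -
have CQ: "al:QQ ` Hi" if "al:C" for al using sets.sets_into_space[OF C] that by auto
have x0: "(SOME x. x:H):space (borel_on H)" using H some_in_eq by(auto simp:space_restrict_space)
have prob: "prob_space (cond C S al)" for al
 using pos x0 by(auto simp:cond_def intro!:prob_space_uniform_measure prob_space_return)
have sets: "sets (cond C S al) = sets (borel_on H)" for al
 using CQ by(auto simp:cond_def uniform_measure_def sets_ma)
show ?thesis
proof (intro measurable_prob_algebraI prob measurable_subprob_algebra sets prob_space_imp_subprob_space)
 fix A assume A: "A:sets (borel_on H)"
 hence Am: "S Int A:sets m" using S by(simp add:sets_m)
 have "(%al. if al:C then em (ma al) (S Int A)/em (ma al) S else ind A (SOME x. x:H)):bmeas mq"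
 proof -
  note [measurable] = C measurable_ma_completion[OF Am] measurable_ma_completion[OF S]
  show ?thesis by measurable
 qed
 moreover have "em (cond C S al) A = (if al:C then em (ma al) (S Int A)/em (ma al) S else ind A (SOME x. x:H))" for al
  using A S sets_ma_iff[OF CQ] by(auto simp:cond_def sets_m)
 ultimately show "(%al. em (cond C S al) A):bmeas mq" by simp
qed
qed

lemma cond_AE:
assumes "al:C" "S:sets m" "al:QQ ` Hi" "AE x in ma al. P x"
shows "AE x in cond C S al. x:S & P x"
proof -
have "AE x in ma al. x:S --> x:S & P x" using assms(4) by eventually_elim simp
hence "AE x in uniform_measure (ma al) S. x:S & P x"
 using assms(2,3) sets_ma_iff by(intro AE_uniform_measureI) blast+
moreover have "cond C S al = uniform_measure (ma al) S" using assms(1) by(simp add:cond_def)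
ultimately show ?thesis by(simp only:)
qed

text \<open>Normalizing on a ray costs at most the factor \<open>1/u\<close>, averaging over
  \<open>C\<close> the factor \<open>1/q\<close>; the rest is the disintegration formula.\<close>

lemma average_le:
assumes C: "C:sets mq" and S: "S:sets m" "S <= Hi" and q: "0 < q" "em mq C = ennreal q" and u: "0 < u"
 and pos: "!!al. al:C ==> ennreal u <= em (ma al) S & em (ma al) S ~= \<infinity>" and B: "B:sets m"
shows "em (uniform_measure mq C \<bind> cond C S) B <= ennreal (1/(q*u))*em (completion m) {x:B Int S. QQ x:C}"
proof -
have ne: "C ~= {}" using q by auto
then obtain al0 where "al0:C" by blast
hence "al0:QQ ` Hi" using sets.sets_into_space[OF C] by auto
hence H: "H ~= {}" using Hi_subset by auto
have pos': "em (ma al) S ~= 0 & em (ma al) S ~= \<infinity>" if "al:C" for al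
 using pos[OF that] order_less_le_trans[of 0 "ennreal u" "em (ma al) S"] u by auto
have k: "cond C S:mq ->M subprob_algebra (borel_on H)"
 by(rule measurable_prob_algebraD, rule cond_kernel[OF C S(1) H]) (rule pos')
have k': "cond C S:uniform_measure mq C ->M subprob_algebra (borel_on H)"
 using k by(simp add:uniform_measure_def)
have m: "(%al. em (cond C S al) B):bmeas mq"
 by(rule measurable_emeasure_kernel[OF k]) (rule B[unfolded sets_m])
have BS: "B Int S:sets m" "B Int S <= Hi" using B S by auto
have "em (uniform_measure mq C \<bind> cond C S) B = nn_integral (uniform_measure mq C) (%al. em (cond C S al) B)"
 using \<open>al0:QQ ` Hi\<close> by(intro emeasure_bind[OF _ k' B[unfolded sets_m]]) (auto simp:uniform_measure_def)
also have "... = nn_integral mq (%al. em (cond C S al) B*ind C al)/em mq C"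
 using m C by(rule nn_integral_uniform_measure)
also have "... <= nn_integral mq (%al. ennreal (1/u)*(em (ma al) (B Int S)*ind C al))/em mq C"
proof (intro divide_right_mono_ennreal nn_integral_mono)
 fix al assume "al:space mq"
 hence a: "al:QQ ` Hi" by simp
 show "em (cond C S al) B*ind C al <= ennreal (1/u)*(em (ma al) (B Int S)*ind C al)"
 proof (cases "al:C")
  case True
  hence "em (cond C S al) B = em (ma al) (B Int S)/em (ma al) S"
   using B S sets_ma_iff[OF a] by(simp add:cond_def Int_commute)
  also have "... <= em (ma al) (B Int S)/ennreal u"
  proof -
   have e: "em (ma al) S = ennreal (measure (ma al) S)" using pos[OF True] by(intro emeasure_eq_ennreal_measure) simp
   hence "u <= measure (ma al) S" using pos[OF True] by(simp add:ennreal_le_iff)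
   thus ?thesis unfolding divide_ennreal_def e using u
    by(intro mult_left_mono) (auto simp:inverse_ennreal intro!:ennreal_leI)
  qed
  also have "... = ennreal (1/u)*em (ma al) (B Int S)"
   unfolding divide_ennreal_def inverse_ennreal[OF u] by(simp add:mult.commute inverse_eq_divide)
  finally show ?thesis using True by simp
 qed simp
qed
also have "... = ennreal (1/u)*em (completion m) {x:B Int S. QQ x:C}/em mq C"
 unfolding fibre_formula0[OF BS C] using measurable_ma_completion[OF BS(1)] C
 by(subst nn_integral_cmult) auto
also have "... = ennreal (1/(q*u))*em (completion m) {x:B Int S. QQ x:C}"
 unfolding divide_ennreal_def q(2) inverse_ennreal[OF q(1)] using q(1) u
 by(simp add:ennreal_mult'[symmetric] mult.assoc[symmetric] mult.commute[of _ "ennreal (inverse q)"] field_simps)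
finally show ?thesis .
qed

text \<open>Suppose that the rays violating the inequality with the bounds \<open>u\<close>,
  \<open>v\<close>, \<open>w\<close> had measure \<open>q > 0\<close>. Averages over them of the
  normalized restrictions to the two slabs have \<open>U\<close> at least the
  \<open>(N-1)\<close>-th roots of \<open>q*u\<close> and \<open>q*v\<close>, while the intermediate
  measure is concentrated on a set of measure at most \<open>w*q\<close>. The factor
  \<open>q\<close> cancels, and \<open>lt\<close> is contradicted.\<close>

lemma bm_step:
assumes ab: "a0 <= b0" "b0 < a1" "a1 <= b1" and t: "0 < t" "t < 1" and u: "0 < u" "0 < v" "0 < w"
 and lt: "w < ((1-t)*u powr (1/(N-1))+t * v powr (1/(N-1))) powr (N-1)"
shows "AE al in qq. ~ (ennreal u <= em (lam al) {a0..b0} & em (lam al) {a0..b0} ~= \<infinity> &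
 ennreal v <= em (lam al) {a1..b1} & em (lam al) {a1..b1} ~= \<infinity> &
 em (lam al) {(1-t)*a0+t*a1..(1-t)*b0+t*b1} <= ennreal w)"
proof -
let ?At = "{(1-t)*a0+t*a1..(1-t)*b0+t*b1}"
define S0 where "S0 = {x:Hi. Gb x:{a0..b0}}"
define S1 where "S1 = {x:Hi. Gb x:{a1..b1}}"
define St where "St = {x:Hi. Gb x:?At}"
have S: "S0:sets m" "S0 <= Hi" "S1:sets m" "S1 <= Hi" "St:sets m" "St <= Hi"
 unfolding S0_def S1_def St_def by((rule slab_m, simp) | blast)+
obtain Nn where Nn: "{al:space qq. ~ good al} <= Nn" "em qq Nn = 0" "Nn:sets qq" by(rule AE_E[OF AE_good])
define C where "C = {al:space mq. al ~: Nn & ennreal u <= em (lam al) {a0..b0} & em (lam al) {a0..b0} ~= \<infinity> &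
 ennreal v <= em (lam al) {a1..b1} & em (lam al) {a1..b1} ~= \<infinity> & em (lam al) ?At <= ennreal w}"
have C: "C:sets mq"
proof -
 have [measurable]: "(%al. em (lam al) {a0..b0}):bmeas mq" "(%al. em (lam al) {a1..b1}):bmeas mq"
  "(%al. em (lam al) ?At):bmeas mq" by(intro measurable_lam; simp)+
 have [measurable]: "Nn:sets mq" using Nn(3) by simp
 show ?thesis unfolding C_def by measurable
qed
have Cg: "good al" "ennreal u <= em (ma al) S0 & em (ma al) S0 ~= \<infinity>"
 "ennreal v <= em (ma al) S1 & em (ma al) S1 ~= \<infinity>" "em (ma al) St <= ennreal w" if "al:C" for al
proof -
 show g: "good al" using that Nn(1) by(auto simp:C_def)
 thus "ennreal u <= em (ma al) S0 & em (ma al) S0 ~= \<infinity>"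
  "ennreal v <= em (ma al) S1 & em (ma al) S1 ~= \<infinity>" "em (ma al) St <= ennreal w"
  using that lam_eq[OF g, of "{a0..b0}"] lam_eq[OF g, of "{a1..b1}"] lam_eq[OF g, of ?At]
  unfolding S0_def S1_def St_def C_def by auto
qed
have "em mq C = 0"
proof (rule ccontr)
 assume nz: "em mq C ~= 0"
 then obtain al0 where "al0:C" by fastforce
 hence Q0: "QQ ` Hi ~= {}" "Hi ~= {}" "H ~= {}" using Cg(1) goodD(1) Hi_subset by auto
 interpret qq: prob_space qq by(rule prob_qq[OF Q0(2)])
 have "QQ ` Hi:sets qq" using sets.top[of qq] by simp
 hence pq: "prob_space mq" by(intro prob_spaceI) (simp add:qq.emeasure_space_1[simplified])
 interpret mq: prob_space mq by(rule pq)
 define q where "q = measure mq C"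
 have q: "em mq C = ennreal q" by(simp only: q_def mq.emeasure_eq_measure)
 hence q0: "0 < q" using nz by(metis ennreal_eq_0_iff linorder_not_le)
 define P where "P = uniform_measure mq C"
 have P: "prob_space P" unfolding P_def using nz mq.emeasure_finite[of C] by(intro prob_space_uniform_measure) auto
 interpret P: prob_space P by(rule P)
 have sP: "sets P = sets mq" "space P = QQ ` Hi" by(simp_all add:P_def uniform_measure_def)
 have pos: "!!al. al:C ==> em (ma al) S0 ~= 0 & em (ma al) S0 ~= \<infinity>"
  "!!al. al:C ==> em (ma al) S1 ~= 0 & em (ma al) S1 ~= \<infinity>"
  using Cg(2,3) u by force+
 have k: "cond C S0:P ->M prob_algebra (borel_on H)" "cond C S1:P ->M prob_algebra (borel_on H)"
  using cond_kernel[OF C S(1) Q0(3) pos(1)] cond_kernel[OF C S(3) Q0(3) pos(2)] by(simp_all add:measurable_cong_sets[OF sP(1) refl])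
 have kp: "(%al. cond C S0 al OM cond C S1 al):P ->M prob_algebra (borel_on H OM borel_on H)"
  using k by measurable
 note ks = measurable_prob_algebraD[OF kp]
 \<comment> \<open>On each ray the first slab lies below the second, so the product of the two
   conditional measures is already causal.\<close>
 let ?pr = "P \<bind> (%al. cond C S0 al OM cond C S1 al)"
 have ps: "prob_space (cond C S0 al)" "prob_space (cond C S1 al)" "sets (cond C S0 al) = sets (borel_on H)"
  "sets (cond C S1 al) = sets (borel_on H)" if "al:space P" for al
  using measurable_space[OF k(1) that] measurable_space[OF k(2) that] by(simp_all add:space_prob_algebra)
 have "AE al in P. prob_space (cond C S0 al OM cond C S1 al)" by(intro AE_I2 prob_space_pair ps)
 hence pr: "prob_space ?pr" by(rule P.prob_space_bind[OF _ ks])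
 have prs: "sets ?pr = sets (borel_on H OM borel_on H)" by(rule sets_bind_measurable[OF ks]) (use Q0(1) sP(2) in simp)
 have m1: "fst:?pr ->M borel_on H" "snd:?pr ->M borel_on H" by(simp_all add:measurable_cong_sets[OF prs refl])
 have mu0: "distr ?pr (borel_on H) fst = P \<bind> cond C S0"
 proof -
  have "distr ?pr (borel_on H) fst = P \<bind> (%al. distr (cond C S0 al OM cond C S1 al) (borel_on H) fst)"
   using Q0(1) sP(2) by(intro distr_bind[OF ks]) auto
  also have "... = P \<bind> cond C S0"
   by(rule bind_cong[OF refl])
    (use ps in "simp add:distr_pair_fst'")
  finally show ?thesis .
 qed
 have mu1: "distr ?pr (borel_on H) snd = P \<bind> cond C S1"
 proof -
  have "distr ?pr (borel_on H) snd = P \<bind> (%al. distr (cond C S0 al OM cond C S1 al) (borel_on H) snd)"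
   using Q0(1) sP(2) by(intro distr_bind[OF ks]) auto
  also have "... = P \<bind> cond C S1"
   by(rule bind_cong[OF refl]) (use ps in "simp add:distr_pair_snd")
  finally show ?thesis .
 qed
 have "AE al in P. AE p in cond C S0 al OM cond C S1 al. le (fst p) (snd p)"
  unfolding P_def
 proof (rule AE_uniform_measureI[OF C], rule AE_I2, rule impI)
  fix al assume "al:space mq" and a: "al:C"
  hence aP: "al:space P" "al:QQ ` Hi" using sP by auto
  note ga = goodD[OF Cg(1)[OF a]]
  have "AE p in cond C S0 al OM cond C S1 al. (fst p:S0 & fst p:OpR al) & (snd p:S1 & snd p:OpR al)"
   by(intro AE_pair_prob ps[OF aP(1)] cond_AE a S aP(2) ga(3))
  thus "AE p in cond C S0 al OM cond C S1 al. le (fst p) (snd p)"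
  proof eventually_elim
   case (elim p)
   hence "G (fst p) <= G (snd p)" using ab by(auto simp:S0_def S1_def Gb_def)
   thus ?case using gauge_le_iff[OF ga(2)] elim by blast
  qed
 qed
 moreover have "Measurable.pred (borel_on H OM borel_on H) (%p. le (fst p) (snd p))"
 unfolding pred_def
 proof -
  have "{p:space (borel_on H OM borel_on H). le (fst p) (snd p)} = {p:H \<times> H. le (fst p) (snd p)}"
   by(simp add:space_pair_measure space_restrict_space)
  thus "{p:space (borel_on H OM borel_on H). le (fst p) (snd p)}:sets (borel_on H OM borel_on H)"
   using le_pairs_measurable[OF closed_le, of H] by simp
 qed
 ultimately have "AE p in ?pr. le (fst p) (snd p)" by(subst AE_bind[OF ks])
 then obtain nu where nu: "nu:OptGeo le H G (P \<bind> cond C S0) (P \<bind> cond C S1)"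
  and U: "!!t. t:{0..1} ==> ennreal (1-t)*Uent (N-1) (P \<bind> cond C S0) m +
    ennreal t*Uent (N-1) (P \<bind> cond C S1) m <= Uent (N-1) (curve_marginal H nu t) m"
  using plan[OF pr m1] unfolding mu0 mu1 by blast
 have avg: "ennreal ((q*u) powr (1/(N-1))) <= Uent (N-1) (P \<bind> cond C S) m &
   (EX F:sets m. F <= {x:S. QQ x:C} & (AE x in P \<bind> cond C S. x:F))"
  if S: "S:sets m" "S <= Hi" and u: "0 < u" and pos: "!!al. al:C ==> ennreal u <= em (ma al) S & em (ma al) S ~= \<infinity>"
   and pr: "prob_space (P \<bind> cond C S)" and st: "sets (P \<bind> cond C S) = sets (borel_on H)" for S u
 proof
  have le: "em (P \<bind> cond C S) B <= ennreal (1/(q*u))*em (completion m) {x:B Int S. QQ x:C}"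
   if "B:sets m" for B unfolding P_def by(rule average_le[OF C S q0 q u _ that]) (rule pos)
  have "ennreal ((1/(1/(q*u))) powr (1/(N-1))) <= Uent (N-1) (P \<bind> cond C S) m"
  proof (rule m.Uent_ge_of_bounded[OF pr])
   fix B assume B: "B:sets m"
   have "em (completion m) {x:B Int S. QQ x:C} <= em (completion m) B" using B by(intro emeasure_mono) auto
   thus "em (P \<bind> cond C S) B <= ennreal (1/(q*u))*em m B"
    by(intro order_trans[OF le[OF B]] mult_left_mono) (use B in simp_all)
  qed (use N q0 u in "simp_all add:st sets_m")
  thus "ennreal ((q*u) powr (1/(N-1))) <= Uent (N-1) (P \<bind> cond C S) m" by simp
  note F = fibre_measurable[OF S C]
  define F where "F = main_part m {x:S. QQ x:C}"
  have Fm: "F:sets m" "F <= {x:S. QQ x:C}"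
   using main_part_null_part_Un[OF F] main_part_sets[OF F] by(auto simp:F_def)
  have "{x:(H - F) Int S. QQ x:C} <= null_part m {x:S. QQ x:C}"
   using main_part_null_part_Un[OF F] by(auto simp:F_def)
  moreover have "null_part m {x:S. QQ x:C}:null_sets (completion m)" by(rule null_part_null_sets[OF F])
  ultimately have "em (completion m) {x:(H - F) Int S. QQ x:C} = 0"
   using null_sets_completion_subset[of "{x:(H - F) Int S. QQ x:C}"] by blast
  moreover have HF: "H - F:sets m" using Fm(1) sets.compl_sets[of F m] by simp
  ultimately have "em (P \<bind> cond C S) (H - F) = 0" using le[OF HF] by simp
  hence "H - F:null_sets (P \<bind> cond C S)" using HF st by(auto simp:sets_m)
  hence nF: "AE x in P \<bind> cond C S. x ~: H - F" by(rule AE_not_in)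
  have sH: "space (P \<bind> cond C S) = H" using sets_eq_imp_space_eq[OF st] by(simp add:space_restrict_space)
  have "AE x in P \<bind> cond C S. x:F"
   using nF AE_space[of "P \<bind> cond C S"] unfolding sH by eventually_elim simp
  thus "EX F:sets m. F <= {x:S. QQ x:C} & (AE x in P \<bind> cond C S. x:F)" using Fm by blast
 qed
 interpret pi: prob_space ?pr by(rule pr)
 have pr: "prob_space (P \<bind> cond C S0)" "prob_space (P \<bind> cond C S1)"
  using pi.prob_space_distr[OF m1(1)] pi.prob_space_distr[OF m1(2)] unfolding mu0 mu1 by auto
 have st: "sets (P \<bind> cond C S0) = sets (borel_on H)" "sets (P \<bind> cond C S1) = sets (borel_on H)"
  unfolding mu0[symmetric] mu1[symmetric] by simp_all
 have U0: "ennreal ((q*u) powr (1/(N-1))) <= Uent (N-1) (P \<bind> cond C S0) m"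
  and U1: "ennreal ((q * v) powr (1/(N-1))) <= Uent (N-1) (P \<bind> cond C S1) m"
  using avg[OF S(1,2) u(1) Cg(2) pr(1) st(1)] avg[OF S(3,4) u(2) Cg(3) pr(2) st(2)] by auto
 obtain F0 where F0: "F0:sets m" "F0 <= {x:S0. QQ x:C}" "AE x in P \<bind> cond C S0. x:F0"
  using avg[OF S(1,2) u(1) Cg(2) pr(1) st(1)] by blast
 obtain F1 where F1: "F1:sets m" "F1 <= {x:S1. QQ x:C}" "AE x in P \<bind> cond C S1. x:F1"
  using avg[OF S(3,4) u(2) Cg(3) pr(2) st(2)] by blast
 obtain Z where Z: "Z:sets m" "{x:St. QQ x:C} <= Z"
  and Ze: "em m Z = nn_integral mq (%al. em (ma al) St*ind C al)"
  using fibre_outer[OF S(5,6) C] by auto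
 have "em m Z <= nn_integral mq (%al. ennreal w*ind C al)"
  unfolding Ze by(intro nn_integral_mono) (use Cg(4) in "auto split:split_indicator")
 also have "... = ennreal (w*q)" using C q u by(subst nn_integral_cmult_indicator) (auto simp:ennreal_mult')
 finally have Zw: "em m Z <= ennreal (w*q)" .
 have zo: "(0::real):{0..1}" "(1::real):{0..1}" "t:{0..1}" using t by auto
 have a0: "AE ga in nu. ga 0:F0"
  unfolding AE_curve_iff(1)[OF nu zo(1) F0(1), symmetric] OptGeoD(3)[OF nu] by(rule F0(3))
 have a1: "AE ga in nu. ga 1:F1"
  unfolding AE_curve_iff(1)[OF nu zo(2) F1(1), symmetric] OptGeoD(4)[OF nu] by(rule F1(3))
 have "AE ga in nu. ga t:Z" using a0 a1 OptGeoD(5)[OF nu]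
 proof eventually_elim
  case (elim ga)
  have i: "ga 0:Hi" "ga 1:Hi" "QQ (ga 0):C" "a0 <= G (ga 0)" "G (ga 0) <= b0" "a1 <= G (ga 1)" "G (ga 1) <= b1"
   using elim(1,2) F0(2) F1(2) by(auto simp:S0_def S1_def Gb_def)
  note r = inner_of_between[OF elim(3) i(1,2) zo(3)]
  have h: "ga t:Hi" using r(1) OR_D(2) by blast
  have "G (ga t):?At" unfolding r(2) using i t by(auto intro!:add_mono mult_left_mono)
  hence "ga t:St" using h by(simp add:St_def Gb_def)
  moreover have "QQ (ga t) = QQ (ga 0)" by(rule QQ_cong[OF i(1) h OR_D(1)[OF r(1)]])
  ultimately show ?case using Z(2) i(3) by auto
 qed
 hence "AE x in curve_marginal H nu t. x:Z" unfolding AE_curve_iff(1)[OF nu zo(3) Z(1)] .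
 moreover have "prob_space (curve_marginal H nu t)"
  by(rule prob_space.prob_space_distr[OF OptGeoD(2)[OF nu] curve_eval[OF nu zo(3)]])
 ultimately have Ut: "Uent (N-1) (curve_marginal H nu t) m <= ennreal ((w*q) powr (1/(N-1)))"
  using u q0 N Z(1) Zw by(intro m.Uent_le_of_concentrated) (auto simp:sets_m)
 define X where "X = (1-t)*u powr (1/(N-1))+t * v powr (1/(N-1))"
 have X0: "0 < X" unfolding X_def using t u by(intro add_pos_pos mult_pos_pos) auto
 have "ennreal (1-t)*ennreal ((q*u) powr (1/(N-1)))+ennreal t*ennreal ((q * v) powr (1/(N-1)))
   <= ennreal ((w*q) powr (1/(N-1)))"
  by(rule order_trans[OF add_mono[OF mult_left_mono[OF U0] mult_left_mono[OF U1]] order_trans[OF U[OF zo(3)] Ut]]) auto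
 hence "(1-t)*(q*u) powr (1/(N-1))+t*(q * v) powr (1/(N-1)) <= (w*q) powr (1/(N-1))"
  using t by(simp add:ennreal_mult'[symmetric] ennreal_plus[symmetric] del:ennreal_plus)
 hence "q powr (1/(N-1))*X <= q powr (1/(N-1))*w powr (1/(N-1))"
  using q0 u by(simp add:powr_mult X_def algebra_simps)
 hence "X <= w powr (1/(N-1))" using q0 by simp
 hence "X powr (N-1) <= (w powr (1/(N-1))) powr (N-1)" using X0 N by(intro powr_mono2) auto
 also have "... = w" using N u by(simp add:powr_powr)
 finally show False using lt by(simp add:X_def)
qed
hence "AE al in mq. al ~: C" using C by(intro AE_not_in) auto
hence "AE al in qq. al ~: C" unfolding AE_qq_iff .
moreover have "AE al in qq. al ~: Nn" using Nn(2,3) by(intro AE_not_in) auto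
ultimately show ?thesis using AE_space
 by eventually_elim (simp add:C_def)
qed

lemma rational_between:
fixes x y :: real assumes "x < y" shows "EX r:Rats. x < r & r < y"
using Rats_dense_in_real[OF assms] .

text \<open>\<open>bm_step\<close> is used for all rational triples below the interpolation function
  \<open>F\<close>. A violation with real masses yields such a triple, because slightly smaller
  first arguments still leave a gap above \<open>w\<close>.\<close>

lemma bm_lam:
assumes ab: "a0 <= b0" "b0 < a1" "a1 <= b1" and t: "0 < t" "t < 1"
shows "AE al in qq. a0:J al --> b1:J al --> 0 < measure (lam al) {a0..b0} --> 0 < measure (lam al) {a1..b1} -->
 ((1-t)*measure (lam al) {a0..b0} powr (1/(N-1))+t*measure (lam al) {a1..b1} powr (1/(N-1))) powr (N-1)
  <= measure (lam al) {(1-t)*a0+t*a1..(1-t)*b0+t*b1}"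
proof -
let ?At = "{(1-t)*a0+t*a1..(1-t)*b0+t*b1}"
define F where "F u v = ((1-t)*u powr (1/(N-1))+t * v powr (1/(N-1))) powr (N-1)" for u v
define T where "T = {p :: (real \<times> real) \<times> real. fst (fst p):Rats & snd (fst p):Rats & snd p:Rats &
 0 < fst (fst p) & 0 < snd (fst p) & 0 < snd p & snd p < F (fst (fst p)) (snd (fst p))}"
have "countable ((Rats \<times> Rats) \<times> Rats :: ((real \<times> real) \<times> real) set)" by(intro countable_SIGMA countable_rat)
hence cT: "countable T" by(rule countable_subset[rotated]) (auto simp:T_def)
have "AE al in qq. ALL p:T. ~ (ennreal (fst (fst p)) <= em (lam al) {a0..b0} & em (lam al) {a0..b0} ~= \<infinity> &
 ennreal (snd (fst p)) <= em (lam al) {a1..b1} & em (lam al) {a1..b1} ~= \<infinity> & em (lam al) ?At <= ennreal (snd p))"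
 unfolding AE_ball_countable[OF cT]
 by(intro ballI bm_step ab t) (auto simp:T_def F_def)
thus ?thesis using AE_good
proof eventually_elim
 case (elim al)
 show ?case
 proof (intro impI, fold F_def, rule ccontr)
  define u v w where "u = measure (lam al) {a0..b0}" and "v = measure (lam al) {a1..b1}" and "w = measure (lam al) ?At"
  assume J: "a0:J al" "b1:J al" and uv: "0 < measure (lam al) {a0..b0}" "0 < measure (lam al) {a1..b1}"
   and "~ F (measure (lam al) {a0..b0}) (measure (lam al) {a1..b1}) <= measure (lam al) ?At"
  hence lt: "w < F u v" "0 < u" "0 < v" "0 <= w" by(auto simp:u_def v_def w_def)
  have fin: "em (lam al) S < \<infinity>" if "S <= {a0..b1}" for S
   by(rule le_less_trans[OF emeasure_mono[OF that]]) (use lam_compact[OF elim(2), of a0 b1] J J_subset_IA in auto)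
  have At: "?At <= {a0..b1}"
  proof
   fix x assume x: "x:?At"
   have "(1-t)*a0+t*a0 <= (1-t)*a0+t*a1" "(1-t)*b0+t*b1 <= (1-t)*b1+t*b1"
    using t ab by(auto intro!:add_mono mult_left_mono)
   thus "x:{a0..b1}" using x by(simp add:algebra_simps)
  qed
  have e: "em (lam al) {a0..b0} = ennreal u" "em (lam al) {a1..b1} = ennreal v" "em (lam al) ?At = ennreal w"
   unfolding u_def v_def w_def using fin[of "{a0..b0}"] fin[of "{a1..b1}"] fin[OF At] ab
   by(auto intro!:emeasure_eq_ennreal_measure)
  have F0: "0 < F u v" using lt by linarith
  \<comment> \<open>\<open>F\<close> is homogeneous of degree 1, so multiplying both masses by
    \<open>s\<close> multiplies its value by \<open>s\<close>; \<open>s\<close> is halfway between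
    \<open>w/F u v\<close> and 1.\<close>
  define s where "s = (w/F u v+1)/2"
  have s: "0 < s" "s < 1" "w < s*F u v" using F0 lt by(auto simp:s_def field_simps)
  have sF: "F (s*u) (s * v) = s*F u v"
  proof -
   have "(1-t)*(s*u) powr (1/(N-1))+t*(s * v) powr (1/(N-1)) =
     s powr (1/(N-1))*((1-t)*u powr (1/(N-1))+t * v powr (1/(N-1)))"
    using s lt by(simp add:powr_mult algebra_simps)
   thus ?thesis using s t N unfolding F_def by(simp add:powr_mult powr_powr)
  qed
  obtain u0 where u0: "u0:Rats" "s*u < u0" "u0 < u" using rational_between[of "s*u" u] s lt by auto
  obtain v0 where v0: "v0:Rats" "s * v < v0" "v0 < v" using rational_between[of "s * v" v] s lt by auto
  obtain w0 where w0: "w0:Rats" "w < w0" "w0 < s*F u v" using rational_between[OF s(3)] by auto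
  have su: "0 < s*u" "0 < s * v" using s lt by auto
  have "F (s*u) (s * v) <= F u0 v0" unfolding F_def
   using u0 v0 su t N by(intro powr_mono2 add_mono mult_left_mono) (auto intro!:add_nonneg_nonneg)
  hence "((u0, v0), w0):T" using u0 v0 w0 su sF lt by(simp add:T_def)
  thus False using elim(1) e u0 v0 w0 by(fastforce intro:ennreal_leI)
 qed
qed
qed

end

section \<open>The curvature condition on the rays\<close>

lemma concave_on_realI:
fixes f :: "real => real"
assumes "convex S" "!!t x y. 0 < t ==> t < 1 ==> x:S ==> y:S ==> (1-t)*f x+t*f y <= f ((1-t)*x+t*y)"
shows "concave_on S f"
unfolding concave_on_def
proof (rule convex_onI)
fix t x y :: real assume "0 < t" "t < 1" "x:S" "y:S"
from assms(2)[OF this] show "- f ((1-t) *\<^sub>R x+t *\<^sub>R y) <= (1-t) * - f x+t * - f y" by simp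
qed (rule assms(1))

text \<open>The limit \<open>e -> 0\<close> of concavity between \<open>p\<close> and points of
  \<open>J\<close> that approach \<open>q\<close>, whose values are at least 0; so \<open>q\<close>,
  which may be outside \<open>J\<close>, acts as a point of value 0.\<close>

lemma concave_endpoint:
fixes k :: "real => real"
assumes k: "concave_on J k" "!!x. x:J ==> 0 <= k x" and th: "0 < th" "th < 1" and p: "p:J"
 and q: "!!e. 0 < e ==> e < 1 ==> q+e*(((1 - th)*q+th*p) - q):J"
shows "th*k p <= k ((1 - th)*q+th*p)"
proof -
let ?z = "(1 - th)*q+th*p"
have le: "(1 - e)*th/(1 - e*th)*k p <= k ?z" if e: "0 < e" "e < 1" for e
proof -
 let ?q = "q+e*(?z - q)"
 let ?s = "(1 - e)*th/(1 - e*th)"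
 have et: "e*th < 1" using mult_strict_mono[of e 1 th 1] e th by simp
 have s: "0 <= ?s" "?s <= 1" using e th et by(auto simp:divide_le_eq_1 algebra_simps)
 have z: "(1 - ?s)*?q+?s*p = ?z" using et by(simp add:divide_simps) (simp add:algebra_simps)
 have "0 <= (1 - ?s)*k ?q" using s k(2)[OF q[OF e]] by simp
 hence "?s*k p <= (1 - ?s)*k ?q+?s*k p" by(rule add_increasing) simp
 also have "... <= k ((1 - ?s)*?q+?s*p)"
  using concave_onD[OF k(1) s q[OF e] p] by simp
 finally show ?thesis unfolding z .
qed
have "((%e. (1 - e)*th/(1 - e*th)*k p) \<longlongrightarrow> (1 - 0)*th/(1 - 0*th)*k p) (at_right 0)"
 by(intro tendsto_intros) auto
moreover have "eventually (%e::real. (1 - e)*th/(1 - e*th)*k p <= k ?z) (at_right 0)"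
 unfolding eventually_at_right_field using le by(intro exI[of _ 1]) simp
ultimately show ?thesis using tendsto_upperbound[of _ "th*k p" "at_right (0::real)"] by fastforce
qed

text \<open>Only extreme points of \<open>S\<close> can be outside \<open>J\<close>. Lowering the
  value at an extreme point, here to 0, preserves concavity.\<close>

lemma concave_extend_zero:
fixes k :: "real => real"
assumes k: "concave_on J k" "!!x. x:J ==> 0 <= k x" and S: "convex S"
 and between: "!!x y z. x:S ==> y:S ==> x < z ==> z < y ==> z:J"
shows "concave_on S (%x. if x:J then k x else 0)"
proof -
let ?k = "%x. if x:J then k x else 0"
have bt: "z:J" if "x:S" "y:S" "x ~= y" "0 < t" "t < 1" "z = (1-t)*x+t*y" for x y z t
proof (cases "x < y")
 case True
 hence "0 < t*(y - x)" "0 < (1-t)*(y - x)" using that by auto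
 moreover have "z = x+t*(y - x)" "z = y - (1-t)*(y - x)" using that(6) by(simp_all add:algebra_simps)
 ultimately show ?thesis using between[OF that(1,2), of z] by linarith
next
 case False
 hence "0 < t*(x - y)" "0 < (1-t)*(x - y)" using that by auto
 moreover have "z = x - t*(x - y)" "z = y+(1-t)*(x - y)" using that(6) by(simp_all add:algebra_simps)
 ultimately show ?thesis using between[OF that(2,1), of z] by linarith
qed
have "(1-t)*?k x+t*?k y <= ?k ((1-t)*x+t*y)" if xy: "x:S" "y:S" and t: "0 < t" "t < 1" for t x y
proof (cases "x = y")
 case False
 define z where "z = (1-t)*x+t*y"
 have z: "z:J" using bt[OF xy False t z_def] .
 have zS: "z:S" using convexD[OF S xy, of "1 - t" t] t by(simp add:z_def)
 have zne: "z ~= x" "z ~= y"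
 proof -
  have "z - x = t*(y - x)" "z - y = (1-t)*(x - y)" by(simp_all add:z_def algebra_simps)
  thus "z ~= x" "z ~= y" using False t by auto
 qed
 have b: "w+e*(z - w):J" if "w:S" "w ~= z" "0 < e" "e < 1" for w e
  by(rule bt[OF that(1) zS that(2-4)]) (simp add:algebra_simps)
 show ?thesis
 proof (cases "x:J"; cases "y:J")
  assume "x:J" "y:J"
  thus ?thesis using concave_onD[OF k(1), of t x y] t z by(simp add:z_def)
 next
  assume x: "x:J" and y: "y ~: J"
  have "(1-t)*k x <= k ((1 - (1-t))*y+(1-t)*x)"
  proof (rule concave_endpoint[OF k _ _ x])
   fix e :: real assume "0 < e" "e < 1"
   thus "y+e*((1 - (1-t))*y+(1-t)*x - y):J"
    using b[OF xy(2)] zne by(simp add:z_def algebra_simps)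
  qed (use t in auto)
  thus ?thesis using x y z by(simp add:z_def algebra_simps)
 next
  assume x: "x ~: J" and y: "y:J"
  have "t*k y <= k ((1-t)*x+t*y)"
  proof (rule concave_endpoint[OF k t y])
   fix e :: real assume "0 < e" "e < 1"
   thus "x+e*((1-t)*x+t*y - x):J"
    using b[OF xy(1)] zne by(simp add:z_def)
  qed
  thus ?thesis using x y z by(simp add:z_def)
 next
  assume "x ~: J" "y ~: J"
  thus ?thesis using k(2)[OF z] z by(simp add:z_def)
 qed
qed (simp add:algebra_simps)
thus ?thesis by(intro concave_on_realI S)
qed

section \<open>Conditional measures as densities\<close>

context ray_measure
begin

lemma ray_interval_eq: "ray_interval le H G al = (%g. g - G al) ` IA al"
by(auto simp:ray_interval_def IA_def)

lemma mem_ray_interval: "t:ray_interval le H G al <-> t+G al:IA al"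
unfolding ray_interval_eq by(auto intro:image_eqI[of _ _ "t+G al"])

lemma Psi_eq:
assumes a: "al:Hi" and t: "t:ray_interval le H G al"
shows "Psi le H G al t = PT al (t+G al)"
unfolding Psi_def
proof (rule the_inv_into_f_eq)
have g: "t+G al:IA al" using t by(simp add:mem_ray_interval)
show "inj_on (%y. GE al y - G al) (Ry al)" using GE_inj[OF a] by(auto simp:inj_on_def)
show "GE al (PT al (t+G al)) - G al = t" using GE_PT[OF a g] by simp
show "PT al (t+G al):Ry al" by(rule PT_mem[OF a g])
qed

lemma IA_borel: "al:Hi ==> IA al:sets borel"
by(rule interval_borel[OF IA_interval])

lemma PT_preimage_IA_borel:
assumes a: "al:Hi" and B: "B:sets m"
shows "{g:IA al. PT al g:B}:sets borel"
proof -
have [measurable]: "B:sets borel" "IA al:sets borel" using B IA_borel[OF a] by(auto simp:m_iff)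
have "{g:IA al. PT al g:B} = {g. g:IA al & PB (al, g):B}"
 using a by(auto simp:PB_def IA_pairs_def)
also have "... : sets borel" by measurable
finally show ?thesis .
qed

text \<open>The coordinate used by \<open>Psi\<close> is centred at \<open>al\<close>; the
  translation by \<open>G al\<close> leads back to gauge values.\<close>

lemma emeasure_ray_density:
assumes a: "al:Hi" and h: "h:bmeas (borel_on (ray_interval le H G al))" and B: "B:sets m"
shows "em (distr (density (restrict_space lborel (ray_interval le H G al)) (%t. ennreal (h t))) (borel_on H) (Psi le H G al)) B =
 nn_integral lborel (%g. ennreal (h (g - G al))*ind {g:IA al. PT al g:B} g)"
proof -
let ?I = "ray_interval le H G al"
let ?D = "density (restrict_space lborel ?I) (%t. ennreal (h t))"
have Iv: "?I = (%t. t+G al) -` IA al" using mem_ray_interval by auto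
have I[measurable]: "?I:sets borel"
 unfolding Iv using measurable_sets[OF _ IA_borel[OF a], of "%t. t+G al" borel] by simp
have s: "sets (restrict_space lborel ?I) = sets (borel_on ?I)" by(rule sets_restrict_space_cong) simp
have sp: "space ?D = ?I" by(simp add:space_restrict_space)
have cont: "continuous_on ?I (%t. PT al (t+G al))"
 by(rule continuous_on_compose2[OF PT_continuous[OF a]]) (auto intro!:continuous_intros simp:mem_ray_interval)
have cont': "continuous_on ?I (Psi le H G al)"
 by(rule continuous_on_cong[THEN iffD2, OF refl _ cont]) (rule Psi_eq[OF a])
have pm: "Psi le H G al:?D ->M borel_on H"
proof (rule measurable_restrict_space2)
 show "Psi le H G al:space ?D \<rightarrow> H"
  unfolding sp using Psi_eq[OF a] PT_mem[OF a] R_subset mem_ray_interval by fastforce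
 have "sets ?D = sets (borel_on ?I)" using s by simp
 thus "Psi le H G al:bmeas ?D"
  using borel_measurable_continuous_on_restrict[OF cont'] by(simp cong: measurable_cong_sets)
qed
let ?E = "{t. t+G al:{g:IA al. PT al g:B}}"
have E: "Psi le H G al -` B Int space ?D = ?E"
 unfolding sp using Psi_eq[OF a] mem_ray_interval by auto
have Em: "?E:sets borel"
 using measurable_sets[OF _ PT_preimage_IA_borel[OF a B], of "%t. t+G al" borel] by(simp add:vimage_def)
have EI: "?E <= ?I" using mem_ray_interval by auto
have Es: "?E:sets (restrict_space lborel ?I)" unfolding s using Em EI by(subst sets_restrict_space_iff) auto
have hm: "h:bmeas (restrict_space lborel ?I)" using h by(simp cong: measurable_cong_sets add:measurable_cong_sets[OF s refl])
have "em (distr ?D (borel_on H) (Psi le H G al)) B = em ?D ?E"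
 using pm B E by(subst emeasure_distr) (auto simp:sets_m)
also have "... = nn_integral (restrict_space lborel ?I) (%t. ennreal (h t)*ind ?E t)"
 using hm Es by(subst emeasure_density) auto
also have "... = nn_integral lborel (%t. ennreal (h t)*ind ?E t*ind ?I t)"
 by(rule nn_integral_restrict_space) simp
also have "... = nn_integral lborel (%t. (%g. ennreal (h (g - G al))*ind {g:IA al. PT al g:B} g) (t+G al))"
 by(rule nn_integral_cong) (use EI in "auto split:split_indicator")
also have "... = nn_integral lborel (%g. ennreal (h (g - G al))*ind {g:IA al. PT al g:B} g)"
proof -
 have "(%t. h t*ind ?I t):bmeas borel"
  using h by(subst (asm) borel_measurable_restrict_space_iff) (auto simp:mult.commute)
 hence hm': "(%g. h (g - G al)*ind ?I (g - G al)):bmeas borel"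
  by(rule measurable_compose[rotated]) simp
 have "(%g. ennreal (h (g - G al)*ind ?I (g - G al))*ind {g:IA al. PT al g:B} g):bmeas borel"
  using hm' PT_preimage_IA_borel[OF a B] by measurable
 moreover have "(%g. ennreal (h (g - G al)*ind ?I (g - G al))*ind {g:IA al. PT al g:B} g) =
   (%g. ennreal (h (g - G al))*ind {g:IA al. PT al g:B} g)"
  by(rule ext) (auto simp:mem_ray_interval split:split_indicator)
 ultimately show ?thesis
  by(subst nn_integral_real_affine[of _ 1 "G al"]) (simp_all add:add.commute)
qed
finally show ?thesis .
qed

end

context nce_rays
begin

text \<open>Concavity is demanded on the whole interval including the coordinates of end-points,
  where \<open>k\<close> is not given. Setting the density to 0 there changes nothing for Lebesgue
  measure and keeps it concave.\<close>

lemma ray_CD0_if_density: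
assumes g: "good al" and k: "concave_on (J al) k" "!!x. x:J al ==> 0 <= k x"
 and den: "!!B. B:sets borel ==> B <= J al ==>
  em (lam al) B = nn_integral lborel (%x. ennreal (k x powr (N - 2))*ind B x)"
shows "ray_CD0 le H G N al (ma al)"
proof -
note a = goodD(2)[OF g]
let ?I = "ray_interval le H G al"
define h where "h t = (if t+G al:J al then k (t+G al) powr (N - 2) else 0)" for t
have kc: "continuous_on (J al) k"
proof -
 have "convex_on (J al) (%x. - k x)" using k(1) by(simp add:concave_on_def)
 hence "continuous_on (J al) (%x. - (- k x))"
  by(intro continuous_on_minus convex_on_continuous J_open a)
 thus ?thesis by simp
qed
have "(%x. k x powr (N - 2)):bmeas (borel_on (J al))"
 using borel_measurable_continuous_on_restrict[OF kc] by simp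
hence "(%x. ind (J al) x *\<^sub>R k x powr (N - 2)):bmeas borel"
 using J_borel[OF a] by(subst (asm) borel_measurable_restrict_space_iff) auto
hence "(%t. ind (J al) (t+G al) *\<^sub>R k (t+G al) powr (N - 2)):bmeas borel"
 by(rule measurable_compose[rotated]) simp
moreover have "(%t. ind (J al) (t+G al) *\<^sub>R k (t+G al) powr (N - 2)) = h" by(auto simp:h_def)
ultimately have hm: "h:bmeas (borel_on ?I)" by(simp add:measurable_restrict_space1)
have conc: "concave_on ?I (%t. h t powr (1/(N - 2)))"
proof -
 have "concave_on (IA al) (%x. if x:J al then k x else 0)"
 proof (rule concave_extend_zero[OF k IA_convex[OF a]])
  fix x y z assume "x:IA al" "y:IA al" "x < z" "z < y"
  thus "z:J al" using IA_between_J[OF a] by(auto simp:IA_def)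
 qed
 moreover have "h (x - G al) powr (1/(N - 2)) = (if x:J al then k x else 0)" for x
  using N k(2)[of x] by(cases "x:J al") (simp_all add:h_def powr_powr)
 ultimately have 1: "concave_on (IA al) (%x. h (x - G al) powr (1/(N - 2)))" by simp
 show ?thesis
 proof (rule concave_on_realI)
  fix t x y :: real assume t: "0 < t" "t < 1" and xy: "x:?I" "y:?I"
  have "h ((1-t)*(x+G al)+t*(y+G al) - G al) powr (1/(N - 2)) >=
    (1-t)*h x powr (1/(N - 2))+t*h y powr (1/(N - 2))"
   using concave_onD[OF 1, of t "x+G al" "y+G al"] t xy by(simp add:mem_ray_interval)
  moreover have "(1-t)*(x+G al)+t*(y+G al) - G al = (1-t)*x+t*y" by(simp add:algebra_simps)
  ultimately show "(1-t)*h x powr (1/(N - 2))+t*h y powr (1/(N - 2)) <= h ((1-t)*x+t*y) powr (1/(N - 2))" by simp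
 next
  show "convex ?I" unfolding ray_interval_eq using IA_convex[OF a] by(rule convex_translation_subtract)
 qed
qed
have eq: "ma al = distr (density (restrict_space lborel ?I) (%t. ennreal (h t))) (borel_on H) (Psi le H G al)"
proof (rule measure_eqI)
 fix B assume "B:sets (ma al)"
 hence B: "B:sets m" using sets_ma_iff[OF goodD(1)[OF g]] by simp
 have "em (ma al) B = nn_integral lborel (%x. ennreal (k x powr (N - 2))*ind {g:J al. PT al g:B} x)"
  unfolding ma_eq[OF g B] by(rule den) (use PT_preimage_borel[OF a B] in auto)
 also have "... = nn_integral lborel (%x. ennreal (h (x - G al))*ind {g:IA al. PT al g:B} x)"
  using J_subset_IA by(intro nn_integral_cong) (auto simp:h_def split:split_indicator)
 finally show "em (ma al) B = em (distr (density (restrict_space lborel ?I) (%t. ennreal (h t))) (borel_on H) (Psi le H G al)) B"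
  by(simp add:emeasure_ray_density[OF a hm B])
qed (simp add:sets_ma goodD(1)[OF g])
show ?thesis unfolding ray_CD0_def
 by(intro exI[of _ h] conjI hm eq conc ballI) (simp add:h_def)
qed

text \<open>Countably many almost everywhere statements with rational data are intersected. On each
  remaining ray either the conditional measure vanishes and the density 0 will do, or the two tail
  lemmas provide \<open>tails\<close> and \<open>bm_measure\<close> applies with exponent
  \<open>N - 1\<close>.\<close>

theorem AE_ray_CD0: "AE al in qq. ray_CD0 le H G N al (ma al)"
proof -
have L: "AE al in qq. ALL b:Rats. (EX g:J al. g < b) & em (lam al) {..<b} = 0 --> em (lam al) UNIV = 0"
 unfolding AE_ball_countable[OF countable_rat] by(intro ballI left_tail)
have R: "AE al in qq. ALL b:Rats. (EX g:J al. b < g) & em (lam al) {b<..} = 0 --> em (lam al) UNIV = 0"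
 unfolding AE_ball_countable[OF countable_rat] by(intro ballI right_tail)
have B: "AE al in qq. ALL a0:Rats. ALL b0:Rats. ALL a1:Rats. ALL b1:Rats. ALL t:Rats. a0 <= b0 & b0 < a1 & a1 <= b1 & 0 < t & t < 1 -->
 a0:J al --> b1:J al --> 0 < measure (lam al) {a0..b0} --> 0 < measure (lam al) {a1..b1} -->
 ((1-t)*measure (lam al) {a0..b0} powr (1/(N-1))+t*measure (lam al) {a1..b1} powr (1/(N-1))) powr (N-1)
  <= measure (lam al) {(1-t)*a0+t*a1..(1-t)*b0+t*b1}"
 unfolding AE_ball_countable[OF countable_rat]
proof (intro ballI)
 fix a0 b0 a1 b1 t :: real
 show "AE al in qq. a0 <= b0 & b0 < a1 & a1 <= b1 & 0 < t & t < 1 -->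
  a0:J al --> b1:J al --> 0 < measure (lam al) {a0..b0} --> 0 < measure (lam al) {a1..b1} -->
  ((1-t)*measure (lam al) {a0..b0} powr (1/(N-1))+t*measure (lam al) {a1..b1} powr (1/(N-1))) powr (N-1)
   <= measure (lam al) {(1-t)*a0+t*a1..(1-t)*b0+t*b1}"
 proof (cases "a0 <= b0 & b0 < a1 & a1 <= b1 & 0 < t & t < 1")
  case True
  thus ?thesis using bm_lam[of a0 b0 a1 b1 t] by simp
 qed (auto intro:AE_I2)
qed
show ?thesis using AE_good L R B
proof eventually_elim
 case (elim al)
 note g = elim(1)
 note a = goodD(2)[OF g]
 show ?case
 proof (cases "em (lam al) UNIV = 0")
  case True
  have cv: "convex (J al)" using J_interval[OF a] by(simp add:is_interval_convex_1)
  show ?thesis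
  proof (rule ray_CD0_if_density[OF g, of "%_. 0"])
   show "concave_on (J al) (%_. 0)" using cv by(simp add:concave_on_def convex_on_const)
   fix B :: "real set" assume "B:sets borel"
   hence "em (lam al) B <= em (lam al) UNIV" by(intro emeasure_mono) auto
   thus "em (lam al) B = nn_integral lborel (%x. ennreal (0 powr (N - 2))*ind B x)" using True by simp
  qed simp
 next
  case False
  interpret b: bm_measure "J al" "lam al" "N - 1"
  proof
   show "1 < N - 1" using N by simp
   show "open (J al)" "is_interval (J al)" by(rule J_open[OF a], rule J_interval[OF a])
   show "em (lam al) {x..y} ~= \<infinity>" if "x:J al" "y:J al" for x y
    using lam_compact[OF g subsetD[OF J_subset_IA that(1)] subsetD[OF J_subset_IA that(2)]] by simp
   show "0 < em (lam al) (J al Int {..<c})" if c: "c:J al" for c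
   proof -
    obtain g' where g': "g':J al" "g' < c" using c J_lower[OF a] by(auto simp:J_def)
    obtain r where r: "r:Rats" "g' < r" "r < c" using rational_between[OF g'(2)] by auto
    have "em (lam al) {..<r} ~= 0" using elim(2) r g' False by blast
    moreover have "em (lam al) {..<r} <= em (lam al) {..<c}" using r by(intro emeasure_mono) auto
    ultimately have "0 < em (lam al) {..<c}" by(metis le_zero_eq zero_less_iff_neq_zero)
    thus ?thesis using lam_J[OF g, of "{..<c}"] by(simp add:Int_commute)
   qed
   show "0 < em (lam al) (J al Int {c<..})" if c: "c:J al" for c
   proof -
    obtain g' where g': "g':J al" "c < g'" using c J_upper[OF a] by(auto simp:J_def)
    obtain r where r: "r:Rats" "c < r" "r < g'" using rational_between[OF g'(2)] by auto
    have "em (lam al) {r<..} ~= 0" using elim(3) r g' False by blast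
    moreover have "em (lam al) {r<..} <= em (lam al) {c<..}" using r by(intro emeasure_mono) auto
    ultimately have "0 < em (lam al) {c<..}" by(metis le_zero_eq zero_less_iff_neq_zero)
    thus ?thesis using lam_J[OF g, of "{c<..}"] by(simp add:Int_commute)
   qed
  qed (use elim(4) in auto)
  show ?thesis
  proof (rule ray_CD0_if_density[OF g b.k_concave b.k_nonneg])
   fix B assume "B:sets borel" "B <= J al"
   from b.density[OF this] show "em (lam al) B = nn_integral lborel (%x. ennreal (b.k x powr (N - 2))*ind B x)" by simp
  qed
 qed
qed
qed

lemma ends_null: "initial_points le H Un final_points le H:null_sets m"
proof (rule null_sets.Un)
interpret rev: nce_rays "%x y. le y x" H "%x. - G x" m QQ qq ma N by(rule reverse_nce)
show "final_points le H:null_sets m" using rev.initial_null by(simp add:initial_points_reverse[of le])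
qed (rule initial_null)

end

section \<open>From the rays to the null energy condition\<close>

text \<open>The integral of \<open>g\<close> may be infinite here; truncation to the sets where
  \<open>g\<close> is at most \<open>j\<close> reduces to the integrable case.\<close>

lemma AE_le_of_nn_integral_le_finite:
fixes f g :: "'a => ennreal"
assumes M: "finite_measure M" and f[measurable]: "f:bmeas M" and g[measurable]: "g:bmeas M"
 and le: "!!C. C:sets M ==> nn_integral M (%x. f x*ind C x) <= nn_integral M (%x. g x*ind C x)"
shows "AE x in M. f x <= g x"
proof -
interpret finite_measure M by fact
have "AE x in M. f x*ind {x:space M. g x <= of_nat j} x <= g x*ind {x:space M. g x <= of_nat j} x" for j :: nat
proof (rule AE_le_of_nn_integral_le)
 let ?D = "{x:space M. g x <= of_nat j}"
 have D[measurable]: "?D:sets M" by measurable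
 show "(%x. f x*ind ?D x):bmeas M" "(%x. g x*ind ?D x):bmeas M" by measurable
 have "nn_integral M (%x. g x*ind ?D x) <= nn_integral M (%x. of_nat j)"
  by(intro nn_integral_mono) (auto split:split_indicator)
 also have "... < \<infinity>" using emeasure_finite[of "space M"] by(simp add:less_top[symmetric] ennreal_mult_eq_top_iff)
 finally show "nn_integral M (%x. g x*ind ?D x) < \<infinity>" .
 fix C assume C: "C:sets M"
 have "ind ?D x*ind C x = (ind (?D Int C) x :: ennreal)" for x by(rule indicator_inter_arith[symmetric])
 thus "nn_integral M (%x. f x*ind ?D x*ind C x) <= nn_integral M (%x. g x*ind ?D x*ind C x)"
  using le[of "?D Int C"] C D by(simp add:mult.assoc)
qed
hence "AE x in M. ALL j::nat. f x*ind {x:space M. g x <= of_nat j} x <= g x*ind {x:space M. g x <= of_nat j} x"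
 by(subst AE_all_countable) blast
thus ?thesis using AE_space
proof eventually_elim
 case (elim x)
 show ?case
 proof (cases "g x = top")
  case False
  then obtain j :: nat where "g x <= of_nat j"
   by(metis ennreal_of_nat_eq_real_of_nat ennreal_cases ennreal_leI real_arch_simple)
  thus ?thesis using spec[OF elim(1), of j] elim(2) by simp
 qed simp
qed
qed

text \<open>The counterpart of \<open>Uent_ge\<close>: the optimal potential is
  \<open>- ln rh\<close>. If its positive part is not integrable, the entropy is minus infinity, and
  truncations from above reach every prescribed value.\<close>

lemma (in sigma_finite_measure) Uent_potential:
assumes mu: "prob_space mu" and sets: "sets mu = sets M" and K: "0 < K" and r: "0 < r" "ennreal r <= Uent K mu M"
shows "EX V. integrable mu V & (ALL B:sets M. (nn_integral mu (%x. ennreal (exp (V x))*ind B x)) <= em M B) &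
 ln r <= (\<integral>x. V x \<partial>mu)/K"
proof -
interpret mu: prob_space mu by fact
have Up: "0 < Uent K mu M" using r by(metis ennreal_less_zero_iff order_less_le_trans)
obtain rh where rh[measurable]: "rh:bmeas M" and nn: "!!x. 0 <= rh x"
 and den: "density M (%x. ennreal (rh x)) = mu" and pos: "AE x in mu. 0 < rh x"
 and Ent: "Ent mu M = (if (nn_integral mu (%x. ennreal (ln (rh x)))) < \<infinity>
   then enn2ereal (nn_integral mu (%x. ennreal (ln (rh x)))) - enn2ereal (nn_integral mu (%x. ennreal (- ln (rh x)))) else \<infinity>)"
 by(rule Ent_cases[OF mu sets Uent_pos_ac[OF Up]]) (rule that, assumption+)
let ?A = "nn_integral mu (%x. ennreal (ln (rh x)))" and ?B = "nn_integral mu (%x. ennreal (- ln (rh x)))"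
have A: "?A < \<infinity>" using Up Ent by(auto simp:Uent_def split:if_splits)
have lm[measurable]: "rh:bmeas mu" using rh by(simp add:measurable_cong_sets[OF sets refl])
have le: "nn_integral mu (%x. ennreal (exp (V x))*ind B x) <= em M B"
 if V: "V:bmeas mu" "!!x. V x <= - ln (rh x)" and B: "B:sets M" for V B
proof -
 have [measurable]: "V:bmeas M" using V by(simp add:measurable_cong_sets[OF sets refl])
 have "nn_integral mu (%x. ennreal (exp (V x))*ind B x) = nn_integral M (%x. ennreal (rh x)*(ennreal (exp (V x))*ind B x))"
  using B by(subst den[symmetric], subst nn_integral_density) auto
 also have "... <= nn_integral M (%x. ind B x)"
 proof (rule nn_integral_mono)
  fix x
  show "ennreal (rh x)*(ennreal (exp (V x))*ind B x) <= ind B x"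
  proof (cases "rh x = 0")
   case False
   hence p: "0 < rh x" using nn[of x] by simp
   have "rh x*exp (V x) <= rh x*exp (- ln (rh x))" using V(2)[of x] p by(intro mult_left_mono) auto
   also have "... = 1" using p by(simp add:exp_minus)
   finally have "ennreal (rh x)*ennreal (exp (V x)) <= 1"
    using p by(simp add:ennreal_mult'[symmetric])
   thus ?thesis by(auto split:split_indicator)
  qed simp
 qed
 finally show ?thesis using B by simp
qed
show ?thesis
proof (cases "?B < \<infinity>")
 case True
 have int: "integrable mu (%x. ln (rh x))"
  unfolding real_integrable_def using A True by auto
 obtain a b where ab: "?A = ennreal a" "0 <= a" "?B = ennreal b" "0 <= b"
  using A True by(cases ?A; cases ?B) auto
 have "Ent mu M = ereal (\<integral>x. ln (rh x) \<partial>mu)"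
  unfolding Ent real_lebesgue_integral_def[OF int] ab(1,3) using ab(2,4) by simp
 hence "ennreal r <= ennreal (exp (- (\<integral>x. ln (rh x) \<partial>mu)/K))" using r(2) by(simp add:Uent_def)
 hence "r <= exp ((\<integral>x. - ln (rh x) \<partial>mu)/K)" by(simp add:ennreal_le_iff)
 hence "ln r <= ln (exp ((\<integral>x. - ln (rh x) \<partial>mu)/K))" using r(1) by(subst ln_le_cancel_iff) auto
 hence "ln r <= (\<integral>x. - ln (rh x) \<partial>mu)/K" by simp
 thus ?thesis using int by(intro exI[of _ "%x. - ln (rh x)"]) (auto intro!:le)
next
 case False
 define V where "V L x = min (- ln (rh x)) (real L)" for L :: nat and x
 have neg: "nn_integral mu (%x. ennreal (- V L x)) <= ?A" for L
  by(intro nn_integral_mono) (auto simp:V_def min_def ennreal_neg)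
 have Vi: "integrable mu (V L)" for L
  unfolding real_integrable_def
 proof (intro conjI)
  show "V L:bmeas mu" unfolding V_def by measurable
  have "nn_integral mu (%x. ennreal (V L x)) <= nn_integral mu (%x. ennreal (real L))"
   by(intro nn_integral_mono ennreal_leI) (simp add:V_def)
  thus "nn_integral mu (%x. ennreal (V L x)) ~= \<infinity>" by(auto simp:mu.emeasure_space_1 top_unique)
  show "nn_integral mu (%x. ennreal (- V L x)) ~= \<infinity>" using A neg[of L] by auto
 qed
 have "(SUP L. nn_integral mu (%x. ennreal (V L x))) = nn_integral mu (%x. (SUP L. ennreal (V L x)))"
  by(rule nn_integral_monotone_convergence_SUP[symmetric])
   (auto simp:V_def incseq_def le_fun_def intro!:ennreal_leI)
 also have "... >= ?B"
 proof (rule nn_integral_mono)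
  fix x
  obtain L :: nat where "- ln (rh x) <= real L" using real_arch_simple by blast
  hence "ennreal (- ln (rh x)) <= ennreal (V L x)" by(simp add:V_def)
  thus "ennreal (- ln (rh x)) <= (SUP L. ennreal (V L x))" by(rule SUP_upper2[OF UNIV_I])
 qed
 finally have top: "(SUP L. nn_integral mu (%x. ennreal (V L x))) = \<infinity>" using False by(simp add:top_unique not_less)
 \<comment> \<open>The positive part of the truncated potential has to outweigh the finite negative
   part and reach \<open>K*ln r\<close>.\<close>
 define c where "c = enn2real ?A + \<bar>K*ln r\<bar>"
 have "ennreal c < (SUP L. nn_integral mu (%x. ennreal (V L x)))" unfolding top infinity_ennreal_def by(rule ennreal_less_top)
 then obtain L where L: "ennreal c < (nn_integral mu (%x. ennreal (V L x)))" unfolding less_SUP_iff by blast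
 have fin: "nn_integral mu (%x. ennreal (V L x)) ~= \<infinity>" using Vi[of L] by(simp add:real_integrable_def)
 have "(\<integral>x. V L x \<partial>mu) = enn2real (nn_integral mu (%x. ennreal (V L x))) - enn2real (nn_integral mu (%x. ennreal (- V L x)))"
  by(rule real_lebesgue_integral_def[OF Vi])
 moreover have "enn2real (nn_integral mu (%x. ennreal (- V L x))) <= enn2real ?A" using neg A by(intro enn2real_mono) auto
 moreover have "c <= enn2real (nn_integral mu (%x. ennreal (V L x)))"
  using enn2real_mono[OF less_imp_le[OF L]] fin by(simp add:less_top c_def del:ennreal_plus)
 ultimately have "K*ln r <= (\<integral>x. V L x \<partial>mu)" unfolding c_def by linarith
 hence "ln r <= (\<integral>x. V L x \<partial>mu)/K" using K by(simp add:pos_le_divide_eq mult.commute)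
 moreover have "V L:bmeas mu" unfolding V_def by measurable
 ultimately show ?thesis using Vi[of L] by(intro exI[of _ "V L"]) (auto intro!:le simp:V_def)
qed
qed

section \<open>Concave densities on the rays and a Borel quotient map\<close>

locale cd_rays = ray_measure le H G m QQ qq ma
for le :: "'a::{heine_borel,polish_space} => 'a => bool" and H :: "'a set" and G :: "'a => real"
 and m :: "'a measure" and QQ :: "'a => 'a" and qq :: "'a measure" and ma :: "'a => 'a measure" +
fixes N :: real
assumes N: "2 < N" and ends: "initial_points le H Un final_points le H:null_sets m"
 and cd: "AE al in qq. ray_CD0 le H G N al (ma al)"
begin

lemma IA_subset_J: "al:Hi ==> IA al <= J al Un {Inf (J al), Sup (J al)}"
proof
fix g assume a: "al:Hi" and "g:IA al"
then obtain x where x: "x:Ry al" "g = GE al x" by(auto simp:IA_def)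
from x(1) a show "g:J al Un {Inf (J al), Sup (J al)}"
proof (cases rule: not_inner_cases)
 case 1
 thus ?thesis using x(2) GE_inner[OF OR_D(2)[OF 1]] by(auto simp:J_def)
qed (simp_all add:x(2) GE_initial GE_final)
qed

text \<open>The curvature condition in gauge values. The given density and \<open>h\<close> differ
  at most at the ends of the interval, a Lebesgue null set. Rays on which \<open>k\<close> vanishes
  are split off, because \<open>concave_density\<close> requires a positive value.\<close>

lemma lam_density:
"AE al in qq. good al & (em (lam al) UNIV = 0 \<or>
 (EX k. concave_density (IA al) k (N-1) & lam al = density lborel (%z. ennreal (concave_density.h (IA al) k (N-1) z))))"
using AE_good cd
proof eventually_elim
case (elim al)
note g = elim(1)
note a = goodD(2)[OF g]
obtain f where f: "f:bmeas (borel_on (ray_interval le H G al))" "!!t. t:ray_interval le H G al ==> 0 <= f t"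
 and ma: "ma al = distr (density (restrict_space lborel (ray_interval le H G al)) (%t. ennreal (f t))) (borel_on H) (Psi le H G al)"
 and conc: "concave_on (ray_interval le H G al) (%t. f t powr (1/(N - 2)))"
 using elim(2) unfolding ray_CD0_def by blast
define k where "k x = f (x - G al) powr (1/(N - 2))" for x
have kp: "k x powr (N - 2) = f (x - G al)" if "x:IA al" for x
 using f(2)[of "x - G al"] that N by(simp add:k_def powr_powr mem_ray_interval)
have kc: "concave_on (IA al) k"
proof (rule concave_on_realI[OF IA_convex[OF a]])
 fix t x y :: real assume t: "0 < t" "t < 1" and xy: "x:IA al" "y:IA al"
 have "(1-t)*(x - G al)+t*(y - G al) = (1-t)*x+t*y - G al" by(simp add:algebra_simps)
 thus "(1-t)*k x+t*k y <= k ((1-t)*x+t*y)"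
  using concave_onD[OF conc, of t "x - G al" "y - G al"] t xy by(simp add:mem_ray_interval k_def)
qed
have JI: "J al <= interior (IA al)" by(rule interior_maximal[OF J_subset_IA J_open[OF a]])
have lam: "em (lam al) S = nn_integral lborel (%x. ennreal (k x powr (N - 2))*ind (S Int J al) x)" if S: "S:sets borel" for S
proof -
 let ?B = "{x:Hi. Gb x:S}"
 have "em (lam al) S = nn_integral lborel (%x. ennreal (f (x - G al))*ind {g:IA al. PT al g:?B} x)"
  unfolding lam_eq[OF g S] by(subst ma, rule emeasure_ray_density[OF a f(1) slab_m[OF S]])
 also have "... = nn_integral lborel (%x. ennreal (k x powr (N - 2))*ind (S Int J al) x)"
 proof (rule nn_integral_cong_AE)
  show "AE x in lborel. ennreal (f (x - G al))*ind {g:IA al. PT al g:?B} x =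
    ennreal (k x powr (N - 2))*ind (S Int J al) x"
   using AE_lborel_singleton[of "Inf (J al)"] AE_lborel_singleton[of "Sup (J al)"]
  proof eventually_elim
   case (elim x)
   show ?case
   proof (cases "x:J al")
    case True
    hence "x:IA al" using J_subset_IA by blast
    thus ?thesis using PT_J[OF a True] OR_D(2)[of "PT al x" al] kp True by(auto simp:Gb_def split:split_indicator)
   next
    case False
    hence "x ~: IA al" using IA_subset_J[OF a] elim by blast
    thus ?thesis using False by simp
   qed
  qed
 qed
 finally show ?thesis .
qed
show ?case
proof (cases "EX p:IA al. 0 < k p")
 case True
 interpret cd: concave_density "IA al" k "N - 1"
  by unfold_locales (use N IA_interval[OF a] kc True in "auto simp:k_def")
 have "lam al = density lborel (%z. ennreal (cd.h z))"
 proof (rule measure_eqI)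
  fix S assume "S:sets (lam al)"
  hence S: "S:sets borel" by simp
  have "em (lam al) S = nn_integral lborel (%x. ennreal (cd.h x)*ind S x)"
   unfolding lam[OF S]
  proof (rule nn_integral_cong_AE)
   show "AE x in lborel. ennreal (k x powr (N - 2))*ind (S Int J al) x = ennreal (cd.h x)*ind S x"
    using AE_lborel_singleton[of "Inf (J al)"] AE_lborel_singleton[of "Sup (J al)"]
   proof eventually_elim
    case (elim x)
    have "x:interior (IA al) <-> x:J al" using IA_subset_J[OF a] elim JI interior_subset by blast
    thus ?case by(auto simp:cd.h_def split:split_indicator)
   qed
  qed
  thus "em (lam al) S = em (density lborel (%z. ennreal (cd.h z))) S"
   using S cd.h_meas by(subst emeasure_density) auto
 qed simp
 thus ?thesis using g cd.concave_density_axioms by blast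
next
 case False
 hence "k x = 0" if "x:J al" for x using that J_subset_IA k_def by(metis order_antisym_conv powr_ge_zero linorder_not_less subsetD)
 hence "nn_integral lborel (%x. ennreal (k x powr (N - 2))*ind (UNIV Int J al) x) = nn_integral (lborel :: real measure) (%x. 0)"
  by(intro nn_integral_cong) (auto split:split_indicator)
 thus ?thesis using g lam[of UNIV] by simp
qed
qed

lemma ray_push_forward:
fixes x y a b :: "real => real"
assumes g: "good al" and d: "concave_density (IA al) k (N-1)" "lam al = density lborel (%z. ennreal (concave_density.h (IA al) k (N-1) z))"
 and t: "0 < t" "t < 1"
 and mono: "!!u v. 0 < u ==> u <= v ==> v < 1 ==> x u <= x v" "!!u v. 0 < u ==> u <= v ==> v < 1 ==> y u <= y v"
 and mem: "!!u. 0 < u ==> u < 1 ==> x u:IA al" "!!u. 0 < u ==> u < 1 ==> y u:IA al"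
 and meas [measurable]: "x:bmeas borel" "y:bmeas borel"
  "a:bmeas borel" "b:bmeas borel"
 and nn: "!!u. 0 <= a u" "!!u. 0 <= b u"
 and hx: "!!c d. c:IA al ==> d:IA al ==> nn_integral lborel (%u. ennreal (a u powr (N-1))*ind {0<..<1} u*ind {c..d} (x u))
   <= em (lam al) {c..d}"
 and hy: "!!c d. c:IA al ==> d:IA al ==> nn_integral lborel (%u. ennreal (b u powr (N-1))*ind {0<..<1} u*ind {c..d} (y u))
   <= em (lam al) {c..d}"
 and B: "B:sets m"
shows "nn_integral lborel (%u. ennreal (((1-t)*a u+t*b u) powr (N-1))*ind {0<..<1} u *
   ind B (PT al ((1-t)*x u+t*y u))) <= em (ma al) B"
proof -
note al = goodD(2)[OF g]
interpret cd: concave_density "IA al" k "N - 1" by(rule d(1))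
let ?E = "{g:IA al. PT al g:B}"
have "nn_integral lborel (%u. ennreal (((1-t)*a u+t*b u) powr (N-1))*ind {0<..<1} u *
   ind B (PT al ((1-t)*x u+t*y u))) =
  nn_integral lborel (%u. ennreal (((1-t)*a u+t*b u) powr (N-1))*ind {0<..<1} u *
   ind ?E ((1-t)*x u+t*y u))"
proof (rule nn_integral_cong)
 fix u :: real
 show "ennreal (((1-t)*a u+t*b u) powr (N-1))*ind {0<..<1} u*ind B (PT al ((1-t)*x u+t*y u)) =
  ennreal (((1-t)*a u+t*b u) powr (N-1))*ind {0<..<1} u*ind ?E ((1-t)*x u+t*y u)"
 proof (cases "0 < u & u < 1")
  case True
  hence "(1-t)*x u+t*y u:IA al"
   using convexD[OF IA_convex[OF al], of "x u" "y u" "1 - t" t] mem[of u] t by simp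
  thus ?thesis by(simp split:split_indicator)
 qed simp
qed
also have "... <= em (density lborel (%z. ennreal (cd.h z))) ?E"
 by(rule cd.push_forward_le[where x = x and y = y and a = a and b = b])
  (fact t mono mem meas nn PT_preimage_IA_borel[OF al B] | simp add:hx hy flip: d(2))+
also have "... = em (lam al) ?E" by(simp add:d(2))
also have "... = em (lam al) (?E Int J al)" by(rule lam_J[symmetric, OF g PT_preimage_IA_borel[OF al B]])
also have "?E Int J al = {g:J al. PT al g:B}" using J_subset_IA by blast
also have "em (lam al) ... = em (ma al) B" by(rule ma_eq[symmetric, OF g B])
finally show ?thesis .
qed

text \<open>\<open>QQ\<close> is measurable for the completion only. One null set contains the null
  parts of the preimages of a countable basis; off this set the preimages are measurable for
  \<open>m\<close>, and on it, as outside the inner part, a constant is used.\<close>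

lemma quotient_version:
assumes ne: "Hi ~= {}"
shows "EX q. q:m ->M qq & (AE x in m. x:Hi & q x = QQ x)"
proof -
obtain x0 where x0: "x0:Hi" using ne by auto
obtain \<B> :: "'a set set" where \<B>: "countable \<B>" "topological_basis \<B>" using ex_countable_basis by blast
define F where "F b = {x:Hi. QQ x:{al:QQ ` Hi. al:b}}" for b
have F: "F b:sets (completion m)" if "b : \<B>" for b
proof -
 have "open b" using topological_basis_open[OF \<B>(2) that] .
 hence "{al:QQ ` Hi. al:b}:sets mq"
  by(intro sets_completionI_sets) (auto simp:sets_qq sets_restrict_space Collect_conj_eq)
 from fibre_measurable[OF Hi_m order_refl this] show ?thesis by(simp add:F_def)
qed
have "AE x in m. ALL b:\<B>. x ~: null_part m (F b)"
 unfolding AE_ball_countable[OF \<B>(1)] by(intro ballI AE_notin_null_part F)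
then obtain Z where Z: "{x:space m. ~ (ALL b:\<B>. x ~: null_part m (F b))} <= Z" "em m Z = 0" "Z:sets m" by(rule AE_E)
define q where "q x = (if x:Hi - Z then QQ x else QQ x0)" for x
have "q:m ->M (sigma UNIV \<B> :: 'a measure)"
proof (rule measurable_measure_of)
 fix b assume b: "b : \<B>"
 have "main_part m (F b) <= F b" "F b - Z <= main_part m (F b)"
  using main_part_null_part_Un[OF F[OF b]] Z(1) b Hi_subset by(auto simp:F_def)
 hence "F b - Z = main_part m (F b) - Z" by blast
 hence 1: "F b - Z:sets m" using main_part_sets[OF F[OF b]] Z(3) by auto
 have "q -` b Int space m = (F b - Z) Un (if QQ x0:b then H - (Hi - Z) else {})"
  using Hi_subset by(intro set_eqI) (auto simp:q_def F_def split:if_splits)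
 also have "... : sets m" using 1 Z(3) Hi_m sets.top[of m] by auto
 finally show "q -` b Int space m:sets m" .
qed auto
hence "q:bmeas m" using borel_eq_countable_basis[OF \<B>] by simp
moreover have "q:space m \<rightarrow> QQ ` Hi" using x0 by(auto simp:q_def)
ultimately have "q:m ->M borel_on (QQ ` Hi)" by(intro measurable_restrict_space2)
hence "q:m ->M qq" by(simp add:measurable_cong_sets[OF refl sets_qq])
moreover have "AE x in m. x:Hi & q x = QQ x"
proof -
 have "Z:null_sets m" using Z by auto
 from AE_not_in[OF this] AE_not_in[OF ends] AE_space show ?thesis
  by eventually_elim (auto simp:q_def inner_part_def)
qed
ultimately show ?thesis by blast
qed

end

lemma emeasure_Icc_outer:
fixes M :: "real measure"
assumes s: "sets M = sets borel" and J: "J:sets borel" and de: "0 < de" and fin: "em M ({c - de..d+de} Int J) ~= \<infinity>"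
 and le: "!!ep. 0 < ep ==> ep <= de ==> X <= em M ({c - ep..d+ep} Int J)"
shows "X <= em M ({c..d} Int J)"
proof -
define e where "e i = de/real (Suc i)" for i
have e: "0 < e i" "e i <= de" for i
 using de by(auto simp:e_def divide_le_eq mult_le_cancel_left1 simp del:of_nat_Suc)
have em: "e j <= e i" if "i <= j" for i j unfolding e_def using de that by(intro divide_left_mono) auto
have e0: "e ----> 0" unfolding e_def by(rule LIMSEQ_Suc[OF lim_const_over_n])
define A where "A i = {c - e i..d+e i} Int J" for i
have "decseq A"
proof (rule antimonoI)
 fix i j :: nat assume "i <= j"
 from em[OF this] show "A j <= A i" by(auto simp:A_def)
qed
moreover have "em M (A i) ~= \<infinity>" for i
proof -
 have "A i <= {c - de..d+de} Int J" using e(2)[of i] by(auto simp:A_def)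
 hence "em M (A i) <= em M ({c - de..d+de} Int J)" using J s by(intro emeasure_mono) auto
 thus ?thesis using fin by(auto simp:top_unique)
qed
moreover have "range A <= sets M"
proof (rule image_subsetI)
 show "A i:sets M" for i unfolding A_def s by(intro sets.Int J) simp
qed
ultimately have "(%i. em M (A i)) ----> em M (\<Inter>i. A i)" by(intro Lim_emeasure_decseq) auto
moreover have "(\<Inter>i. A i) = {c..d} Int J"
proof (intro antisym subsetI)
 fix z assume z: "z:(\<Inter>i. A i)"
 have l: "(%i. c - e i) ----> c - 0" "(%i. d+e i) ----> d+0"
  by(rule tendsto_diff[OF tendsto_const e0], rule tendsto_add[OF tendsto_const e0])
 have "c <= z" using LIMSEQ_le_const2[OF l(1), of z] z by(auto simp:A_def)
 moreover have "z <= d" using LIMSEQ_le_const[OF l(2), of z] z by(auto simp:A_def)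
 ultimately show "z:{c..d} Int J" using z by(auto simp:A_def)
next
 fix z assume z: "z:{c..d} Int J"
 have "z:A i" for i using z e(1)[of i] by(auto simp:A_def)
 thus "z:(\<Inter>i. A i)" by blast
qed
moreover have "X <= em M (A i)" for i unfolding A_def by(rule le[OF e])
ultimately show ?thesis by(auto intro:LIMSEQ_le_const)
qed

lemma AE_unif_between:
assumes "AE u in unif. P u" and "0 <= p" "p < q" "q <= 1"
shows "EX u. p < u & u < q & P u"
proof (rule ccontr)
assume n: "~ ?thesis"
have "AE u in unif. u ~: {p<..<q}" using assms(1) by eventually_elim (use n in auto)
hence "em unif {p<..<q} = 0" by(subst (asm) AE_iff_measurable[of "{p<..<q}"]) (auto simp:greaterThanLessThan_def)
moreover have "{p<..<q} Int {0<..<1} = {p<..<q}" using assms by auto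
ultimately show False using assms(3) by(simp add:emeasure_unif)
qed

section \<open>Random points on random rays\<close>

locale ray_coupling = cd_rays le H G m QQ qq ma N+P: prob_space P
for le :: "'a::{heine_borel,polish_space} => 'a => bool" and H :: "'a set" and G :: "'a => real"
 and m :: "'a measure" and QQ :: "'a => 'a" and qq :: "'a measure" and ma :: "'a => 'a measure" and N :: real
 and P :: "'p measure" +
fixes al :: "'p => 'a"
assumes Hi_ne: "Hi ~= {}" and al_m: "al:P ->M qq" and ac: "absolutely_continuous qq (distr P qq al)"
begin

abbreviation "sg == distr P qq al"
abbreviation "sg' == RN_deriv qq sg"

sublocale q: prob_space qq by(rule prob_qq[OF Hi_ne])
sublocale s: prob_space sg by(rule P.prob_space_distr[OF al_m])
sublocale u: prob_space unif by(rule prob_space_unif)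

sublocale su: pair_sigma_finite sg unif
by(simp add:pair_sigma_finite_def s.sigma_finite_measure_axioms u.sigma_finite_measure_axioms)

lemma density_sg: "density qq sg' = sg" by(rule q.density_RN_deriv[OF ac]) simp

lemma sg'_finite: "AE a in qq. sg' a ~= \<infinity>"
by(rule q.RN_deriv_finite[OF s.sigma_finite_measure_axioms ac]) simp

lemma qq_borel [measurable]: "(%a. a):bmeas qq"
by(simp add:measurable_cong_sets[OF sets_qq refl] measurable_restrict_space1)

lemma fst_borel [measurable]: "fst:bmeas (qq OM borel)"
using measurable_compose[OF measurable_fst qq_borel] by simp

lemma PB_qq [measurable]: "(%p. PB (fst p, snd p)):bmeas (qq OM borel)"
by(rule measurable_compose[OF _ PB_measurable]) measurable

lemma AE_sg: "(AE a in sg. R a) <-> (AE a in qq. 0 < sg' a --> R a)"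
by(subst density_sg[symmetric], subst AE_density) auto

lemma disintegrate_sg:
assumes F: "F:bmeas (qq OM borel)"
shows "nn_integral (sg OM unif) F = nn_integral qq (%a. sg' a*nn_integral unif (%u. F (a, u)))"
 and "(%a. nn_integral unif (%u. F (a, u))):bmeas qq"
proof -
have F1: "F:bmeas (sg OM unif)" using F by(simp cong: measurable_cong_sets)
have F2: "F:bmeas (qq OM unif)" using F by(simp cong: measurable_cong_sets)
show m: "(%a. nn_integral unif (%u. F (a, u))):bmeas qq" using u.borel_measurable_nn_integral_fst[OF F2] .
have "nn_integral (sg OM unif) F = nn_integral sg (%a. (nn_integral unif (%u. F (a, u))))" by(rule u.nn_integral_fst[symmetric, OF F1])
also have "... = nn_integral qq (%a. sg' a*nn_integral unif (%u. F (a, u)))"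
 by(subst density_sg[symmetric], rule nn_integral_density) (use m in auto)
finally show "nn_integral (sg OM unif) F = nn_integral qq (%a. sg' a*nn_integral unif (%u. F (a, u)))" .
qed

text \<open>\<open>x a u\<close> models the random point \<open>f\<close> by its coordinate: for
  \<open>a\<close> with the law of \<open>al\<close> and an independent uniform \<open>u\<close>,
  ray and coordinate have the right joint law.\<close>

definition has_law :: "('p => 'a) => ('a => real => real) => bool" where
"has_law f x <-> f:P ->M borel_on H & (AE p in P. f p:Ry (al p)) &
  (%p. x (fst p) (snd p)):bmeas (qq OM borel) &
  distr (sg OM unif) (qq OM borel) (%p. (fst p, x (fst p) (snd p))) = distr P (qq OM borel) (%p. (al p, Gx (al p) (f p)))"

lemma has_law_eq: "has_law f x ==> distr (sg OM unif) (qq OM borel) (%p. (fst p, x (fst p) (snd p))) =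
 distr P (qq OM borel) (%p. (al p, Gx (al p) (f p)))"
unfolding has_law_def by(elim conjE)

lemma has_law_m:
assumes "has_law f x"
shows "f:bmeas P" "(%p. (fst p, x (fst p) (snd p))):sg OM unif ->M qq OM borel"
 "(%p. (al p, Gx (al p) (f p))):P ->M qq OM borel"
proof -
have x: "(%p. x (fst p) (snd p)):bmeas (sg OM unif)"
 using assms by(simp add:has_law_def cong: measurable_cong_sets)
show f: "f:bmeas P"
 using assms measurable_restrict_space2_iff[of f P borel H] by(auto simp:has_law_def)
show "(%p. (fst p, x (fst p) (snd p))):sg OM unif ->M qq OM borel"
 by(rule measurable_Pair[OF _ x]) (simp cong: measurable_cong_sets)
have a: "al:bmeas P" using measurable_compose[OF al_m qq_borel] by simp
have "(%p. Gx (al p) (f p)):bmeas P"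
 using measurable_compose[OF measurable_Pair[OF a f] Gx_measurable] by simp
thus "(%p. (al p, Gx (al p) (f p))):P ->M qq OM borel" by(rule measurable_Pair[OF al_m])
qed

lemma has_law_integral:
assumes l: "has_law f x" and F: "F:bmeas (qq OM borel)"
shows "nn_integral (sg OM unif) (%p. F (fst p, x (fst p) (snd p))) = nn_integral P (%p. F (al p, Gx (al p) (f p)))"
proof -
have "nn_integral (sg OM unif) (%p. F (fst p, x (fst p) (snd p))) =
  nn_integral (distr (sg OM unif) (qq OM borel) (%p. (fst p, x (fst p) (snd p)))) F"
 by(rule nn_integral_distr[symmetric, OF has_law_m(2)[OF l]]) (use F in simp)
also have "... = nn_integral P (%p. F (al p, Gx (al p) (f p)))"
 unfolding has_law_eq[OF l] by(rule nn_integral_distr[OF has_law_m(3)[OF l]]) (use F in simp)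
finally show ?thesis .
qed

lemma al_Q: "p:space P ==> al p:QQ ` Hi" using measurable_space[OF al_m] by simp

lemma has_law_coord: "has_law f x ==> AE p in P. Gx (al p) (f p):IA (al p) & PB (al p, Gx (al p) (f p)) = f p"
proof -
assume "has_law f x"
hence "AE p in P. f p:Ry (al p)" by(simp add:has_law_def)
thus ?thesis using AE_space
proof eventually_elim
 case (elim p)
 have a: "al p:Hi" using Q_Hi[OF al_Q[OF elim(2)]] .
 have g: "GE (al p) (f p) = Gx (al p) (f p)" by(rule GE_eq_Gx[OF a elim(1)])
 thus ?case using GE_mem[OF elim(1)] PT_GE[OF a elim(1)] a by(simp add:PB_def IA_pairs_def)
qed
qed

lemma IA_pairs_qq: "{p:space (qq OM borel). p:IA_pairs}:sets (qq OM borel)"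
proof -
have "(%p. (fst p, snd p)):qq OM borel ->M borel OM (borel :: real measure)" by measurable
from measurable_sets[OF this IA_pairs_borel] show ?thesis by(simp add:vimage_def Collect_conj_eq Int_commute)
qed

lemma has_law_pairs:
assumes l: "has_law f x"
shows "AE p in sg OM unif. (fst p, x (fst p) (snd p)):IA_pairs"
proof -
have "AE p in P. (al p, Gx (al p) (f p)):IA_pairs"
 using has_law_coord[OF l] AE_space by eventually_elim (use Q_Hi[OF al_Q] in "simp add:IA_pairs_def")
hence "AE q in distr P (qq OM borel) (%p. (al p, Gx (al p) (f p))). q:IA_pairs"
 by(subst AE_distr_iff[OF has_law_m(3)[OF l] IA_pairs_qq])
hence "AE q in distr (sg OM unif) (qq OM borel) (%p. (fst p, x (fst p) (snd p))). q:IA_pairs"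
 unfolding has_law_eq[OF l] .
thus "AE p in sg OM unif. (fst p, x (fst p) (snd p)):IA_pairs" by(rule AE_distrD[OF has_law_m(2)[OF l]])
qed

text \<open>Almost every \<open>u\<close> becomes every \<open>u\<close>: by monotonicity
  \<open>x a u\<close> lies between values at admissible parameters on both sides, and
  \<open>IA a\<close> is an interval.\<close>

lemma has_law_IA:
assumes l: "has_law f x" and mono: "!!a u v. 0 < u ==> u <= v ==> v < 1 ==> x a u <= x a v"
shows "AE a in qq. 0 < sg' a --> (ALL u. 0 < u & u < 1 --> x a u:IA a)"
proof -
have "AE a in sg. AE u in unif. (a, x a u):IA_pairs" using su.AE_pair[OF has_law_pairs[OF l]] by simp
hence "AE a in qq. 0 < sg' a --> (AE u in unif. (a, x a u):IA_pairs)" unfolding AE_sg .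
thus ?thesis
proof eventually_elim
 case (elim a)
 show ?case
 proof (intro impI allI, elim conjE)
  fix u :: real assume s: "0 < sg' a" and u: "0 < u" "u < 1"
  hence ae: "AE u in unif. (a, x a u):IA_pairs" using elim by blast
  obtain v where v: "0 < v" "v < u" "(a, x a v):IA_pairs" using AE_unif_between[OF ae, of 0 u] u by auto
  obtain w where w: "u < w" "w < 1" "(a, x a w):IA_pairs" using AE_unif_between[OF ae, of u 1] u by auto
  have "a:Hi" using v(3) by(simp add:IA_pairs_def)
  thus "x a u:IA a"
   using mem_is_interval_1_I[OF IA_interval, of a "x a v" "x a w"] v w mono[of v u a] mono[of u w a] u by(simp add:IA_pairs_def)
 qed
qed
qed

text \<open>A bound by \<open>m\<close> is localized to almost every ray by testing it on slabs over
  measurable sets \<open>C\<close> of rays and between rational gauge values. Real intervals are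
  then approximated from outside.\<close>

lemma conditional_bound:
assumes l: "has_law f x" and V[measurable]: "V:bmeas borel"
 and le: "!!B. B:sets m ==> nn_integral P (%p. ennreal (exp (V (f p)))*ind B (f p)) <= em m B"
shows "AE a in qq. ALL c:IA a. ALL d:IA a. sg' a*nn_integral unif (%u. ennreal (exp (V (PB (a, x a u))))*ind {c..d} (x a u)) <= em (lam a) {c..d}"
proof -
define E where "E a c d = nn_integral unif (%u. ennreal (exp (V (PB (a, x a u))))*ind {c..d} (x a u))" for a c d
have xm[measurable]: "(%p. x (fst p) (snd p)):bmeas (qq OM borel)" using l by(simp add:has_law_def)
note [measurable] = has_law_m[OF l] al_m
let ?e = "initial_points le H Un final_points le H"
have "nn_integral P (%p. ennreal (exp (V (f p)))*ind ?e (f p)) = 0" using le[of ?e] ends by(auto simp:null_sets_def)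
hence fi: "AE p in P. f p ~: ?e"
 by(subst (asm) nn_integral_0_iff_AE) (auto split:split_indicator_asm elim!:eventually_mono)
have Em: "(%a. E a c d):bmeas qq" for c d
proof -
 have "(%p. ennreal (exp (V (PB (fst p, x (fst p) (snd p)))))*ind {c..d} (x (fst p) (snd p))):bmeas (qq OM borel)"
 proof -
  have "(%p. PB (fst p, x (fst p) (snd p))):bmeas (qq OM borel)"
   by(rule measurable_compose[OF _ PB_measurable]) measurable
  thus ?thesis by measurable
 qed
 from disintegrate_sg(2)[OF this] show ?thesis by(simp add:E_def)
qed
have rat: "AE a in qq. sg' a*E a c d <= em (lam a) {c..d}" for c d
proof -
 obtain g where g[measurable]: "g:bmeas qq" and gl: "AE a in qq. em (lam a) {c..d} = g a"
  using completion_ex_borel_measurable[OF measurable_lam[of "{c..d}"]] by auto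
 have "AE a in qq. sg' a*E a c d <= g a"
 proof (rule AE_le_of_nn_integral_le_finite[OF q.finite_measure_axioms _ g])
  show "(%a. sg' a*E a c d):bmeas qq" using Em by measurable
  fix C assume C[measurable]: "C:sets qq"
  define F where "F p = ind C (fst p)*(ennreal (exp (V (PB (fst p, snd p))))*ind {c..d} (snd p))" for p :: "'a \<times> real"
  have Fm: "F:bmeas (qq OM borel)" unfolding F_def by measurable
  have Fm': "(%p. F (fst p, x (fst p) (snd p))):bmeas (qq OM borel)"
   by(rule measurable_compose[OF _ Fm]) measurable
  let ?S = "{z:Hi. Gb z:{c..d}}"
  have S: "?S:sets m" "?S <= Hi" by(auto intro!:slab_m simp del:atLeastAtMost_iff)
  have C': "C:sets mq" using C by simp
  obtain Z where Z: "Z:sets m" "{z:?S. QQ z:C} <= Z" "em m Z = nn_integral mq (%a. em (ma a) ?S*ind C a)"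
   using fibre_outer[OF S C'] by auto
  have "nn_integral qq (%a. sg' a*E a c d*ind C a) = nn_integral qq (%a. sg' a*nn_integral unif (%u. F (a, x a u)))"
   by(rule nn_integral_cong) (auto simp:F_def E_def split:split_indicator)
  also have "... = nn_integral (sg OM unif) (%p. F (fst p, x (fst p) (snd p)))" using disintegrate_sg(1)[OF Fm'] by simp
  also have "... = nn_integral P (%p. F (al p, Gx (al p) (f p)))" by(rule has_law_integral[OF l Fm])
  also have "... <= nn_integral P (%p. ennreal (exp (V (f p)))*ind Z (f p))"
  proof (rule nn_integral_mono_AE)
   have "AE p in P. f p:Ry (al p)" using l by(simp add:has_law_def)
   thus "AE p in P. F (al p, Gx (al p) (f p)) <= ennreal (exp (V (f p)))*ind Z (f p)"
    using has_law_coord[OF l] fi AE_space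
   proof eventually_elim
    case (elim p)
    note aQ = al_Q[OF elim(4)]
    have i: "f p:Hi" using elim(1,3) R_subset by(auto simp:inner_part_def)
    hence "QQ (f p) = al p" using QQ_iff[OF i aQ] elim(1) by(simp add:in_open_ray_iff)
    moreover have "Gx (al p) (f p) = Gb (f p)" using elim(3) by(simp add:Gx_def)
    ultimately show ?case using Z(2) i elim(2) by(auto simp:F_def split:split_indicator)
   qed
  qed
  also have "... <= em m Z" by(rule le[OF Z(1)])
  also have "... = nn_integral qq (%a. em (lam a) {c..d}*ind C a)"
   unfolding Z(3) by(subst slab_formula) (simp_all add:nn_integral_completion)
  also have "... = nn_integral qq (%a. g a*ind C a)"
   by(rule nn_integral_cong_AE) (use gl in "auto elim!:eventually_mono")
  finally show "nn_integral qq (%a. sg' a*E a c d*ind C a) <= nn_integral qq (%a. g a*ind C a)" .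
 qed
 thus ?thesis using gl by eventually_elim simp
qed
have "AE a in qq. ALL c:Rats. ALL d:Rats. sg' a*E a c d <= em (lam a) {c..d}"
 unfolding AE_ball_countable[OF countable_rat] by(intro ballI rat)
thus ?thesis using AE_good
proof eventually_elim
 case (elim a)
 note g = elim(2)
 note al = goodD(2)[OF g]
 show ?case
 proof (intro ballI, fold E_def)
  fix c d assume cd: "c:IA a" "d:IA a"
  \<comment> \<open>A smaller element of \<open>IA a\<close> keeps the enlarged intervals within
    finite mass; if \<open>c\<close> is the least one, intersecting with \<open>J a\<close> cuts off
    what lies to its left.\<close>
  obtain c' de1 where c': "c':IA a" "0 < de1" "!!z. z:J a ==> c - de1 <= z ==> c' <= z"
  proof (cases "EX c':IA a. c' < c")
   case True
   then obtain c' where "c':IA a" "c' < c" by blast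
   thus ?thesis using that[of c' "c - c'"] by auto
  next
   case False
   thus ?thesis using that[of c 1] cd J_subset_IA by(force simp:not_less)
  qed
  obtain d' de2 where d': "d':IA a" "0 < de2" "!!z. z:J a ==> z <= d+de2 ==> z <= d'"
  proof (cases "EX d':IA a. d < d'")
   case True
   then obtain d' where "d':IA a" "d < d'" by blast
   thus ?thesis using that[of d' "d' - d"] by auto
  next
   case False
   thus ?thesis using that[of d 1] cd J_subset_IA by(force simp:not_less)
  qed
  define de where "de = min de1 de2"
  have de: "0 < de" using c' d' by(simp add:de_def)
  have sub: "{c - de..d+de} Int J a <= {c'..d'}" using c'(3) d'(3) by(auto simp:de_def)
  have "sg' a*E a c d <= em (lam a) ({c..d} Int J a)"
  proof (rule emeasure_Icc_outer[OF _ J_borel[OF al] de])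
   have "em (lam a) ({c - de..d+de} Int J a) <= em (lam a) {c'..d'}" by(rule emeasure_mono[OF sub]) simp
   thus "em (lam a) ({c - de..d+de} Int J a) ~= \<infinity>" using lam_compact[OF g c'(1) d'(1)] by auto
   fix ep :: real assume e: "0 < ep" "ep <= de"
   obtain r where r: "r:Rats" "c - ep < r" "r < c" using Rats_dense_in_real[of "c - ep" c] e by auto
   obtain s where s: "s:Rats" "d < s" "s < d+ep" using Rats_dense_in_real[of d "d+ep"] e by auto
   have "sg' a*E a c d <= sg' a*E a r s" unfolding E_def using r s
    by(intro mult_left_mono nn_integral_mono) (auto split:split_indicator)
   also have "... <= em (lam a) {r..s}" using elim(1) r(1) s(1) by blast
   also have "... = em (lam a) ({r..s} Int J a)" by(rule lam_J[symmetric, OF g]) simp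
   also have "... <= em (lam a) ({c - ep..d+ep} Int J a)"
    using r s J_borel[OF al] by(intro emeasure_mono) auto
   finally show "sg' a*E a c d <= em (lam a) ({c - ep..d+ep} Int J a)" .
  qed simp
  also have "... = em (lam a) {c..d}" by(rule lam_J[OF g]) simp
  finally show "sg' a*E a c d <= em (lam a) {c..d}" .
 qed
qed
qed

end

section \<open>Interpolated weights\<close>

context ray_coupling
begin

text \<open>\<open>w\<close> stands for the \<open>(N-1)\<close>-th root of the weight
  \<open>exp V\<close> of a potential: such roots are interpolated linearly, and
  \<open>w = 0\<close> is available where there is no potential.\<close>

definition cb :: "('a => real => real) => ('a => real => real) => bool" where
"cb x w <-> (%p. w (fst p) (snd p)):bmeas (qq OM borel) & (ALL a u. 0 <= w a u) &
  (AE a in qq. ALL c:IA a. ALL d:IA a. sg' a*nn_integral unif (%u. ennreal (w a u powr (N-1))*ind {c..d} (x a u)) <= em (lam a) {c..d})"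

lemma cb_zero: "cb x (%_ _. 0)" by(simp add:cb_def)

lemma cb_potential:
assumes l: "has_law f x" and V[measurable]: "V:bmeas borel"
 and le: "!!B. B:sets m ==> nn_integral P (%p. ennreal (exp (V (f p)))*ind B (f p)) <= em m B"
shows "cb x (%a u. exp (V (PB (a, x a u))/(N-1)))"
proof -
have [measurable]: "(%p. x (fst p) (snd p)):bmeas (qq OM borel)" using l by(simp add:has_law_def)
have [measurable]: "(%p. PB (fst p, x (fst p) (snd p))):bmeas (qq OM borel)"
 by(rule measurable_compose[OF _ PB_measurable]) measurable
have "exp (v / (N-1)) powr (N-1) = exp v" for v using N by(simp add:powr_def)
thus ?thesis using conditional_bound[OF l V le] by(simp add:cb_def)
qed

lemma section_m:
assumes "(%p. w (fst p) (snd p)):bmeas (qq OM borel)" "a:space qq"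
shows "(%u. w a u):bmeas (borel :: real measure)"
using measurable_compose[OF measurable_Pair1'[OF assms(2)] assms(1)] by simp

lemma has_law_x: "has_law f x ==> (%p. x (fst p) (snd p)):bmeas (qq OM borel)" by(simp add:has_law_def)

lemma PB_comp:
assumes "g:bmeas (qq OM borel)"
shows "(%p. PB (fst p, g p)):bmeas (qq OM (borel :: real measure))"
by(rule measurable_compose[OF _ PB_measurable]) (use assms in measurable)

text \<open>On almost every ray \<open>ray_push_forward\<close> combines the two conditional bounds,
  and the disintegration formula integrates the result to a bound by \<open>m\<close>. The density
  \<open>sg' a\<close> of the law of the rays is absorbed into the weights.\<close>

lemma push_m:
assumes lx: "has_law f0 x" and ly: "has_law f1 y"
 and mono: "!!a u v. 0 < u ==> u <= v ==> v < 1 ==> x a u <= x a v" "!!a u v. 0 < u ==> u <= v ==> v < 1 ==> y a u <= y a v"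
 and c: "cb x w0" "cb y w1" and t: "0 < t" "t < 1" and B: "B:sets m"
shows "nn_integral (sg OM unif) (%p. ennreal (((1-t)*w0 (fst p) (snd p)+t*w1 (fst p) (snd p)) powr (N-1)) *
  ind B (PB (fst p, (1-t)*x (fst p) (snd p)+t*y (fst p) (snd p)))) <= em m B"
proof -
note [measurable] = has_law_x[OF lx] has_law_x[OF ly]
have [measurable]: "(%p. w0 (fst p) (snd p)):bmeas (qq OM borel)" "(%p. w1 (fst p) (snd p)):bmeas (qq OM borel)"
 using c by(simp_all add:cb_def)
have w: "0 <= w0 a u" "0 <= w1 a u" for a u using c by(simp_all add:cb_def)
have [measurable]: "B:sets borel" using B by(simp add:m_iff)
define F where "F p = ennreal (((1-t)*w0 (fst p) (snd p)+t*w1 (fst p) (snd p)) powr (N-1)) *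
  ind B (PB (fst p, (1-t)*x (fst p) (snd p)+t*y (fst p) (snd p)))" for p
have "(%p. PB (fst p, (1-t)*x (fst p) (snd p)+t*y (fst p) (snd p))):bmeas (qq OM borel)"
 by(rule PB_comp) measurable
hence F: "F:bmeas (qq OM borel)" unfolding F_def by measurable
\<comment> \<open>A ray without mass has no \<open>concave_density\<close>. There the conditional
  bound on the intervals \<open>?K k\<close>, which eventually contain each value
  \<open>z a u\<close>, forces the weight to be 0.\<close>
have vanish: "AE u in unif. w a u = 0"
 if wm: "(%p. w (fst p) (snd p)):bmeas (qq OM borel)" and zm: "(%p. z (fst p) (snd p)):bmeas (qq OM borel)"
  and a: "a:space qq" and s: "0 < sg' a" and l0: "em (lam a) UNIV = 0" and w: "!!u. 0 <= w a u"
  and zI: "!!u. 0 < u ==> u < 1 ==> z a u:IA a" and zm': "!!u v. 0 < u ==> u <= v ==> v < 1 ==> z a u <= z a v"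
  and b: "ALL c:IA a. ALL d:IA a. sg' a*nn_integral unif (%u. ennreal (w a u powr (N-1))*ind {c..d} (z a u)) <= em (lam a) {c..d}"
 for a w z
proof -
 let ?K = "%k. {z a (1/real (k+3))..z a (1 - 1/real (k+3))}"
 note [measurable] = section_m[OF wm a] section_m[OF zm a]
 have "AE u in unif. ennreal (w a u powr (N-1))*ind (?K k) (z a u) = 0" for k :: nat
 proof -
  have k: "0 < 1/real (k+3)" "1/real (k+3) < 1" by auto
  have i: "z a (1/real (k+3)):IA a" "z a (1 - 1/real (k+3)):IA a" using k by(auto intro!:zI)
  have "sg' a*nn_integral unif (%u. ennreal (w a u powr (N-1))*ind (?K k) (z a u))
    <= em (lam a) (?K k)" using b i by blast
  also have "... <= em (lam a) UNIV" by(intro emeasure_mono) auto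
  finally have "nn_integral unif (%u. ennreal (w a u powr (N-1))*ind (?K k) (z a u)) = 0"
   using s l0 by auto
  thus ?thesis by(subst (asm) nn_integral_0_iff_AE) auto
 qed
 hence "AE u in unif. ALL k::nat. ennreal (w a u powr (N-1))*ind (?K k) (z a u) = 0"
  by(subst AE_all_countable) blast
 thus ?thesis using AE_unif
 proof eventually_elim
  case (elim u)
  have "0 < min u (1 - u)" using elim(2) by simp
  then obtain k where k: "1/real (Suc k) < min u (1 - u)" by(rule nat_approx_posE)
  have k3: "1/real (k+3) <= 1/real (Suc k)" "0 < 1/real (k+3)" by(auto intro!:divide_left_mono)
  hence b: "1/real (k+3) <= u" "u <= 1 - 1/real (k+3)" using k by auto
  hence "z a u:?K k"
   using zm'[OF k3(2) b(1)] zm'[OF _ b(2)] elim(2) by auto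
  thus ?case using spec[OF elim(1), of k] by simp
 qed
qed
have main: "AE a in qq. sg' a*nn_integral unif (%u. F (a, u)) <= em (ma a) B"
proof -
 have b: "AE a in qq. ALL c:IA a. ALL d:IA a. sg' a*nn_integral unif (%u. ennreal (w0 a u powr (N-1))*ind {c..d} (x a u)) <= em (lam a) {c..d}"
  "AE a in qq. ALL c:IA a. ALL d:IA a. sg' a*nn_integral unif (%u. ennreal (w1 a u powr (N-1))*ind {c..d} (y a u)) <= em (lam a) {c..d}"
  using c by(simp_all add:cb_def)
 have I: "AE a in qq. 0 < sg' a --> (ALL u. 0 < u & u < 1 --> x a u:IA a)"
  "AE a in qq. 0 < sg' a --> (ALL u. 0 < u & u < 1 --> y a u:IA a)"
  by(rule has_law_IA[OF lx], rule mono(1), assumption+) (rule has_law_IA[OF ly], rule mono(2), assumption+)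
 show ?thesis using b lam_density I sg'_finite AE_space
 proof eventually_elim
  case (elim a)
  show ?case
  proof (cases "sg' a = 0")
   case False
   hence s0: "0 < sg' a" by(simp add:zero_less_iff_neq_zero)
   define s where "s = enn2real (sg' a)"
   have s: "sg' a = ennreal s" "0 < s" using elim(6) s0 by(auto simp:s_def enn2real_positive_iff less_top)
   have g: "good a" using elim(3) by blast
   note al = goodD(2)[OF g]
   have xI: "x a u:IA a" "y a u:IA a" if "0 < u" "u < 1" for u using elim(4,5) s0 that by auto
   note sec = section_m[OF has_law_x[OF lx] elim(7)] section_m[OF has_law_x[OF ly] elim(7)]
    section_m[of w0, OF _ elim(7)] section_m[of w1, OF _ elim(7)]
   have [measurable]: "(%u. x a u):bmeas borel" "(%u. y a u):bmeas borel"
    "(%u. w0 a u):bmeas borel" "(%u. w1 a u):bmeas borel"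
    using c by(auto intro!:sec simp:cb_def)
   have Fs: "(%u. F (a, u)):bmeas borel"
    using measurable_compose[OF measurable_Pair1'[OF elim(7)] F] .
   show ?thesis
   proof (cases "em (lam a) UNIV = 0")
    case True
    have "AE u in unif. w0 a u = 0" by(rule vanish[of w0 x]) (use c mono xI elim(1,7) s0 True w in "auto simp:cb_def")
    moreover have "AE u in unif. w1 a u = 0" by(rule vanish[of w1 y]) (use c mono xI elim(2,7) s0 True w in "auto simp:cb_def")
    ultimately have "AE u in unif. F (a, u) = 0" by eventually_elim (simp add:F_def)
    hence "nn_integral unif (%u. F (a, u)) = 0" using Fs by(subst nn_integral_0_iff_AE) auto
    thus ?thesis by simp
   next
    case False
    then obtain k where k: "concave_density (IA a) k (N-1)" "lam a = density lborel (%z. ennreal (concave_density.h (IA a) k (N-1) z))"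
     using elim(3) by blast
    \<comment> \<open>Multiplying both weights by this root multiplies each \<open>(N-1)\<close>-th
      power, also that of the interpolated weight, by \<open>s\<close>.\<close>
    define r where "r = s powr (1/(N-1))"
    have r: "0 < r" "(r * v) powr (N-1) = s * v powr (N-1)" if "0 <= v" for v
     using s(2) N that by(auto simp:r_def powr_mult powr_powr)
    have r0: "0 < r" using s(2) by(simp add:r_def)
    let ?w = "%u. ((1-t)*(r*w0 a u)+t*(r*w1 a u)) powr (N-1)" and ?z = "%u. PT a ((1-t)*x a u+t*y a u)"
    have hh: "nn_integral lborel (%u. ennreal ((r * v u) powr (N-1))*ind {0<..<1} u*ind {c..d} (z u)) <= em (lam a) {c..d}"
     if v: "v:bmeas borel" "!!u. 0 <= v u" and z: "z:bmeas borel"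
      and b: "sg' a*nn_integral unif (%u. ennreal (v u powr (N-1))*ind {c..d} (z u)) <= em (lam a) {c..d}" for v z c d
    proof -
     note [measurable] = v(1) z
     have "nn_integral lborel (%u. ennreal ((r * v u) powr (N-1))*ind {0<..<1} u*ind {c..d} (z u)) =
       nn_integral lborel (%u. ennreal s*(ennreal (v u powr (N-1))*ind {c..d} (z u)*ind {0<..<1} u))"
      by(rule nn_integral_cong) (use s(2) v(2) in "simp add:r ennreal_mult' mult_ac")
     also have "... = sg' a*nn_integral unif (%u. ennreal (v u powr (N-1))*ind {c..d} (z u))"
      unfolding s(1) by(subst nn_integral_unif, measurable) (rule nn_integral_cmult, measurable)
     finally show ?thesis using b by simp
    qed
    have "nn_integral lborel (%u. ennreal (?w u)*ind {0<..<1} u *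
      ind B (?z u)) <= em (ma a) B"
     by(rule ray_push_forward[OF g k t, where x = "x a" and y = "y a"])
      (use mono xI r0 w B in "auto intro!:hh elim(1,2)[rule_format]")
    moreover have "sg' a*nn_integral unif (%u. F (a, u)) = nn_integral lborel (%u. ennreal (?w u)*ind {0<..<1} u *
      ind B (?z u))"
    proof -
     have "sg' a*nn_integral unif (%u. F (a, u)) = nn_integral lborel (%u. ennreal s*(F (a, u)*ind {0<..<1} u))"
      unfolding s(1) nn_integral_unif[OF Fs] by(rule nn_integral_cmult[symmetric]) (use Fs in measurable)
     also have "... = nn_integral lborel (%u. ennreal (?w u)*ind {0<..<1} u *
      ind B (?z u))"
     proof (rule nn_integral_cong)
      fix u :: real
      show "ennreal s*(F (a, u)*ind {0<..<1} u) = ennreal (?w u)*ind {0<..<1} u *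
       ind B (?z u)"
      proof (cases "0 < u & u < 1")
       case True
       have v0: "0 <= (1-t)*w0 a u+t*w1 a u" using t w by simp
       have "(1-t)*(r*w0 a u)+t*(r*w1 a u) = r*((1-t)*w0 a u+t*w1 a u)" by(simp add:algebra_simps)
       hence "?w u = s*((1-t)*w0 a u+t*w1 a u) powr (N-1)"
        using r(2)[OF v0] by simp
       moreover have "(1-t)*x a u+t*y a u:IA a"
        using convexD[OF IA_convex[OF al], of "x a u" "y a u" "1 - t" t] xI True t by simp
       hence "PB (a, (1-t)*x a u+t*y a u) = ?z u"
        using al by(simp add:PB_def IA_pairs_def)
       ultimately show ?thesis using True s(2) by(simp add:F_def ennreal_mult' mult.assoc)
      qed simp
     qed
     finally show ?thesis .
    qed
    ultimately show ?thesis by simp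
   qed
  qed simp
 qed
qed
have "nn_integral (sg OM unif) F <= nn_integral qq (%a. em (ma a) B)"
 unfolding disintegrate_sg(1)[OF F] by(rule nn_integral_mono_AE[OF main])
also have "... = nn_integral mq (%a. em (ma a) (B Int Hi)*ind (space mq) a)"
 unfolding nn_integral_completion
proof (rule nn_integral_cong_AE)
 show "AE a in qq. em (ma a) B = em (ma a) (B Int Hi)*ind (space mq) a" using AE_good AE_space
 proof eventually_elim
  case (elim a)
  have "em (ma a) B = em (ma a) (B Int Hi)"
  proof (rule emeasure_eq_AE)
   show "AE x in ma a. x:B <-> x:B Int Hi" using goodD(3)[OF elim(1)] by eventually_elim (use OR_D(2) in blast)
  qed (use sets_ma_iff[OF goodD(1)[OF elim(1)]] B Hi_m in auto)
  thus ?case using elim(2) by simp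
 qed
qed
also have "... = em (completion m) {x:B Int Hi. QQ x:space mq}"
 by(rule fibre_formula0[symmetric, OF _ _ sets.top]) (use B Hi_m in auto)
also have "... <= em (completion m) B" using B by(intro emeasure_mono) auto
also have "... = em m B" using B by simp
finally show ?thesis unfolding F_def .
qed

lemma potential:
assumes f: "f:P ->M borel_on H" and r: "0 < r" "ennreal r <= Uent (N-1) (distr P (borel_on H) f) m"
shows "EX V:bmeas borel. integrable P (%p. V (f p)) & ln r <= (\<integral>p. V (f p) \<partial>P)/(N-1) &
 (ALL B:sets m. (nn_integral P (%p. ennreal (exp (V (f p)))*ind B (f p))) <= em m B)"
proof -
have N1: "0 < N - 1" using N by simp
obtain V where V: "integrable (distr P (borel_on H) f) V" "ln r <= (\<integral>x. V x \<partial>distr P (borel_on H) f)/(N-1)"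
 and le: "!!B. B:sets m ==> nn_integral (distr P (borel_on H) f) (%x. ennreal (exp (V x))*ind B x) <= em m B"
 using m.Uent_potential[OF P.prob_space_distr[OF f] _ N1 r] sets_m by auto
have Vm: "V:bmeas (borel_on H)" using borel_measurable_integrable[OF V(1)] by simp
define W where "W x = ind H x *\<^sub>R V x" for x
have W: "W:bmeas borel"
 using Vm unfolding W_def by(subst (asm) borel_measurable_restrict_space_iff) auto
have eq: "W (f p) = V (f p)" if "p:space P" for p
 using measurable_space[OF f that] by(simp add:space_restrict_space W_def)
have "integrable P (%p. W (f p)) = integrable P (%p. V (f p))"
 by(rule Bochner_Integration.integrable_cong[OF refl]) (rule eq)
hence 1: "integrable P (%p. W (f p))" using integrable_distr[OF f V(1)] by simp
have "(\<integral>p. W (f p) \<partial>P) = (\<integral>p. V (f p) \<partial>P)" by(rule Bochner_Integration.integral_cong[OF refl eq])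
also have "... = (\<integral>x. V x \<partial>distr P (borel_on H) f)" by(rule integral_distr[symmetric, OF f Vm])
finally have 2: "ln r <= (\<integral>p. W (f p) \<partial>P)/(N-1)" using V(2) by simp
have 3: "nn_integral P (%p. ennreal (exp (W (f p)))*ind B (f p)) <= em m B" if B: "B:sets m" for B
proof -
 have "(%x. ennreal (exp (V x))*ind B x):bmeas (borel_on H)" using Vm B[unfolded sets_m] by measurable
 hence "nn_integral (distr P (borel_on H) f) (%x. ennreal (exp (V x))*ind B x) = nn_integral P (%p. ennreal (exp (V (f p)))*ind B (f p))"
  by(intro nn_integral_distr f) simp
 also have "... = nn_integral P (%p. ennreal (exp (W (f p)))*ind B (f p))"
  by(rule nn_integral_cong) (simp only: eq)
 finally show ?thesis using le[OF B] by simp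
qed
show ?thesis by(rule bexI[OF _ W]) (use 1 2 3 in simp)
qed

lemma has_law_real:
fixes V :: "'a => real"
assumes l: "has_law f x" and V: "V:bmeas borel" and i: "integrable P (%p. V (f p))"
shows "integrable (sg OM unif) (%p. V (PB (fst p, x (fst p) (snd p))))"
 and "(\<integral>p. V (PB (fst p, x (fst p) (snd p))) \<partial>(sg OM unif)) = (\<integral>p. V (f p) \<partial>P)"
proof -
let ?F = "%q. V (PB (fst q, snd q)) :: real"
have F: "?F:bmeas (qq OM borel)" using measurable_compose[OF PB_comp[OF measurable_snd] V] .
have fm: "f:bmeas P" by(rule has_law_m(1)[OF l])
have ae: "AE p in P. V (f p) = V (PB (al p, Gx (al p) (f p)))" using has_law_coord[OF l] by eventually_elim simp
have Vf: "(%p. V (f p)):bmeas P" by(rule measurable_compose[OF fm V])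
have VP: "(%p. V (PB (al p, Gx (al p) (f p)))):bmeas P"
 using measurable_compose[OF has_law_m(3)[OF l] F] by simp
have "integrable P (%p. ?F (al p, Gx (al p) (f p)))" using integrable_cong_AE_imp[OF i, of "%p. V (PB (al p, Gx (al p) (f p)))"] VP ae by simp
hence "integrable (distr P (qq OM borel) (%p. (al p, Gx (al p) (f p)))) ?F"
 by(subst integrable_distr_eq[OF has_law_m(3)[OF l] F])
thus "integrable (sg OM unif) (%p. V (PB (fst p, x (fst p) (snd p))))"
 unfolding has_law_eq[OF l, symmetric] by(subst (asm) integrable_distr_eq[OF has_law_m(2)[OF l] F]) simp
have "(\<integral>p. V (PB (fst p, x (fst p) (snd p))) \<partial>(sg OM unif)) = (\<integral>q. ?F q \<partial>distr P (qq OM borel) (%p. (al p, Gx (al p) (f p))))"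
 unfolding has_law_eq[OF l, symmetric] by(subst integral_distr[OF has_law_m(2)[OF l] F]) simp
also have "... = (\<integral>p. V (PB (al p, Gx (al p) (f p))) \<partial>P)" by(subst integral_distr[OF has_law_m(3)[OF l] F]) simp
also have "... = (\<integral>p. V (f p) \<partial>P)" by(rule integral_cong_AE[OF VP Vf]) (use ae in "auto elim:eventually_mono")
finally show "(\<integral>p. V (PB (fst p, x (fst p) (snd p))) \<partial>(sg OM unif)) = (\<integral>p. V (f p) \<partial>P)" .
qed

end

lemma restrict_const_curve: "z:H ==> restrict (%_. z) {0..1}:mspace (curve_space H)"
by(rule restrict_mem_curve_space) auto

lemma eq_on_rationals:
fixes f g :: "real => 'a::t2_space"
assumes f: "continuous_on {0..1} f" and g: "continuous_on {0..1} g" and eq: "!!t. t:Rats ==> t:{0..1} ==> f t = g t" and t: "t:{0..1}"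
shows "f t = g t"
proof -
define r where "r n = real_of_int \<lfloor>t*real (Suc n)\<rfloor> / real (Suc n)" for n
have r: "r n:Rats" for n by(simp add:r_def)
have b: "t - 1/real (Suc n) <= r n" "r n <= t" for n
proof -
 have "(t*real (Suc n) - 1)/real (Suc n) <= r n" unfolding r_def by(intro divide_right_mono) linarith+
 thus "t - 1/real (Suc n) <= r n" by(simp add:diff_divide_distrib del:of_nat_Suc)
 show "r n <= t" unfolding r_def by(simp add:divide_le_eq del:of_nat_Suc)
qed
have r01: "r n:{0..1}" for n
proof -
 have "r n <= 1" using b(2)[of n] t by(meson atLeastAtMost_iff order_trans)
 moreover have "0 <= r n" unfolding r_def using t by(intro divide_nonneg_pos) auto
 ultimately show ?thesis by simp
qed
have "(%n. t - 1/real (Suc n)) ----> t - 0" by(rule tendsto_diff[OF tendsto_const LIMSEQ_Suc[OF lim_1_over_n]])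
hence "(%n. t - 1/real (Suc n)) ----> t" by simp
from tendsto_sandwich[OF _ _ this tendsto_const, of r] have lim: "r ----> t"
 by(meson always_eventually b)
have ev: "\<forall>\<^sub>F n in sequentially. r n:{0..1}" by(intro always_eventually allI r01)
have "(%n. f (r n)) ----> f t" "(%n. g (r n)) ----> g t"
 using continuous_on_tendsto_compose[OF f lim t ev] continuous_on_tendsto_compose[OF g lim t ev] .
moreover have "(%n. f (r n)) = (%n. g (r n))" using eq[OF r r01] by simp
ultimately show ?thesis by(auto intro:LIMSEQ_unique)
qed

section \<open>A Borel set of \<open>G\<close>-causal curves\<close>

context null_rays
begin

text \<open>A Borel set of \<open>G\<close>-causal curves that contains all the curves constructed here.\<close>

definition nice :: "(real => 'a) => bool" where
"nice ga <-> (ALL t:Rats Int {0..1}. ga t = ga 0) \<or> (ga (1/2):Hi & le (ga 0) (ga 1) &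
  (ALL t:Rats Int {0..1}. (le (ga t) (ga (1/2)) \<or> le (ga (1/2)) (ga t)) &
   Gx (ga (1/2)) (ga t) = (1-t)*Gx (ga (1/2)) (ga 0)+t*Gx (ga (1/2)) (ga 1)))"

lemma nice_sets: "{ga:space (borel_curves H). nice ga}:sets (borel_curves H)"
proof -
have ev[measurable]: "(%ga. ga t):bmeas (borel_curves H)" if "t:{0..1}" for t
 using measurable_compose[OF measurable_curve_eval[OF that] measurable_restrict_space1[OF measurable_ident]] by simp
have le_m: "Measurable.pred (borel_curves H) (%ga. le (ga s) (ga t))" if "s:{0..1}" "t:{0..1}" for s t
 using measurable_sets[OF borel_measurable_Pair[OF ev[OF that(1)] ev[OF that(2)]] borel_closed[OF closed_le]]
 by(simp add:pred_def vimage_def Collect_conj_eq Int_commute)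
have gx: "(%ga. Gx (ga (1/2)) (ga t)):bmeas (borel_curves H)" if t: "t:{0..1}" for t
 using measurable_compose[OF measurable_Pair[OF ev[of "1/2"] ev[OF t]] Gx_measurable] by simp
have h: "(0::real):{0..1}" "(1/2::real):{0..1}" "(1::real):{0..1}" by auto
have c: "countable (Rats Int {0..1::real})" using countable_rat by blast
have 1: "Measurable.pred (borel_curves H) (%ga. ALL t:Rats Int {0..1}. ga t = ga 0)"
 unfolding pred_def
proof (rule sets_Collect_ball_countable[OF c])
 fix t :: real assume "t:Rats Int {0..1}"
 hence [measurable]: "(%ga. ga t):bmeas (borel_curves H)" "(%ga. ga 0):bmeas (borel_curves H)"
  using ev h(1) by auto
 show "{ga:space (borel_curves H). ga t = ga 0}:sets (borel_curves H)" by measurable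
qed
have 2: "Measurable.pred (borel_curves H) (%ga. ALL t:Rats Int {0..1}. (le (ga t) (ga (1/2)) \<or> le (ga (1/2)) (ga t)) &
   Gx (ga (1/2)) (ga t) = (1-t)*Gx (ga (1/2)) (ga 0)+t*Gx (ga (1/2)) (ga 1))"
 unfolding pred_def
proof (rule sets_Collect_ball_countable[OF c])
 fix t :: real assume "t:Rats Int {0..1}"
 hence t: "t:{0..1}" by simp
 have "(%ga. (1-t)*Gx (ga (1/2)) (ga 0)+t*Gx (ga (1/2)) (ga 1)):bmeas (borel_curves H)"
  by(intro borel_measurable_add borel_measurable_times borel_measurable_const gx h)
 note e = measurable_equality_set[OF gx[OF t] this, folded pred_def]
 show "{ga:space (borel_curves H). (le (ga t) (ga (1/2)) \<or> le (ga (1/2)) (ga t)) &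
   Gx (ga (1/2)) (ga t) = (1-t)*Gx (ga (1/2)) (ga 0)+t*Gx (ga (1/2)) (ga 1)}:sets (borel_curves H)"
  unfolding pred_def[symmetric] by(intro pred_intros_logic(3) pred_intros_logic(5) le_m t h e)
qed
have 3: "Measurable.pred (borel_curves H) (%ga. ga (1/2):Hi)" using ev[OF h(2)] by measurable
show ?thesis using pred_intros_logic(5)[OF 1 pred_intros_logic(3)[OF 3 pred_intros_logic(3)[OF le_m[OF h(1,3)] 2]]]
 unfolding nice_def pred_def .
qed

text \<open>A continuous curve is determined by its rational times: it is constant, or it coincides
  with the \<open>ray_curve\<close> on the ray fixed by its inner middle point.\<close>

lemma nice_G_causal:
assumes g: "ga:mspace (curve_space H)" and n: "nice ga"
shows "ga:G_causal_curves le H G"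
proof -
have cg: "continuous_on {0..1} ga" and gH: "ga ` {0..1} <= H" and gx: "ga:extensional {0..1}"
 using g by(auto simp:mem_curve_space_iff)
from n show ?thesis unfolding nice_def
proof (elim disjE conjE)
 assume "ALL t:Rats Int {0..1}. ga t = ga 0"
 hence "ga t = ga 0" if "t:{0..1}" for t using eq_on_rationals[OF cg continuous_on_const _ that] by blast
 hence "ga constant_on {0..1}" unfolding constant_on_def by blast
 thus ?thesis using g by(simp add:G_causal_curves_def)
next
 assume z: "ga (1/2):Hi" and l01: "le (ga 0) (ga 1)" and *: "ALL t:Rats Int {0..1}. (le (ga t) (ga (1/2)) \<or> le (ga (1/2)) (ga t)) &
   Gx (ga (1/2)) (ga t) = (1-t)*Gx (ga (1/2)) (ga 0)+t*Gx (ga (1/2)) (ga 1)"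
 define z where "z = ga (1/2)"
 have zi: "z:Hi" using z by(simp add:z_def)
 have R: "ga t:Ry z" if "t:Rats" "t:{0..1}" for t
 proof -
  have "ga t:H" "z:H" using gH that(2) zi Hi_subset by auto
  moreover have "le (ga t) z \<or> le z (ga t)" using bspec[OF *, of t] that by(simp add:z_def)
  ultimately show ?thesis unfolding in_ray_iff by(intro conjI)
 qed
 have r01: "ga 0:Ry z" "ga 1:Ry z" using R[of 0] R[of 1] by auto
 let ?a = "GE z (ga 0)" and ?b = "GE z (ga 1)"
 have ab: "?a:IA z" "?b:IA z" "?a <= ?b" using GE_mem r01 GE_le_iff[OF zi r01] l01 by auto
 have rc: "continuous_on {0..1} (ray_curve z ?a ?b)" "ray_curve z ?a ?b:extensional {0..1}"
  using ray_curve_curve[OF zi ab(1,2)] by(auto simp:mem_curve_space_iff)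
 have "ga t = ray_curve z ?a ?b t" if t: "t:{0..1}" for t
 proof (rule eq_on_rationals[OF cg rc(1) _ t])
  fix s :: real assume s: "s:Rats" "s:{0..1}"
  have "GE z (ga s) = (1 - s)*?a+s*?b"
   using conjunct2[OF bspec[OF *, of s]] s GE_eq_Gx[OF zi R[OF s]] GE_eq_Gx[OF zi r01(1)] GE_eq_Gx[OF zi r01(2)] by(simp add:z_def)
  thus "ga s = ray_curve z ?a ?b s" using PT_GE[OF zi R[OF s]] s by(simp add:ray_curve_def)
 qed
 hence "ga = ray_curve z ?a ?b" by(rule extensionalityI[OF gx rc(2)])
 thus ?thesis using ray_curve_G_causal[OF zi ab] by simp
qed
qed

text \<open>\<open>nice\<close> takes the middle point of the curve itself as base point; it lies on
  the open ray of \<open>c\<close>, so both give the same coordinates.\<close>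

lemma ray_curve_nice:
assumes c: "c:Hi" and ab: "a:IA c" "b:IA c" "a <= b"
shows "nice (ray_curve c a b)"
proof (cases "a = b")
case True
hence "(1-t)*a+t*b = a" for t by(simp add:algebra_simps)
thus ?thesis by(simp add:nice_def ray_curve_def)
next
case False
let ?g = "ray_curve c a b"
have I: "(1-t)*a+t*b:IA c" if "t:{0..1}" for t using IA_convex_comb[OF c ab(1,2) that] .
have R: "?g t:Ry c" "GE c (?g t) = (1-t)*a+t*b" if "t:{0..1}" for t
 using PT_mem[OF c I[OF that]] GE_PT[OF c I[OF that]] that by(simp_all add:ray_curve_def)
have h: "(0::real):{0..1}" "(1/2::real):{0..1}" "(1::real):{0..1}" by auto
have "(1 - 1/2)*a+1/2*b:J c"
 using IA_between_J[OF c R(1)[OF h(1)] R(1)[OF h(3)], of "(1 - 1/2)*a+1/2*b"] R(2)[OF h(1)] R(2)[OF h(3)] ab(3) False by simp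
hence O: "?g (1/2):OpR c" using PT_J[OF c] h by(simp add:ray_curve_def)
let ?z = "?g (1/2)"
have zi: "?z:Hi" by(rule OR_D(2)[OF O])
have Rz: "?g t:Ry ?z" if "t:{0..1}" for t using R(1)[OF that] ray_eq[OF c O] by simp
have Gz: "Gx ?z (?g t) = (1-t)*a+t*b" if "t:{0..1}" for t
 using R(2)[OF that] GE_eq_Gx[OF zi Rz[OF that]] GE_ray_eq[OF c O] by simp
have "le (?g 0) (?g 1)" using GE_le_iff[OF c R(1)[OF h(1)] R(1)[OF h(3)]] R(2)[OF h(1)] R(2)[OF h(3)] ab(3) by simp
thus ?thesis unfolding nice_def using zi Rz Gz h by(auto simp:in_ray_iff)
qed

lemma AE_G_causal_distr:
assumes f: "f:M ->M borel_curves H" and n: "!!p. p:space M ==> nice (f p)"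
shows "AE ga in distr M (borel_curves H) f. ga:G_causal_curves le H G"
proof -
have "AE ga in distr M (borel_curves H) f. nice ga" by(subst AE_distr_iff[OF f nice_sets]) (simp add:n)
thus ?thesis using AE_space by eventually_elim (simp add:nice_G_causal space_borel_curves)
qed

end

section \<open>The monotone plan and its entropy\<close>

locale ray_plan = ray_coupling le H G m QQ qq ma N P al
for le :: "'a::{heine_borel,polish_space} => 'a => bool" and H :: "'a set" and G :: "'a => real"
 and m :: "'a measure" and QQ :: "'a => 'a" and qq :: "'a measure" and ma :: "'a => 'a measure" and N :: real
 and P :: "'p measure" and al :: "'p => 'a" +
fixes f0 f1 :: "'p => 'a" and x y :: "'a => real => real"
assumes lx: "has_law f0 x" and ly: "has_law f1 y"
 and mono: "!!a u v. 0 < u ==> u <= v ==> v < 1 ==> x a u <= x a v" "!!a u v. 0 < u ==> u <= v ==> v < 1 ==> y a u <= y a v"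
 and xy: "AE a in sg. ALL u. 0 < u & u < 1 --> x a u <= y a u"
begin

definition ok :: "'a \<times> real => bool" where
"ok p <-> (fst p, x (fst p) (snd p)):IA_pairs & (fst p, y (fst p) (snd p)):IA_pairs & x (fst p) (snd p) <= y (fst p) (snd p)"

text \<open>On the null set where \<open>ok\<close> fails, a constant curve keeps the map measurable
  and inside the curve space.\<close>

definition Ga :: "'a \<times> real => real => 'a" where
"Ga p = (if ok p then ray_curve (fst p) (x (fst p) (snd p)) (y (fst p) (snd p)) else restrict (%_. fst p) {0..1})"

abbreviation "R == sg OM unif"

lemma sets_R [measurable_cong]: "sets R = sets (qq OM borel)" by(rule sets_pair_measure_cong) simp_all

lemma prob_R: "prob_space R" by(rule prob_space_pair[OF s.prob_space_axioms u.prob_space_axioms])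

lemma xy_R [measurable]: "(%p. x (fst p) (snd p)):bmeas R" "(%p. y (fst p) (snd p)):bmeas R"
using has_law_x[OF lx] has_law_x[OF ly] by(simp_all add:measurable_cong_sets[OF sets_R refl])

lemma fst_R [measurable]: "fst:bmeas R" using fst_borel by(simp add:measurable_cong_sets[OF sets_R refl])

lemma ok_m [measurable]: "Measurable.pred R ok"
proof -
have "Measurable.pred R (%p. (fst p, g p):IA_pairs)" if "g:bmeas R" for g :: "_ => real"
 using measurable_sets[OF measurable_Pair[OF fst_R that] IA_pairs_borel]
 by(simp add:pred_def vimage_def Collect_conj_eq Int_commute)
from this[OF xy_R(1)] this[OF xy_R(2)] show ?thesis unfolding ok_def by measurable
qed

lemma AE_ok: "AE p in R. ok p"
proof -
have "AE a in sg. AE u in unif. x a u <= y a u"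
 using xy by eventually_elim (use AE_unif in "auto elim:eventually_mono")
hence "AE a in sg. AE u in unif. x (fst (a, u)) (snd (a, u)) <= y (fst (a, u)) (snd (a, u))" by simp
hence "AE p in R. x (fst p) (snd p) <= y (fst p) (snd p)"
 by(rule su.AE_pair_measure[rotated]) measurable
thus ?thesis using has_law_pairs[OF lx] has_law_pairs[OF ly] by eventually_elim (simp add:ok_def)
qed

lemma space_R: "p:space R ==> fst p:Hi" using Q_Hi by(auto simp:space_pair_measure)

lemma okD:
assumes "ok p"
shows "fst p:Hi" "x (fst p) (snd p):IA (fst p)" "y (fst p) (snd p):IA (fst p)"
 "t:{0..1} ==> Ga p t = PB (fst p, (1-t)*x (fst p) (snd p)+t*y (fst p) (snd p))"
proof -
show a: "fst p:Hi" "x (fst p) (snd p):IA (fst p)" "y (fst p) (snd p):IA (fst p)"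
 using assms by(simp_all add:ok_def IA_pairs_def)
show "Ga p t = PB (fst p, (1-t)*x (fst p) (snd p)+t*y (fst p) (snd p))" if "t:{0..1}"
 using IA_convex_comb[OF a that] a that assms by(simp add:Ga_def ray_curve_def PB_def IA_pairs_def)
qed

lemma Ga_curve: "p:space R ==> Ga p:mspace (curve_space H)"
proof (cases "ok p")
case True
thus ?thesis using ray_curve_curve[OF okD(1-3)[OF True]] by(simp add:Ga_def)
next
case False
assume "p:space R"
hence "fst p:H" using space_R Hi_subset by blast
thus ?thesis using False restrict_const_curve by(simp add:Ga_def)
qed

lemma Ga_nice: "nice (Ga p)"
proof (cases "ok p")
case True
thus ?thesis using ray_curve_nice[OF okD(1-3)[OF True]] by(simp add:Ga_def ok_def)
qed (simp add:Ga_def nice_def)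

lemma Ga_m: "Ga:R ->M borel_curves H"
proof (rule measurable_into_curves)
show "Ga:space R \<rightarrow> mspace (curve_space H)" using Ga_curve by blast
fix t :: real assume t: "t:{0..1}"
have [measurable]: "(%p. PB (fst p, (1-t)*x (fst p) (snd p)+t*y (fst p) (snd p))):bmeas R"
 by(rule measurable_compose[OF _ PB_measurable]) measurable
have "Ga p t = (if ok p then PB (fst p, (1-t)*x (fst p) (snd p)+t*y (fst p) (snd p)) else fst p)" for p
 using okD(4)[OF _ t, of p] t by(auto simp:Ga_def)
thus "(%p. Ga p t):bmeas R" by simp
qed

definition "nu = distr R (borel_curves H) Ga"

lemma Ga_eval: "t:{0..1} ==> (%p. Ga p t):R ->M borel_on H"
using measurable_compose[OF Ga_m measurable_curve_eval] .

lemma marginal: "t:{0..1} ==> curve_marginal H nu t = distr R (borel_on H) (%p. Ga p t)"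
unfolding nu_def by(subst distr_distr[OF measurable_curve_eval Ga_m]) (simp_all add:comp_def)

lemma end_law:
assumes l: "has_law f z" and e: "AE p in R. Ga p t = PB (fst p, z (fst p) (snd p))" and t: "t:{0..1}"
shows "curve_marginal H nu t = distr P (borel_on H) f"
proof (rule measure_eqI)
have f: "f:P ->M borel_on H" using l by(simp add:has_law_def)
fix B assume "B:sets (curve_marginal H nu t)"
hence B: "B:sets m" by(simp add:sets_m)
hence [measurable]: "B:sets borel" by(simp add:m_iff)
let ?F = "%q. ind B (PB (fst q, snd q)) :: ennreal"
have F: "?F:bmeas (qq OM borel)" using PB_qq by measurable
have ind: "em (distr M (borel_on H) g) B = nn_integral M (%p. ind B (g p))" if g: "g:M ->M borel_on H" for M :: "'c measure" and g
proof -
 have "em (distr M (borel_on H) g) B = nn_integral (distr M (borel_on H) g) (%z. ind B z)" using B by(simp add:sets_m)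
 also have "... = nn_integral M (%p. ind B (g p))" by(rule nn_integral_distr[OF g]) (use B in "simp add:sets_m")
 finally show ?thesis .
qed
have "em (curve_marginal H nu t) B = nn_integral R (%p. ind B (Ga p t))"
 unfolding marginal[OF t] by(rule ind[OF Ga_eval[OF t]])
also have "... = nn_integral R (%p. ?F (fst p, z (fst p) (snd p)))"
 by(rule nn_integral_cong_AE) (use e in "auto elim!:eventually_mono")
also have "... = nn_integral P (%p. ?F (al p, Gx (al p) (f p)))" by(rule has_law_integral[OF l F])
also have "... = nn_integral P (%p. ind B (f p))"
proof (rule nn_integral_cong_AE)
 show "AE p in P. ?F (al p, Gx (al p) (f p)) = ind B (f p)" using has_law_coord[OF l] by eventually_elim simp
qed
also have "... = em (distr P (borel_on H) f) B" by(rule ind[OF f, symmetric])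
finally show "em (curve_marginal H nu t) B = em (distr P (borel_on H) f) B" .
qed simp

lemma nu_OptGeo: "nu:OptGeo le H G (distr P (borel_on H) f0) (distr P (borel_on H) f1)"
proof -
have "AE p in R. Ga p 0 = PB (fst p, x (fst p) (snd p))" "AE p in R. Ga p 1 = PB (fst p, y (fst p) (snd p))"
 using AE_ok okD(4)[of _ 0] okD(4)[of _ 1] by(auto elim!:eventually_mono)
from end_law[OF lx this(1)] end_law[OF ly this(2)]
have e: "curve_marginal H nu 0 = distr P (borel_on H) f0" "curve_marginal H nu 1 = distr P (borel_on H) f1" by simp_all
have "AE ga in nu. ga:G_causal_curves le H G" unfolding nu_def
 by(rule AE_G_causal_distr[OF Ga_m Ga_nice])
moreover have "sets nu = sets (borel_curves H)" "prob_space nu"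
 unfolding nu_def by(simp, rule prob_space.prob_space_distr[OF prob_R Ga_m])
ultimately show ?thesis using e by(simp add:OptGeo_def)
qed

text \<open>Once \<open>exp V\<close> is dominated by the interpolated weight, \<open>push_m\<close>
  supplies exactly the hypothesis of \<open>Uent_ge\<close> for evaluation at time
  \<open>t\<close>.\<close>

lemma finish:
assumes c: "cb x w0" "cb y w1" and t: "0 < t" "t < 1" and V: "integrable R V"
 and le: "!!p. exp (V p) <= ((1-t)*w0 (fst p) (snd p)+t*w1 (fst p) (snd p)) powr (N-1)"
shows "ennreal (exp ((\<integral>p. V p \<partial>R)/(N-1))) <= Uent (N-1) (curve_marginal H nu t) m"
proof -
have t': "t:{0..1}" using t by simp
have sm: "sets m = sets (borel_on H)" by(rule sets_m)
have "distr R (borel_on H) (%p. Ga p t) = distr R m (%p. Ga p t)" by(rule distr_cong) (simp_all add:sm)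
moreover have "ennreal (exp ((\<integral>p. V p \<partial>R)/(N-1))) <= Uent (N-1) (distr R m (%p. Ga p t)) m"
proof (rule m.Uent_ge[OF prob_R _ _ V])
 show "(%p. Ga p t):R ->M m" using Ga_eval[OF t'] by(simp add:measurable_cong_sets[OF refl sm])
 fix B assume B: "B:sets m"
 have "nn_integral R (%p. ennreal (exp (V p))*ind B (Ga p t)) <=
   nn_integral R (%p. ennreal (((1-t)*w0 (fst p) (snd p)+t*w1 (fst p) (snd p)) powr (N-1)) *
  ind B (PB (fst p, (1-t)*x (fst p) (snd p)+t*y (fst p) (snd p))))"
 proof (rule nn_integral_mono_AE)
  show "AE p in R. ennreal (exp (V p))*ind B (Ga p t) <= ennreal (((1-t)*w0 (fst p) (snd p)+t*w1 (fst p) (snd p)) powr (N-1)) *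
   ind B (PB (fst p, (1-t)*x (fst p) (snd p)+t*y (fst p) (snd p)))"
   using AE_ok by eventually_elim (simp add:okD(4)[OF _ t'] mult_right_mono ennreal_leI le)
 qed
 also have "... <= em m B" by(rule push_m[OF lx ly _ _ c t B]) (rule mono, assumption+)+
 finally show "nn_integral R (%p. ennreal (exp (V p))*ind B (Ga p t)) <= em m B" .
qed (use N in simp)
ultimately show ?thesis by(simp add:marginal[OF t'])
qed

text \<open>The potentials of the two marginals are combined with the weights for which the weighted
inequality of arithmetic and geometric means is sharp.\<close>

lemma Uent_marginal:
assumes t: "0 < t" "t < 1" and r: "0 <= r0" "0 <= r1"
 and U: "ennreal r0 <= Uent (N-1) (distr P (borel_on H) f0) m" "ennreal r1 <= Uent (N-1) (distr P (borel_on H) f1) m"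
shows "ennreal ((1-t)*r0+t*r1) <= Uent (N-1) (curve_marginal H nu t) m"
proof -
have N1: "0 < N - 1" using N by simp
have fm: "f0:P ->M borel_on H" "f1:P ->M borel_on H" using lx ly by(simp_all add:has_law_def)
interpret R: prob_space R by(rule prob_R)
have pot: "EX W w. integrable R W & cb z w & (ALL p. w (fst p) (snd p) = exp (W p/(N-1))) & ln r <= (\<integral>p. W p \<partial>R)/(N-1)"
 if l: "has_law f z" and r: "0 < r" "ennreal r <= Uent (N-1) (distr P (borel_on H) f) m" for f z r
proof -
 have "f:P ->M borel_on H" using l by(simp add:has_law_def)
 from potential[OF this r] obtain V where V: "V:bmeas borel" "integrable P (%p. V (f p))"
  "ln r <= (\<integral>p. V (f p) \<partial>P)/(N-1)" "!!B. B:sets m ==> nn_integral P (%p. ennreal (exp (V (f p)))*ind B (f p)) <= em m B" by blast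
 note i = has_law_real[OF l V(1,2)]
 have "cb z (%a u. exp (V (PB (a, z a u))/(N-1)))" by(rule cb_potential[OF l V(1)]) (rule V(4))
 thus ?thesis using i V(3)
  by(intro exI[of _ "%p. V (PB (fst p, z (fst p) (snd p)))"] exI[of _ "%a u. exp (V (PB (a, z a u))/(N-1))"]) simp
qed
have pw: "exp (v / (N-1)) powr (N-1) = exp v" for v using N1 by(simp add:powr_def)
\<comment> \<open>For a lower bound 0 at one end no potential is at hand and the weight 0 is used
  there; the factor \<open>s\<close> of the other weight enters the potential as the constant
  \<open>(N-1)*ln s\<close>.\<close>
have single: "ennreal (s*r) <= Uent (N-1) (curve_marginal H nu t) m"
 if W: "integrable R W" "ln r <= (\<integral>p. W p \<partial>R)/(N-1)" and sr: "0 < s" "0 < r" and c: "cb x w0" "cb y w1"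
  and e: "!!p. (1-t)*w0 (fst p) (snd p)+t*w1 (fst p) (snd p) = s*exp (W p/(N-1))" for W s r w0 w1
proof -
 have a: "ennreal (exp ((\<integral>p. (N-1)*ln s+W p \<partial>R)/(N-1))) <= Uent (N-1) (curve_marginal H nu t) m"
 proof (rule finish[OF c t])
  show "integrable R (%p. (N-1)*ln s+W p)" using W by simp
  show "exp ((N-1)*ln s+W p) <= ((1-t)*w0 (fst p) (snd p)+t*w1 (fst p) (snd p)) powr (N-1)" for p
   unfolding e using sr by(simp add:powr_mult pw exp_add) (simp add:powr_def)
 qed
 have b: "(\<integral>p. (N-1)*ln s+W p \<partial>R)/(N-1) = ln s+(\<integral>p. W p \<partial>R)/(N-1)"
  using W N1 by(simp add:R.prob_space add_divide_distrib)
 have c: "s*r <= exp (ln s+(\<integral>p. W p \<partial>R)/(N-1))"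
 proof -
  have "s*r = exp (ln s+ln r)" using sr by(simp add:exp_add)
  also have "... <= exp (ln s+(\<integral>p. W p \<partial>R)/(N-1))" using W(2) by simp
  finally show ?thesis .
 qed
 show ?thesis by(rule order_trans[OF ennreal_leI[OF c] a[unfolded b]])
qed
consider "r0 = 0" "r1 = 0" | "0 < r0" "r1 = 0" | "r0 = 0" "0 < r1" | "0 < r0" "0 < r1" using r by linarith
thus ?thesis
proof cases
 case 2
 obtain W w where "integrable R W" "cb x w" "ALL p. w (fst p) (snd p) = exp (W p/(N-1))" "ln r0 <= (\<integral>p. W p \<partial>R)/(N-1)"
  using pot[OF lx 2(1) U(1)] by blast
 thus ?thesis using single[of W r0 "1 - t" w "%_ _. 0"] cb_zero t 2 by simp
next
 case 3
 obtain W w where "integrable R W" "cb y w" "ALL p. w (fst p) (snd p) = exp (W p/(N-1))" "ln r1 <= (\<integral>p. W p \<partial>R)/(N-1)"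
  using pot[OF ly 3(2) U(2)] by blast
 thus ?thesis using single[of W r1 t "%_ _. 0" w] cb_zero t 3 by simp
next
 case 4
 obtain W0 w0 where W0: "integrable R W0" "cb x w0" "ALL p. w0 (fst p) (snd p) = exp (W0 p/(N-1))" "ln r0 <= (\<integral>p. W0 p \<partial>R)/(N-1)"
  using pot[OF lx 4(1) U(1)] by blast
 obtain W1 w1 where W1: "integrable R W1" "cb y w1" "ALL p. w1 (fst p) (snd p) = exp (W1 p/(N-1))" "ln r1 <= (\<integral>p. W1 p \<partial>R)/(N-1)"
  using pot[OF ly 4(2) U(2)] by blast
 define S where "S = (1-t)*r0+t*r1"
 define th where "th = t*r1/S"
 have S: "0 < S" unfolding S_def using t 4 by(intro add_pos_pos mult_pos_pos) auto
 have th: "0 <= th" "1 - th = (1-t)*r0/S" "0 <= 1 - th"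
 proof -
  show "0 <= th" using S t 4 by(simp add:th_def)
  show e: "1 - th = (1-t)*r0/S" using S by(simp add:th_def S_def field_simps)
  show "0 <= 1 - th" unfolding e using S t 4 by simp
 qed
 have lin: "((1 - c)*(n*a+u)+c*(n*b+v))/n = (1 - c)*(a+u/n)+c*(b+v / n)" if "0 < n" for a b c n u v :: real
  using that by(simp add:field_simps)
 define V where "V p = (1 - th)*((N-1)*ln (S/r0)+W0 p)+th*((N-1)*ln (S/r1)+W1 p)" for p
 have Vi: "integrable R V" unfolding V_def using W0 W1 by simp
 have "exp (V p) <= ((1-t)*w0 (fst p) (snd p)+t*w1 (fst p) (snd p)) powr (N-1)" for p
 proof -
  have "V p/(N-1) = (1 - th)*(ln (S/r0)+W0 p/(N-1))+th*(ln (S/r1)+W1 p/(N-1))"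
   unfolding V_def by(rule lin[OF N1])
  also have "exp ... <= (1 - th)*exp (ln (S/r0)+W0 p/(N-1))+th*exp (ln (S/r1)+W1 p/(N-1))"
   using convex_onD[OF exp_convex, of th "ln (S/r0)+W0 p/(N-1)" "ln (S/r1)+W1 p/(N-1)"] th by simp
  also have "... = (1-t)*w0 (fst p) (snd p)+t*w1 (fst p) (snd p)"
   using S 4 unfolding th(2) by(simp add:th_def exp_add W0(3) W1(3))
  finally have "exp (V p/(N-1)) powr (N-1) <= ((1-t)*w0 (fst p) (snd p)+t*w1 (fst p) (snd p)) powr (N-1)"
   using N1 by(intro powr_mono2) auto
  thus ?thesis by(simp add:pw)
 qed
 from finish[OF W0(2) W1(2) t Vi this]
 have a: "ennreal (exp ((\<integral>p. V p \<partial>R)/(N-1))) <= Uent (N-1) (curve_marginal H nu t) m" .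
 have c: "S <= exp ((\<integral>p. V p \<partial>R)/(N-1))"
 proof -
  have "(\<integral>p. V p \<partial>R) = (1 - th)*((N-1)*ln (S/r0)+(\<integral>p. W0 p \<partial>R))+th*((N-1)*ln (S/r1)+(\<integral>p. W1 p \<partial>R))"
   unfolding V_def using W0 W1 by(simp add:R.prob_space)
  with lin[OF N1] have "(\<integral>p. V p \<partial>R)/(N-1) = (1 - th)*(ln (S/r0)+(\<integral>p. W0 p \<partial>R)/(N-1))+th*(ln (S/r1)+(\<integral>p. W1 p \<partial>R)/(N-1))"
   by simp
  also have "... >= (1 - th)*(ln (S/r0)+ln r0)+th*(ln (S/r1)+ln r1)"
   using th W0(4) W1(4) by(intro add_mono mult_left_mono) auto
  also have "(1 - th)*(ln (S/r0)+ln r0)+th*(ln (S/r1)+ln r1) = ln S"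
   using S 4 by(simp add:ln_div algebra_simps)
  finally have "exp (ln S) <= exp ((\<integral>p. V p \<partial>R)/(N-1))" by simp
  thus ?thesis using S by simp
 qed
 show ?thesis using order_trans[OF ennreal_leI[OF c] a] unfolding S_def .
qed simp
qed

text \<open>\<open>U\<close> is infinite if the entropy is minus infinity;
  \<open>Uent_marginal\<close> is then applied to arbitrarily large real numbers in its
  place.\<close>

lemma Uent_plan:
assumes t: "t:{0..1}"
shows "ennreal (1-t)*Uent (N-1) (distr P (borel_on H) f0) m+ennreal t*Uent (N-1) (distr P (borel_on H) f1) m
  <= Uent (N-1) (curve_marginal H nu t) m"
proof -
let ?A = "Uent (N-1) (distr P (borel_on H) f0) m" and ?B = "Uent (N-1) (distr P (borel_on H) f1) m"
let ?U = "Uent (N-1) (curve_marginal H nu t) m"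
note e = OptGeoD(3,4)[OF nu_OptGeo]
consider "t = 0" | "t = 1" | "0 < t" "t < 1" using t by fastforce
thus ?thesis
proof cases
 case 3
 note U = Uent_marginal[OF 3]
 have inf: "?U = \<infinity>" if "!!r. 0 <= r ==> ennreal (s*r) <= ?U" and s: "0 < s" for s
 proof -
  have "of_nat k <= ?U" for k :: nat using that(1)[of "real k / s"] s by(simp add:ennreal_of_nat_eq_real_of_nat)
  thus ?thesis by(metis ennreal_Ex_less_of_nat infinity_ennreal_def less_top not_less)
 qed
 show ?thesis
 proof (cases ?A)
  case top
  have "?U = \<infinity>" by(rule inf[of "1 - t"]) (use U[of _ 0] 3 top in simp_all)
  thus ?thesis by simp
 next
  case r0: (real r0)
  show ?thesis
  proof (cases ?B)
   case top
   have "?U = \<infinity>" by(rule inf[of t]) (use U[of 0] 3 top in simp_all)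
   thus ?thesis by simp
  next
   case r1: (real r1)
   have "ennreal (1-t)*ennreal r0+ennreal t*ennreal r1 = ennreal ((1-t)*r0+t*r1)"
    using 3 r0 r1 by(simp add:ennreal_mult' ennreal_plus)
   thus ?thesis using U[of r0 r1] r0 r1 by simp
  qed
 qed
qed (simp_all add:e)
qed

end

section \<open>From causal couplings to plans along rays\<close>

context cd_rays
begin

text \<open>Absolute continuity of one marginal puts its point in the inner part almost surely,
  where it determines a ray. The other point is comparable with it and so lies on the same ray,
  possibly as an end-point. The law of this ray is absolutely continuous with respect to
  \<open>qq\<close>.\<close>

lemma NCe_ac:
assumes P: "prob_space P" and f: "f0:P ->M borel_on H" "f1:P ->M borel_on H" and le: "AE p in P. le (f0 p) (f1 p)"
 and c: "c = f0 \<or> c = f1" and ac: "absolutely_continuous m (distr P (borel_on H) c)"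
shows "EX nu:OptGeo le H G (distr P (borel_on H) f0) (distr P (borel_on H) f1). ALL t:{0..1}.
  ennreal (1-t)*Uent (N-1) (distr P (borel_on H) f0) m+ennreal t*Uent (N-1) (distr P (borel_on H) f1) m
   <= Uent (N-1) (curve_marginal H nu t) m"
proof -
interpret P: prob_space P by fact
have cm: "c:P ->M borel_on H" using c f by blast
have tr: "AE p in P. R (c p)" if "AE x in m. R x" for R
proof -
 have "AE x in distr P (borel_on H) c. R x" by(rule absolutely_continuous_AE[OF _ ac that]) (simp add:sets_m)
 thus ?thesis by(rule AE_distrD[OF cm])
qed
have "AE x in m. x:Hi" using AE_not_in[OF ends] AE_space by eventually_elim (auto simp:inner_part_def)
from P.AE_ex[OF tr[OF this]] have ne: "Hi ~= {}" by blast
obtain q where q: "q:m ->M qq" "AE x in m. x:Hi & q x = QQ x" using quotient_version[OF ne] by blast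
define al where "al p = q (c p)" for p
have am: "al:P ->M qq" unfolding al_def
 by(rule measurable_compose[OF cm]) (use q(1) in "simp add:measurable_cong_sets[OF sets_m refl]")
have acs: "absolutely_continuous qq (distr P qq al)"
 unfolding absolutely_continuous_def
proof
 fix C assume C: "C:null_sets qq"
 have "AE x in m. x ~: {x:Hi. QQ x:C}" using AE_not_in[OF null_qq[OF C]] by(simp add:AE_completion_iff)
 hence "AE x in m. q x ~: C" using q(2) by eventually_elim auto
 hence "AE p in P. al p ~: C" unfolding al_def by(rule tr)
 moreover have "em (distr P qq al) C = em P {p:space P. al p:C}"
  using C am by(subst emeasure_distr) (auto simp:vimage_def Collect_conj_eq Int_commute)
 moreover have "{p:space P. al p:C}:sets P" using measurable_sets[OF am, of C] C by(auto simp:vimage_def Collect_conj_eq Int_commute)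
 ultimately show "C:null_sets (distr P qq al)" using C null_setsI[of "distr P qq al" C] AE_iff_measurable[of "{p:space P. al p:C}" P "%p. al p ~: C"] by auto
qed
have r: "AE p in P. f0 p:Ry (al p) & f1 p:Ry (al p)"
 using tr[OF q(2)] le AE_space
proof eventually_elim
 case (elim p)
 have H: "f0 p:H" "f1 p:H" using measurable_space[OF f(1) elim(3)] measurable_space[OF f(2) elim(3)] by(simp_all add:space_restrict_space)
 have i: "c p:Hi" "al p = QQ (c p)" using elim(1) by(simp_all add:al_def)
 have "f0 p:Ry (c p)" "f1 p:Ry (c p)" using c elim(2) H le_refl by(auto simp:in_ray_iff)
 thus ?case using ray_eq[OF QQ_in[OF i(1)] QQ_self[OF i(1)]] i(2) by simp
qed
interpret ray_coupling le H G m QQ qq ma N P al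
 by unfold_locales (rule ne am acs)+
have gm: "(%p. Gx (al p) (g p)):bmeas P" if g: "g:P ->M borel_on H" for g
proof -
 have "g:bmeas P" using g by(simp add:measurable_restrict_space2_iff)
 moreover have "al:bmeas P" using measurable_compose[OF am qq_borel] by simp
 ultimately show ?thesis using measurable_compose[OF measurable_Pair Gx_measurable, of al P g] by simp
qed
have "AE p in P. Gx (al p) (f0 p) <= Gx (al p) (f1 p)" using r le AE_space
proof eventually_elim
 case (elim p)
 have a: "al p:Hi" by(rule Q_Hi[OF al_Q[OF elim(3)]])
 show ?case using GE_le_iff[OF a, of "f0 p" "f1 p"] GE_eq_Gx[OF a] elim by simp
qed
from conditional_monotone_coupling[OF P am gm[OF f(1)] gm[OF f(2)] this] obtain x y where xy:
 "(%p. x (fst p) (snd p)):bmeas (qq OM borel)" "(%p. y (fst p) (snd p)):bmeas (qq OM borel)"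
 "ALL a u v. 0 < u & u <= v & v < 1 --> x a u <= x a v & y a u <= (y a v :: real)"
 "AE a in distr P qq al. ALL u. 0 < u & u < 1 --> x a u <= (y a u :: real)"
 "distr (distr P qq al OM unif) (qq OM borel) (%p. (fst p, x (fst p) (snd p))) = distr P (qq OM borel) (%p. (al p, Gx (al p) (f0 p)))"
 "distr (distr P qq al OM unif) (qq OM borel) (%p. (fst p, y (fst p) (snd p))) = distr P (qq OM borel) (%p. (al p, Gx (al p) (f1 p)))"
 by(elim exE conjE) (rule that)
interpret ray_plan le H G m QQ qq ma N P al f0 f1 x y
proof
 show "has_law f0 x" "has_law f1 y" using f r xy by(simp_all add:has_law_def)
 show "x a u <= x a v" "y a u <= y a v" if "0 < u" "u <= v" "v < 1" for a u v using xy(3) that by blast+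
qed (rule xy(4))
show ?thesis using nu_OptGeo Uent_plan by blast
qed

text \<open>Both points may be end-points shared by several rays. A Borel choice of an intermediate
  inner point singles out one ray for each pair, along which the two points are joined.\<close>

lemma OptGeo_exists:
assumes P: "prob_space P" and f: "f0:P ->M borel_on H" "f1:P ->M borel_on H" and le: "AE p in P. le (f0 p) (f1 p)"
shows "OptGeo le H G (distr P (borel_on H) f0) (distr P (borel_on H) f1) ~= {}"
proof -
interpret P: prob_space P by fact
obtain mi where mi: "mi:bmeas borel"
 and mi': "ALL x:H. ALL y:H. le x y & x ~= y --> mi (x, y):Hi & le x (mi (x, y)) & le (mi (x, y)) y"
 using middle_selection by blast
define z a b where "z p = mi (f0 p, f1 p)" and "a p = Gx (z p) (f0 p)" and "b p = Gx (z p) (f1 p)" for p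
define ok where "ok p <-> f0 p ~= f1 p & (z p, a p):IA_pairs & (z p, b p):IA_pairs & a p <= b p" for p
define Ga where "Ga p = (if ok p then ray_curve (z p) (a p) (b p) else restrict (%_. f0 p) {0..1})" for p
have fm[measurable]: "f0:bmeas P" "f1:bmeas P" using f by(simp_all add:measurable_restrict_space2_iff)
have zm[measurable]: "z:bmeas P" unfolding z_def using measurable_compose[OF borel_measurable_Pair[OF fm] mi] .
have [measurable]: "a:bmeas P" "b:bmeas P" unfolding a_def b_def
 using measurable_compose[OF measurable_Pair[OF zm fm(1)] Gx_measurable] measurable_compose[OF measurable_Pair[OF zm fm(2)] Gx_measurable] by simp_all
have okm[measurable]: "Measurable.pred P ok" unfolding ok_def by measurable
have okD: "z p:Hi" "a p:IA (z p)" "b p:IA (z p)" "a p <= b p" if "ok p" for p using that by(simp_all add:ok_def IA_pairs_def)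
have fH: "f0 p:H" "f1 p:H" if "p:space P" for p
 using measurable_space[OF f(1) that] measurable_space[OF f(2) that] by(simp_all add:space_restrict_space)
have cur: "Ga p:mspace (curve_space H)" if "p:space P" for p
 using ray_curve_curve[OF okD(1-3), of p] restrict_const_curve[OF fH(1)[OF that]] by(simp add:Ga_def)
have nice: "nice (Ga p)" for p
proof (cases "ok p")
 case True
 thus ?thesis using ray_curve_nice[OF okD[OF True]] by(simp add:Ga_def)
qed (simp add:Ga_def nice_def)
have Gam: "Ga:P ->M borel_curves H"
proof (rule measurable_into_curves)
 show "Ga:space P \<rightarrow> mspace (curve_space H)" using cur by blast
 fix t :: real assume t: "t:{0..1}"
 have "Ga p t = (if ok p then PB (z p, (1-t)*a p+t*b p) else f0 p)" for p
  using IA_convex_comb[OF okD(1-3) t, of p] okD(1)[of p] t by(auto simp:Ga_def ray_curve_def PB_def IA_pairs_def)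
 moreover have "(%p. PB (z p, (1-t)*a p+t*b p)):bmeas P"
  by(rule measurable_compose[OF _ PB_measurable]) measurable
 ultimately show "(%p. Ga p t):bmeas P" by simp
qed
have ends: "AE p in P. Ga p 0 = f0 p & Ga p 1 = f1 p"
 using le AE_space
proof eventually_elim
 case (elim p)
 note H = fH[OF elim(2)]
 show ?case
 proof (cases "f0 p = f1 p")
  case False
  hence zi: "z p:Hi" "le (f0 p) (z p)" "le (z p) (f1 p)" using mi' H elim(1) by(auto simp:z_def)
  hence R: "f0 p:Ry (z p)" "f1 p:Ry (z p)" using H Hi_subset by(auto simp:in_ray_iff)
  have g: "GE (z p) (f0 p) = a p" "GE (z p) (f1 p) = b p" using GE_eq_Gx[OF zi(1)] R by(simp_all add:a_def b_def)
  have "ok p" using GE_mem[OF R(1)] GE_mem[OF R(2)] GE_le_iff[OF zi(1) R] elim(1) zi(1) g False by(simp add:ok_def IA_pairs_def)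
  thus ?thesis using PT_GE[OF zi(1) R(1)] PT_GE[OF zi(1) R(2)] g by(simp add:Ga_def ray_curve_ends)
 next
  case True
  thus ?thesis by(simp add:Ga_def ok_def)
 qed
qed
have marg: "curve_marginal H (distr P (borel_curves H) Ga) t = distr P (borel_on H) g"
 if t: "t:{0..1}" and g: "g:P ->M borel_on H" and e: "AE p in P. Ga p t = g p" for t g
proof -
 have "curve_marginal H (distr P (borel_curves H) Ga) t = distr P (borel_on H) (%p. Ga p t)"
  by(subst distr_distr[OF measurable_curve_eval[OF t] Gam]) (simp add:comp_def)
 also have "... = distr P (borel_on H) g"
  by(rule distr_cong_AE[OF refl refl e]) (use measurable_compose[OF Gam measurable_curve_eval[OF t]] g in simp_all)
 finally show ?thesis .
qed
have "AE p in P. Ga p 0 = f0 p" "AE p in P. Ga p 1 = f1 p" using ends by(auto elim:eventually_mono)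
hence "distr P (borel_curves H) Ga:OptGeo le H G (distr P (borel_on H) f0) (distr P (borel_on H) f1)"
 using marg[OF _ f(1), of 0] marg[OF _ f(2), of 1] P.prob_space_distr[OF Gam] AE_G_causal_distr[OF Gam nice] by(simp add:OptGeo_def)
thus ?thesis by blast
qed

text \<open>A positive \<open>U\<close> at one end makes that marginal absolutely continuous, so
  \<open>NCe_ac\<close> applies; if both vanish, the inequality is trivial and it suffices that some
  plan exists.\<close>

theorem NCe_if_CD: "NCe le H G m N"
unfolding NCe_def
proof (intro allI impI, elim conjE)
fix mu0 mu1 assume "causal_couplings le H mu0 mu1 ~= {}"
then obtain pr where pr: "sets pr = sets (borel_on H OM borel_on H)" "prob_space pr"
  "distr pr (borel_on H) fst = mu0" "distr pr (borel_on H) snd = mu1"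
  "em pr {p:H \<times> H. le (fst p) (snd p)} = 1"
 by(auto simp:causal_couplings_def)
interpret pr: prob_space pr by fact
have fs: "fst:pr ->M borel_on H" "snd:pr ->M borel_on H"
 by(simp_all add:measurable_cong_sets[OF pr(1) refl])
have "AE p in pr. p:{p:H \<times> H. le (fst p) (snd p)}"
 using pr(5) by(intro pr.AE_prob_1) (simp add:measure_def)
hence le: "AE p in pr. le (fst p) (snd p)" by eventually_elim simp
let ?goal = "EX nu:OptGeo le H G mu0 mu1. ALL t:{0..1}.
  ennreal (1-t)*Uent (N-1) mu0 m+ennreal t*Uent (N-1) mu1 m <= Uent (N-1) (curve_marginal H nu t) m"
show ?goal
proof (cases "0 < Uent (N-1) mu0 m \<or> 0 < Uent (N-1) mu1 m")
 case True
 thus ?thesis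
  using NCe_ac[OF pr(2) fs le, of fst] NCe_ac[OF pr(2) fs le, of snd] Uent_pos_ac[of "N - 1" _ m] unfolding pr(3,4) by blast
next
 case False
 thus ?thesis using OptGeo_exists[OF pr(2) fs le] unfolding pr(3,4) by auto
qed
qed

end

text \<open>The disintegration is assumed conditionally because rays are available only under weak
  convexity, which the energy condition itself implies. It describes \<open>m\<close> on the inner
  part only, so the absence of mass at the end-points appears as a separate clause.\<close>

theorem theorem6p8:
  fixes ll le :: "'a::{heine_borel,polish_space} \<Rightarrow> 'a \<Rightarrow> bool"
    and H :: "'a set" and G :: "'a \<Rightarrow> real" and m :: "'a measure" and N :: real
    and QQ :: "'a \<Rightarrow> 'a" and qq :: "'a measure" and ma :: "'a \<Rightarrow> 'a measure"
  assumes "topological_causal_space ll le"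
    and "synthetic_null_hypersurface ll le H G m"
    and "null_non_branching le H"
    and "N > 2"
    and "weakly_convex le H \<Longrightarrow> ray_disintegration le H m QQ qq ma"
  shows "NCe le H G m N \<longleftrightarrow>
           weakly_convex le H \<and>
           initial_points le H \<union> final_points le H \<in> null_sets m \<and>
           (AE \<alpha> in qq. ray_CD0 le H G N \<alpha> (ma \<alpha>))"
proof -
have le: "le x x" "le x y ==> le y z ==> le x z" "closed {(x, y). le x y}" for x y z
 using assms(1) by (auto simp: topological_causal_space_def elim: reflpE transpE)
have H: "closed H" "gauge_for le H G" "radon_measure_on H m" "initial_points le H Int final_points le H : null_sets m"
 using assms(2) by (auto simp: synthetic_null_hypersurface_def)
have rays: "ray_measure le H G m QQ qq ma" if "weakly_convex le H"
 by unfold_locales (use le H that assms(3,5) in auto)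
show ?thesis
proof
 assume nce: "NCe le H G m N"
 note w = weakly_convex_if_NCe[OF nce le(3)]
 interpret ray_measure le H G m QQ qq ma by (rule rays[OF w])
 interpret nce_rays le H G m QQ qq ma N
  by unfold_locales (use assms(4) nce H in auto)
 show "weakly_convex le H & initial_points le H Un final_points le H : null_sets m & (AE al in qq. ray_CD0 le H G N al (ma al))"
  using w ends_null AE_ray_CD0 by blast
next
 assume cd: "weakly_convex le H & initial_points le H Un final_points le H : null_sets m & (AE al in qq. ray_CD0 le H G N al (ma al))"
 interpret ray_measure le H G m QQ qq ma by (rule rays) (use cd in blast)
 interpret cd_rays le H G m QQ qq ma N
  by unfold_locales (use assms(4) cd in auto)
 show "NCe le H G m N" by (rule NCe_if_CD)
qed
qed

end
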